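(* Let $C,G>0$, $M>1$ and $Y\in(1,2)$. Let $S_t=S_0e^{X_t}$, $t\ge0$, with $S_0>0$ and $X_t=L_t$, be the exponential pure-jump CGMY model (no Brownian component, $\sigma=0$) described in the context (so that $\mathbb{E}(e^{X_t})=1$ for all $t\ge0$), and let $\tilde\gamma$, $(Z_t)_{t\geq 0}$, $\widetilde U_1$, $\widetilde{\mathbb{P}}$, $\widetilde{\mathbb{E}}$ and $p_Z(1,\cdot)$ be as in the context. Let $t\mapsto\kappa_t\in\mathbb{R}$ be a deterministic function such that $\kappa_t=o(1)$ as $t\to0$. Set $$d_1:=\widetilde{\mathbb{E}}\left(Z_1^+\right)=\frac1\pi\Gamma\!\left(1-\frac1Y\right)\left(2C\,\Gamma(-Y)\left|\cos\!\left(\frac{\pi Y}{2}\right)\right|\right)^{\frac1Y},$$ $$d_2:=\frac{C\,\Gamma(-Y)}{2}\left[(M-1)^Y-M^Y-(G+1)^Y+G^Y\right],$$ $$d_{31}:=\frac{\tilde\gamma^2}{2}\,p_Z(1,0)=\frac{\tilde\gamma^2}{2\pi}\Gamma\!\left(1+\frac1Y\right)\left(-2C\,\Gamma(-Y)\cos\!\left(\frac{\pi Y}{2}\right)\right)^{-\frac1Y},$$ $$d_{32}:=-\frac12\widetilde{\mathbb{E}}\left(\left(Z_1^++\widetilde U_1\right)^2\mathbf 1_{\{Z_1^++\widetilde U_1\le0\}}\right)-\int_0^\infty w\left(\widetilde{\mathbb{P}}\left(Z_1^++\widetilde U_1\ge w\right)-\frac{CM^Y}{Yw^Y}-\frac{C(G+1)^Y}{Yw^Y}\right)dw,$$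 $$\widetilde c_\kappa(t):=\kappa_t\int_0^1\widetilde{\mathbb{P}}\left(Z_t\ge\kappa_tw\right)dw .$$ Then, as $t\to0$, $$\frac{e^{-\kappa_t}}{S_0}\,\mathbb{E}\left(\left(S_t-S_0e^{\kappa_t}\right)^+\right)+\widetilde c_\kappa(t)=d_1t^{\frac1Y}+d_2t+d_{31}t^{2-\frac1Y}+d_{32}t^{\frac2Y}+o(\kappa_t)+o\!\left(t^{2-\frac1Y}\right)+o\!\left(t^{\frac2Y}\right),$$ where the terms $o(t^{2-1/Y})$ and $o(t^{2/Y})$ do not depend on the function $\kappa_t$.
   Context: Model: $L=(L_t)_{t\ge0}$ is, under $\mathbb{P}$, a pure-jump (no Gaussian part) CGMY Lévy process with parameters $C,G,M,Y$, i.e. with Lévy measure $$\nu(dx)=C|x|^{-Y-1}\left(e^{-Mx}\mathbf 1_{\{x>0\}}+e^{Gx}\mathbf 1_{\{x<0\}}\right)dx .$$ The interest rate is zero and $\mathbb{P}$ is a martingale measure for $S_t=S_0e^{L_t}$; that is, the drift of $L$ is the one for which $\mathbb{E}(e^{L_t})=1$ for all $t\ge0$. Auxiliary objects. Put $$\tilde\gamma:=-C\,\Gamma(-Y)\left[(M-1)^Y+(G+1)^Y-M^Y-G^Y\right].$$ On a space with probability $\widetilde{\mathbb{P}}$ and expectation $\widetilde{\mathbb{E}}$, let $(\bar U^{(p)}_t)_{t\ge0}$ and $(-\bar U^{(n)}_t)_{t\ge0}$ be independent and identically distributed one-sided (spectrally positive), centered, strictly $Y$-stable Lévy processes with Lévy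 measure $Cx^{-Y-1}\mathbf 1_{\{x>0\}}dx$, i.e. $$\widetilde{\mathbb{E}}\left(e^{iu\bar U^{(p)}_t}\right)=\exp\left(t\int_0^\infty\left(e^{iux}-1-iux\right)Cx^{-Y-1}dx\right),\qquad u\in\mathbb{R}.$$ Define $$Z_t:=\bar U^{(p)}_t+\bar U^{(n)}_t,\qquad \widetilde U_t:=(M-1)\bar U^{(p)}_t-(G+1)\bar U^{(n)}_t .$$ Thus $Z$ is a symmetric strictly $Y$-stable process with Lévy measure $C|x|^{-Y-1}dx$, and $p_Z(1,\cdot)$ denotes the continuous probability density of $Z_1$. (In the original setting, $\widetilde{\mathbb{P}}$ is a measure locally equivalent to $\mathbb{P}$ under which $X_t=Z_t+t\tilde\gamma$; only the joint law of $Z$ and $\widetilde U$ under $\widetilde{\mathbb{P}}$ matters for the statement.) Notation: $x^+:=x\mathbf 1_{\{x>0\}}$, and $\Gamma$ is the Gamma function (extended to negative non-integers). A term $o(\kappa_t)$ is a quantity $r(t)$ such that for each $\varepsilon>0$, $|r(t)|\le\varepsilon|\kappa_t|$ for all sufficiently small $t>0$. *)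

theory Defs
  imports "HOL-Probability.Probability" "HOL-Library.Landau_Symbols"
begin

definition cadlag :: "(real \<Rightarrow> real) \<Rightarrow> bool" where
  "cadlag f \<longleftrightarrow> (\<forall>t\<ge>0. (f \<longlongrightarrow> f t) (at_right t)) \<and> (\<forall>t>0. \<exists>l. (f \<longlongrightarrow> l) (at_left t))"

text \<open>Real-valued processes have the time set \<open>{0..}\<close>; the values of \<open>X\<close> at negative times are
  irrelevant.\<close>

definition (in prob_space) levy_process :: "(real \<Rightarrow> 'a \<Rightarrow> real) \<Rightarrow> bool" where
  "levy_process X \<longleftrightarrow>
     (\<forall>t\<ge>0. random_variable borel (X t)) \<and>
     (AE \<omega> in M. X 0 \<omega> = 0) \<and>
     (\<forall>n s. 0 \<le> s 0 \<and> (\<forall>i<n. s i \<le> s (Suc i)) \<longrightarrow>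
        indep_vars (\<lambda>_. borel) (\<lambda>i \<omega>. X (s (Suc i)) \<omega> - X (s i) \<omega>) {..<n::nat}) \<and>
     (\<forall>s\<ge>0. \<forall>t\<ge>0. distr M borel (\<lambda>\<omega>. X (s + t) \<omega> - X s \<omega>) = distr M borel (X t)) \<and>
     (\<forall>t\<ge>0. \<forall>\<epsilon>>0. ((\<lambda>s. \<P>(\<omega> in M. \<epsilon> \<le> \<bar>X s \<omega> - X t \<omega>\<bar>)) \<longlongrightarrow> 0) (at t within {0..})) \<and>
     (AE \<omega> in M. cadlag (\<lambda>t. X t \<omega>))"

text \<open>Independence as processes, i.e. of the two generated sigma-algebras, not merely of the
  one-dimensional marginals.\<close>

definition (in prob_space) indep_processes ::
    "(real \<Rightarrow> 'a \<Rightarrow> real) \<Rightarrow> (real \<Rightarrow> 'a \<Rightarrow> real) \<Rightarrow> bool" where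
  "indep_processes X X' \<longleftrightarrow>
     indep_var (PiM {0..} (\<lambda>_. borel)) (\<lambda>\<omega>. \<lambda>t\<in>{0..}. X t \<omega>)
               (PiM {0..} (\<lambda>_. borel)) (\<lambda>\<omega>. \<lambda>t\<in>{0..}. X' t \<omega>)"

text \<open>Levy--Khintchine exponent of the triplet \<open>(b, \<sigma>\<^sup>2, \<nu>)\<close> relative to the truncation
  function \<open>x 1\<^bsub>{\<bar>x\<bar> \<le> 1}\<^esub>\<close>.\<close>

definition levy_exponent :: "real \<Rightarrow> real \<Rightarrow> real measure \<Rightarrow> real \<Rightarrow> complex" where
  "levy_exponent b \<sigma>2 \<nu> u =
     \<i> * of_real (b * u) - of_real (\<sigma>2 * u\<^sup>2 / 2) +
     (\<integral>x. (iexp (u * x) - 1 - \<i> * of_real (u * x * indicator {-1..1} x)) \<partial>\<nu>)"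

definition (in prob_space) levy_process_with_triplet ::
    "(real \<Rightarrow> 'a \<Rightarrow> real) \<Rightarrow> real \<Rightarrow> real \<Rightarrow> real measure \<Rightarrow> bool" where
  "levy_process_with_triplet X b \<sigma>2 \<nu> \<longleftrightarrow>
     levy_process X \<and>
     (\<forall>t\<ge>0. \<forall>u. char (distr M borel (X t)) u = exp (of_real t * levy_exponent b \<sigma>2 \<nu> u))"

definition cgmy_levy_measure :: "real \<Rightarrow> real \<Rightarrow> real \<Rightarrow> real \<Rightarrow> real measure" where
  "cgmy_levy_measure C G M Y = density lborel (\<lambda>x. ennreal
     (C * \<bar>x\<bar> powr (- Y - 1) *
        (exp (- M * x) * indicator {0<..} x + exp (G * x) * indicator {..<0} x)))"

text \<open>The drift is left free here.\<close>

definition (in prob_space) cgmy_process ::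
    "real \<Rightarrow> real \<Rightarrow> real \<Rightarrow> real \<Rightarrow> (real \<Rightarrow> 'a \<Rightarrow> real) \<Rightarrow> bool" where
  "cgmy_process C G M' Y X \<longleftrightarrow>
     (\<exists>b. levy_process_with_triplet X b 0 (cgmy_levy_measure C G M' Y))"

text \<open>The full compensator (no truncation) makes the process centered, which for \<open>1 < Y < 2\<close> is the
  same as strict stability.\<close>

definition (in prob_space) centered_positive_stable_process ::
    "real \<Rightarrow> real \<Rightarrow> (real \<Rightarrow> 'a \<Rightarrow> real) \<Rightarrow> bool" where
  "centered_positive_stable_process C Y X \<longleftrightarrow>
     levy_process X \<and>
     (\<forall>t\<ge>0. \<forall>u. char (distr M borel (X t)) u =
        exp (of_real t *
          (CLBINT x:{0<..}. (iexp (u * x) - 1 - \<i> * of_real (u * x)) * of_real (C * x powr (- Y - 1)))))"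

text \<open>The continuous version of the Lebesgue density of a real random variable; it is unique if it
  exists.\<close>

definition continuous_density :: "'a measure \<Rightarrow> ('a \<Rightarrow> real) \<Rightarrow> real \<Rightarrow> real" where
  "continuous_density M X =
     (THE p. continuous_on UNIV p \<and> (\<forall>x. 0 \<le> p x) \<and> distributed M lborel X (\<lambda>x. ennreal (p x)))"

definition cgmy_gamma_tilde :: "real \<Rightarrow> real \<Rightarrow> real \<Rightarrow> real \<Rightarrow> real" where
  "cgmy_gamma_tilde C G M Y =
     - C * Gamma (- Y) * ((M - 1) powr Y + (G + 1) powr Y - M powr Y - G powr Y)"

end

theory Submission
  imports Defs "HOL-Real_Asymp.Real_Asymp"
begin

text \<open>Put \<open>h = t powr (1/Y)\<close>, and let \<open>\<eta>\<close> be the log-Laplace exponent of \<open>Utilde 1\<close>. Comparing characteristic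
  functions, the law of \<open>L t\<close> is that of \<open>h * Z 1 + \<gamma> * t\<close> under an exponential tilt of \<open>Pt\<close>, the drift being
  forced by the martingale condition. Changing the measure once more by \<open>exp (L t)\<close> turns the normalized price into
  the expectation of \<open>exp (- h * Utilde 1 - \<eta> * t) * exp (- \<kappa>) * \<psi> (h * Z 1 + \<gamma> * t - \<kappa>)\<close> for the bounded function
  \<open>\<psi> x = 1 - exp (- max x 0)\<close>.

  For \<open>\<kappa> = 0\<close> and without the drift this is a difference of Laplace transforms, and
  \<open>V = max (Z 1) 0 + Utilde 1\<close> satisfies \<open>Pt (V \<ge> w) = K w powr (-Y) + O(w powr (-Y-1))\<close>; integration by parts
  yields \<open>d1\<close>, \<open>d32\<close> and most of \<open>d2\<close>. The drift contributes the increment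
  \<open>max (h * Z 1 + \<gamma> * t) 0 - max (h * Z 1) 0\<close>, whose expectation expands around \<open>Pt (Z 1 > 0) = 1/2\<close> with the density
  at 0 as second coefficient; this is \<open>d31\<close>. The strike moves the expectation by
  \<open>- \<kappa> * (\<integral> Pt (h * Z 1 + \<gamma> * t \<ge> \<kappa> * w) dw)\<close> up to \<open>o(\<kappa>)\<close>, and since the density of \<open>Z 1\<close> is bounded and
  \<open>t / h\<close> tends to 0, dropping the drift there costs \<open>o(\<kappa>)\<close> only.

  The tail of \<open>V\<close> and the exponential moments of \<open>Upos 1\<close> come from compound Poisson approximation: the small jumps
  have exponential moments uniformly in the truncation level, the jumps above 1 have an explicit tail, and convolving tail
  estimates loses only a constant factor, so the constants grow geometrically in the number of jumps and can be summed over
  its Poisson law.\<close>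

section \<open>Improper integrals\<close>

text \<open>The laws are given only by characteristic functions, while the argument needs tails,
  exponential moments and a density. Exponential moments exist on Re z >= 0 because the one-sided
  laws have no negative jumps; after the last change of measure the two variables carry the weights
  M - 1 and G + 1, and M > 1 keeps both positive. The obstacle is the infinite second moment of V: a
  term of order h powr Y precedes the one of order h^2 in its Laplace transform. Subtracting K w
  powr (-Y) from the tail isolates that term, and d32 contains the integral of w times the tail
  error, which converges at infinity thanks to the extra power in the error bound. Hence a
  second-order tail estimate with explicit constants is needed, in a form that survives weak limits.
  Two remainders are kept apart because t powr (2 - 1/Y) and t powr (2/Y) change order at Y = 3/2.
  The strike enters only through an error carrying the factor |\<kappa>|, so the other two
  remainders are fixed before \<kappa> is chosen.\<close>

lemma powr_le_powr_iff:
  fixes x y a :: real assumes "a > 0" "x \<ge> 0" "y \<ge> 0"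
  shows "x powr a \<le> y powr a \<longleftrightarrow> x \<le> y"
  using assms powr_mono2[of a x y] powr_less_mono2[of a y x] by (cases "x \<le> y") auto

lemma nn_integral_powr_upper:
  fixes a p :: real assumes "p > 1" "a > 0"
  shows "(\<integral>\<^sup>+x. ennreal (x powr (- p)) * indicator {a..} x \<partial>lborel) = ennreal (a powr (1 - p) / (p - 1))"
proof -
  have "((\<lambda>x. x powr (-p)) has_integral (- (a powr (- p + 1)) / (- p + 1))) {a..}"
    using assms by (intro has_integral_powr_to_inf) auto
  also have "- (a powr (- p + 1)) / (- p + 1) = a powr (1 - p) / (p - 1)"
    by (simp add: minus_divide_left[symmetric] minus_divide_right add.commute)
  finally show ?thesis by (intro nn_integral_has_integral_lebesgue') auto
qed

lemma nn_integral_powr_lower: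
  fixes a p :: real assumes "p > - 1" "a \<ge> 0"
  shows "(\<integral>\<^sup>+x. ennreal (x powr p) * indicator {0..a} x \<partial>lborel) = ennreal (a powr (p + 1) / (p + 1))"
  using has_integral_powr_from_0[of p a] assms by (intro nn_integral_has_integral_lebesgue') auto

text \<open>Euler's integral after the substitution x -> s x. Most of the Tonelli computations of
  this section end in this kernel.\<close>

lemma nn_integral_Gamma_scaled:
  fixes a s :: real assumes "a > 0" "s > 0"
  shows "(\<integral>\<^sup>+x. ennreal (x powr (a - 1) * exp (- s * x)) * indicator {0<..} x \<partial>lborel) = ennreal (Gamma a / s powr a)"
proof -
  have "ennreal (Gamma a) = (\<integral>\<^sup>+x. ennreal (x powr (a - 1) * exp (- x)) * indicator {0<..} x \<partial>lborel)"
    unfolding Gamma_conv_nn_integral_real[OF assms(1)]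
    by (intro nn_integral_cong_AE eventually_mono[OF AE_lborel_singleton[of 0]])
      (auto simp: indicator_def exp_minus field_simps)
  also have "\<dots> = ennreal s * (\<integral>\<^sup>+x. ennreal ((s * x) powr (a - 1) * exp (- (s * x))) * indicator {0<..} (s * x) \<partial>lborel)"
    using assms by (subst nn_integral_real_affine[where c=s and t=0]) auto
  also have "\<dots> = ennreal s * (\<integral>\<^sup>+x. ennreal (s powr (a - 1)) * (ennreal (x powr (a - 1) * exp (- s * x)) * indicator {0<..} x) \<partial>lborel)"
    using assms by (intro arg_cong[where f="\<lambda>I. ennreal s * I"] nn_integral_cong)
      (auto simp: indicator_def powr_mult zero_less_mult_iff ennreal_mult mult_ac)
  also have "\<dots> = ennreal (s powr a) * (\<integral>\<^sup>+x. ennreal (x powr (a - 1) * exp (- s * x)) * indicator {0<..} x \<partial>lborel)"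
    using assms by (subst nn_integral_cmult) (auto simp: mult.assoc[symmetric] ennreal_mult[symmetric] powr_mult_base)
  finally have "ennreal (1 / s powr a) * ennreal (Gamma a) = ennreal (1 / s powr a) * \<dots>" by simp
  then show ?thesis using assms
    by (simp add: mult.assoc[symmetric] ennreal_mult[symmetric] Gamma_real_nonneg)
qed

lemma nn_integral_exp_upper:
  "(\<integral>\<^sup>+v. ennreal (exp (- v)) * indicator {a..} v \<partial>lborel) = ennreal (exp (- a))" for a :: real
proof -
  have "(\<integral>\<^sup>+v. ennreal (exp (- v)) * indicator {a..} v \<partial>lborel) = ennreal (0 - (- exp (- a)))"
  proof (rule nn_integral_FTC_atLeast)
    show "((\<lambda>v::real. - exp (- v)) \<longlongrightarrow> 0) at_top"
      using tendsto_minus[OF filterlim_compose[OF exp_at_bot filterlim_uminus_at_bot_at_top]] by simp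
  qed (auto intro!: derivative_eq_intros)
  then show ?thesis by simp
qed

text \<open>Since exp(-x) - 1 + x is the integral of (x - s) exp(-s) over 0 < s < x, Tonelli leaves
  the integral of exp(-s) s powr (1 - Y) / (Y (Y - 1)). This is Gamma(2 - Y) / (Y (Y - 1)), and two
  steps of the functional equation turn it into Gamma(-Y).\<close>

lemma nn_integral_exp_minus_1_plus:
  fixes Y :: real assumes Y: "1 < Y" "Y < 2"
  shows "(\<integral>\<^sup>+x. ennreal ((exp (- x) - 1 + x) * x powr (- Y - 1)) * indicator {0<..} x \<partial>lborel) = ennreal (Gamma (- Y))"
proof -
  have inner: "(\<integral>\<^sup>+s. ennreal (if 0 < s \<and> s < x then (x - s) * exp (- s) else 0) \<partial>lborel) = ennreal (exp (- x) - 1 + x)" if x: "x > 0" for x :: real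
  proof -
    have "((\<lambda>s. (x - s) * exp (- s)) has_integral ((1 - x + x) * exp (- x) - (1 - x + 0) * exp (- 0))) {0..x}"
      using x by (intro fundamental_theorem_of_calculus)
        (auto intro!: derivative_eq_intros simp: algebra_simps simp flip: has_real_derivative_iff_has_vector_derivative)
    moreover have "(1 - x + x) * exp (- x) - (1 - x + 0) * exp (- 0) = exp (- x) - 1 + x" by simp
    ultimately have "((\<lambda>s. (x - s) * exp (- s)) has_integral (exp (- x) - 1 + x)) {0..x}"
      by (simp only:)
    then have "ennreal (exp (- x) - 1 + x) = (\<integral>\<^sup>+s. ennreal ((x - s) * exp (- s)) * indicator {0..x} s \<partial>lborel)"
      using x by (subst nn_integral_has_integral_lebesgue') auto
    also have "\<dots> = (\<integral>\<^sup>+s. ennreal (if 0 < s \<and> s < x then (x - s) * exp (- s) else 0) \<partial>lborel)"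
      by (intro nn_integral_cong_AE eventually_mono[OF AE_lborel_singleton[of 0]]) (auto simp: indicator_def)
    finally show ?thesis by simp
  qed
  have outer: "(\<integral>\<^sup>+x. ennreal (if s < x then (x - s) * x powr (- Y - 1) else 0) \<partial>lborel) = ennreal (s powr (1 - Y) / (Y * (Y - 1)))" if s: "s > 0" for s :: real
  proof -
    have e: "(x - s) * x powr (- Y - 1) = x powr (- Y) - s * x powr (- Y - 1)" if "x \<ge> s" for x
      using s that by (simp add: powr_diff left_diff_distrib diff_divide_distrib)
    have "((\<lambda>x. x powr (- Y) - s * x powr (- Y - 1)) has_integral (- (s powr (- Y + 1)) / (- Y + 1) - s * (- (s powr (- Y - 1 + 1)) / (- Y - 1 + 1)))) {s..}"
      using s Y by (intro has_integral_diff has_integral_mult_right has_integral_powr_to_inf) auto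
    also have "- (s powr (- Y + 1)) / (- Y + 1) - s * (- (s powr (- Y - 1 + 1)) / (- Y - 1 + 1)) = s powr (1 - Y) / (Y * (Y - 1))"
      using s Y by (simp add: field_simps powr_diff powr_minus powr_add)
    finally have "((\<lambda>x. (x - s) * x powr (- Y - 1)) has_integral (s powr (1 - Y) / (Y * (Y - 1)))) {s..}"
      by (subst has_integral_cong[OF e]) auto
    then have "(\<integral>\<^sup>+x. ennreal ((x - s) * x powr (- Y - 1)) * indicator {s..} x \<partial>lborel) = ennreal (s powr (1 - Y) / (Y * (Y - 1)))"
      by (rule nn_integral_has_integral_lebesgue'[rotated]) auto
    also have "(\<integral>\<^sup>+x. ennreal ((x - s) * x powr (- Y - 1)) * indicator {s..} x \<partial>lborel) = (\<integral>\<^sup>+x. ennreal (if s < x then (x - s) * x powr (- Y - 1) else 0) \<partial>lborel)"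
      by (intro nn_integral_cong) (auto simp: indicator_def)
    finally show ?thesis .
  qed
  have "(\<integral>\<^sup>+x. ennreal ((exp (- x) - 1 + x) * x powr (- Y - 1)) * indicator {0<..} x \<partial>lborel)
     = (\<integral>\<^sup>+x. (\<integral>\<^sup>+s. ennreal (if 0 < s \<and> s < x then (x - s) * exp (- s) * x powr (- Y - 1) else 0) \<partial>lborel) \<partial>lborel)"
  proof (intro nn_integral_cong)
    fix x :: real
    have "(\<integral>\<^sup>+s. ennreal (if 0 < s \<and> s < x then (x - s) * exp (- s) * x powr (- Y - 1) else 0) \<partial>lborel)
       = (\<integral>\<^sup>+s. ennreal (x powr (- Y - 1)) * ennreal (if 0 < s \<and> s < x then (x - s) * exp (- s) else 0) \<partial>lborel)"
      by (intro nn_integral_cong) (auto simp: ennreal_mult[symmetric] mult_ac)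
    also have "\<dots> = ennreal (x powr (- Y - 1)) * (\<integral>\<^sup>+s. ennreal (if 0 < s \<and> s < x then (x - s) * exp (- s) else 0) \<partial>lborel)"
      by (rule nn_integral_cmult) auto
    also have "\<dots> = ennreal ((exp (- x) - 1 + x) * x powr (- Y - 1)) * indicator {0<..} x"
    proof (cases "x > 0")
      case True
      have "exp (- x) - 1 + x \<ge> 0" using exp_ge_add_one_self[of "-x"] by simp
      with True show ?thesis by (simp add: inner ennreal_mult mult_ac)
    next
      case False
      then have "(\<lambda>s. ennreal (if 0 < s \<and> s < x then (x - s) * exp (- s) else 0)) = (\<lambda>_. 0)"
        by (auto intro!: ext)
      then show ?thesis using False by simp
    qed
    finally show "ennreal ((exp (- x) - 1 + x) * x powr (- Y - 1)) * indicator {0<..} x = (\<integral>\<^sup>+s. ennreal (if 0 < s \<and> s < x then (x - s) * exp (- s) * x powr (- Y - 1) else 0) \<partial>lborel)" by simp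
  qed
  also have "\<dots> = (\<integral>\<^sup>+s. (\<integral>\<^sup>+x. ennreal (if 0 < s \<and> s < x then (x - s) * exp (- s) * x powr (- Y - 1) else 0) \<partial>lborel) \<partial>lborel)"
    by (rule lborel_pair.Fubini') measurable
  also have "\<dots> = (\<integral>\<^sup>+s. ennreal (1 / (Y * (Y - 1))) * (ennreal (s powr ((2 - Y) - 1) * exp (- 1 * s)) * indicator {0<..} s) \<partial>lborel)"
  proof (intro nn_integral_cong)
    fix s :: real
    show "(\<integral>\<^sup>+x. ennreal (if 0 < s \<and> s < x then (x - s) * exp (- s) * x powr (- Y - 1) else 0) \<partial>lborel)
      = ennreal (1 / (Y * (Y - 1))) * (ennreal (s powr ((2 - Y) - 1) * exp (- 1 * s)) * indicator {0<..} s)"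
    proof (cases "s > 0")
      case True
      have "(\<integral>\<^sup>+x. ennreal (if 0 < s \<and> s < x then (x - s) * exp (- s) * x powr (- Y - 1) else 0) \<partial>lborel)
        = (\<integral>\<^sup>+x. ennreal (exp (- s)) * ennreal (if s < x then (x - s) * x powr (- Y - 1) else 0) \<partial>lborel)"
        using True by (intro nn_integral_cong) (auto simp: ennreal_mult[symmetric] mult_ac)
      also have "\<dots> = ennreal (exp (- s)) * ennreal (s powr (1 - Y) / (Y * (Y - 1)))"
        by (subst nn_integral_cmult) (auto simp: outer True)
      finally show ?thesis using True Y by (simp add: ennreal_mult[symmetric] field_simps)
    qed simp
  qed
  also have "\<dots> = ennreal (1 / (Y * (Y - 1))) * ennreal (Gamma (2 - Y) / 1 powr (2 - Y))"
    using Y by (subst nn_integral_cmult, simp) (subst nn_integral_Gamma_scaled, auto)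
  also have "\<dots> = ennreal (Gamma (- Y))"
  proof -
    \<comment> \<open>The functional equation is applied at -Y and 1 - Y, which lie in (-2,-1) and
      (-1,0) and so avoid the poles.\<close>
    have ni: "- Y \<notin> \<int>\<^sub>\<le>\<^sub>0" "1 - Y \<notin> \<int>\<^sub>\<le>\<^sub>0"
    proof -
      have a: "x \<notin> \<int>" if "-2 < x" "x < -1" for x :: real
      proof
        assume "x \<in> \<int>"
        then obtain n where "x = of_int n" by (auto elim: Ints_cases)
        with that have "-2 < n" "n < -1" by linarith+
        then show False by simp
      qed
      have b: "x \<notin> \<int>" if "-1 < x" "x < 0" for x :: real
      proof
        assume "x \<in> \<int>"
        then obtain n where "x = of_int n" by (auto elim: Ints_cases)
        with that have "-1 < n" "n < 0" by linarith+
        then show False by simp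
      qed
      have "- Y \<notin> \<int>" "1 - Y \<notin> \<int>"
        using Y a[of "- Y"] b[of "1 - Y"] by auto
      then show "- Y \<notin> \<int>\<^sub>\<le>\<^sub>0" "1 - Y \<notin> \<int>\<^sub>\<le>\<^sub>0" using nonpos_Ints_Int by blast+
    qed
    have "Gamma (2 - Y) = (1 - Y) * Gamma (1 - Y)" using Gamma_plus1[OF ni(2)] by simp
    moreover have "Gamma (1 - Y) = (- Y) * Gamma (- Y)" using Gamma_plus1[OF ni(1)] by simp
    ultimately have "Gamma (2 - Y) = (Y * (Y - 1)) * Gamma (- Y)" by (simp add: algebra_simps)
    then show ?thesis using Y by (simp add: ennreal_mult'[symmetric])
  qed
  finally show ?thesis .
qed

text \<open>Writing 1 / (1 + s^2) as the integral of exp(-r (1 + s^2)) over r > 0 splits the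
  integral into Gamma(Y/2) / 2 and Gamma(1 - Y/2); the reflection formula evaluates their
  product.\<close>

lemma nn_integral_powr_over_1_plus_square:
  fixes Y :: real assumes Y: "0 < Y" "Y < 2"
  shows "(\<integral>\<^sup>+s. ennreal (s powr (Y - 1) / (1 + s\<^sup>2)) * indicator {0<..} s \<partial>lborel) = ennreal (pi / (2 * sin (pi * Y / 2)))"
proof -
  \<comment> \<open>Instead of substituting for s^2, the factor exp(-r s^2) is written as the
    integral of exp(-v) over v >= r s^2. Exchanging the integrals leaves a pure power of s on a
    bounded interval.\<close>
  have outer: "(\<integral>\<^sup>+s. ennreal (if 0 < s then s powr (Y - 1) * exp (- (r * s\<^sup>2)) else 0) \<partial>lborel) = ennreal (Gamma (Y / 2) / 2 * r powr (- Y / 2))" if r: "r > 0" for r :: real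
  proof -
    have "(\<integral>\<^sup>+s. ennreal (if 0 < s then s powr (Y - 1) * exp (- (r * s\<^sup>2)) else 0) \<partial>lborel)
      = (\<integral>\<^sup>+s. (\<integral>\<^sup>+v. ennreal (if 0 < s \<and> r * s\<^sup>2 \<le> v then s powr (Y - 1) * exp (- v) else 0) \<partial>lborel) \<partial>lborel)"
    proof (intro nn_integral_cong)
      fix s :: real
      have "(\<integral>\<^sup>+v. ennreal (if 0 < s \<and> r * s\<^sup>2 \<le> v then s powr (Y - 1) * exp (- v) else 0) \<partial>lborel)
        = (\<integral>\<^sup>+v. ennreal (if 0 < s then s powr (Y - 1) else 0) * (ennreal (exp (- v)) * indicator {r * s\<^sup>2..} v) \<partial>lborel)"
        by (intro nn_integral_cong) (auto simp: ennreal_mult indicator_def)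
      also have "\<dots> = ennreal (if 0 < s then s powr (Y - 1) * exp (- (r * s\<^sup>2)) else 0)"
        by (subst nn_integral_cmult) (auto simp: nn_integral_exp_upper ennreal_mult)
      finally show "ennreal (if 0 < s then s powr (Y - 1) * exp (- (r * s\<^sup>2)) else 0) = (\<integral>\<^sup>+v. ennreal (if 0 < s \<and> r * s\<^sup>2 \<le> v then s powr (Y - 1) * exp (- v) else 0) \<partial>lborel)" by simp
    qed
    also have "\<dots> = (\<integral>\<^sup>+v. (\<integral>\<^sup>+s. ennreal (if 0 < s \<and> r * s\<^sup>2 \<le> v then s powr (Y - 1) * exp (- v) else 0) \<partial>lborel) \<partial>lborel)"
      by (rule lborel_pair.Fubini') measurable
    also have "\<dots> = (\<integral>\<^sup>+v. ennreal (r powr (- Y / 2) / Y) * (ennreal (v powr ((Y / 2 + 1) - 1) * exp (- 1 * v)) * indicator {0<..} v) \<partial>lborel)"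
    proof (intro nn_integral_cong)
      fix v :: real
      show "(\<integral>\<^sup>+s. ennreal (if 0 < s \<and> r * s\<^sup>2 \<le> v then s powr (Y - 1) * exp (- v) else 0) \<partial>lborel)
        = ennreal (r powr (- Y / 2) / Y) * (ennreal (v powr ((Y / 2 + 1) - 1) * exp (- 1 * v)) * indicator {0<..} v)"
      proof (cases "v > 0")
        case True
        have iff: "r * s\<^sup>2 \<le> v \<longleftrightarrow> s \<le> sqrt (v / r)" if "s > 0" for s
        proof -
          have "r * s\<^sup>2 \<le> v \<longleftrightarrow> s\<^sup>2 \<le> v / r" using r by (simp add: field_simps)
          also have "\<dots> \<longleftrightarrow> sqrt (s\<^sup>2) \<le> sqrt (v / r)" by (rule real_sqrt_le_iff[symmetric])
          finally show ?thesis using that by simp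
        qed
        have "(\<integral>\<^sup>+s. ennreal (if 0 < s \<and> r * s\<^sup>2 \<le> v then s powr (Y - 1) * exp (- v) else 0) \<partial>lborel)
          = (\<integral>\<^sup>+s. ennreal (exp (- v)) * (ennreal (s powr (Y - 1)) * indicator {0..sqrt (v / r)} s) \<partial>lborel)"
          using r True by (intro nn_integral_cong_AE eventually_mono[OF AE_lborel_singleton[of 0]])
            (auto simp: ennreal_mult indicator_def iff mult_ac not_less)
        also have "\<dots> = ennreal (exp (- v)) * ennreal (sqrt (v / r) powr Y / Y)"
          using Y r True by (subst nn_integral_cmult, simp) (subst nn_integral_powr_lower, auto)
        also have "sqrt (v / r) powr Y = v powr (Y / 2) * r powr (- Y / 2)"
        proof -
          have "sqrt (v / r) powr Y = ((v / r) powr (1 / 2)) powr Y"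
            using r True powr_half_sqrt[of "v / r"] by simp
          also have "\<dots> = (v / r) powr (Y / 2)" by (simp add: powr_powr)
          also have "\<dots> = v powr (Y / 2) * r powr (- Y / 2)"
            using r True by (simp add: powr_divide powr_minus_divide)
          finally show ?thesis .
        qed
        finally show ?thesis using True Y by (simp add: ennreal_mult[symmetric] mult_ac)
      next
        case False
        have pos: "r * s\<^sup>2 > 0" if "s > 0" for s using that r by simp
        have "\<not> (0 < s \<and> r * s\<^sup>2 \<le> v)" for s
          by (cases "0 < s") (use pos[of s] False in auto)
        then have "(\<lambda>s. ennreal (if 0 < s \<and> r * s\<^sup>2 \<le> v then s powr (Y - 1) * exp (- v) else 0)) = (\<lambda>_. 0)"
          by (intro ext if_not_P arg_cong[where f=ennreal, of _ 0, simplified]) auto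
        then show ?thesis using False by simp
      qed
    qed
    also have "\<dots> = ennreal (r powr (- Y / 2) / Y) * ennreal (Gamma (Y / 2 + 1) / 1 powr (Y / 2 + 1))"
      using Y by (subst nn_integral_cmult, simp) (subst nn_integral_Gamma_scaled, auto)
    also have "Gamma (Y / 2 + 1) = Y / 2 * Gamma (Y / 2)"
      using Y by (intro Gamma_plus1) (auto elim!: nonpos_Ints_cases)
    finally show ?thesis using Y by (simp add: ennreal_mult'[symmetric] mult_ac)
  qed
  have "(\<integral>\<^sup>+s. ennreal (s powr (Y - 1) / (1 + s\<^sup>2)) * indicator {0<..} s \<partial>lborel)
     = (\<integral>\<^sup>+s. (\<integral>\<^sup>+r. ennreal (if 0 < s \<and> 0 < r then s powr (Y - 1) * exp (- (r * s\<^sup>2)) * exp (- r) else 0) \<partial>lborel) \<partial>lborel)"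
  proof (intro nn_integral_cong)
    fix s :: real
    have "(\<integral>\<^sup>+r. ennreal (if 0 < s \<and> 0 < r then s powr (Y - 1) * exp (- (r * s\<^sup>2)) * exp (- r) else 0) \<partial>lborel)
      = (\<integral>\<^sup>+r. ennreal (if 0 < s then s powr (Y - 1) else 0) * (ennreal (r powr (1 - 1) * exp (- (1 + s\<^sup>2) * r)) * indicator {0<..} r) \<partial>lborel)"
    proof (intro nn_integral_cong)
      fix r :: real
      have "exp (- (1 + s\<^sup>2) * r) = exp (- (r * s\<^sup>2)) * exp (- r)"
        by (simp only: exp_add[symmetric]) (simp add: algebra_simps)
      then show "ennreal (if 0 < s \<and> 0 < r then s powr (Y - 1) * exp (- (r * s\<^sup>2)) * exp (- r) else 0)
        = ennreal (if 0 < s then s powr (Y - 1) else 0) * (ennreal (r powr (1 - 1) * exp (- (1 + s\<^sup>2) * r)) * indicator {0<..} r)"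
        by (auto simp: ennreal_mult[symmetric] mult.assoc)
    qed
    also have "\<dots> = ennreal (if 0 < s then s powr (Y - 1) else 0) * ennreal (Gamma 1 / (1 + s\<^sup>2) powr 1)"
      by (subst nn_integral_cmult, simp) (subst nn_integral_Gamma_scaled, auto simp: add_pos_nonneg)
    also have "\<dots> = ennreal (s powr (Y - 1) / (1 + s\<^sup>2)) * indicator {0<..} s"
      by (auto simp: ennreal_mult'[symmetric] add_nonneg_nonneg)
    finally show "ennreal (s powr (Y - 1) / (1 + s\<^sup>2)) * indicator {0<..} s = (\<integral>\<^sup>+r. ennreal (if 0 < s \<and> 0 < r then s powr (Y - 1) * exp (- (r * s\<^sup>2)) * exp (- r) else 0) \<partial>lborel)" by simp
  qed
  also have "\<dots> = (\<integral>\<^sup>+r. (\<integral>\<^sup>+s. ennreal (if 0 < s \<and> 0 < r then s powr (Y - 1) * exp (- (r * s\<^sup>2)) * exp (- r) else 0) \<partial>lborel) \<partial>lborel)"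
    by (rule lborel_pair.Fubini') measurable
  also have "\<dots> = (\<integral>\<^sup>+r. ennreal (Gamma (Y / 2) / 2) * (ennreal (r powr ((1 - Y / 2) - 1) * exp (- 1 * r)) * indicator {0<..} r) \<partial>lborel)"
  proof (intro nn_integral_cong)
    fix r :: real
    show "(\<integral>\<^sup>+s. ennreal (if 0 < s \<and> 0 < r then s powr (Y - 1) * exp (- (r * s\<^sup>2)) * exp (- r) else 0) \<partial>lborel)
      = ennreal (Gamma (Y / 2) / 2) * (ennreal (r powr ((1 - Y / 2) - 1) * exp (- 1 * r)) * indicator {0<..} r)"
    proof (cases "r > 0")
      case True
      have "(\<integral>\<^sup>+s. ennreal (if 0 < s \<and> 0 < r then s powr (Y - 1) * exp (- (r * s\<^sup>2)) * exp (- r) else 0) \<partial>lborel)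
        = (\<integral>\<^sup>+s. ennreal (exp (- r)) * ennreal (if 0 < s then s powr (Y - 1) * exp (- (r * s\<^sup>2)) else 0) \<partial>lborel)"
        using True by (intro nn_integral_cong) (auto simp: ennreal_mult mult_ac)
      also have "\<dots> = ennreal (exp (- r)) * ennreal (Gamma (Y / 2) / 2 * r powr (- Y / 2))"
        by (subst nn_integral_cmult) (auto simp: outer True)
      finally show ?thesis using True Y by (simp add: ennreal_mult[symmetric] Gamma_real_nonneg mult_ac)
    qed simp
  qed
  also have "\<dots> = ennreal (Gamma (Y / 2) / 2) * ennreal (Gamma (1 - Y / 2) / 1 powr (1 - Y / 2))"
    using Y by (subst nn_integral_cmult, simp) (subst nn_integral_Gamma_scaled, auto)
  also have "\<dots> = ennreal (Gamma (Y / 2) * Gamma (1 - Y / 2) / 2)"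
    using Y by (simp add: ennreal_mult[symmetric] Gamma_real_nonneg)
  also have "Gamma (Y / 2) * Gamma (1 - Y / 2) = pi / sin (pi * Y / 2)"
  proof -
    have "complex_of_real (Gamma (Y / 2) * Gamma (1 - Y / 2)) = Gamma (complex_of_real (Y / 2)) * Gamma (1 - complex_of_real (Y / 2))"
      unfolding of_real_mult Gamma_complex_of_real[symmetric] of_real_diff of_real_1 ..
    also have "\<dots> = complex_of_real (pi / sin (pi * (Y / 2)))"
      unfolding Gamma_reflection_complex by (metis of_real_divide of_real_mult sin_of_real)
    finally show ?thesis by (simp only: of_real_eq_iff) simp
  qed
  finally show ?thesis by (simp add: field_simps)
qed

text \<open>The power x powr (-Y - 1) is a Gamma integral of s powr Y exp(-s x), and the Laplace
  transform of 1 - cos is 1 / (s (1 + s^2)). Tonelli thus reduces the claim to the preceding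
  integral.\<close>

lemma nn_integral_1_minus_cos:
  fixes Y :: real assumes Y: "0 < Y" "Y < 2"
  shows "(\<integral>\<^sup>+x. ennreal ((1 - cos x) * x powr (- Y - 1)) * indicator {0<..} x \<partial>lborel) = ennreal (pi / (2 * Gamma (Y + 1) * sin (pi * Y / 2)))"
proof -
  have lap: "(\<integral>\<^sup>+x. ennreal (if 0 < x then (1 - cos x) * exp (- s * x) else 0) \<partial>lborel) = ennreal (1 / (s * (1 + s\<^sup>2)))" if s: "s > 0" for s :: real
  proof -
    let ?F = "\<lambda>x. - exp (- s * x) / s + exp (- s * x) * (s * cos x - sin x) / (s\<^sup>2 + 1)"
    have pos: "s\<^sup>2 + 1 > 0" by (simp add: add_nonneg_pos)
    define K where "K = 1 / (s\<^sup>2 + 1)"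
    have K: "K * (s\<^sup>2 + 1) = 1" using pos by (simp add: K_def)
    have F_eq: "?F = (\<lambda>x. - (1 / s) * exp (- s * x) + K * (exp (- s * x) * (s * cos x - sin x)))"
      by (simp add: K_def)
    have e0: "((\<lambda>x. exp (- s * x)) \<longlongrightarrow> 0) at_top"
      using s by (intro filterlim_compose[OF exp_at_bot] filterlim_tendsto_neg_mult_at_bot[OF tendsto_const]) (auto simp: filterlim_ident)
    have "((\<lambda>x. exp (- s * x) * (s * cos x - sin x) / (s\<^sup>2 + 1)) \<longlongrightarrow> 0) at_top"
    proof (rule tendsto_0_le[OF e0, where K="(s + 1) / (s\<^sup>2 + 1)"], intro always_eventually allI)
      fix x
      have "\<bar>s * cos x - sin x\<bar> \<le> s + 1"
      proof -
        have "\<bar>s * cos x\<bar> \<le> s" using s mult_left_mono[OF abs_cos_le_one[of x], of s] by (simp add: abs_mult)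
        then show ?thesis using abs_sin_le_one[of x] by linarith
      qed
      then have "exp (- s * x) * \<bar>s * cos x - sin x\<bar> / (s\<^sup>2 + 1) \<le> exp (- s * x) * (s + 1) / (s\<^sup>2 + 1)"
        using pos by (intro divide_right_mono mult_left_mono) auto
      then show "norm (exp (- s * x) * (s * cos x - sin x) / (s\<^sup>2 + 1)) \<le> norm (exp (- s * x)) * ((s + 1) / (s\<^sup>2 + 1))"
        using pos by (simp add: abs_mult)
    qed
    moreover have "((\<lambda>x. - exp (- s * x) / s) \<longlongrightarrow> 0) at_top"
      using tendsto_divide[OF tendsto_minus[OF e0] tendsto_const[of s]] s by simp
    ultimately have lim: "(?F \<longlongrightarrow> 0) at_top"
      using tendsto_add_zero by blast
    have der: "DERIV ?F x :> (1 - cos x) * exp (- s * x)" for x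
    proof -
      have "DERIV ?F x :> exp (- s * x) + K * (- s * exp (- s * x) * (s * cos x - sin x) + exp (- s * x) * (- s * sin x - cos x))"
        unfolding F_eq using s by (auto intro!: derivative_eq_intros simp: algebra_simps)
      also have "K * (- s * exp (- s * x) * (s * cos x - sin x) + exp (- s * x) * (- s * sin x - cos x)) = - (exp (- s * x) * cos x) * (K * (s\<^sup>2 + 1))"
        by (simp add: algebra_simps power2_eq_square)
      finally show ?thesis unfolding K by (simp add: algebra_simps)
    qed
    have "(\<integral>\<^sup>+x. ennreal ((1 - cos x) * exp (- s * x)) * indicator {0..} x \<partial>lborel) = ennreal (0 - ?F 0)"
      by (rule nn_integral_FTC_atLeast[OF _ der _ lim]) auto
    also have "0 - ?F 0 = 1 / (s * (1 + s\<^sup>2))"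
      using s pos by (simp add: field_simps power2_eq_square)
    also have "(\<integral>\<^sup>+x. ennreal ((1 - cos x) * exp (- s * x)) * indicator {0..} x \<partial>lborel) = (\<integral>\<^sup>+x. ennreal (if 0 < x then (1 - cos x) * exp (- s * x) else 0) \<partial>lborel)"
      by (intro nn_integral_cong) (auto simp: indicator_def)
    finally show ?thesis .
  qed
  have G: "Gamma (Y + 1) > 0" using Y by (intro Gamma_real_pos) auto
  have "ennreal (Gamma (Y + 1)) * (\<integral>\<^sup>+x. ennreal ((1 - cos x) * x powr (- Y - 1)) * indicator {0<..} x \<partial>lborel)
     = (\<integral>\<^sup>+x. ennreal (if 0 < x then (1 - cos x) else 0) * ennreal (if 0 < x then Gamma (Y + 1) / x powr (Y + 1) else 0) \<partial>lborel)"
    using G by (subst nn_integral_cmult[symmetric], simp, intro nn_integral_cong)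
      (auto simp: indicator_def ennreal_mult[symmetric] powr_minus powr_diff powr_add field_simps)
  also have "\<dots> = (\<integral>\<^sup>+x. (\<integral>\<^sup>+s. ennreal (if 0 < x \<and> 0 < s then (1 - cos x) * exp (- s * x) * s powr Y else 0) \<partial>lborel) \<partial>lborel)"
  proof (intro nn_integral_cong)
    fix x :: real
    show "ennreal (if 0 < x then (1 - cos x) else 0) * ennreal (if 0 < x then Gamma (Y + 1) / x powr (Y + 1) else 0) = (\<integral>\<^sup>+s. ennreal (if 0 < x \<and> 0 < s then (1 - cos x) * exp (- s * x) * s powr Y else 0) \<partial>lborel)"
    proof (cases "x > 0")
      case True
      have "(\<integral>\<^sup>+s. ennreal (if 0 < x \<and> 0 < s then (1 - cos x) * exp (- s * x) * s powr Y else 0) \<partial>lborel)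
        = (\<integral>\<^sup>+s. ennreal (1 - cos x) * (ennreal (s powr ((Y + 1) - 1) * exp (- x * s)) * indicator {0<..} s) \<partial>lborel)"
        using True by (intro nn_integral_cong) (auto simp: ennreal_mult indicator_def mult_ac)
      also have "\<dots> = ennreal (1 - cos x) * ennreal (Gamma (Y + 1) / x powr (Y + 1))"
        using Y True by (subst nn_integral_cmult, simp) (subst nn_integral_Gamma_scaled, auto)
      finally show ?thesis using True by simp
    qed simp
  qed
  also have "\<dots> = (\<integral>\<^sup>+s. (\<integral>\<^sup>+x. ennreal (if 0 < x \<and> 0 < s then (1 - cos x) * exp (- s * x) * s powr Y else 0) \<partial>lborel) \<partial>lborel)"
    by (rule lborel_pair.Fubini') measurable
  also have "\<dots> = (\<integral>\<^sup>+s. ennreal (s powr (Y - 1) / (1 + s\<^sup>2)) * indicator {0<..} s \<partial>lborel)"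
  proof (intro nn_integral_cong)
    fix s :: real
    show "(\<integral>\<^sup>+x. ennreal (if 0 < x \<and> 0 < s then (1 - cos x) * exp (- s * x) * s powr Y else 0) \<partial>lborel) = ennreal (s powr (Y - 1) / (1 + s\<^sup>2)) * indicator {0<..} s"
    proof (cases "s > 0")
      case True
      have "(\<integral>\<^sup>+x. ennreal (if 0 < x \<and> 0 < s then (1 - cos x) * exp (- s * x) * s powr Y else 0) \<partial>lborel)
        = (\<integral>\<^sup>+x. ennreal (s powr Y) * ennreal (if 0 < x then (1 - cos x) * exp (- s * x) else 0) \<partial>lborel)"
        using True by (intro nn_integral_cong) (auto simp: ennreal_mult mult_ac)
      also have "\<dots> = ennreal (s powr Y) * ennreal (1 / (s * (1 + s\<^sup>2)))"
        by (subst nn_integral_cmult) (auto simp: lap True)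
      finally show ?thesis using True by (simp add: ennreal_mult[symmetric] powr_diff field_simps)
    qed simp
  qed
  also have "\<dots> = ennreal (pi / (2 * sin (pi * Y / 2)))"
    by (rule nn_integral_powr_over_1_plus_square[OF Y])
  finally have "ennreal (1 / Gamma (Y + 1)) * (ennreal (Gamma (Y + 1)) * (\<integral>\<^sup>+x. ennreal ((1 - cos x) * x powr (- Y - 1)) * indicator {0<..} x \<partial>lborel)) = ennreal (1 / Gamma (Y + 1)) * ennreal (pi / (2 * sin (pi * Y / 2)))"
    by simp
  then show ?thesis using G
    by (simp add: mult.assoc[symmetric] ennreal_mult'[symmetric] mult.commute[of _ 2])
qed

text \<open>The modulus of a stable characteristic function has this shape, so the value yields both
  its integrability and, by Fourier inversion, the density of the symmetric law at 0.\<close>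

lemma nn_integral_exp_minus_powr:
  fixes c Y :: real assumes "c > 0" "Y > 0"
  shows "(\<integral>\<^sup>+u. ennreal (exp (- (c * u powr Y))) * indicator {0<..} u \<partial>lborel) = ennreal (Gamma (1 + 1 / Y) * c powr (- 1 / Y))"
proof -
  have "(\<integral>\<^sup>+u. ennreal (exp (- (c * u powr Y))) * indicator {0<..} u \<partial>lborel)
    = (\<integral>\<^sup>+u. (\<integral>\<^sup>+v. ennreal (if 0 < u \<and> c * u powr Y \<le> v then exp (- v) else 0) \<partial>lborel) \<partial>lborel)"
  proof (intro nn_integral_cong)
    fix u :: real
    show "ennreal (exp (- (c * u powr Y))) * indicator {0<..} u = (\<integral>\<^sup>+v. ennreal (if 0 < u \<and> c * u powr Y \<le> v then exp (- v) else 0) \<partial>lborel)"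
    proof (cases "u > 0")
      case True
      have "(\<integral>\<^sup>+v. ennreal (if 0 < u \<and> c * u powr Y \<le> v then exp (- v) else 0) \<partial>lborel) = (\<integral>\<^sup>+v. ennreal (exp (- v)) * indicator {c * u powr Y..} v \<partial>lborel)"
        using True by (intro nn_integral_cong) (auto simp: indicator_def)
      then show ?thesis using True by (simp add: nn_integral_exp_upper)
    qed simp
  qed
  also have "\<dots> = (\<integral>\<^sup>+v. (\<integral>\<^sup>+u. ennreal (if 0 < u \<and> c * u powr Y \<le> v then exp (- v) else 0) \<partial>lborel) \<partial>lborel)"
    by (rule lborel_pair.Fubini') measurable
  also have "\<dots> = (\<integral>\<^sup>+v. ennreal (c powr (- 1 / Y)) * (ennreal (v powr ((1 + 1 / Y) - 1) * exp (- 1 * v)) * indicator {0<..} v) \<partial>lborel)"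
  proof (intro nn_integral_cong)
    fix v :: real
    show "(\<integral>\<^sup>+u. ennreal (if 0 < u \<and> c * u powr Y \<le> v then exp (- v) else 0) \<partial>lborel) = ennreal (c powr (- 1 / Y)) * (ennreal (v powr ((1 + 1 / Y) - 1) * exp (- 1 * v)) * indicator {0<..} v)"
    proof (cases "v > 0")
      case True
      have iff: "c * u powr Y \<le> v \<longleftrightarrow> u \<le> (v / c) powr (1 / Y)" if "u > 0" for u
      proof -
        have "c * u powr Y \<le> v \<longleftrightarrow> u powr Y \<le> v / c" using assms by (simp add: field_simps)
        also have "\<dots> \<longleftrightarrow> (u powr Y) powr (1 / Y) \<le> (v / c) powr (1 / Y)"
          using assms True that by (subst powr_le_powr_iff) auto
        finally show ?thesis using assms that by (simp add: powr_powr)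
      qed
      have "(\<integral>\<^sup>+u. ennreal (if 0 < u \<and> c * u powr Y \<le> v then exp (- v) else 0) \<partial>lborel) = (\<integral>\<^sup>+u. ennreal (exp (- v)) * indicator {0<..(v / c) powr (1 / Y)} u \<partial>lborel)"
        by (intro nn_integral_cong) (auto simp: indicator_def iff)
      also have "\<dots> = ennreal (exp (- v)) * ennreal ((v / c) powr (1 / Y))"
        by (simp add: nn_integral_cmult_indicator)
      also have "(v / c) powr (1 / Y) = v powr (1 / Y) * c powr (- 1 / Y)"
        using True assms by (simp add: powr_divide powr_minus_divide)
      finally show ?thesis using True assms
        by (simp add: ennreal_mult[symmetric] mult_ac)
    next
      case False
      have pos: "c * u powr Y > 0" if "u > 0" for u using that assms by simp
      have "\<not> (0 < u \<and> c * u powr Y \<le> v)" for u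
        by (cases "0 < u") (use pos[of u] False in auto)
      then have "(\<lambda>u. ennreal (if 0 < u \<and> c * u powr Y \<le> v then exp (- v) else 0)) = (\<lambda>_. 0)"
        by (intro ext if_not_P arg_cong[where f=ennreal, of _ 0, simplified]) auto
      then show ?thesis using False by simp
    qed
  qed
  also have "\<dots> = ennreal (c powr (- 1 / Y)) * ennreal (Gamma (1 + 1 / Y) / 1 powr (1 + 1 / Y))"
    using assms by (subst nn_integral_cmult, simp) (subst nn_integral_Gamma_scaled, auto simp: add_pos_pos)
  finally show ?thesis using assms Gamma_real_pos[of "1 + 1 / Y"]
    by (simp add: ennreal_mult[symmetric] add_pos_pos less_imp_le mult_ac)
qed

text \<open>This evaluates the first absolute moment of the symmetric stable law, which is an
  integral of one minus its characteristic function against u powr (-2). The difference 1 - exp(-a)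
  is expanded as an integral of exp(-v) over 0 < v <= a.\<close>

lemma nn_integral_1_minus_exp_minus_powr:
  fixes c Y :: real assumes "c > 0" "Y > 1"
  shows "(\<integral>\<^sup>+u. ennreal ((1 - exp (- (c * u powr Y))) * u powr (- 2)) * indicator {0<..} u \<partial>lborel) = ennreal (c powr (1 / Y) * Gamma (1 - 1 / Y))"
proof -
  have "(\<integral>\<^sup>+u. ennreal ((1 - exp (- (c * u powr Y))) * u powr (- 2)) * indicator {0<..} u \<partial>lborel)
    = (\<integral>\<^sup>+u. (\<integral>\<^sup>+v. ennreal (if 0 < u \<and> 0 < v \<and> v \<le> c * u powr Y then exp (- v) * u powr (- 2) else 0) \<partial>lborel) \<partial>lborel)"
  proof (intro nn_integral_cong)
    fix u :: real
    show "ennreal ((1 - exp (- (c * u powr Y))) * u powr (- 2)) * indicator {0<..} u = (\<integral>\<^sup>+v. ennreal (if 0 < u \<and> 0 < v \<and> v \<le> c * u powr Y then exp (- v) * u powr (- 2) else 0) \<partial>lborel)"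
    proof (cases "u > 0")
      case True
      have nn: "0 \<le> c * u powr Y" using assms by simp
      have "((\<lambda>v. exp (- v)) has_integral (- exp (- (c * u powr Y)) - (- exp (- 0)))) {0..c * u powr Y}"
        using nn by (intro fundamental_theorem_of_calculus)
          (auto intro!: derivative_eq_intros simp flip: has_real_derivative_iff_has_vector_derivative)
      then have I: "(\<integral>\<^sup>+v. ennreal (exp (- v)) * indicator {0..c * u powr Y} v \<partial>lborel) = ennreal (1 - exp (- (c * u powr Y)))"
        by (subst nn_integral_has_integral_lebesgue') auto
      have "(\<integral>\<^sup>+v. ennreal (if 0 < u \<and> 0 < v \<and> v \<le> c * u powr Y then exp (- v) * u powr (- 2) else 0) \<partial>lborel)
        = (\<integral>\<^sup>+v. ennreal (u powr (- 2)) * (ennreal (exp (- v)) * indicator {0..c * u powr Y} v) \<partial>lborel)"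
        using True by (intro nn_integral_cong_AE eventually_mono[OF AE_lborel_singleton[of 0]])
          (auto simp: indicator_def ennreal_mult mult_ac not_less)
      also have "\<dots> = ennreal (u powr (- 2)) * ennreal (1 - exp (- (c * u powr Y)))"
        by (subst nn_integral_cmult) (auto simp: I)
      finally show ?thesis using True nn by (simp add: ennreal_mult[symmetric] mult_ac)
    qed simp
  qed
  also have "\<dots> = (\<integral>\<^sup>+v. (\<integral>\<^sup>+u. ennreal (if 0 < u \<and> 0 < v \<and> v \<le> c * u powr Y then exp (- v) * u powr (- 2) else 0) \<partial>lborel) \<partial>lborel)"
    by (rule lborel_pair.Fubini') measurable
  also have "\<dots> = (\<integral>\<^sup>+v. ennreal (c powr (1 / Y)) * (ennreal (v powr ((1 - 1 / Y) - 1) * exp (- 1 * v)) * indicator {0<..} v) \<partial>lborel)"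
  proof (intro nn_integral_cong)
    fix v :: real
    show "(\<integral>\<^sup>+u. ennreal (if 0 < u \<and> 0 < v \<and> v \<le> c * u powr Y then exp (- v) * u powr (- 2) else 0) \<partial>lborel) = ennreal (c powr (1 / Y)) * (ennreal (v powr ((1 - 1 / Y) - 1) * exp (- 1 * v)) * indicator {0<..} v)"
    proof (cases "v > 0")
      case True
      have iff: "v \<le> c * u powr Y \<longleftrightarrow> (v / c) powr (1 / Y) \<le> u" if "u > 0" for u
      proof -
        have "v \<le> c * u powr Y \<longleftrightarrow> v / c \<le> u powr Y" using assms by (simp add: field_simps)
        also have "\<dots> \<longleftrightarrow> (v / c) powr (1 / Y) \<le> (u powr Y) powr (1 / Y)"
          using assms True that by (subst powr_le_powr_iff) auto
        finally show ?thesis using assms that by (simp add: powr_powr)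
      qed
      have p: "(v / c) powr (1 / Y) > 0" using assms True by simp
      have "(\<integral>\<^sup>+u. ennreal (if 0 < u \<and> 0 < v \<and> v \<le> c * u powr Y then exp (- v) * u powr (- 2) else 0) \<partial>lborel) = (\<integral>\<^sup>+u. ennreal (exp (- v)) * (ennreal (u powr (- 2)) * indicator {(v / c) powr (1 / Y)..} u) \<partial>lborel)"
        using True order.strict_trans2[OF p] by (intro nn_integral_cong) (auto simp: indicator_def iff ennreal_mult)
      also have "\<dots> = ennreal (exp (- v)) * ennreal (((v / c) powr (1 / Y)) powr (- 1))"
        using p by (subst nn_integral_cmult, simp) (subst nn_integral_powr_upper, auto)
      also have "((v / c) powr (1 / Y)) powr (- 1) = v powr (- 1 / Y) * c powr (1 / Y)"
        using True assms by (simp add: powr_divide powr_minus_divide powr_powr)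
      finally show ?thesis using True assms
        by (simp add: ennreal_mult[symmetric] mult_ac)
    qed simp
  qed
  also have "\<dots> = ennreal (c powr (1 / Y)) * ennreal (Gamma (1 - 1 / Y) / 1 powr (1 - 1 / Y))"
    using assms by (subst nn_integral_cmult, simp) (subst nn_integral_Gamma_scaled, auto)
  finally show ?thesis by (simp add: ennreal_mult'[symmetric])
qed

section \<open>The exponent of the one-sided stable law\<close>

text \<open>The right half-plane is convex and every derivative of exp(-w) is bounded by 1 there, so
  the complex Taylor estimate holds with constant 1.\<close>

lemma cmod_exp_Taylor_le:
  assumes "Re w \<ge> 0"
  shows "cmod (exp (- w) - (\<Sum>i\<le>n. (- 1) ^ i * w ^ i / fact i)) \<le> cmod w ^ Suc n / fact n"
proof -
  let ?f = "\<lambda>i x :: complex. (- 1) ^ i * exp (- x)"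
  have "cmod (?f 0 w - (\<Sum>i\<le>n. ?f i 0 * (w - 0) ^ i / fact i)) \<le> 1 * cmod (w - 0) ^ Suc n / fact n"
    by (rule complex_Taylor[where S="{w. Re w \<ge> 0}"])
      (use assms in \<open>auto intro!: derivative_eq_intros convex_halfspace_Re_ge simp: norm_mult norm_power\<close>)
  then show ?thesis by simp
qed

lemma cmod_exp_minus_1_le: "Re w \<ge> 0 \<Longrightarrow> cmod (exp (- w) - 1) \<le> cmod w"
  using cmod_exp_Taylor_le[of w 0] by simp

lemma cmod_exp_minus_1_plus_le: "Re w \<ge> 0 \<Longrightarrow> cmod (exp (- w) - 1 + w) \<le> (cmod w)\<^sup>2"
  using cmod_exp_Taylor_le[of w 1] by (simp add: power2_eq_square algebra_simps)

lemma set_integrable_powr_lower: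
  fixes a p :: real assumes "p > - 1" "a \<ge> 0"
  shows "set_integrable lborel {0..a} (\<lambda>x. x powr p)"
  unfolding set_integrable_def
  using nn_integral_powr_lower[OF assms]
  by (intro integrableI_nn_integral_finite[where x="a powr (p + 1) / (p + 1)"])
    (auto simp: mult.commute ennreal_mult' ennreal_indicator)

lemma set_integrable_powr_upper:
  fixes a p :: real assumes "p > 1" "a > 0"
  shows "set_integrable lborel {a..} (\<lambda>x. x powr (- p))"
  unfolding set_integrable_def
  using nn_integral_powr_upper[OF assms]
  by (intro integrableI_nn_integral_finite[where x="a powr (1 - p) / (p - 1)"])
    (auto simp: mult.commute ennreal_mult' ennreal_indicator)

text \<open>Common integrable majorant, of the form min(x^2, x) times x powr (-Y - 1): it is
  integrable at 0 because Y < 2 and at infinity because Y > 1. At x = 1 both summands count, which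
  is harmless for a majorant.\<close>

definition stable_dom :: "real \<Rightarrow> real \<Rightarrow> real" where
  "stable_dom Y x = indicator {0..1} x * x powr (1 - Y) + indicator {1..} x * x powr (- Y)"

lemma stable_dom_nonneg: "0 \<le> stable_dom Y x"
  by (simp add: stable_dom_def)

lemma stable_dom_measurable [measurable]: "stable_dom Y \<in> borel_measurable borel"
  unfolding stable_dom_def by measurable

lemma integrable_stable_dom:
  assumes "1 < Y" "Y < 2" shows "integrable lborel (stable_dom Y)"
  unfolding stable_dom_def
  using set_integrable_powr_lower[of "1 - Y" 1] set_integrable_powr_upper[of Y 1] assms
  by (intro Bochner_Integration.integrable_add) (auto simp: set_integrable_def)

definition stable_integrand :: "real \<Rightarrow> real \<Rightarrow> complex \<Rightarrow> real \<Rightarrow> complex" where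
  "stable_integrand C Y z x = (exp (- z * of_real x) - 1 + z * of_real x) * of_real (C * x powr (- Y - 1))"

text \<open>The log-Laplace exponent of the centred one-sided law, taken as a function on the right
  half-plane. Its values at -i u give the characteristic function and those at M - i u the
  exponentially tilted one, so a single function serves both measures.\<close>

definition stable_exponent :: "real \<Rightarrow> real \<Rightarrow> complex \<Rightarrow> complex" where
  "stable_exponent C Y z = (CLBINT x:{0<..}. stable_integrand C Y z x)"

lemma stable_integrand_measurable [measurable]: "stable_integrand C Y z \<in> borel_measurable borel"
  unfolding stable_integrand_def by measurable

text \<open>Second-order Taylor estimate for x <= 1, first-order estimate for x > 1; the two powers
  of |z| in the constant belong to these two cases.\<close>

lemma stable_integrand_bound:
  assumes "C \<ge> 0" "Re z \<ge> 0" "x > 0"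
  shows "cmod (stable_integrand C Y z x) \<le> C * ((cmod z)\<^sup>2 + 2 * cmod z) * stable_dom Y x"
proof (cases "x \<le> 1")
  case True
  have "cmod (exp (- z * of_real x) - 1 + z * of_real x) \<le> (cmod (z * of_real x))\<^sup>2"
    using cmod_exp_minus_1_plus_le[of "z * of_real x"] assms by simp
  also have "\<dots> = (cmod z)\<^sup>2 * x\<^sup>2" using assms by (simp add: norm_mult power_mult_distrib)
  finally have "cmod (stable_integrand C Y z x) \<le> ((cmod z)\<^sup>2 * x\<^sup>2) * (C * x powr (- Y - 1))"
    using assms by (simp add: stable_integrand_def norm_mult abs_mult mult_right_mono)
  also have "\<dots> = C * (cmod z)\<^sup>2 * (x\<^sup>2 * x powr (- Y - 1))" by simp
  also have "x\<^sup>2 * x powr (- Y - 1) = x powr (1 - Y)"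
    using assms by (simp add: powr_numeral[symmetric] powr_add[symmetric] del: powr_numeral)
  also have "C * (cmod z)\<^sup>2 * x powr (1 - Y) \<le> C * ((cmod z)\<^sup>2 + 2 * cmod z) * stable_dom Y x"
    using assms True by (intro mult_mono) (auto simp: stable_dom_def)
  finally show ?thesis .
next
  case False
  have "cmod (exp (- z * of_real x) - 1 + z * of_real x) \<le> cmod (exp (- z * of_real x) - 1) + cmod (z * of_real x)"
    by (rule norm_triangle_ineq)
  also have "\<dots> \<le> 2 * cmod (z * of_real x)"
    using cmod_exp_minus_1_le[of "z * of_real x"] assms by simp
  also have "\<dots> = 2 * cmod z * x" using assms by (simp add: norm_mult)
  finally have "cmod (stable_integrand C Y z x) \<le> (2 * cmod z * x) * (C * x powr (- Y - 1))"
    using assms by (simp add: stable_integrand_def norm_mult abs_mult mult_right_mono)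
  also have "\<dots> = C * (2 * cmod z) * (x * x powr (- Y - 1))" by simp
  also have "x * x powr (- Y - 1) = x powr (- Y)"
    using assms by (simp add: powr_diff)
  also have "C * (2 * cmod z) * x powr (- Y) \<le> C * ((cmod z)\<^sup>2 + 2 * cmod z) * stable_dom Y x"
    using assms False by (intro mult_mono) (auto simp: stable_dom_def)
  finally show ?thesis .
qed

lemma set_integrable_stable_integrand:
  assumes "C \<ge> 0" "1 < Y" "Y < 2" "Re z \<ge> 0" "A \<in> sets borel" "A \<subseteq> {0<..}"
  shows "set_integrable lborel A (stable_integrand C Y z)"
  unfolding set_integrable_def
proof (rule Bochner_Integration.integrable_bound)
  show "integrable lborel (\<lambda>x. C * ((cmod z)\<^sup>2 + 2 * cmod z) * stable_dom Y x)"
    using assms integrable_stable_dom by simp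
  show "AE x in lborel. norm (indicator A x *\<^sub>R stable_integrand C Y z x) \<le> norm (C * ((cmod z)\<^sup>2 + 2 * cmod z) * stable_dom Y x)"
    using stable_integrand_bound[OF assms(1,4)] assms(1,6)
    by (intro always_eventually allI) (auto simp: indicator_def abs_mult stable_dom_nonneg subset_iff)
qed (use assms in measurable)

text \<open>Self-similarity: the kernel x powr (-Y - 1) dx is homogeneous of degree -Y, so the
  substitution x -> h x pulls out h powr Y. With h = t powr (1/Y) every statement at time t is
  reduced to time 1.\<close>

lemma stable_exponent_scale:
  assumes "h > 0"
  shows "stable_exponent C Y (of_real h * z) = of_real (h powr Y) * stable_exponent C Y z"
proof -
  have s: "stable_integrand C Y z (h * x) = of_real (h powr (- Y - 1)) * stable_integrand C Y (of_real h * z) x" if "x > 0" for x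
    using assms that by (simp add: stable_integrand_def powr_mult mult_ac)
  have "stable_exponent C Y z = \<bar>h\<bar> *\<^sub>R (\<integral>x. indicator {0<..} (0 + h * x) *\<^sub>R stable_integrand C Y z (0 + h * x) \<partial>lborel)"
    unfolding stable_exponent_def set_lebesgue_integral_def
    using assms by (subst lborel_integral_real_affine[where c=h and t=0]) auto
  also have "(\<integral>x. indicator {0<..} (0 + h * x) *\<^sub>R stable_integrand C Y z (0 + h * x) \<partial>lborel)
     = (\<integral>x. of_real (h powr (- Y - 1)) * (indicator {0<..} x *\<^sub>R stable_integrand C Y (of_real h * z) x) \<partial>lborel)"
    using assms by (intro Bochner_Integration.integral_cong) (auto simp: indicator_def zero_less_mult_iff s)
  also have "\<dots> = of_real (h powr (- Y - 1)) * stable_exponent C Y (of_real h * z)"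
    unfolding stable_exponent_def set_lebesgue_integral_def integral_mult_right_zero[symmetric] ..
  finally have "stable_exponent C Y z = of_real (h * h powr (- Y - 1)) * stable_exponent C Y (of_real h * z)"
    using assms by (simp add: scaleR_conv_of_real mult.assoc)
  also have "h * h powr (- Y - 1) = h powr (- Y)" using assms by (simp add: powr_diff)
  finally have "of_real (h powr Y) * stable_exponent C Y z = of_real (h powr Y * h powr (- Y)) * stable_exponent C Y (of_real h * z)"
    by simp
  also have "h powr Y * h powr (- Y) = 1" using assms by (simp add: powr_minus)
  finally show ?thesis by simp
qed

lemma stable_exponent_0 [simp]: "stable_exponent C Y 0 = 0"
  by (simp add: stable_exponent_def stable_integrand_def)

text \<open>Scaling reduces the claim to l = 1, where the exponent is the Gamma integral computed
  above; the scaling argument excludes l = 0, which is trivial.\<close>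

lemma stable_exponent_of_real:
  assumes "C \<ge> 0" "1 < Y" "Y < 2" "l \<ge> 0"
  shows "stable_exponent C Y (of_real l) = of_real (C * Gamma (- Y) * l powr Y)"
proof -
  have nn: "0 \<le> exp (- x) - 1 + x" for x :: real using exp_ge_add_one_self[of "-x"] by simp
  have "stable_exponent C Y 1 = (\<integral>x. of_real (C * (indicator {0<..} x * ((exp (- x) - 1 + x) * x powr (- Y - 1)))) \<partial>lborel)"
    unfolding stable_exponent_def set_lebesgue_integral_def stable_integrand_def
    by (intro Bochner_Integration.integral_cong) (auto simp: indicator_def exp_of_real[symmetric] simp flip: of_real_minus)
  also have "\<dots> = of_real (\<integral>x. C * (indicator {0<..} x * ((exp (- x) - 1 + x) * x powr (- Y - 1))) \<partial>lborel)"
    by (rule integral_complex_of_real)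
  also have "(\<integral>x. C * (indicator {0<..} x * ((exp (- x) - 1 + x) * x powr (- Y - 1))) \<partial>lborel) = C * (\<integral>x. indicator {0<..} x * ((exp (- x) - 1 + x) * x powr (- Y - 1)) \<partial>lborel)"
    by (rule integral_mult_right_zero)
  also have "(\<integral>x. indicator {0<..} x * ((exp (- x) - 1 + x) * x powr (- Y - 1)) \<partial>lborel) = enn2real (\<integral>\<^sup>+x. ennreal (indicator {0<..} x * ((exp (- x) - 1 + x) * x powr (- Y - 1))) \<partial>lborel)"
    using nn by (intro integral_eq_nn_integral) auto
  also have "(\<integral>\<^sup>+x. ennreal (indicator {0<..} x * ((exp (- x) - 1 + x) * x powr (- Y - 1))) \<partial>lborel) = ennreal (Gamma (- Y))"
    unfolding nn_integral_exp_minus_1_plus[OF assms(2,3), symmetric]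
    by (intro nn_integral_cong) (auto simp: indicator_def)
  \<comment> \<open>The conversion from extended reals preserves the value only if Gamma(-Y) >= 0;
    this follows from the functional equation, as Gamma(2 - Y) > 0 and Y (Y - 1) > 0.\<close>
  also have "enn2real (ennreal (Gamma (- Y))) = Gamma (- Y)"
  proof -
    have ni: "- Y \<notin> \<int>\<^sub>\<le>\<^sub>0" "1 - Y \<notin> \<int>\<^sub>\<le>\<^sub>0"
    proof -
      have "Y \<noteq> of_int n" for n
      proof
        assume "Y = of_int n"
        with assms have "1 < n" "n < 2" by linarith+
        then show False by simp
      qed
      then have "Y \<notin> \<int>" by (auto elim!: Ints_cases)
      then have "- Y \<notin> \<int>" "1 - Y \<notin> \<int>" by (auto simp: minus_in_Ints_iff)
      then show "- Y \<notin> \<int>\<^sub>\<le>\<^sub>0" "1 - Y \<notin> \<int>\<^sub>\<le>\<^sub>0" using nonpos_Ints_Int by blast+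
    qed
    have "Gamma (2 - Y) = (1 - Y) * Gamma (1 - Y)" using Gamma_plus1[OF ni(2)] by simp
    moreover have "Gamma (1 - Y) = (- Y) * Gamma (- Y)" using Gamma_plus1[OF ni(1)] by simp
    ultimately have "Gamma (- Y) = Gamma (2 - Y) / (Y * (Y - 1))" using assms by (simp add: field_simps)
    moreover have "Gamma (2 - Y) > 0" using assms by (intro Gamma_real_pos) auto
    ultimately have "Gamma (- Y) \<ge> 0" using assms by simp
    then show ?thesis by simp
  qed
  finally have one: "stable_exponent C Y 1 = of_real (C * Gamma (- Y))" .
  show ?thesis
  proof (cases "l = 0")
    case False
    then show ?thesis using assms stable_exponent_scale[of l C Y 1] by (simp add: one)
  qed simp
qed

text \<open>The reflection formula at Y produces sin(pi Y), whose double-angle form cancels the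
  cosine. This reconciles the constant of the cosine integral with the constant written through
  Gamma(-Y).\<close>

lemma Gamma_neg_cos:
  assumes "1 < Y" "Y < 2"
  shows "Gamma (- Y) * cos (pi * Y / 2) = - pi / (2 * Gamma (Y + 1) * sin (pi * Y / 2))"
proof -
  have s: "sin (pi * Y / 2) > 0" using assms by (intro sin_gt_zero) auto
  have "cos (pi * Y / 2) < cos (pi / 2)" using assms by (intro cos_monotone_0_pi) (auto simp: field_simps)
  then have c: "cos (pi * Y / 2) \<noteq> 0" by simp
  have G: "Gamma (Y + 1) > 0" using assms by (intro Gamma_real_pos) auto
  have dbl: "sin (pi * Y) = 2 * sin (pi * Y / 2) * cos (pi * Y / 2)"
    using sin_double[of "pi * Y / 2"] by simp
  have "complex_of_real (Gamma Y * Gamma (- Y)) = complex_of_real (- pi / (Y * sin (pi * Y)))"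
    using Gamma_reflection_complex'[of "of_real Y"]
    by (simp add: Gamma_complex_of_real[symmetric] sin_of_real[symmetric])
  then have "Gamma Y * Gamma (- Y) = - pi / (Y * sin (pi * Y))" by (simp only: of_real_eq_iff)
  moreover have "Gamma (Y + 1) = Y * Gamma Y"
    using assms by (intro Gamma_plus1) (auto elim!: nonpos_Ints_cases)
  ultimately have "Gamma (Y + 1) * Gamma (- Y) = - pi / sin (pi * Y)" using assms by (simp add: mult.assoc)
  then show ?thesis unfolding dbl using s c G by (simp add: field_simps)
qed

text \<open>The sine and the linear compensator are odd and cancel, leaving -2 C times the integral
  of 1 - cos; scaling then restores the dependence on |u|. The result is the exponent of the
  difference of two independent copies.\<close>

lemma stable_exponent_symmetrize:
  assumes "C \<ge> 0" "1 < Y" "Y < 2"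
  shows "stable_exponent C Y (\<i> * of_real u) + stable_exponent C Y (- (\<i> * of_real u)) = of_real (2 * C * Gamma (- Y) * cos (pi * Y / 2) * \<bar>u\<bar> powr Y)"
proof -
  let ?S = "\<lambda>z. stable_exponent C Y z + stable_exponent C Y (- z)"
  have "?S \<i> = (CLBINT x:{0<..}. stable_integrand C Y \<i> x + stable_integrand C Y (- \<i>) x)"
    unfolding stable_exponent_def using assms
    by (intro set_integral_add(2)[symmetric] set_integrable_stable_integrand) auto
  also have "\<dots> = (\<integral>x. of_real (- 2 * C * (indicator {0<..} x * ((1 - cos x) * x powr (- Y - 1)))) \<partial>lborel)"
    unfolding set_lebesgue_integral_def stable_integrand_def
    by (intro Bochner_Integration.integral_cong)
      (auto simp: indicator_def complex_eq_iff Re_exp Im_exp algebra_simps)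
  also have "\<dots> = of_real (\<integral>x. - 2 * C * (indicator {0<..} x * ((1 - cos x) * x powr (- Y - 1))) \<partial>lborel)"
    by (rule integral_complex_of_real)
  also have "(\<integral>x. - 2 * C * (indicator {0<..} x * ((1 - cos x) * x powr (- Y - 1))) \<partial>lborel) = - 2 * C * (\<integral>x. indicator {0<..} x * ((1 - cos x) * x powr (- Y - 1)) \<partial>lborel)"
    by (rule integral_mult_right_zero)
  also have "(\<integral>x. indicator {0<..} x * ((1 - cos x) * x powr (- Y - 1)) \<partial>lborel) = enn2real (\<integral>\<^sup>+x. ennreal (indicator {0<..} x * ((1 - cos x) * x powr (- Y - 1))) \<partial>lborel)"
    by (intro integral_eq_nn_integral) auto
  also have "(\<integral>\<^sup>+x. ennreal (indicator {0<..} x * ((1 - cos x) * x powr (- Y - 1))) \<partial>lborel) = ennreal (pi / (2 * Gamma (Y + 1) * sin (pi * Y / 2)))"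
    using assms by (subst nn_integral_1_minus_cos[symmetric], simp, simp)
      (intro nn_integral_cong, auto simp: indicator_def)
  also have "enn2real \<dots> = pi / (2 * Gamma (Y + 1) * sin (pi * Y / 2))"
  proof -
    have "Gamma (Y + 1) > 0" "sin (pi * Y / 2) > 0"
      using assms by (auto intro!: Gamma_real_pos sin_gt_zero)
    then show ?thesis by simp
  qed
  also have "\<dots> = - (Gamma (- Y) * cos (pi * Y / 2))"
    using Gamma_neg_cos[OF assms(2,3)] by simp
  finally have one: "?S \<i> = of_real (2 * C * Gamma (- Y) * cos (pi * Y / 2))" by simp
  have "?S (\<i> * of_real v) = of_real (2 * C * Gamma (- Y) * cos (pi * Y / 2) * \<bar>v\<bar> powr Y)" if "v > 0" for v
    using one that stable_exponent_scale[of v C Y \<i>] stable_exponent_scale[of v C Y "- \<i>"]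
    by (simp add: mult_ac) (simp add: algebra_simps flip: distrib_left)
  from this[of u] this[of "- u"] show ?thesis
    by (cases "u > 0"; cases "u = 0") (auto simp: add.commute)
qed

section \<open>First absolute moments from characteristic functions\<close>

lemma nn_integral_1_minus_cos_scaled:
  "(\<integral>\<^sup>+u. ennreal ((1 - cos (u * x)) * u powr (- 2)) * indicator {0<..} u \<partial>lborel) = ennreal (pi / 2 * \<bar>x\<bar>)"
proof -
  have *: "(\<integral>\<^sup>+u. ennreal ((1 - cos (u * x)) * u powr (- 2)) * indicator {0<..} u \<partial>lborel) = ennreal (pi / 2 * x)" if "x > 0" for x :: real
  proof -
    have "ennreal (pi / 2) = (\<integral>\<^sup>+u. ennreal ((1 - cos u) * u powr (- 2)) * indicator {0<..} u \<partial>lborel)"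
      using nn_integral_1_minus_cos[of 1] by (simp add: Gamma_numeral)
    also have "\<dots> = ennreal \<bar>x\<bar> * (\<integral>\<^sup>+u. ennreal ((1 - cos (0 + x * u)) * (0 + x * u) powr (- 2)) * indicator {0<..} (0 + x * u) \<partial>lborel)"
      using that by (intro nn_integral_real_affine) auto
    also have "(\<integral>\<^sup>+u. ennreal ((1 - cos (0 + x * u)) * (0 + x * u) powr (- 2)) * indicator {0<..} (0 + x * u) \<partial>lborel)
      = (\<integral>\<^sup>+u. ennreal (x powr (- 2)) * (ennreal ((1 - cos (u * x)) * u powr (- 2)) * indicator {0<..} u) \<partial>lborel)"
      using that by (intro nn_integral_cong)
        (auto simp: indicator_def zero_less_mult_iff powr_mult mult_ac ennreal_mult[symmetric])
    also have "\<dots> = ennreal (x powr (- 2)) * (\<integral>\<^sup>+u. ennreal ((1 - cos (u * x)) * u powr (- 2)) * indicator {0<..} u \<partial>lborel)"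
      by (intro nn_integral_cmult) auto
    finally have "ennreal x * ennreal (pi / 2) = ennreal (x * (x * x powr (- 2))) * (\<integral>\<^sup>+u. ennreal ((1 - cos (u * x)) * u powr (- 2)) * indicator {0<..} u \<partial>lborel)"
      using that by (simp add: ennreal_mult mult.assoc)
    also have "x * (x * x powr (- 2)) = 1" using that by (simp add: powr_minus power2_eq_square field_simps)
    finally show ?thesis using that by (simp add: ennreal_mult'[symmetric] mult.commute)
  qed
  show ?thesis
  proof (cases x "0 :: real" rule: linorder_cases)
    case less
    then show ?thesis using *[of "- x"] by simp
  next
    case greater
    then show ?thesis using * by simp
  qed simp
qed

text \<open>The cosine integral with exponent Y = 1 represents |x|; averaging it over the law turns
  cos(u x) into the real part of the characteristic function. As an identity of extended reals it
  presupposes no finite moment.\<close>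

lemma (in real_distribution) nn_integral_abs_eq_char:
  "(\<integral>\<^sup>+x. ennreal (pi / 2 * \<bar>x\<bar>) \<partial>M) = (\<integral>\<^sup>+u. ennreal ((1 - Re (char M u)) * u powr (- 2)) * indicator {0<..} u \<partial>lborel)"
proof -
  interpret pair_sigma_finite lborel M
    by (intro pair_sigma_finite.intro sigma_finite_measure_axioms lborel.sigma_finite_measure_axioms)
  have "(\<integral>\<^sup>+x. ennreal (pi / 2 * \<bar>x\<bar>) \<partial>M) = (\<integral>\<^sup>+x. (\<integral>\<^sup>+u. ennreal ((1 - cos (u * x)) * u powr (- 2)) * indicator {0<..} u \<partial>lborel) \<partial>M)"
    unfolding nn_integral_1_minus_cos_scaled ..
  also have "\<dots> = (\<integral>\<^sup>+u. (\<integral>\<^sup>+x. ennreal ((1 - cos (u * x)) * u powr (- 2)) * indicator {0<..} u \<partial>M) \<partial>lborel)"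
    by (rule Fubini') measurable
  also have "\<dots> = (\<integral>\<^sup>+u. ennreal ((1 - Re (char M u)) * u powr (- 2)) * indicator {0<..} u \<partial>lborel)"
  proof (intro nn_integral_cong)
    fix u :: real
    have i: "integrable M (\<lambda>x. cos (u * x))" by (rule integrable_const_bound[where B=1]) auto
    have "(\<integral>\<^sup>+x. ennreal ((1 - cos (u * x)) * u powr (- 2)) * indicator {0<..} u \<partial>M) = (\<integral>\<^sup>+x. ennreal ((1 - cos (u * x)) * u powr (- 2)) \<partial>M) * indicator {0<..} u"
      by (intro nn_integral_multc) auto
    also have "(\<integral>\<^sup>+x. ennreal ((1 - cos (u * x)) * u powr (- 2)) \<partial>M) = ennreal (\<integral>x. (1 - cos (u * x)) * u powr (- 2) \<partial>M)"
      using i by (intro nn_integral_eq_integral) auto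
    also have "(\<integral>x. (1 - cos (u * x)) * u powr (- 2) \<partial>M) = (1 - (\<integral>x. cos (u * x) \<partial>M)) * u powr (- 2)"
      using i prob_space by (simp del: space_eq_univ)
    also have "(\<integral>x. cos (u * x) \<partial>M) = Re (char M u)"
      unfolding char_def by (subst integral_Re[symmetric]) (auto simp: Re_exp intro!: integrable_iexp)
    finally show "(\<integral>\<^sup>+x. ennreal ((1 - cos (u * x)) * u powr (- 2)) * indicator {0<..} u \<partial>M) = ennreal ((1 - Re (char M u)) * u powr (- 2)) * indicator {0<..} u" .
  qed
  finally show ?thesis .
qed

section \<open>Densities from integrable characteristic functions\<close>

text \<open>Fourier inversion. Taking the real part makes the function real valued before the
  integral itself is known to be real.\<close>

definition char_density :: "(real \<Rightarrow> complex) \<Rightarrow> real \<Rightarrow> real" where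
  "char_density \<phi> x = Re (CLBINT u. iexp (- (u * x)) * \<phi> u) / (2 * pi)"

lemma integrable_iexp_mult:
  assumes "integrable lborel \<phi>"
  shows "integrable lborel (\<lambda>u. iexp (- (u * x)) * \<phi> u)"
  by (rule Bochner_Integration.integrable_bound[OF assms]) (use assms in \<open>auto simp: norm_mult\<close>)

lemma continuous_char_density:
  assumes int: "integrable lborel \<phi>"
  shows "continuous_on UNIV (char_density \<phi>)"
proof (intro continuous_at_imp_continuous_on ballI)
  fix x :: real
  have [measurable]: "\<phi> \<in> borel_measurable borel" using int by auto
  show "isCont (char_density \<phi>) x"
    unfolding continuous_at_sequentially
  proof (intro allI impI)
    fix X :: "nat \<Rightarrow> real" assume X: "X \<longlonglongrightarrow> x"
    have "(\<lambda>n. (CLBINT u. iexp (- (u * X n)) * \<phi> u)) \<longlonglongrightarrow> (CLBINT u. iexp (- (u * x)) * \<phi> u)"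
    proof (rule integral_dominated_convergence)
      show "AE u in lborel. (\<lambda>n. iexp (- (u * X n)) * \<phi> u) \<longlonglongrightarrow> iexp (- (u * x)) * \<phi> u"
        using X by (intro always_eventually allI tendsto_intros)
      show "AE u in lborel. norm (iexp (- (u * X n)) * \<phi> u) \<le> norm (\<phi> u)" for n
        by (simp add: norm_mult)
    qed (use int in auto)
    then show "(char_density \<phi> \<circ> X) \<longlonglongrightarrow> char_density \<phi> x"
      unfolding o_def char_density_def by (intro tendsto_divide tendsto_Re tendsto_const) auto
  qed
qed

lemma abs_char_density_le:
  "\<bar>char_density \<phi> x\<bar> \<le> (LBINT u. norm (\<phi> u)) / (2 * pi)"
proof -
  have "\<bar>Re (CLBINT u. iexp (- (u * x)) * \<phi> u)\<bar> \<le> norm (CLBINT u. iexp (- (u * x)) * \<phi> u)"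
    by (rule abs_Re_le_cmod)
  also have "\<dots> \<le> (LBINT u. norm (iexp (- (u * x)) * \<phi> u))" by (rule integral_norm_bound)
  finally show ?thesis by (simp add: char_density_def norm_mult divide_right_mono)
qed

lemma set_integral_iexp:
  fixes a b t :: real assumes "a \<le> b" "t \<noteq> 0"
  shows "(CLBINT x:{a..b}. iexp (- (t * x))) = (iexp (- (t * a)) - iexp (- (t * b))) / (\<i> * t)"
proof -
  have "set_integrable lborel {a..b} (\<lambda>x. iexp (- (t * x)))"
    by (intro borel_integrable_atLeastAtMost' continuous_intros)
  moreover have "((\<lambda>x. iexp (- (t * x))) has_integral (- iexp (- (t * b)) / (\<i> * t) - - iexp (- (t * a)) / (\<i> * t))) {a..b}"
  proof (rule fundamental_theorem_of_calculus[OF assms(1)])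
    fix x :: real
    have "((\<lambda>z. - exp (\<i> * (- (of_real t * z))) / (\<i> * of_real t)) has_field_derivative exp (\<i> * (- (of_real t * of_real x)))) (at (of_real x))"
      using assms by (auto intro!: derivative_eq_intros simp: mult_ac)
    from has_vector_derivative_real_field[OF this, of "{a..b}"]
    show "((\<lambda>x. - iexp (- (t * x)) / (\<i> * t)) has_vector_derivative iexp (- (t * x))) (at x within {a..b})"
      by simp
  qed
  ultimately show ?thesis
    by (subst set_borel_integral_eq_integral(2)) (auto dest!: integral_unique simp: diff_divide_distrib)
qed

context real_distribution
begin

text \<open>In Levy's inversion formula the kernel is bounded by b - a, so integrability of the
  characteristic function lets the truncated integrals converge by domination. The kernel is
  moreover the integral of exp(-i t x) over [a, b], and Fubini makes the density appear. The
  endpoints must not be atoms; the next lemmas remove this restriction.\<close>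

lemma measure_Ioc_char_density_aux:
  assumes int: "integrable lborel (char M)" and ab: "a \<le> b" "measure M {a} = 0" "measure M {b} = 0"
  shows "measure M {a<..b} = (LBINT x:{a..b}. char_density (char M) x)"
proof -
  define g where "g t = (iexp (- (t * a)) - iexp (- (t * b))) / (\<i> * t) * char M t" for t :: real
  have [measurable]: "g \<in> borel_measurable borel" unfolding g_def by measurable
  have bound: "norm (g t) \<le> (b - a) * norm (char M t)" if "t \<noteq> 0" for t
  proof -
    have "norm ((iexp (- (t * a)) - iexp (- (t * b))) / (\<i> * t)) \<le> b - a"
      using Levy_Inversion_aux2[of "- b" "- a" t] ab that by simp
    then show ?thesis unfolding g_def norm_mult by (rule mult_right_mono) simp
  qed
  have bound_AE: "AE t in lborel. norm (g t) \<le> (b - a) * norm (char M t)"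
    by (intro eventually_mono[OF AE_lborel_singleton[of 0]] bound) auto
  have "(\<lambda>T::nat. CLBINT t:{- real T..real T}. g t) \<longlonglongrightarrow> (CLBINT t. g t)"
    unfolding set_lebesgue_integral_def
  proof (rule integral_dominated_convergence)
    show "integrable lborel (\<lambda>t. (b - a) * norm (char M t))" using int by auto
    show "AE t in lborel. (\<lambda>T. indicator {- real T..real T} t *\<^sub>R g t) \<longlonglongrightarrow> g t"
    proof (rule always_eventually, rule allI, rule tendsto_eventually)
      fix t :: real
      show "\<forall>\<^sub>F T in sequentially. indicator {- real T..real T} t *\<^sub>R g t = g t"
        using eventually_ge_at_top[of "nat \<lceil>\<bar>t\<bar>\<rceil>"]
      proof eventually_elim
        case (elim T)
        then have "\<bar>t\<bar> \<le> real T" by linarith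
        then show ?case by (auto simp: abs_le_iff)
      qed
    qed
    show "AE t in lborel. norm (indicator {- real T..real T} t *\<^sub>R g t) \<le> (b - a) * norm (char M t)" for T
      using bound_AE by eventually_elim (auto simp: indicator_def intro: order.trans[OF norm_ge_zero])
  qed auto
  moreover have "(CLBINT t=- ereal (real T)..ereal (real T). g t) = (CLBINT t:{- real T..real T}. g t)" for T
    using interval_integral_Icc[of "- real T" "real T" g] by simp
  ultimately have "(\<lambda>T::nat. 1 / (2 * pi) * (CLBINT t=- real T..real T. g t)) \<longlonglongrightarrow> 1 / (2 * pi) * (CLBINT t. g t)"
    by (intro tendsto_intros) (simp add: uminus_ereal.simps(1)[symmetric] del: uminus_ereal.simps)
  moreover have "(\<lambda>T::nat. 1 / (2 * pi) * (CLBINT t=- real T..real T. g t)) \<longlonglongrightarrow> measure M {a<..b}"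
    using Levy_Inversion[OF ab] unfolding g_def by simp
  ultimately have eq: "complex_of_real (measure M {a<..b}) = 1 / (2 * pi) * (CLBINT t. g t)"
    by (rule LIMSEQ_unique[rotated])
  define f where "f x t = indicator {a..b} x *\<^sub>R (iexp (- (t * x)) * char M t)" for x t :: real
  have fm: "(\<lambda>(x, t). f x t) \<in> borel_measurable (lborel \<Otimes>\<^sub>M lborel)" unfolding f_def by measurable
  have fi: "integrable lborel (f x)" for x
    unfolding f_def using integrable_iexp_mult[OF int] by simp
  have fint: "integrable (lborel \<Otimes>\<^sub>M lborel) (\<lambda>(x, t). f x t)"
  proof (rule lborel_pair.Fubini_integrable)
    have "(\<lambda>x. LBINT t. norm (case (x, t) of (x, t) \<Rightarrow> f x t)) = (\<lambda>x. indicator {a..b} x *\<^sub>R (LBINT t. norm (char M t)))"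
      by (auto simp: f_def norm_mult)
    moreover have "integrable lborel (indicator {a..b} :: real \<Rightarrow> real)"
      by (intro integrable_real_indicator) (auto simp: emeasure_lborel_Icc_eq)
    ultimately show "integrable lborel (\<lambda>x. LBINT t. norm (case (x, t) of (x, t) \<Rightarrow> f x t))" by simp
  qed (use fm fi in auto)
  have "(CLBINT t. g t) = (CLBINT t. (CLBINT x. f x t))"
  proof (rule integral_cong_AE)
    show "(\<lambda>t. CLBINT x. f x t) \<in> borel_measurable lborel"
      using fm by (intro lborel.borel_measurable_lebesgue_integral) (simp add: f_def)
    show "AE t in lborel. g t = (CLBINT x. f x t)"
    proof (intro eventually_mono[OF AE_lborel_singleton[of 0]])
      fix t :: real assume t: "t \<noteq> 0"
      have "(CLBINT x. f x t) = (CLBINT x:{a..b}. iexp (- (t * x))) * char M t"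
        unfolding f_def set_lebesgue_integral_def scaleR_conv_of_real
        by (simp add: mult.assoc[symmetric])
      then show "g t = (CLBINT x. f x t)" using set_integral_iexp[OF ab(1) t] by (simp add: g_def)
    qed
  qed simp
  also have "\<dots> = (CLBINT x. (CLBINT t. f x t))"
    by (rule lborel_pair.Fubini_integral[OF fint])
  finally have "measure M {a<..b} = Re (1 / (2 * pi) * (CLBINT x. (CLBINT t. f x t)))"
    using eq by (metis Re_complex_of_real)
  also have "\<dots> = Re (CLBINT x. (CLBINT t. f x t)) / (2 * pi)" by simp
  also have "Re (CLBINT x. (CLBINT t. f x t)) = (LBINT x. Re (CLBINT t. f x t))"
    using lborel_pair.integrable_fst'[OF fint] by (intro integral_Re[symmetric]) simp
  also have "\<dots> / (2 * pi) = (LBINT x. Re (CLBINT t. f x t) / (2 * pi))" by simp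
  also have "\<dots> = (LBINT x:{a..b}. char_density (char M) x)"
    unfolding set_lebesgue_integral_def char_density_def f_def
    by (intro Bochner_Integration.integral_cong) (auto simp: indicator_def)
  finally show ?thesis .
qed

lemma set_integrable_char_density:
  assumes int: "integrable lborel (char M)"
  shows "set_integrable lborel {a..b} (char_density (char M))"
  using continuous_char_density[OF int] by (intro borel_integrable_atLeastAtMost') (auto intro: continuous_on_subset)

lemma set_integral_char_density_le:
  assumes int: "integrable lborel (char M)" "a \<le> b"
  shows "\<bar>LBINT x:{a..b}. char_density (char M) x\<bar> \<le> (LBINT u. norm (char M u)) / (2 * pi) * (b - a)"
proof -
  have "\<bar>LBINT x:{a..b}. char_density (char M) x\<bar> \<le> (LBINT x:{a..b}. \<bar>char_density (char M) x\<bar>)"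
    using set_integral_norm_bound[OF set_integrable_char_density[OF int(1)], of a b] by simp
  also have "\<dots> \<le> (LBINT x:{a..b}. (LBINT u. norm (char M u)) / (2 * pi))"
    using continuous_char_density[OF int(1)] abs_char_density_le
    by (intro set_integral_mono borel_integrable_atLeastAtMost' continuous_intros) (auto intro: continuous_on_subset)
  also have "\<dots> = (LBINT u. norm (char M u)) / (2 * pi) * (b - a)"
    using int(2) by (simp add: set_lebesgue_integral_def)
  finally show ?thesis .
qed

text \<open>There are only countably many atoms, so x is contained in arbitrarily short intervals
  with atom-free endpoints. By inversion their mass is at most a constant times their
  length.\<close>

lemma measure_singleton_eq_0:
  assumes int: "integrable lborel (char M)"
  shows "measure M {x} = 0"
proof (rule ccontr)
  assume "measure M {x} \<noteq> 0"
  then have pos: "measure M {x} > 0" by (simp add: zero_less_measure_iff)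
  define K where "K = (LBINT u. norm (char M u)) / (2 * pi)"
  have K: "K \<ge> 0" unfolding K_def by (intro divide_nonneg_nonneg Bochner_Integration.integral_nonneg) auto
  \<comment> \<open>Chosen so that (K + 1) * (2 * d) is half the mass at x; the 1 protects against K
    = 0.\<close>
  define d where "d = measure M {x} / 4 / (K + 1)"
  have d: "d > 0" using pos K by (simp add: d_def)
  have ex: "\<exists>y\<in>{l<..<r}. measure M {y} = 0" if "l < r" for l r :: real
  proof (rule ccontr)
    assume "\<not> ?thesis"
    then have "{l<..<r} \<subseteq> {y. measure M {y} > 0}" by (auto simp: zero_less_measure_iff)
    then have "countable {l<..<r}" using countable_atoms countable_subset by blast
    then show False using uncountable_open_interval[of l r] that by simp
  qed
  obtain a where a: "x - d < a" "a < x" "measure M {a} = 0" using ex[of "x - d" x] d by auto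
  obtain b where b: "x < b" "b < x + d" "measure M {b} = 0" using ex[of x "x + d"] d by auto
  have "measure M {x} \<le> measure M {a<..b}" using a b by (intro finite_measure_mono) auto
  also have "\<dots> = (LBINT x:{a..b}. char_density (char M) x)"
    using a b by (intro measure_Ioc_char_density_aux int) auto
  also have "\<dots> \<le> \<bar>LBINT x:{a..b}. char_density (char M) x\<bar>" by simp
  also have "\<dots> \<le> K * (b - a)" unfolding K_def using a b by (intro set_integral_char_density_le int) auto
  also have "\<dots> \<le> (K + 1) * (2 * d)" using a b K by (intro mult_mono) auto
  also have "\<dots> = measure M {x} / 2" using K by (simp add: d_def field_simps)
  finally show False using pos by simp
qed

lemma measure_Ioc_char_density:
  assumes "integrable lborel (char M)" "a \<le> b"
  shows "measure M {a<..b} = (LBINT x:{a..b}. char_density (char M) x)"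
  using assms by (intro measure_Ioc_char_density_aux measure_singleton_eq_0)

text \<open>By continuity, a negative value would persist on a short interval and give it negative
  mass.\<close>

lemma char_density_nonneg:
  assumes int: "integrable lborel (char M)"
  shows "char_density (char M) x \<ge> 0"
proof (rule ccontr)
  let ?p = "char_density (char M)"
  assume neg: "\<not> ?thesis"
  have "isCont ?p x" using continuous_char_density[OF int] by (simp add: continuous_on_eq_continuous_at)
  then have "\<forall>\<^sub>F y in at x. ?p y < ?p x / 2"
    using neg by (intro order_tendstoD(2)[where y="?p x"]) (auto simp: isCont_def)
  then obtain d where d: "d > 0" "\<And>y. y \<noteq> x \<Longrightarrow> dist y x < d \<Longrightarrow> ?p y < ?p x / 2"
    by (auto simp: eventually_at)
  have le: "?p y \<le> ?p x / 2" if "y \<in> {x..x + d / 2}" for y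
  proof (cases "y = x")
    case False
    then show ?thesis using d(2)[of y] that d(1) by (auto simp: dist_real_def less_imp_le)
  qed (use neg in auto)
  have "0 \<le> measure M {x<..x + d / 2}" by simp
  also have "\<dots> = (LBINT y:{x..x + d / 2}. ?p y)" using d by (intro measure_Ioc_char_density int) auto
  also have "\<dots> \<le> (LBINT y:{x..x + d / 2}. ?p x / 2)"
    using le by (intro set_integral_mono set_integrable_char_density int borel_integrable_atLeastAtMost' continuous_intros) auto
  also have "\<dots> = ?p x / 2 * (d / 2)" using d by (simp add: set_lebesgue_integral_def)
  also have "\<dots> < 0" using neg d by (simp add: mult_neg_pos)
  finally show False by simp
qed

lemma eq_density_char_density:
  assumes int: "integrable lborel (char M)"
  shows "M = density lborel (\<lambda>x. ennreal (char_density (char M) x))"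
proof (rule measure_eqI_generator_eq)
  let ?p = "char_density (char M)"
  have [measurable]: "?p \<in> borel_measurable borel"
    using continuous_char_density[OF int] by (rule borel_measurable_continuous_onI)
  show "Int_stable (range (\<lambda>(a, b). {a<..b :: real}))"
    by (auto simp: Int_stable_def)
  show "sets M = sigma_sets UNIV (range (\<lambda>(a, b). {a<..b :: real}))"
    by (simp add: borel_sigma_sets_Ioc)
  show "sets (density lborel (\<lambda>x. ennreal (?p x))) = sigma_sets UNIV (range (\<lambda>(a, b). {a<..b :: real}))"
    by (simp add: borel_sigma_sets_Ioc)
  show "(\<Union>i. {- real i<..real i}) = UNIV" 
  proof safe
    fix x :: real
    obtain n where "\<bar>x\<bar> < real n" using reals_Archimedean2 by blast
    then show "x \<in> (\<Union>i. {- real i<..real i})" by (auto intro!: exI[of _ n])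
  qed auto
  show "range (\<lambda>i. {- real i<..real i}) \<subseteq> range (\<lambda>(a, b). {a<..b :: real})" by auto
  fix X assume "X \<in> range (\<lambda>(a, b). {a<..b :: real})"
  then obtain a b where X: "X = {a<..b}" by auto
  show "emeasure M X = emeasure (density lborel (\<lambda>x. ennreal (?p x))) X"
  proof (cases "a \<le> b")
    case True
    have "emeasure (density lborel (\<lambda>x. ennreal (?p x))) X = (\<integral>\<^sup>+x. ennreal (?p x) * indicator X x \<partial>lborel)"
      unfolding X by (intro emeasure_density) auto
    also have "\<dots> = (\<integral>\<^sup>+x. ennreal (indicator {a..b} x *\<^sub>R ?p x) \<partial>lborel)"
      unfolding X by (intro nn_integral_cong_AE eventually_mono[OF AE_lborel_singleton[of a]]) (auto simp: indicator_def)
    also have "\<dots> = ennreal (LBINT x:{a..b}. ?p x)"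
      unfolding set_lebesgue_integral_def using set_integrable_char_density[OF int, of a b] char_density_nonneg[OF int]
      by (intro nn_integral_eq_integral) (auto simp: set_integrable_def)
    also have "\<dots> = emeasure M X"
      unfolding X using measure_Ioc_char_density[OF int True] by (simp add: emeasure_eq_measure)
    finally show ?thesis ..
  qed (simp add: X)
qed (auto simp: emeasure_eq_measure)

end


section \<open>Power tails of sums and maxima\<close>

text \<open>One estimate for all a > 0, without a threshold. For small a the term K * a powr (-Y -
  1) dominates everything else, so this costs only a larger constant, and a constant that is uniform
  along a sequence passes to its weak limit.\<close>

definition tail_bound :: "real measure \<Rightarrow> real \<Rightarrow> real \<Rightarrow> real \<Rightarrow> bool" where
  "tail_bound \<mu> Y k K \<longleftrightarrow> (\<forall>a>0. \<bar>measure \<mu> {a..} - k * a powr (- Y)\<bar> \<le> K * a powr (- Y - 1))"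

lemma tail_boundD: "tail_bound \<mu> Y k K \<Longrightarrow> a > 0 \<Longrightarrow> \<bar>measure \<mu> {a..} - k * a powr (- Y)\<bar> \<le> K * a powr (- Y - 1)"
  by (simp add: tail_bound_def)

lemma tail_bound_le:
  assumes "tail_bound \<mu> Y k K" "a > 0"
  shows "measure \<mu> {a..} \<le> k * a powr (- Y) + K * a powr (- Y - 1)"
  using tail_boundD[OF assms] by linarith

lemma (in prob_space) abs_moment_tail_le:
  assumes [measurable]: "X \<in> borel_measurable M" and "integrable M X" "a > 0" "(\<integral>x. \<bar>X x\<bar> \<partial>M) \<le> m"
  shows "prob {x\<in>space M. X x \<ge> a} \<le> m / a"
proof -
  have "prob {x\<in>space M. X x \<ge> a} \<le> prob {x\<in>space M. \<bar>X x\<bar> \<ge> a}" by (intro finite_measure_mono) auto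
  also have "\<dots> \<le> (\<integral>x. \<bar>X x\<bar> \<partial>M) / a"
    using assms by (intro integral_Markov_inequality_measure[where A="{}"]) auto
  also have "\<dots> \<le> m / a" using assms by (intro divide_right_mono) auto
  finally show ?thesis .
qed

lemma powr_neg_diff_le:
  fixes a b c Y :: real
  assumes "Y > 0" "c > 0" "c \<le> a" "c \<le> b"
  shows "\<bar>a powr (- Y) - b powr (- Y)\<bar> \<le> Y * c powr (- Y - 1) * \<bar>a - b\<bar>"
proof -
  have "norm (a powr (- Y) - b powr (- Y)) \<le> Y * c powr (- Y - 1) * norm (a - b)"
  proof (rule field_differentiable_bound[of "{c..}" "\<lambda>x. x powr (- Y)" "\<lambda>x. - Y * x powr (- Y - 1)"])
    fix z assume "z \<in> {c..}"
    then have z: "c \<le> z" "0 < z" using assms by auto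
    then show "((\<lambda>x. x powr (- Y)) has_field_derivative - Y * z powr (- Y - 1)) (at z within {c..})"
      by (auto intro!: derivative_eq_intros)
    have "z powr (- Y - 1) \<le> c powr (- Y - 1)" using assms z by (intro powr_mono2') auto
    then show "norm (- Y * z powr (- Y - 1)) \<le> Y * c powr (- Y - 1)" using assms by (simp add: abs_mult)
  qed (use assms in auto)
  then show ?thesis by simp
qed

text \<open>Sum of three errors at the level w / (\<alpha> + \<beta>): the error of the given tail
  bound, the mass of the second variable above that level by Markov's inequality, and the effect of
  shifting w by \<beta> times the second variable.\<close>

definition tail_const :: "real \<Rightarrow> real \<Rightarrow> real \<Rightarrow> real" where
  "tail_const Y \<alpha> \<beta> = (\<alpha> + \<beta>) powr (Y + 1) + \<alpha> powr Y * (\<alpha> + \<beta>) + \<alpha> powr Y * (Y * \<beta> * (\<alpha> / (\<alpha> + \<beta>)) powr (- Y - 1))"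

lemma tail_const_nonneg: "\<alpha> > 0 \<Longrightarrow> \<beta> \<ge> 0 \<Longrightarrow> Y > 0 \<Longrightarrow> tail_const Y \<alpha> \<beta> \<ge> 0"
  by (auto simp: tail_const_def intro!: add_nonneg_nonneg mult_nonneg_nonneg)

text \<open>The contribution of \<open>X\<close> being large while \<open>Y \<le> w / (\<alpha> + \<beta>)\<close>: replacing \<open>w - \<beta> Y\<close> by
  \<open>w\<close> costs one more power of \<open>w\<close>, at the price of a first moment of \<open>Y\<close>.\<close>

lemma tail_half:
  fixes \<mu> \<rho> :: "real measure"
  assumes \<mu>: "real_distribution \<mu>" and \<rho>: "real_distribution \<rho>"
    and tb: "tail_bound \<mu> Y k K" and k: "k \<ge> 0" "K \<ge> 0"
    and int: "integrable \<rho> (\<lambda>x. x)" "(\<integral>x. \<bar>x\<bar> \<partial>\<rho>) \<le> m"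
    and Y: "Y > 0" and \<alpha>: "\<alpha> > 0" and \<beta>: "\<beta> \<ge> 0" and w: "w > 0"
  shows "\<bar>(\<integral>y. indicator {..w / (\<alpha> + \<beta>)} y * measure \<mu> {(w - \<beta> * y) / \<alpha>..} \<partial>\<rho>) - k * \<alpha> powr Y * w powr (- Y)\<bar>
     \<le> tail_const Y \<alpha> \<beta> * (K + k * m) * w powr (- Y - 1)"
proof -
  interpret \<mu>: real_distribution \<mu> by fact
  interpret \<rho>: real_distribution \<rho> by fact
  define s where "s = \<alpha> + \<beta>"
  define \<theta> where "\<theta> = w / s"
  have s: "s > 0" using \<alpha> \<beta> by (simp add: s_def)
  have \<theta>: "\<theta> > 0" using w s by (simp add: \<theta>_def)
  have "w = s * \<theta>" using s by (simp add: \<theta>_def)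
  then have w_eq: "w = \<alpha> * \<theta> + \<beta> * \<theta>" by (simp add: s_def distrib_right)
  have m: "m \<ge> 0" using int(2) by (rule order.trans[rotated]) auto
  have mono_T: "antimono (\<lambda>a. measure \<mu> {a..})" by (intro antimonoI \<mu>.finite_measure_mono) auto
  have [measurable]: "(\<lambda>a. measure \<mu> {a..}) \<in> borel_measurable borel"
  proof -
    have "mono (\<lambda>a. - measure \<mu> {a..})" using mono_T by (auto simp: monotone_def)
    then have "(\<lambda>a. - (- measure \<mu> {a..})) \<in> borel_measurable borel"
      by (intro borel_measurable_uminus borel_measurable_mono)
    then show ?thesis by simp
  qed
  let ?T = "\<lambda>y. indicator {..\<theta>} y * measure \<mu> {(w - \<beta> * y) / \<alpha>..}"
  have intT: "integrable \<rho> ?T"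
    by (rule \<rho>.integrable_const_bound[where B=1]) (auto simp: indicator_def)
  let ?c = "K * \<theta> powr (- Y - 1)" and ?d = "k * \<alpha> powr Y * (Y * (\<alpha> * \<theta>) powr (- Y - 1) * \<beta>)"
    and ?e = "k * \<alpha> powr Y * w powr (- Y)"
  have pt: "\<bar>?T y - indicator {..\<theta>} y * ?e\<bar> \<le> ?c + ?d * \<bar>y\<bar>" for y
  proof (cases "y \<le> \<theta>")
    case True
    \<comment> \<open>Below the level \<theta> the shifted threshold stays at least \<alpha> *
      \<theta>, a fixed fraction of w, so the mean value estimate for the power applies with a
      constant of the right order.\<close>
    have le: "\<alpha> * \<theta> \<le> w - \<beta> * y" using mult_left_mono[OF True \<beta>] unfolding w_eq by simp
    then have pos: "w - \<beta> * y > 0" using \<alpha> \<theta> mult_pos_pos[OF \<alpha> \<theta>] by linarith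
    have th: "\<theta> \<le> (w - \<beta> * y) / \<alpha>" using le \<alpha> by (simp add: field_simps)
    have "\<bar>measure \<mu> {(w - \<beta> * y) / \<alpha>..} - k * ((w - \<beta> * y) / \<alpha>) powr (- Y)\<bar> \<le> K * ((w - \<beta> * y) / \<alpha>) powr (- Y - 1)"
      using pos \<alpha> by (intro tail_boundD[OF tb]) auto
    also have "\<dots> \<le> ?c" using th \<theta> Y k by (intro mult_left_mono powr_mono2') auto
    finally have 1: "\<bar>measure \<mu> {(w - \<beta> * y) / \<alpha>..} - k * ((w - \<beta> * y) / \<alpha>) powr (- Y)\<bar> \<le> ?c" .
    have 2: "k * ((w - \<beta> * y) / \<alpha>) powr (- Y) = k * \<alpha> powr Y * (w - \<beta> * y) powr (- Y)"
      using pos \<alpha> by (simp add: powr_divide powr_minus divide_simps)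
    have "\<bar>(w - \<beta> * y) powr (- Y) - w powr (- Y)\<bar> \<le> Y * (\<alpha> * \<theta>) powr (- Y - 1) * \<bar>(w - \<beta> * y) - w\<bar>"
      using Y \<alpha> \<theta> \<beta> le by (intro powr_neg_diff_le) (auto simp: w_eq)
    also have "\<bar>(w - \<beta> * y) - w\<bar> = \<beta> * \<bar>y\<bar>" using \<beta> by (simp add: abs_mult)
    finally have "k * \<alpha> powr Y * \<bar>(w - \<beta> * y) powr (- Y) - w powr (- Y)\<bar> \<le> k * \<alpha> powr Y * (Y * (\<alpha> * \<theta>) powr (- Y - 1) * (\<beta> * \<bar>y\<bar>))"
      using k by (intro mult_left_mono) auto
    then have "\<bar>k * \<alpha> powr Y * (w - \<beta> * y) powr (- Y) - ?e\<bar> \<le> ?d * \<bar>y\<bar>"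
      using k by (simp add: abs_mult right_diff_distrib[symmetric] mult.assoc)
    with 1 2 True show ?thesis by simp
  next
    case False
    then show ?thesis using k Y \<beta> by (auto intro!: add_nonneg_nonneg mult_nonneg_nonneg)
  qed
  have intI: "integrable \<rho> (\<lambda>y. indicator {..\<theta>} y * ?e)"
    by (rule \<rho>.integrable_const_bound[where B="\<bar>?e\<bar>"]) (auto simp: indicator_def)
  have "\<bar>(\<integral>y. ?T y \<partial>\<rho>) - (\<integral>y. indicator {..\<theta>} y * ?e \<partial>\<rho>)\<bar> = \<bar>\<integral>y. ?T y - indicator {..\<theta>} y * ?e \<partial>\<rho>\<bar>"
    using intT intI by simp
  also have "\<dots> \<le> (\<integral>y. \<bar>?T y - indicator {..\<theta>} y * ?e\<bar> \<partial>\<rho>)" by (rule integral_abs_bound)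
  also have "\<dots> \<le> (\<integral>y. ?c + ?d * \<bar>y\<bar> \<partial>\<rho>)"
    using pt intT intI int by (intro integral_mono) auto
  also have "\<dots> = ?c + ?d * (\<integral>y. \<bar>y\<bar> \<partial>\<rho>)" using int \<rho>.prob_space by (simp del: \<rho>.space_eq_univ)
  also have "\<dots> \<le> ?c + ?d * m" using int k Y \<beta> by (intro add_left_mono mult_left_mono) auto
  finally have A: "\<bar>(\<integral>y. ?T y \<partial>\<rho>) - (\<integral>y. indicator {..\<theta>} y * ?e \<partial>\<rho>)\<bar> \<le> ?c + ?d * m" .
  have "(\<integral>y. indicator {..\<theta>} y * ?e \<partial>\<rho>) = measure \<rho> {..\<theta>} * ?e" by simp
  also have "measure \<rho> {..\<theta>} = 1 - measure \<rho> {\<theta><..}"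
    using \<rho>.prob_compl[of "{\<theta><..}"] by (simp add: Compl_eq_Diff_UNIV[symmetric] not_less flip: Compl_greaterThan)
  finally have B1: "(\<integral>y. indicator {..\<theta>} y * ?e \<partial>\<rho>) - ?e = - measure \<rho> {\<theta><..} * ?e" by (simp add: algebra_simps)
  have "measure \<rho> {\<theta><..} \<le> measure \<rho> {y\<in>space \<rho>. y \<ge> \<theta>}" by (intro \<rho>.finite_measure_mono) auto
  also have "\<dots> \<le> m / \<theta>" by (rule \<rho>.abs_moment_tail_le[OF _ int(1) \<theta> int(2)]) simp
  finally have "measure \<rho> {\<theta><..} * ?e \<le> m / \<theta> * ?e" using k by (intro mult_right_mono) auto
  then have B: "\<bar>(\<integral>y. indicator {..\<theta>} y * ?e \<partial>\<rho>) - ?e\<bar> \<le> m / \<theta> * ?e"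
    unfolding B1 using k by (simp add: abs_mult)
  have c: "?c = K * s powr (Y + 1) * w powr (- Y - 1)"
    using w s by (simp add: \<theta>_def powr_divide powr_minus powr_diff powr_add divide_simps)
  have d: "?d * m = \<alpha> powr Y * (Y * \<beta> * (\<alpha> / s) powr (- Y - 1)) * (k * m) * w powr (- Y - 1)"
  proof -
    have "\<alpha> * \<theta> = (\<alpha> / s) * w" by (simp add: \<theta>_def)
    then have "(\<alpha> * \<theta>) powr (- Y - 1) = (\<alpha> / s) powr (- Y - 1) * w powr (- Y - 1)"
      using \<alpha> s w by (simp only: powr_mult)
    then show ?thesis by simp
  qed
  have e: "m / \<theta> * ?e = \<alpha> powr Y * s * (k * m) * w powr (- Y - 1)"
    using w s by (simp add: \<theta>_def powr_diff field_simps)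
  \<comment> \<open>Expanding the product yields the three errors that occur and further cross
    terms; the latter are nonnegative and are dropped.\<close>
  have "tail_const Y \<alpha> \<beta> * (K + k * m) * w powr (- Y - 1) = (?c + ?d * m + m / \<theta> * ?e)
     + (\<alpha> powr Y * s + \<alpha> powr Y * (Y * \<beta> * (\<alpha> / s) powr (- Y - 1))) * K * w powr (- Y - 1)
     + s powr (Y + 1) * (k * m) * w powr (- Y - 1)"
    unfolding c d e unfolding tail_const_def s_def[symmetric] by (simp add: algebra_simps)
  moreover have "(\<alpha> powr Y * s + \<alpha> powr Y * (Y * \<beta> * (\<alpha> / s) powr (- Y - 1))) * K * w powr (- Y - 1) \<ge> 0"
    using k s Y \<beta> by (intro mult_nonneg_nonneg add_nonneg_nonneg) auto
  moreover have "s powr (Y + 1) * (k * m) * w powr (- Y - 1) \<ge> 0"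
    using k m by simp
  ultimately have "?c + ?d * m + m / \<theta> * ?e \<le> tail_const Y \<alpha> \<beta> * (K + k * m) * w powr (- Y - 1)"
    by linarith
  with A B show ?thesis unfolding \<theta>_def s_def by linarith
qed

text \<open>One large variable decides. The coefficients have equal sums, so the two forms agree on
  the diagonal and the first is the larger one for x >= y. With \<theta> = w / (\<alpha> + \<beta>),
  reaching w forces x or y to be at least \<theta>: if y <= \<theta> only the first form matters, if
  x <= \<theta> only the second. Both cases fall under \<open>tail_half\<close>, and both variables
  being large has probability of order w powr (-Y - 1).\<close>

lemma tail_max_linear:
  fixes \<mu> \<rho> :: "real measure"
  assumes \<mu>: "real_distribution \<mu>" and \<rho>: "real_distribution \<rho>"
    and tb: "tail_bound \<mu> Y k K" "tail_bound \<rho> Y k' K'" and k: "k \<ge> 0" "K \<ge> 0" "k' \<ge> 0" "K' \<ge> 0"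
    and int: "integrable \<mu> (\<lambda>x. x)" "(\<integral>x. \<bar>x\<bar> \<partial>\<mu>) \<le> m"
    and int': "integrable \<rho> (\<lambda>x. x)" "(\<integral>x. \<bar>x\<bar> \<partial>\<rho>) \<le> m'"
    and Y: "Y > 0" and \<alpha>: "0 < \<alpha>'" "\<alpha>' \<le> \<alpha>" and \<beta>: "0 < \<beta>" "\<beta> \<le> \<beta>'" and s: "\<alpha> + \<beta> = \<alpha>' + \<beta>'" and w: "w > 0"
  shows "\<bar>measure (\<mu> \<Otimes>\<^sub>M \<rho>) {(x, y). max (\<alpha> * x + \<beta> * y) (\<alpha>' * x + \<beta>' * y) \<ge> w}
       - (k * \<alpha> powr Y + k' * \<beta>' powr Y) * w powr (- Y)\<bar>
     \<le> (tail_const Y \<alpha> \<beta> + tail_const Y \<beta>' \<alpha>' + (\<alpha> + \<beta>) powr (Y + 1)) * (K + K' + k * m' + k' * m) * w powr (- Y - 1)"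
proof -
  interpret \<mu>: real_distribution \<mu> by fact
  interpret \<rho>: real_distribution \<rho> by fact
  interpret P: pair_prob_space \<mu> \<rho> ..
  define s where "s = \<alpha> + \<beta>"
  define \<theta> where "\<theta> = w / s"
  have s0: "s > 0" using \<alpha> \<beta> by (simp add: s_def)
  have \<theta>: "\<theta> > 0" using w s0 by (simp add: \<theta>_def)
  have "w = s * \<theta>" using s0 by (simp add: \<theta>_def)
  then have w_eq: "w = \<alpha> * \<theta> + \<beta> * \<theta>" "w = \<alpha>' * \<theta> + \<beta>' * \<theta>"
    unfolding distrib_right[symmetric] s[symmetric] by (simp_all add: s_def)
  have m: "m \<ge> 0" using int(2) by (rule order.trans[rotated]) auto
  have m': "m' \<ge> 0" using int'(2) by (rule order.trans[rotated]) auto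
  let ?E = "{(x, y). max (\<alpha> * x + \<beta> * y) (\<alpha>' * x + \<beta>' * y) \<ge> w}"
  let ?A = "?E \<inter> {(x, y). y \<le> \<theta>}" and ?B = "?E \<inter> {(x, y). x \<le> \<theta>}"
  have setsP: "sets (\<mu> \<Otimes>\<^sub>M \<rho>) = sets (borel \<Otimes>\<^sub>M borel)" by (intro sets_pair_measure_cong) auto
  have spP: "space (\<mu> \<Otimes>\<^sub>M \<rho>) = UNIV" by (simp add: space_pair_measure)
  have mE: "?E \<in> sets (\<mu> \<Otimes>\<^sub>M \<rho>)"
  proof -
    have "{z \<in> space (borel \<Otimes>\<^sub>M borel). w \<le> max (\<alpha> * fst z + \<beta> * snd z) (\<alpha>' * fst z + \<beta>' * snd z)} \<in> sets (borel \<Otimes>\<^sub>M borel)"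
      by measurable
    then show ?thesis unfolding setsP by (simp add: space_pair_measure case_prod_beta')
  qed
  have mY: "{(x, y). y \<le> \<theta>} \<in> sets (\<mu> \<Otimes>\<^sub>M \<rho>)" 
  proof -
    have "{z \<in> space (borel \<Otimes>\<^sub>M borel). snd z \<le> \<theta>} \<in> sets (borel \<Otimes>\<^sub>M (borel :: real measure))" by measurable
    then show ?thesis unfolding setsP by (simp add: space_pair_measure case_prod_beta')
  qed
  have mX: "{(x, y). x \<le> \<theta>} \<in> sets (\<mu> \<Otimes>\<^sub>M \<rho>)"
  proof -
    have "{z \<in> space (borel \<Otimes>\<^sub>M borel). fst z \<le> \<theta>} \<in> sets ((borel :: real measure) \<Otimes>\<^sub>M borel)" by measurable
    then show ?thesis unfolding setsP by (simp add: space_pair_measure case_prod_beta')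
  qed
  \<comment> \<open>If y <= x the first form is the maximum; otherwise x < y <= \<theta>, and both
    forms stay below w.\<close>
  have secA: "(\<lambda>x. (x, y)) -` ?A = (if y \<le> \<theta> then {(w - \<beta> * y) / \<alpha>..} else {})" for y
  proof (cases "y \<le> \<theta>")
    case True
    have "max (\<alpha> * x + \<beta> * y) (\<alpha>' * x + \<beta>' * y) \<ge> w \<longleftrightarrow> (w - \<beta> * y) / \<alpha> \<le> x" for x
    proof (cases "y \<le> x")
      case True
      have "(\<alpha> * x + \<beta> * y) - (\<alpha>' * x + \<beta>' * y) = (\<alpha> - \<alpha>') * (x - y)"
        using s by (simp add: algebra_simps) (metis add_diff_cancel_left' add.commute add_diff_eq distrib_right diff_add_eq)
      also have "\<dots> \<ge> 0" using True \<alpha> by (intro mult_nonneg_nonneg) auto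
      finally have "max (\<alpha> * x + \<beta> * y) (\<alpha>' * x + \<beta>' * y) = \<alpha> * x + \<beta> * y" by simp
      then show ?thesis using \<alpha> by (simp add: field_simps)
    next
      case False
      have "\<alpha> * x < \<alpha> * \<theta>" "\<alpha>' * x < \<alpha>' * \<theta>" "\<beta> * y \<le> \<beta> * \<theta>" "\<beta>' * y \<le> \<beta>' * \<theta>"
        using False True \<open>y \<le> \<theta>\<close> \<alpha> \<beta> by (auto intro!: mult_strict_left_mono mult_left_mono)
      then have "\<not> max (\<alpha> * x + \<beta> * y) (\<alpha>' * x + \<beta>' * y) \<ge> w" "\<alpha> * x < w - \<beta> * y"
        using w_eq by auto
      then show ?thesis using \<alpha> by (simp add: field_simps)
    qed
    then show ?thesis using True by auto
  qed auto
  have secB: "Pair x -` ?B = (if x \<le> \<theta> then {(w - \<alpha>' * x) / \<beta>'..} else {})" for x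
  proof (cases "x \<le> \<theta>")
    case True
    have "max (\<alpha> * x + \<beta> * y) (\<alpha>' * x + \<beta>' * y) \<ge> w \<longleftrightarrow> (w - \<alpha>' * x) / \<beta>' \<le> y" for y
    proof (cases "x \<le> y")
      case True
      have "(\<alpha>' * x + \<beta>' * y) - (\<alpha> * x + \<beta> * y) = (\<alpha> - \<alpha>') * (y - x)"
        using s by (simp add: algebra_simps) (metis add_diff_cancel_left' add.commute add_diff_eq distrib_right diff_add_eq)
      also have "\<dots> \<ge> 0" using True \<alpha> by (intro mult_nonneg_nonneg) auto
      finally have "max (\<alpha> * x + \<beta> * y) (\<alpha>' * x + \<beta>' * y) = \<alpha>' * x + \<beta>' * y" by simp
      then show ?thesis using \<beta> by (simp add: field_simps)
    next
      case False
      have "\<beta> * y < \<beta> * \<theta>" "\<beta>' * y < \<beta>' * \<theta>" "\<alpha> * x \<le> \<alpha> * \<theta>" "\<alpha>' * x \<le> \<alpha>' * \<theta>"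
        using False True \<open>x \<le> \<theta>\<close> \<alpha> \<beta> by (auto intro!: mult_strict_left_mono mult_left_mono)
      then have "\<not> max (\<alpha> * x + \<beta> * y) (\<alpha>' * x + \<beta>' * y) \<ge> w" "\<beta>' * y < w - \<alpha>' * x"
        using w_eq by auto
      then show ?thesis using \<beta> by (simp add: field_simps)
    qed
    then show ?thesis using True by auto
  qed auto
  have PA: "measure (\<mu> \<Otimes>\<^sub>M \<rho>) ?A = (\<integral>y. indicator {..\<theta>} y * measure \<mu> {(w - \<beta> * y) / \<alpha>..} \<partial>\<rho>)"
  proof -
    have "emeasure (\<mu> \<Otimes>\<^sub>M \<rho>) ?A = (\<integral>\<^sup>+y. emeasure \<mu> ((\<lambda>x. (x, y)) -` ?A) \<partial>\<rho>)"
      using mE mY by (intro P.emeasure_pair_measure_alt2) auto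
    also have "\<dots> = (\<integral>\<^sup>+y. ennreal (measure \<mu> ((\<lambda>x. (x, y)) -` ?A)) \<partial>\<rho>)"
      by (simp add: \<mu>.emeasure_eq_measure)
    finally have "measure (\<mu> \<Otimes>\<^sub>M \<rho>) ?A = enn2real (\<integral>\<^sup>+y. ennreal (measure \<mu> ((\<lambda>x. (x, y)) -` ?A)) \<partial>\<rho>)"
      by (simp add: measure_def)
    also have "\<dots> = (\<integral>y. measure \<mu> ((\<lambda>x. (x, y)) -` ?A) \<partial>\<rho>)"
    proof (intro integral_eq_nn_integral[symmetric])
      show "(\<lambda>y. measure \<mu> ((\<lambda>x. (x, y)) -` ?A)) \<in> borel_measurable \<rho>"
        unfolding measure_def using mE mY by (intro borel_measurable_enn2real P.measurable_emeasure_Pair2) auto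
    qed auto
    also have "\<dots> = (\<integral>y. indicator {..\<theta>} y * measure \<mu> {(w - \<beta> * y) / \<alpha>..} \<partial>\<rho>)"
      unfolding secA by (intro Bochner_Integration.integral_cong) auto
    finally show ?thesis .
  qed
  have PB: "measure (\<mu> \<Otimes>\<^sub>M \<rho>) ?B = (\<integral>x. indicator {..\<theta>} x * measure \<rho> {(w - \<alpha>' * x) / \<beta>'..} \<partial>\<mu>)"
  proof -
    have "emeasure (\<mu> \<Otimes>\<^sub>M \<rho>) ?B = (\<integral>\<^sup>+x. emeasure \<rho> (Pair x -` ?B) \<partial>\<mu>)"
      using mE mX by (intro \<rho>.emeasure_pair_measure_alt) auto
    also have "\<dots> = (\<integral>\<^sup>+x. ennreal (measure \<rho> (Pair x -` ?B)) \<partial>\<mu>)"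
      by (simp add: \<rho>.emeasure_eq_measure)
    finally have "measure (\<mu> \<Otimes>\<^sub>M \<rho>) ?B = enn2real (\<integral>\<^sup>+x. ennreal (measure \<rho> (Pair x -` ?B)) \<partial>\<mu>)"
      by (simp add: measure_def)
    also have "\<dots> = (\<integral>x. measure \<rho> (Pair x -` ?B) \<partial>\<mu>)"
    proof (intro integral_eq_nn_integral[symmetric])
      show "(\<lambda>x. measure \<rho> (Pair x -` ?B)) \<in> borel_measurable \<mu>"
        unfolding measure_def using mE mX by (intro borel_measurable_enn2real \<rho>.measurable_emeasure_Pair) auto
    qed auto
    also have "\<dots> = (\<integral>x. indicator {..\<theta>} x * measure \<rho> {(w - \<alpha>' * x) / \<beta>'..} \<partial>\<mu>)"
      unfolding secB by (intro Bochner_Integration.integral_cong) auto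
    finally show ?thesis .
  qed
  define Q where "Q = measure \<mu> {\<theta>..} * measure \<rho> {\<theta>..}"
  have Qm: "measure (\<mu> \<Otimes>\<^sub>M \<rho>) ({\<theta>..} \<times> {\<theta>..}) = Q"
    unfolding Q_def by (simp add: measure_def \<rho>.emeasure_pair_measure_Times enn2real_mult)
  have mQ: "{\<theta>..} \<times> {\<theta>..} \<in> sets (\<mu> \<Otimes>\<^sub>M \<rho>)" by auto
  have "measure (\<mu> \<Otimes>\<^sub>M \<rho>) ?E = measure (\<mu> \<Otimes>\<^sub>M \<rho>) ((?A \<union> ?B) \<union> (?E - (?A \<union> ?B)))"
    by (rule arg_cong[where f="measure _"]) auto
  also have "\<dots> = measure (\<mu> \<Otimes>\<^sub>M \<rho>) (?A \<union> ?B) + measure (\<mu> \<Otimes>\<^sub>M \<rho>) (?E - (?A \<union> ?B))"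
    using mE mX mY by (intro P.finite_measure_Union) auto
  also have "measure (\<mu> \<Otimes>\<^sub>M \<rho>) (?A \<union> ?B) = measure (\<mu> \<Otimes>\<^sub>M \<rho>) ?A + measure (\<mu> \<Otimes>\<^sub>M \<rho>) ?B - measure (\<mu> \<Otimes>\<^sub>M \<rho>) (?A \<inter> ?B)"
    using mE mX mY by (intro measure_Un3) (auto simp: P.fmeasurable_eq_sets)
  finally have dec: "measure (\<mu> \<Otimes>\<^sub>M \<rho>) ?E - measure (\<mu> \<Otimes>\<^sub>M \<rho>) ?A - measure (\<mu> \<Otimes>\<^sub>M \<rho>) ?B
     = measure (\<mu> \<Otimes>\<^sub>M \<rho>) (?E - (?A \<union> ?B)) - measure (\<mu> \<Otimes>\<^sub>M \<rho>) (?A \<inter> ?B)" by simp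
  \<comment> \<open>Outside ?A and ?B both coordinates exceed \<theta>, while ?A and ?B can meet
    only at the point (\<theta>, \<theta>). Both corrections therefore lie in the same quadrant, of
    mass Q.\<close>
  have q1: "measure (\<mu> \<Otimes>\<^sub>M \<rho>) (?E - (?A \<union> ?B)) \<le> Q"
    unfolding Qm[symmetric] using mQ by (intro P.finite_measure_mono) auto
  have q2: "measure (\<mu> \<Otimes>\<^sub>M \<rho>) (?A \<inter> ?B) \<le> Q"
    unfolding Qm[symmetric]
  proof (intro P.finite_measure_mono mQ subsetI)
    fix z assume "z \<in> ?A \<inter> ?B"
    then obtain x y where z: "z = (x, y)" "x \<le> \<theta>" "y \<le> \<theta>" "max (\<alpha> * x + \<beta> * y) (\<alpha>' * x + \<beta>' * y) \<ge> w" by auto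
    have pos: "0 < \<alpha>" "0 < \<beta>'" using \<alpha> \<beta> by auto
    have le: "\<alpha> * x \<le> \<alpha> * \<theta>" "\<alpha>' * x \<le> \<alpha>' * \<theta>" "\<beta> * y \<le> \<beta> * \<theta>" "\<beta>' * y \<le> \<beta>' * \<theta>"
      using z \<alpha> \<beta> by (auto intro!: mult_left_mono)
    have "\<not> x < \<theta>"
    proof
      assume "x < \<theta>"
      then have "\<alpha> * x < \<alpha> * \<theta>" "\<alpha>' * x < \<alpha>' * \<theta>" using \<alpha> pos by auto
      then show False using le z(4) w_eq by auto
    qed
    moreover have "\<not> y < \<theta>"
    proof
      assume "y < \<theta>"
      then have "\<beta> * y < \<beta> * \<theta>" "\<beta>' * y < \<beta>' * \<theta>" using \<beta> pos by auto
      then show False using le z(4) w_eq by auto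
    qed
    ultimately show "z \<in> {\<theta>..} \<times> {\<theta>..}" using z by auto
  qed
  \<comment> \<open>The tail bound is used for one factor only. The other is estimated by Markov's
    inequality next to k and by 1 next to K, so no product K * K' appears and the estimate stays
    linear in the constants.\<close>
  have Q: "Q \<le> s powr (Y + 1) * (K + k * m') * w powr (- Y - 1)"
  proof -
    have "{x \<in> space \<rho>. \<theta> \<le> x} = {\<theta>..}" by auto
    then have r1: "measure \<rho> {\<theta>..} \<le> m' / \<theta>"
      using \<rho>.abs_moment_tail_le[OF _ int'(1) \<theta> int'(2)] by (simp only: borel_measurable_integrable[OF int'(1)])
    have "Q \<le> (k * \<theta> powr (- Y) + K * \<theta> powr (- Y - 1)) * measure \<rho> {\<theta>..}"
      unfolding Q_def using \<theta> by (intro mult_right_mono tail_bound_le[OF tb(1)]) auto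
    also have "\<dots> = k * \<theta> powr (- Y) * measure \<rho> {\<theta>..} + K * \<theta> powr (- Y - 1) * measure \<rho> {\<theta>..}"
      by (simp add: algebra_simps)
    also have "\<dots> \<le> k * \<theta> powr (- Y) * (m' / \<theta>) + K * \<theta> powr (- Y - 1) * 1"
      using r1 k by (intro add_mono mult_left_mono) auto
    also have "\<dots> = (K + k * m') * \<theta> powr (- Y - 1)" using \<theta> by (simp add: powr_diff field_simps)
    also have "\<theta> powr (- Y - 1) = s powr (Y + 1) * w powr (- Y - 1)"
      using w s0 by (simp add: \<theta>_def powr_divide powr_minus powr_diff powr_add divide_simps)
    finally show ?thesis by (simp add: mult_ac)
  qed
  have hA: "\<bar>measure (\<mu> \<Otimes>\<^sub>M \<rho>) ?A - k * \<alpha> powr Y * w powr (- Y)\<bar> \<le> tail_const Y \<alpha> \<beta> * (K + k * m') * w powr (- Y - 1)"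
    unfolding PA unfolding \<theta>_def s_def using \<alpha> \<beta> by (intro tail_half[OF \<mu> \<rho> tb(1) k(1,2) int' Y _ _ w]) auto
  have hB: "\<bar>measure (\<mu> \<Otimes>\<^sub>M \<rho>) ?B - k' * \<beta>' powr Y * w powr (- Y)\<bar> \<le> tail_const Y \<beta>' \<alpha>' * (K' + k' * m) * w powr (- Y - 1)"
    using tail_half[OF \<rho> \<mu> tb(2) k(3,4) int Y _ _ w, of \<beta>' \<alpha>'] \<alpha> \<beta>
    unfolding PB unfolding \<theta>_def s_def s by (simp add: add.commute)
  let ?W = "w powr (- Y - 1)" and ?R = "K + K' + k * m' + k' * m"
  have nn: "k * m' \<ge> 0" "k' * m \<ge> 0" using k m m' by auto
  have t1: "tail_const Y \<alpha> \<beta> * (K + k * m') * ?W \<le> tail_const Y \<alpha> \<beta> * ?R * ?W"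
    using \<alpha> \<beta> Y k nn by (intro mult_right_mono mult_left_mono tail_const_nonneg) auto
  have t2: "tail_const Y \<beta>' \<alpha>' * (K' + k' * m) * ?W \<le> tail_const Y \<beta>' \<alpha>' * ?R * ?W"
    using \<alpha> \<beta> Y k nn by (intro mult_right_mono mult_left_mono tail_const_nonneg) auto
  have t3: "s powr (Y + 1) * (K + k * m') * ?W \<le> s powr (Y + 1) * ?R * ?W"
    using k nn by (intro mult_right_mono mult_left_mono) auto
  have q0: "measure (\<mu> \<Otimes>\<^sub>M \<rho>) (?E - (?A \<union> ?B)) \<ge> 0" "measure (\<mu> \<Otimes>\<^sub>M \<rho>) (?A \<inter> ?B) \<ge> 0" by auto
  have "\<bar>measure (\<mu> \<Otimes>\<^sub>M \<rho>) ?E - (k * \<alpha> powr Y * w powr (- Y) + k' * \<beta>' powr Y * w powr (- Y))\<bar>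
     \<le> tail_const Y \<alpha> \<beta> * ?R * ?W + tail_const Y \<beta>' \<alpha>' * ?R * ?W + s powr (Y + 1) * ?R * ?W"
    using hA hB t1 t2 t3 Q q1 q2 q0 dec by linarith
  then show ?thesis unfolding s_def by (simp only: distrib_right)
qed

lemma tail_bound_mono: "tail_bound \<mu> Y k K \<Longrightarrow> K \<le> K' \<Longrightarrow> tail_bound \<mu> Y k K'"
  unfolding tail_bound_def by (meson mult_right_mono order.trans powr_ge_zero)

section \<open>Compound Poisson laws\<close>

lemma real_distribution_convolution:
  assumes "real_distribution \<mu>" "real_distribution \<rho>"
  shows "real_distribution (\<mu> \<star> \<rho>)"
proof -
  interpret \<mu>: real_distribution \<mu> by fact
  interpret \<rho>: real_distribution \<rho> by fact
  interpret P: pair_prob_space \<mu> \<rho> ..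
  have "prob_space (\<mu> \<star> \<rho>)" unfolding convolution_def by (intro P.prob_space_distr) measurable
  then show ?thesis by (simp add: real_distribution_def real_distribution_axioms_def)
qed

lemma exp_convolution:
  fixes z :: complex
  assumes "real_distribution \<mu>" "real_distribution \<rho>"
    and i: "integrable \<mu> (\<lambda>x. exp (z * of_real x))" "integrable \<rho> (\<lambda>x. exp (z * of_real x))"
  shows "integrable (\<mu> \<star> \<rho>) (\<lambda>x. exp (z * of_real x))"
    and "(\<integral>x. exp (z * of_real x) \<partial>(\<mu> \<star> \<rho>)) = (\<integral>x. exp (z * of_real x) \<partial>\<mu>) * (\<integral>x. exp (z * of_real x) \<partial>\<rho>)"
proof -
  interpret \<mu>: real_distribution \<mu> by fact
  interpret \<rho>: real_distribution \<rho> by fact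
  interpret P: pair_prob_space \<mu> \<rho> ..
  have e: "exp (z * of_real (case p of (x, y) \<Rightarrow> x + y)) = (case p of (x, y) \<Rightarrow> exp (z * of_real x) * exp (z * of_real y))" for p
    by (auto simp: distrib_left exp_add split: prod.split)
  have int: "integrable (\<mu> \<Otimes>\<^sub>M \<rho>) (\<lambda>(x, y). exp (z * of_real x) * exp (z * of_real y))"
  proof (rule P.Fubini_integrable)
    have "(\<lambda>x. \<integral>y. norm (case (x, y) of (x, y) \<Rightarrow> exp (z * of_real x) * exp (z * of_real y)) \<partial>\<rho>) = (\<lambda>x. norm (exp (z * of_real x)) * (\<integral>y. norm (exp (z * of_real y)) \<partial>\<rho>))"
      unfolding case_prod_conv norm_mult integral_mult_right_zero ..
    moreover have "integrable \<mu> (\<lambda>x. norm (exp (z * of_real x)) * (\<integral>y. norm (exp (z * of_real y)) \<partial>\<rho>))"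
      by (intro integrable_mult_left integrable_norm i)
    ultimately show "integrable \<mu> (\<lambda>x. \<integral>y. norm (case (x, y) of (x, y) \<Rightarrow> exp (z * of_real x) * exp (z * of_real y)) \<partial>\<rho>)"
      by (simp only:)
  qed (use i in auto)
  then show "integrable (\<mu> \<star> \<rho>) (\<lambda>x. exp (z * of_real x))"
    unfolding convolution_def by (subst integrable_distr_eq) (auto simp: e)
  have "(\<integral>x. exp (z * of_real x) \<partial>(\<mu> \<star> \<rho>)) = (\<integral>(x, y). exp (z * of_real x) * exp (z * of_real y) \<partial>(\<mu> \<Otimes>\<^sub>M \<rho>))"
    unfolding convolution_def by (subst integral_distr) (auto simp: e)
  also have "\<dots> = (\<integral>x. (\<integral>y. exp (z * of_real x) * exp (z * of_real y) \<partial>\<rho>) \<partial>\<mu>)"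
    using P.integral_fst'[OF int] by simp
  also have "\<dots> = (\<integral>x. exp (z * of_real x) \<partial>\<mu>) * (\<integral>x. exp (z * of_real x) \<partial>\<rho>)" by simp
  finally show "(\<integral>x. exp (z * of_real x) \<partial>(\<mu> \<star> \<rho>)) = (\<integral>x. exp (z * of_real x) \<partial>\<mu>) * (\<integral>x. exp (z * of_real x) \<partial>\<rho>)" .
qed

text \<open>Stated in \<open>ennreal\<close> so that it entails integrability.\<close>

definition abs_moment_le :: "real measure \<Rightarrow> real \<Rightarrow> bool" where
  "abs_moment_le \<mu> m \<longleftrightarrow> 0 \<le> m \<and> (\<integral>\<^sup>+x. ennreal \<bar>x\<bar> \<partial>\<mu>) \<le> ennreal m"

lemma abs_moment_leD:
  assumes "abs_moment_le \<mu> m" "sets \<mu> = sets borel"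
  shows "integrable \<mu> (\<lambda>x. x)" "(\<integral>x. \<bar>x\<bar> \<partial>\<mu>) \<le> m" "0 \<le> m"
proof -
  have [measurable_cong]: "sets \<mu> = sets borel" by fact
  show i: "integrable \<mu> (\<lambda>x. x)"
    using assms(1) by (intro integrableI_bounded) (auto simp: abs_moment_le_def elim: order.strict_trans1)
  have "ennreal (\<integral>x. \<bar>x\<bar> \<partial>\<mu>) = (\<integral>\<^sup>+x. ennreal \<bar>x\<bar> \<partial>\<mu>)"
    using i by (intro nn_integral_eq_integral[symmetric]) auto
  then have "ennreal (\<integral>x. \<bar>x\<bar> \<partial>\<mu>) \<le> ennreal m" using assms(1) by (simp add: abs_moment_le_def)
  then show "(\<integral>x. \<bar>x\<bar> \<partial>\<mu>) \<le> m" "0 \<le> m" using assms(1) by (auto simp: abs_moment_le_def)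
qed

lemma abs_moment_le_convolution:
  assumes "real_distribution \<mu>" "real_distribution \<rho>" "abs_moment_le \<mu> m" "abs_moment_le \<rho> m'"
  shows "abs_moment_le (\<mu> \<star> \<rho>) (m + m')"
proof -
  interpret \<mu>: real_distribution \<mu> by fact
  interpret \<rho>: real_distribution \<rho> by fact
  have "(\<integral>\<^sup>+x. ennreal \<bar>x\<bar> \<partial>(\<mu> \<star> \<rho>)) = (\<integral>\<^sup>+x. \<integral>\<^sup>+y. ennreal \<bar>x + y\<bar> \<partial>\<rho> \<partial>\<mu>)"
    by (intro nn_integral_convolution \<mu>.finite_measure_axioms \<rho>.finite_measure_axioms) auto
  also have "\<dots> \<le> (\<integral>\<^sup>+x. \<integral>\<^sup>+y. ennreal \<bar>x\<bar> + ennreal \<bar>y\<bar> \<partial>\<rho> \<partial>\<mu>)"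
    by (intro nn_integral_mono) (simp flip: ennreal_plus add: abs_triangle_ineq)
  also have "\<dots> = (\<integral>\<^sup>+x. ennreal \<bar>x\<bar> + (\<integral>\<^sup>+y. ennreal \<bar>y\<bar> \<partial>\<rho>) \<partial>\<mu>)"
    by (simp add: nn_integral_add \<rho>.emeasure_space_1[simplified])
  also have "\<dots> = (\<integral>\<^sup>+x. ennreal \<bar>x\<bar> \<partial>\<mu>) + (\<integral>\<^sup>+y. ennreal \<bar>y\<bar> \<partial>\<rho>)"
    by (simp add: nn_integral_add \<mu>.emeasure_space_1[simplified])
  also have "\<dots> \<le> ennreal m + ennreal m'"
    using assms by (intro add_mono) (auto simp: abs_moment_le_def)
  finally show ?thesis using assms(3,4) by (auto simp: abs_moment_le_def simp flip: ennreal_plus)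
qed

text \<open>The constant of \<open>tail_max_linear\<close> when all four coefficients are 1; it
  depends on Y alone.\<close>

definition conv_tail_const :: "real \<Rightarrow> real" where
  "conv_tail_const Y = 2 * tail_const Y 1 1 + 2 powr (Y + 1)"

lemma conv_tail_const_nonneg: "Y > 0 \<Longrightarrow> conv_tail_const Y \<ge> 0"
  by (simp add: conv_tail_const_def tail_const_nonneg)

text \<open>The case in which the two linear forms coincide. Leading coefficients add exactly, and
  the new error is linear in the old data with a factor depending only on Y, which makes iteration
  possible.\<close>

lemma tail_bound_convolution:
  assumes \<mu>: "real_distribution \<mu>" and \<rho>: "real_distribution \<rho>"
    and tb: "tail_bound \<mu> Y k K" "tail_bound \<rho> Y k' K'" and k: "k \<ge> 0" "K \<ge> 0" "k' \<ge> 0" "K' \<ge> 0"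
    and m: "abs_moment_le \<mu> m" "abs_moment_le \<rho> m'" and Y: "Y > 0"
  shows "tail_bound (\<mu> \<star> \<rho>) Y (k + k') (conv_tail_const Y * (K + K' + k * m' + k' * m))"
  unfolding tail_bound_def
proof (intro allI impI)
  interpret \<mu>: real_distribution \<mu> by fact
  interpret \<rho>: real_distribution \<rho> by fact
  fix a :: real assume a: "a > 0"
  have "measure (\<mu> \<star> \<rho>) {a..} = measure (\<mu> \<Otimes>\<^sub>M \<rho>) ((\<lambda>(x, y). x + y) -` {a..} \<inter> space (\<mu> \<Otimes>\<^sub>M \<rho>))"
    unfolding convolution_def by (intro measure_distr) auto
  also have "(\<lambda>(x, y). x + y) -` {a..} \<inter> space (\<mu> \<Otimes>\<^sub>M \<rho>) = {(x, y). max (1 * x + 1 * y) (1 * x + 1 * y) \<ge> a}"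
    by (auto simp: space_pair_measure)
  finally show "\<bar>measure (\<mu> \<star> \<rho>) {a..} - (k + k') * a powr (- Y)\<bar> \<le> (conv_tail_const Y * (K + K' + k * m' + k' * m)) * a powr (- Y - 1)"
    using tail_max_linear[OF \<mu> \<rho> tb k abs_moment_leD(1,2)[OF m(1) \<mu>.M_is_borel] abs_moment_leD(1,2)[OF m(2) \<rho>.M_is_borel] Y, of 1 1 1 1 a] a
    by (simp add: conv_tail_const_def)
qed

primrec conv_pow :: "real measure \<Rightarrow> nat \<Rightarrow> real measure" where
  "conv_pow J 0 = return borel 0"
| "conv_pow J (Suc n) = (J \<star> conv_pow J n)"

lemma real_distribution_conv_pow:
  assumes "real_distribution J" shows "real_distribution (conv_pow J n)"
proof (induction n)
  case 0
  then show ?case by (simp add: real_distribution_def real_distribution_axioms_def prob_space_return)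
qed (simp add: assms real_distribution_convolution)

lemma exp_conv_pow:
  fixes z :: complex
  assumes "real_distribution J" "integrable J (\<lambda>x. exp (z * of_real x))"
  shows "integrable (conv_pow J n) (\<lambda>x. exp (z * of_real x)) \<and> (\<integral>x. exp (z * of_real x) \<partial>conv_pow J n) = (\<integral>x. exp (z * of_real x) \<partial>J) ^ n"
proof (induction n)
  case 0
  have "integrable (return borel 0) (\<lambda>x. exp (z * of_real x))"
    using real_distribution_conv_pow[OF assms(1), of 0]
    by (intro integrableI_bounded) (auto simp: nn_integral_return)
  then show ?case by (simp add: integral_return)
next
  case (Suc n)
  then show ?case using exp_convolution[OF assms(1) real_distribution_conv_pow[OF assms(1)] assms(2)] by simp
qed

lemma abs_moment_le_conv_pow:
  assumes "real_distribution J" "abs_moment_le J m"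
  shows "abs_moment_le (conv_pow J n) (real n * m)"
proof (induction n)
  case 0
  then show ?case by (simp add: abs_moment_le_def nn_integral_return)
next
  case (Suc n)
  then show ?case
    using abs_moment_le_convolution[OF assms(1) real_distribution_conv_pow[OF assms(1)] assms(2) Suc]
    by (simp add: algebra_simps)
qed

text \<open>The error constants satisfy a recursion of the form K_(n+1) = c (K + K_n + 2 n k m),
  which a geometric sequence dominates. Geometric growth is affordable because Poisson variables
  have all exponential moments.\<close>

lemma tail_bound_conv_pow:
  assumes J: "real_distribution J" and tb: "tail_bound J Y k K" and k: "k \<ge> 0" "K \<ge> 0" and m: "abs_moment_le J m" and Y: "Y > 0"
  shows "\<exists>D\<ge>1. \<forall>n. tail_bound (conv_pow J n) Y (real n * k) (D ^ n)"
proof -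
  let ?c = "conv_tail_const Y"
  \<comment> \<open>The bound 2 gives n <= D ^ n, and the second entry absorbs one step of the
    recursion.\<close>
  define D where "D = max 2 (?c * (K + 1 + 2 * k * m))"
  have m0: "m \<ge> 0" using m by (simp add: abs_moment_le_def)
  have c: "?c \<ge> 0" using Y by (rule conv_tail_const_nonneg)
  have D: "D \<ge> 2" "D \<ge> ?c * (K + 1 + 2 * k * m)" by (auto simp: D_def)
  have nD: "real n \<le> D ^ n" for n
  proof -
    have "real n \<le> 2 ^ n" using of_nat_less_two_power[of n] by (simp add: less_imp_le)
    also have "\<dots> \<le> D ^ n" using D by (intro power_mono) auto
    finally show ?thesis .
  qed
  have D1: "1 \<le> D ^ n" for n using D by simp
  have "tail_bound (conv_pow J n) Y (real n * k) (D ^ n)" for n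
  proof (induction n)
    case 0
    show ?case by (auto simp: tail_bound_def measure_return)
  next
    case (Suc n)
    have "tail_bound (J \<star> conv_pow J n) Y (k + real n * k) (?c * (K + D ^ n + k * (real n * m) + real n * k * m))"
      using k D by (intro tail_bound_convolution J real_distribution_conv_pow tb Suc m abs_moment_le_conv_pow Y) auto
    moreover have "?c * (K + D ^ n + k * (real n * m) + real n * k * m) \<le> D ^ Suc n"
    proof -
      have "K + D ^ n + k * (real n * m) + real n * k * m = K * 1 + D ^ n + 2 * k * m * real n" by simp
      also have "\<dots> \<le> K * D ^ n + D ^ n + 2 * k * m * D ^ n"
        using k m0 nD D1 by (intro add_mono mult_left_mono) auto
      also have "\<dots> = (K + 1 + 2 * k * m) * D ^ n" by (simp add: algebra_simps)
      finally have "?c * (K + D ^ n + k * (real n * m) + real n * k * m) \<le> ?c * ((K + 1 + 2 * k * m) * D ^ n)"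
        using c by (intro mult_left_mono) auto
      also have "\<dots> = (?c * (K + 1 + 2 * k * m)) * D ^ n" by simp
      also have "\<dots> \<le> D * D ^ n" using D by (intro mult_right_mono) auto
      finally show ?thesis by simp
    qed
    ultimately have "tail_bound (J \<star> conv_pow J n) Y (k + real n * k) (D ^ Suc n)" by (rule tail_bound_mono)
    then show ?case by (simp add: algebra_simps)
  qed
  then show ?thesis using D by (intro exI[of _ D]) auto
qed

section \<open>Poisson mixtures of convolution powers\<close>

lemma poisson_power:
  fixes w :: "'a :: {real_normed_field, banach, second_countable_topology}"
  assumes "rate > 0"
  shows "integrable (measure_pmf (poisson_pmf rate)) (\<lambda>n. w ^ n)"
    and "(\<integral>n. w ^ n \<partial>measure_pmf (poisson_pmf rate)) = exp (of_real rate * (w - 1))"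
proof -
  let ?f = "\<lambda>n. (rate ^ n / fact n * exp (- rate)) *\<^sub>R w ^ n"
  have eq: "measure_pmf (poisson_pmf rate) = density (count_space UNIV) (\<lambda>n. ennreal (rate ^ n / fact n * exp (- rate)))"
    using assms by (subst measure_pmf_eq_density) simp
  have f_eq: "?f = (\<lambda>n. exp (- of_real rate) * ((of_real rate * w) ^ n /\<^sub>R fact n))"
    by (auto simp: scaleR_conv_of_real power_mult_distrib exp_of_real[symmetric] field_simps)
  have "summable (\<lambda>n. norm (?f n))"
  proof -
    have "summable (\<lambda>n. exp (- rate) * ((rate * norm w) ^ n /\<^sub>R fact n))"
      by (rule summable_mult[OF summable_exp_generic])
    then show ?thesis using assms by (simp add: norm_power power_mult_distrib divide_inverse abs_mult mult_ac)
  qed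
  then have i: "integrable (count_space UNIV) ?f" by (simp add: integrable_count_space_nat_iff)
  then show "integrable (measure_pmf (poisson_pmf rate)) (\<lambda>n. w ^ n)"
    unfolding eq using assms by (subst integrable_density) auto
  have "(\<integral>n. w ^ n \<partial>measure_pmf (poisson_pmf rate)) = (\<Sum>n. ?f n)"
    unfolding eq using assms i by (subst integral_density) (auto simp: integral_count_space_nat)
  also have "\<dots> = exp (- of_real rate) * exp (of_real rate * w)"
    unfolding f_eq using sums_mult[OF exp_converges[of "of_real rate * w"], of "exp (- of_real rate)"] by (intro sums_unique[symmetric])
  finally show "(\<integral>n. w ^ n \<partial>measure_pmf (poisson_pmf rate)) = exp (of_real rate * (w - 1))"
    by (simp add: mult_exp_exp algebra_simps)
qed

definition compound_poisson :: "real \<Rightarrow> real measure \<Rightarrow> real measure" where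
  "compound_poisson rate J = measure_pmf (poisson_pmf rate) \<bind> conv_pow J"

context
  fixes J :: "real measure" and rate :: real
  assumes J: "real_distribution J" and rate: "rate > 0"
begin

lemma conv_pow_kernel: "conv_pow J \<in> measure_pmf p \<rightarrow>\<^sub>M subprob_algebra borel"
proof -
  have "conv_pow J n \<in> space (subprob_algebra borel)" for n
  proof -
    interpret real_distribution "conv_pow J n" by (rule real_distribution_conv_pow[OF J])
    show ?thesis by (simp add: space_subprob_algebra prob_space_imp_subprob_space prob_space_axioms)
  qed
  then show ?thesis by simp
qed

lemma sets_compound_poisson [simp, measurable_cong]: "sets (compound_poisson rate J) = sets borel"
  unfolding compound_poisson_def
  by (rule sets_bind) (use real_distribution.events_eq_borel[OF real_distribution_conv_pow[OF J]] in auto)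

lemma nn_integral_compound_poisson:
  "f \<in> borel_measurable borel \<Longrightarrow> (\<integral>\<^sup>+x. f x \<partial>compound_poisson rate J) = (\<integral>\<^sup>+n. \<integral>\<^sup>+x. f x \<partial>conv_pow J n \<partial>measure_pmf (poisson_pmf rate))"
  unfolding compound_poisson_def by (rule nn_integral_bind[OF _ conv_pow_kernel])

lemma real_distribution_compound_poisson: "real_distribution (compound_poisson rate J)"
proof -
  have "emeasure (compound_poisson rate J) (space (compound_poisson rate J)) = (\<integral>\<^sup>+x. 1 \<partial>compound_poisson rate J)" by simp
  also have "\<dots> = (\<integral>\<^sup>+n. \<integral>\<^sup>+x. 1 \<partial>conv_pow J n \<partial>measure_pmf (poisson_pmf rate))"
    by (rule nn_integral_compound_poisson) simp
  also have "\<dots> = (\<integral>\<^sup>+n. 1 \<partial>measure_pmf (poisson_pmf rate))"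
  proof (intro nn_integral_cong)
    fix n
    interpret real_distribution "conv_pow J n" by (rule real_distribution_conv_pow[OF J])
    show "(\<integral>\<^sup>+x. 1 \<partial>conv_pow J n) = 1" using emeasure_space_1 by simp
  qed
  finally have "prob_space (compound_poisson rate J)" by (intro prob_spaceI) simp
  then show ?thesis by (simp add: real_distribution_def real_distribution_axioms_def)
qed

text \<open>Mixing is an identity between integrals of nonnegative functions. Real integrands follow
  by splitting into positive and negative parts, complex ones by real and imaginary parts.\<close>

lemma integral_compound_poisson_nonneg:
  fixes f :: "real \<Rightarrow> real"
  assumes i: "integrable (compound_poisson rate J) f" and nn: "\<And>x. 0 \<le> f x"
    and j: "\<And>n. integrable (conv_pow J n) f"
  shows "integrable (measure_pmf (poisson_pmf rate)) (\<lambda>n. \<integral>x. f x \<partial>conv_pow J n) \<and>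
    (\<integral>x. f x \<partial>compound_poisson rate J) = (\<integral>n. \<integral>x. f x \<partial>conv_pow J n \<partial>measure_pmf (poisson_pmf rate))"
proof -
  have [measurable]: "f \<in> borel_measurable borel" using borel_measurable_integrable[OF i] by simp
  have "ennreal (\<integral>x. f x \<partial>compound_poisson rate J) = (\<integral>\<^sup>+x. ennreal (f x) \<partial>compound_poisson rate J)"
    using i nn by (intro nn_integral_eq_integral[symmetric]) auto
  also have "\<dots> = (\<integral>\<^sup>+n. \<integral>\<^sup>+x. ennreal (f x) \<partial>conv_pow J n \<partial>measure_pmf (poisson_pmf rate))"
    by (rule nn_integral_compound_poisson) simp
  also have "\<dots> = (\<integral>\<^sup>+n. ennreal (\<integral>x. f x \<partial>conv_pow J n) \<partial>measure_pmf (poisson_pmf rate))"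
    using j nn by (intro nn_integral_cong nn_integral_eq_integral) auto
  finally have eq: "(\<integral>\<^sup>+n. ennreal (\<integral>x. f x \<partial>conv_pow J n) \<partial>measure_pmf (poisson_pmf rate)) = ennreal (\<integral>x. f x \<partial>compound_poisson rate J)" ..
  have I: "integrable (measure_pmf (poisson_pmf rate)) (\<lambda>n. \<integral>x. f x \<partial>conv_pow J n)"
    using nn eq by (intro integrableI_nn_integral_finite) (auto intro!: Bochner_Integration.integral_nonneg)
  then have "ennreal (\<integral>n. \<integral>x. f x \<partial>conv_pow J n \<partial>measure_pmf (poisson_pmf rate)) = ennreal (\<integral>x. f x \<partial>compound_poisson rate J)"
    unfolding eq[symmetric] using nn by (intro nn_integral_eq_integral[symmetric]) (auto intro!: Bochner_Integration.integral_nonneg)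
  then show ?thesis using I nn by (subst (asm) ennreal_inj) (auto intro!: Bochner_Integration.integral_nonneg)
qed

lemma integral_compound_poisson_real:
  fixes f :: "real \<Rightarrow> real"
  assumes i: "integrable (compound_poisson rate J) f" and j: "\<And>n. integrable (conv_pow J n) f"
  shows "integrable (measure_pmf (poisson_pmf rate)) (\<lambda>n. \<integral>x. f x \<partial>conv_pow J n) \<and>
    (\<integral>x. f x \<partial>compound_poisson rate J) = (\<integral>n. \<integral>x. f x \<partial>conv_pow J n \<partial>measure_pmf (poisson_pmf rate))"
proof -
  have e: "(\<integral>x. f x \<partial>N) = (\<integral>x. max 0 (f x) \<partial>N) - (\<integral>x. max 0 (- f x) \<partial>N)" if "integrable N f" for N :: "real measure"
  proof -
    have "(\<integral>x. f x \<partial>N) = (\<integral>x. max 0 (f x) - max 0 (- f x) \<partial>N)"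
      by (intro Bochner_Integration.integral_cong) auto
    then show ?thesis using that by simp
  qed
  have p: "integrable (compound_poisson rate J) (\<lambda>x. max 0 (f x))" "integrable (compound_poisson rate J) (\<lambda>x. max 0 (- f x))"
    "\<And>n. integrable (conv_pow J n) (\<lambda>x. max 0 (f x))" "\<And>n. integrable (conv_pow J n) (\<lambda>x. max 0 (- f x))"
    using i j by auto
  note a = integral_compound_poisson_nonneg[OF p(1) _ p(3)] integral_compound_poisson_nonneg[OF p(2) _ p(4)]
  show ?thesis
    unfolding e[OF i] e[OF j] using a by simp
qed

lemma integral_compound_poisson:
  fixes f :: "real \<Rightarrow> complex"
  assumes i: "integrable (compound_poisson rate J) f" and j: "\<And>n. integrable (conv_pow J n) f"
  shows "(\<integral>x. f x \<partial>compound_poisson rate J) = (\<integral>n. \<integral>x. f x \<partial>conv_pow J n \<partial>measure_pmf (poisson_pmf rate))"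
proof -
  have R: "integrable (measure_pmf (poisson_pmf rate)) (\<lambda>n. Re (\<integral>x. f x \<partial>conv_pow J n))"
    "Re (\<integral>x. f x \<partial>compound_poisson rate J) = (\<integral>n. Re (\<integral>x. f x \<partial>conv_pow J n) \<partial>measure_pmf (poisson_pmf rate))"
    using integral_compound_poisson_real[of "\<lambda>x. Re (f x)"] i j by auto
  have I: "integrable (measure_pmf (poisson_pmf rate)) (\<lambda>n. Im (\<integral>x. f x \<partial>conv_pow J n))"
    "Im (\<integral>x. f x \<partial>compound_poisson rate J) = (\<integral>n. Im (\<integral>x. f x \<partial>conv_pow J n) \<partial>measure_pmf (poisson_pmf rate))"
    using integral_compound_poisson_real[of "\<lambda>x. Im (f x)"] i j by auto
  have "integrable (measure_pmf (poisson_pmf rate)) (\<lambda>n. \<integral>x. f x \<partial>conv_pow J n)"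
  proof -
    have "integrable (measure_pmf (poisson_pmf rate)) (\<lambda>n. of_real (Re (\<integral>x. f x \<partial>conv_pow J n)) + \<i> * of_real (Im (\<integral>x. f x \<partial>conv_pow J n)))"
      by (intro Bochner_Integration.integrable_add integrable_mult_right integrable_of_real R(1) I(1))
    then show ?thesis by (simp add: complex_eq[symmetric])
  qed
  then show ?thesis using R(2) I(2) by (intro complex_eqI) auto
qed

text \<open>Since |exp(z x)| = exp(Re z x), integrability follows from the Poisson generating
  function at the real Laplace transform of a jump; the value is the generating function at the
  complex one.\<close>

lemma exp_compound_poisson:
  fixes z :: complex
  assumes i: "integrable J (\<lambda>x. exp (z * of_real x))"
  shows "integrable (compound_poisson rate J) (\<lambda>x. exp (z * of_real x))"
    and "(\<integral>x. exp (z * of_real x) \<partial>compound_poisson rate J) = exp (of_real rate * ((\<integral>x. exp (z * of_real x) \<partial>J) - 1))"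
proof -
  have nz: "norm (exp (z * of_real x)) = exp (Re z * x)" for x by simp
  have iR: "integrable J (\<lambda>x. exp (of_real (Re z) * complex_of_real x))"
    using integrable_of_real[OF integrable_norm[OF i], where 'a=complex] unfolding nz
    by (simp only: of_real_mult exp_of_real[symmetric])
  have q: "integrable (conv_pow J n) (\<lambda>x. exp (z * of_real x))" for n
    using exp_conv_pow[OF J i] by blast
  have nn: "(\<integral>\<^sup>+x. ennreal (norm (exp (z * of_real x))) \<partial>conv_pow J n) = ennreal ((\<integral>x. exp (Re z * x) \<partial>J) ^ n)" for n
  proof -
    have "complex_of_real (\<integral>x. exp (Re z * x) \<partial>conv_pow J n) = complex_of_real ((\<integral>x. exp (Re z * x) \<partial>J) ^ n)"
      using exp_conv_pow[OF J iR, of n]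
      by (simp add: exp_of_real flip: of_real_mult)
    then have "(\<integral>x. exp (Re z * x) \<partial>conv_pow J n) = (\<integral>x. exp (Re z * x) \<partial>J) ^ n" by (simp only: of_real_eq_iff)
    moreover have "(\<integral>\<^sup>+x. ennreal (norm (exp (z * of_real x))) \<partial>conv_pow J n) = ennreal (\<integral>x. norm (exp (z * of_real x)) \<partial>conv_pow J n)"
      by (intro nn_integral_eq_integral integrable_norm q) auto
    ultimately show ?thesis by (simp add: nz)
  qed
  show I: "integrable (compound_poisson rate J) (\<lambda>x. exp (z * of_real x))"
  proof (rule integrableI_bounded)
    have "(\<integral>\<^sup>+x. ennreal (norm (exp (z * of_real x))) \<partial>compound_poisson rate J) = (\<integral>\<^sup>+n. ennreal ((\<integral>x. exp (Re z * x) \<partial>J) ^ n) \<partial>measure_pmf (poisson_pmf rate))"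
      by (subst nn_integral_compound_poisson, simp) (simp only: nn)
    also have "\<dots> = ennreal (\<integral>n. (\<integral>x. exp (Re z * x) \<partial>J) ^ n \<partial>measure_pmf (poisson_pmf rate))"
      by (intro nn_integral_eq_integral poisson_power(1) rate) (auto intro!: zero_le_power Bochner_Integration.integral_nonneg)
    finally show "(\<integral>\<^sup>+x. ennreal (norm (exp (z * of_real x))) \<partial>compound_poisson rate J) < \<infinity>" by simp
  qed simp
  have "(\<integral>x. exp (z * of_real x) \<partial>compound_poisson rate J) = (\<integral>n. (\<integral>x. exp (z * of_real x) \<partial>J) ^ n \<partial>measure_pmf (poisson_pmf rate))"
    using integral_compound_poisson[OF I q] exp_conv_pow[OF J i] by simp
  then show "(\<integral>x. exp (z * of_real x) \<partial>compound_poisson rate J) = exp (of_real rate * ((\<integral>x. exp (z * of_real x) \<partial>J) - 1))"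
    by (simp add: poisson_power(2)[OF rate])
qed

lemma abs_moment_le_compound_poisson:
  assumes m: "abs_moment_le J m"
  shows "abs_moment_le (compound_poisson rate J) (m * exp rate)"
proof -
  have m0: "m \<ge> 0" using m by (simp add: abs_moment_le_def)
  have "(\<integral>\<^sup>+x. ennreal \<bar>x\<bar> \<partial>compound_poisson rate J) = (\<integral>\<^sup>+n. \<integral>\<^sup>+x. ennreal \<bar>x\<bar> \<partial>conv_pow J n \<partial>measure_pmf (poisson_pmf rate))"
    by (rule nn_integral_compound_poisson) simp
  \<comment> \<open>The crude n <= 2 ^ n replaces the Poisson mean by the generating function at 2,
    which is exp rate.\<close>
  also have "\<dots> \<le> (\<integral>\<^sup>+n. ennreal (m * 2 ^ n) \<partial>measure_pmf (poisson_pmf rate))"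
  proof (intro nn_integral_mono)
    fix n
    have "(\<integral>\<^sup>+x. ennreal \<bar>x\<bar> \<partial>conv_pow J n) \<le> ennreal (real n * m)"
      using abs_moment_le_conv_pow[OF J m, of n] by (simp add: abs_moment_le_def)
    also have "\<dots> \<le> ennreal (m * 2 ^ n)"
      using m0 of_nat_less_two_power[of n, where 'a=real] by (intro ennreal_leI) (simp add: mult.commute mult_left_mono)
    finally show "(\<integral>\<^sup>+x. ennreal \<bar>x\<bar> \<partial>conv_pow J n) \<le> ennreal (m * 2 ^ n)" .
  qed
  also have "\<dots> = ennreal (\<integral>n. m * 2 ^ n \<partial>measure_pmf (poisson_pmf rate))"
    using m0 poisson_power(1)[OF rate, of "2 :: real"] by (intro nn_integral_eq_integral) auto
  also have "(\<integral>n. m * 2 ^ n \<partial>measure_pmf (poisson_pmf rate)) = m * exp rate"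
    using poisson_power(2)[OF rate, of "2 :: real"] by simp
  finally show ?thesis using m0 by (simp add: abs_moment_le_def)
qed

text \<open>Averaging the bounds for convolution powers over the number of jumps: the coefficient n
  k becomes rate * k, and the errors D ^ n sum to the generating function at D, which is finite for
  every D.\<close>

lemma tail_bound_compound_poisson:
  assumes tb: "tail_bound J Y k K" and k: "k \<ge> 0" "K \<ge> 0" and m: "abs_moment_le J m" and Y: "Y > 0"
  shows "\<exists>K'\<ge>0. tail_bound (compound_poisson rate J) Y (rate * k) K'"
proof -
  obtain D where D: "D \<ge> 1" "\<And>n. tail_bound (conv_pow J n) Y (real n * k) (D ^ n)"
    using tail_bound_conv_pow[OF J tb k m Y] by blast
  let ?p = "measure_pmf (poisson_pmf rate)"
  interpret CP: real_distribution "compound_poisson rate J" by (rule real_distribution_compound_poisson)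
  have Dp: "integrable ?p (\<lambda>n. D ^ n)" "(\<integral>n. D ^ n \<partial>?p) = exp (rate * (D - 1))"
    using poisson_power[OF rate, of D] by auto
  \<comment> \<open>Here the exact mean is required, since it enters the leading coefficient of the
    tail.\<close>
  have mean: "integrable ?p real" "(\<integral>n. real n \<partial>?p) = rate"
  proof -
    let ?f = "\<lambda>n. (rate ^ n / fact n * exp (- rate)) *\<^sub>R real n"
    have eq: "?p = density (count_space UNIV) (\<lambda>n. ennreal (rate ^ n / fact n * exp (- rate)))"
      using rate by (subst measure_pmf_eq_density) simp
    have "(\<lambda>n. ?f (Suc n)) = (\<lambda>n. rate * exp (- rate) * (rate ^ n /\<^sub>R fact n))"
      by (auto simp: divide_simps simp del: of_nat_Suc)
    then have "(\<lambda>n. ?f (Suc n)) sums (rate * exp (- rate) * exp rate)"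
      using sums_mult[OF exp_converges[of rate], of "rate * exp (- rate)"] by simp
    then have s: "?f sums rate" by (subst (asm) sums_Suc_iff) (simp add: exp_minus field_simps)
    then have i: "integrable (count_space UNIV) ?f"
      using rate by (auto simp: integrable_count_space_nat_iff sums_iff)
    then show "integrable ?p real" unfolding eq using rate by (subst integrable_density) auto
    show "(\<integral>n. real n \<partial>?p) = rate"
      unfolding eq using rate i s by (subst integral_density) (auto simp: integral_count_space_nat sums_iff)
  qed
  have "tail_bound (compound_poisson rate J) Y (rate * k) (exp (rate * (D - 1)))"
    unfolding tail_bound_def
  proof (intro allI impI)
    fix a :: real assume a: "a > 0"
    have sq: "real_distribution (conv_pow J n)" for n by (rule real_distribution_conv_pow[OF J])
    have Iq: "integrable (conv_pow J n) (indicator {a..} :: real \<Rightarrow> real)" for n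
    proof -
      interpret real_distribution "conv_pow J n" by (rule sq)
      show ?thesis by (rule integrable_const_bound[where B=1]) (auto simp: indicator_def)
    qed
    have Mq: "(\<integral>x. indicator {a..} x \<partial>conv_pow J n) = measure (conv_pow J n) {a..}" for n
    proof -
      interpret real_distribution "conv_pow J n" by (rule sq)
      show ?thesis by simp
    qed
    have "integrable (compound_poisson rate J) (indicator {a..} :: real \<Rightarrow> real)"
      by (rule CP.integrable_const_bound[where B=1]) (auto simp: indicator_def)
    from integral_compound_poisson_real[OF this Iq]
    have T: "integrable ?p (\<lambda>n. measure (conv_pow J n) {a..})" "measure (compound_poisson rate J) {a..} = (\<integral>n. measure (conv_pow J n) {a..} \<partial>?p)"
      unfolding Mq by auto
    have "rate * k * a powr (- Y) = (\<integral>n. real n * k * a powr (- Y) \<partial>?p)"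
      using mean by simp
    then have "\<bar>measure (compound_poisson rate J) {a..} - rate * k * a powr (- Y)\<bar> = \<bar>\<integral>n. measure (conv_pow J n) {a..} - real n * k * a powr (- Y) \<partial>?p\<bar>"
      using T mean by (simp add: Bochner_Integration.integral_diff)
    also have "\<dots> \<le> (\<integral>n. \<bar>measure (conv_pow J n) {a..} - real n * k * a powr (- Y)\<bar> \<partial>?p)"
      by (rule integral_abs_bound)
    also have "\<dots> \<le> (\<integral>n. D ^ n * a powr (- Y - 1) \<partial>?p)"
      using T mean Dp a by (intro integral_mono tail_boundD[OF D(2)]) auto
    also have "\<dots> = exp (rate * (D - 1)) * a powr (- Y - 1)" using Dp by simp
    finally show "\<bar>measure (compound_poisson rate J) {a..} - rate * k * a powr (- Y)\<bar> \<le> exp (rate * (D - 1)) * a powr (- Y - 1)" .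
  qed
  then show ?thesis by (intro exI[of _ "exp (rate * (D - 1))"]) auto
qed

end

section \<open>Approximation of the stable law by compound Poisson laws\<close>

definition levy_mass :: "real \<Rightarrow> real \<Rightarrow> real set \<Rightarrow> real" where
  "levy_mass C Y A = (LBINT x:A. C * x powr (- Y - 1))"

definition jump_law :: "real \<Rightarrow> real \<Rightarrow> real set \<Rightarrow> real measure" where
  "jump_law C Y A = density lborel (\<lambda>x. ennreal (indicator A x * (C * x powr (- Y - 1)) / levy_mass C Y A))"

text \<open>Law at time 1 of the sum of all jumps with size in A, without compensator.\<close>

definition levy_cp :: "real \<Rightarrow> real \<Rightarrow> real set \<Rightarrow> real measure" where
  "levy_cp C Y A = compound_poisson (levy_mass C Y A) (jump_law C Y A)"

lemma set_integrable_powr_tail: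
  fixes p a c :: real
  assumes "p > 1" "a > 0" "A \<in> sets borel" "A \<subseteq> {a..}"
  shows "set_integrable lborel A (\<lambda>x. c * x powr (- p))"
  by (rule set_integrable_subset[OF set_integrable_mult_right[OF set_integrable_powr_upper[OF assms(1,2)]]]) (use assms in auto)

context
  fixes C Y a :: real and A :: "real set"
  assumes C: "C > 0" and Y: "Y > 0" and a: "a > 0" and A: "A \<in> sets borel" "A \<subseteq> {a..}" and mass: "levy_mass C Y A > 0"
begin

lemma kernel_integrable: "set_integrable lborel A (\<lambda>x. C * x powr (- Y - 1))"
  using set_integrable_powr_tail[of "Y + 1" a A C] Y a A by simp

lemma sets_jump_law [simp, measurable_cong]: "sets (jump_law C Y A) = sets borel"
  by (simp add: jump_law_def)

lemma nn_integral_jump_law: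
  assumes [measurable]: "f \<in> borel_measurable borel"
  shows "(\<integral>\<^sup>+x. f x \<partial>jump_law C Y A) = (\<integral>\<^sup>+x. ennreal (indicator A x * (C * x powr (- Y - 1)) / levy_mass C Y A) * f x \<partial>lborel)"
  unfolding jump_law_def using A by (intro nn_integral_density) auto

lemma real_distribution_jump_law: "real_distribution (jump_law C Y A)"
proof -
  have "emeasure (jump_law C Y A) (space (jump_law C Y A)) = (\<integral>\<^sup>+x. 1 \<partial>jump_law C Y A)" by simp
  also have "\<dots> = (\<integral>\<^sup>+x. ennreal (indicator A x * (C * x powr (- Y - 1)) / levy_mass C Y A) \<partial>lborel)"
    by (subst nn_integral_jump_law) auto
  also have "\<dots> = ennreal (LBINT x. indicator A x * (C * x powr (- Y - 1)) / levy_mass C Y A)"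
    using kernel_integrable C mass by (intro nn_integral_eq_integral) (auto simp: set_integrable_def)
  also have "(LBINT x. indicator A x * (C * x powr (- Y - 1)) / levy_mass C Y A) = levy_mass C Y A / levy_mass C Y A"
    unfolding levy_mass_def set_lebesgue_integral_def real_scaleR_def integral_divide_zero ..
  finally have "prob_space (jump_law C Y A)" using mass by (intro prob_spaceI) simp
  then show ?thesis by (simp add: real_distribution_def real_distribution_axioms_def)
qed

text \<open>The rate cancels the normalization of the jump law and leaves the exponential formula.
  The boundedness hypothesis covers bounded sets with arbitrary z as well as half-lines with Re z <=
  0, the two uses made of it.\<close>

lemma exp_levy_cp:
  fixes z :: complex
  assumes B: "\<And>x. x \<in> A \<Longrightarrow> norm (exp (z * of_real x)) \<le> B"
  shows "integrable (levy_cp C Y A) (\<lambda>x. exp (z * of_real x))"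
    and "(\<integral>x. exp (z * of_real x) \<partial>levy_cp C Y A) = exp (CLBINT x:A. (exp (z * of_real x) - 1) * of_real (C * x powr (- Y - 1)))"
proof -
  have i: "set_integrable lborel A (\<lambda>x. exp (z * of_real x) * of_real (C * x powr (- Y - 1)))"
  proof (rule set_integrable_bound[where f="\<lambda>x. B * (C * x powr (- Y - 1))"])
    show "set_integrable lborel A (\<lambda>x. B * (C * x powr (- Y - 1)))"
      by (intro set_integrable_mult_right kernel_integrable)
    show "set_borel_measurable lborel A (\<lambda>x. exp (z * of_real x) * of_real (C * x powr (- Y - 1)))"
      unfolding set_borel_measurable_def using A by measurable
    show "AE x in lborel. x \<in> A \<longrightarrow> norm (exp (z * of_real x) * of_real (C * x powr (- Y - 1))) \<le> norm (B * (C * x powr (- Y - 1)))"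
    proof (intro always_eventually allI impI)
      fix x assume x: "x \<in> A"
      have "norm (exp (z * of_real x) * of_real (C * x powr (- Y - 1))) = norm (exp (z * of_real x)) * (C * x powr (- Y - 1))"
        using C by (simp only: norm_mult norm_of_real) simp
      also have "\<dots> \<le> B * (C * x powr (- Y - 1))" using B[OF x] C by (intro mult_right_mono) auto
      also have "\<dots> \<le> norm (B * (C * x powr (- Y - 1)))" by simp
      finally show "norm (exp (z * of_real x) * of_real (C * x powr (- Y - 1))) \<le> norm (B * (C * x powr (- Y - 1)))" .
    qed
  qed
  have k: "set_integrable lborel A (\<lambda>x. complex_of_real (C * x powr (- Y - 1)))"
    using kernel_integrable unfolding set_integrable_def
    by (intro integrable_of_real[where 'a=complex, THEN Bochner_Integration.integrable_cong[THEN iffD1, rotated -1]]) (auto simp: scaleR_conv_of_real)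
  have s: "(indicator A x * (C * x powr (- Y - 1)) / levy_mass C Y A) *\<^sub>R exp (z * of_real x)
     = (indicator A x *\<^sub>R (exp (z * of_real x) * of_real (C * x powr (- Y - 1)))) / of_real (levy_mass C Y A)" for x
    by (simp add: scaleR_conv_of_real)
  have iJ: "integrable (jump_law C Y A) (\<lambda>x. exp (z * of_real x))"
    unfolding jump_law_def using A C mass i by (subst integrable_density) (auto simp: s set_integrable_def)
  have eJ: "(\<integral>x. exp (z * of_real x) \<partial>jump_law C Y A) = (CLBINT x:A. exp (z * of_real x) * of_real (C * x powr (- Y - 1))) / of_real (levy_mass C Y A)"
    unfolding jump_law_def using A C mass
    by (subst integral_density) (auto simp: s set_lebesgue_integral_def)
  show "integrable (levy_cp C Y A) (\<lambda>x. exp (z * of_real x))"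
    unfolding levy_cp_def by (rule exp_compound_poisson(1)[OF real_distribution_jump_law mass iJ])
  have mass_eq: "complex_of_real (levy_mass C Y A) = (CLBINT x:A. of_real (C * x powr (- Y - 1)))"
    unfolding levy_mass_def by (rule set_integral_complex_of_real[symmetric])
  have "of_real (levy_mass C Y A) * ((\<integral>x. exp (z * of_real x) \<partial>jump_law C Y A) - 1)
     = (CLBINT x:A. exp (z * of_real x) * of_real (C * x powr (- Y - 1))) - of_real (levy_mass C Y A)"
    unfolding eJ using mass by (simp add: right_diff_distrib)
  also have "\<dots> = (CLBINT x:A. (exp (z * of_real x) - 1) * of_real (C * x powr (- Y - 1)))"
    unfolding mass_eq set_integral_diff(2)[symmetric, OF i k] left_diff_distrib by simp
  finally show "(\<integral>x. exp (z * of_real x) \<partial>levy_cp C Y A) = exp (CLBINT x:A. (exp (z * of_real x) - 1) * of_real (C * x powr (- Y - 1)))"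
    unfolding levy_cp_def exp_compound_poisson(2)[OF real_distribution_jump_law mass iJ] by (simp only:)
qed

lemma real_distribution_levy_cp: "real_distribution (levy_cp C Y A)"
  unfolding levy_cp_def by (rule real_distribution_compound_poisson[OF real_distribution_jump_law mass])

end

lemma levy_mass_tail:
  assumes "C > 0" "Y > 0" "a > 0"
  shows "levy_mass C Y {a..} = C / Y * a powr (- Y)"
proof -
  have "levy_mass C Y {a..} = C * (LBINT x. indicator {a..} x * x powr (- (Y + 1)))"
    unfolding levy_mass_def set_lebesgue_integral_def
    by (subst integral_mult_right_zero[symmetric]) (auto intro!: Bochner_Integration.integral_cong simp: mult_ac)
  also have "(LBINT x. indicator {a..} x * x powr (- (Y + 1))) = enn2real (\<integral>\<^sup>+x. ennreal (x powr (- (Y + 1))) * indicator {a..} x \<partial>lborel)"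
    by (subst integral_eq_nn_integral) (auto intro!: arg_cong[where f=enn2real] nn_integral_cong simp: indicator_def)
  also have "\<dots> = a powr (- Y) / Y" using assms by (subst nn_integral_powr_upper) auto
  finally show ?thesis by simp
qed

text \<open>Normalized jumps above 1 are Pareto distributed, with tail exactly b powr (-Y) for b >=
  1; the rate C / Y supplies the coefficient of the compound law.\<close>

lemma levy_cp_tail:
  assumes C: "C > 0" and Y: "Y > 1"
  shows "\<exists>K m. K \<ge> 0 \<and> tail_bound (levy_cp C Y {1..}) Y (C / Y) K \<and> abs_moment_le (levy_cp C Y {1..}) m"
proof -
  let ?J = "jump_law C Y {1..}"
  have mass: "levy_mass C Y {1..} = C / Y" using levy_mass_tail[of C Y 1] assms by simp
  have prem: "Y > 0" "(1 :: real) > 0" "{1 :: real..} \<in> sets borel" "{1 :: real..} \<subseteq> {1..}" "levy_mass C Y {1..} > 0"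
    using assms by (auto simp: mass)
  note ctx = C prem
  interpret J: real_distribution ?J by (rule real_distribution_jump_law[OF ctx])
  have J_eq: "emeasure ?J {b..} = ennreal (b powr (- Y))" if "b \<ge> 1" for b
  proof -
    have "emeasure ?J {b..} = (\<integral>\<^sup>+x. indicator {b..} x \<partial>?J)" by (simp add: sets_jump_law[OF ctx])
    also have "\<dots> = (\<integral>\<^sup>+x. ennreal (indicator {1..} x * (C * x powr (- Y - 1)) / levy_mass C Y {1..}) * indicator {b..} x \<partial>lborel)"
      by (rule nn_integral_jump_law[OF ctx]) auto
    also have "\<dots> = (\<integral>\<^sup>+x. ennreal Y * (ennreal (x powr (- Y - 1)) * indicator {b..} x) \<partial>lborel)"
      using that assms unfolding mass
      by (intro nn_integral_cong) (auto simp: indicator_def ennreal_mult[symmetric] field_simps)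
    also have "\<dots> = ennreal Y * ennreal (b powr (- Y) / Y)"
      using that assms nn_integral_powr_upper[of "Y + 1" b] by (subst nn_integral_cmult) auto
    finally show ?thesis using assms by (simp add: ennreal_mult'[symmetric])
  qed
  have tb: "tail_bound ?J Y 1 1"
    unfolding tail_bound_def
  proof (intro allI impI)
    fix b :: real assume b: "b > 0"
    show "\<bar>measure ?J {b..} - 1 * b powr (- Y)\<bar> \<le> 1 * b powr (- Y - 1)"
    proof (cases "b \<ge> 1")
      case True
      then show ?thesis using J_eq[OF True] by (simp add: J.emeasure_eq_measure)
    next
      case False
      \<comment> \<open>Below 1 the tail probability lies in [0, 1] and b powr (-Y) >= 1, so the
        difference is at most b powr (-Y), hence at most b powr (-Y - 1).\<close>
      have "b powr 0 \<le> b powr (- Y)" "b powr (- Y) \<le> b powr (- Y - 1)"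
        by (rule powr_mono'; use b False assms in simp)+
      moreover have "measure ?J {b..} \<le> 1" "measure ?J {b..} \<ge> 0" by auto
      moreover have "b powr 0 = 1" using b by simp
      ultimately show ?thesis by linarith
    qed
  qed
  have m: "abs_moment_le ?J (Y / (Y - 1))"
  proof -
    have "(\<integral>\<^sup>+x. ennreal \<bar>x\<bar> \<partial>?J) = (\<integral>\<^sup>+x. ennreal (indicator {1..} x * (C * x powr (- Y - 1)) / levy_mass C Y {1..}) * ennreal \<bar>x\<bar> \<partial>lborel)"
      by (rule nn_integral_jump_law[OF ctx]) auto
    also have "\<dots> = (\<integral>\<^sup>+x. ennreal Y * (ennreal (x powr (- Y)) * indicator {1..} x) \<partial>lborel)"
      using assms unfolding mass
      by (intro nn_integral_cong) (auto simp: indicator_def ennreal_mult[symmetric] powr_diff)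
    also have "\<dots> = ennreal Y * ennreal (1 powr (1 - Y) / (Y - 1))"
      using assms by (subst nn_integral_cmult, simp) (subst nn_integral_powr_upper, auto)
    finally show ?thesis using assms by (simp add: abs_moment_le_def ennreal_mult'[symmetric])
  qed
  obtain K where "K \<ge> 0" "tail_bound (compound_poisson (levy_mass C Y {1..}) ?J) Y (levy_mass C Y {1..} * 1) K"
    using tail_bound_compound_poisson[OF J.real_distribution_axioms prem(5) tb _ _ m prem(1)] by auto
  moreover have "abs_moment_le (compound_poisson (levy_mass C Y {1..}) ?J) (Y / (Y - 1) * exp (levy_mass C Y {1..}))"
    by (rule abs_moment_le_compound_poisson[OF J.real_distribution_axioms prem(5) m])
  ultimately show ?thesis unfolding levy_cp_def mass by auto
qed

lemma powr_le_exp: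
  fixes a p :: real assumes "a > 0" "p > 0"
  shows "a powr p \<le> p powr p * exp a"
proof -
  have "(a / p) powr p \<le> exp (a / p) powr p"
  proof (rule powr_mono2)
    show "a / p \<le> exp (a / p)" using exp_ge_add_one_self[of "a / p"] by linarith
  qed (use assms in auto)
  also have "\<dots> = exp a" using assms by (simp add: exp_powr_real)
  finally show ?thesis using assms by (simp add: powr_divide field_simps)
qed

text \<open>Two-sided exponential moments beat every power, so the leading tail coefficient is 0.
  Only the bound R enters, and for the small jumps it will not depend on the truncation
  level.\<close>

lemma exp_moments_bounds:
  fixes R Y :: real
  assumes \<mu>: "real_distribution \<mu>" and Y: "Y > 0"
    and i: "integrable \<mu> (\<lambda>x. exp x)" "integrable \<mu> (\<lambda>x. exp (- x))" "(\<integral>x. exp x \<partial>\<mu>) \<le> R" "(\<integral>x. exp (- x) \<partial>\<mu>) \<le> R"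
  shows "tail_bound \<mu> Y 0 (R * (Y + 1) powr (Y + 1))" "abs_moment_le \<mu> (2 * R)"
proof -
  interpret real_distribution \<mu> by fact
  have R: "R \<ge> 0" using i(3) by (rule order.trans[rotated]) (auto intro!: Bochner_Integration.integral_nonneg)
  show "tail_bound \<mu> Y 0 (R * (Y + 1) powr (Y + 1))"
    unfolding tail_bound_def
  proof (intro allI impI)
    fix a :: real assume a: "a > 0"
    have "measure \<mu> {a..} = measure \<mu> {x\<in>space \<mu>. exp x \<ge> exp a}" by (rule arg_cong[where f="measure \<mu>"]) auto
    also have "\<dots> \<le> (\<integral>x. exp x \<partial>\<mu>) / exp a"
      using i by (intro integral_Markov_inequality_measure[where A="{}"]) auto
    also have "\<dots> \<le> R / exp a" using i by (intro divide_right_mono) auto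
    also have "\<dots> \<le> R * ((Y + 1) powr (Y + 1) * a powr (- Y - 1))"
    proof -
      have "a powr (Y + 1) \<le> (Y + 1) powr (Y + 1) * exp a" using a Y by (intro powr_le_exp) auto
      then have "1 / exp a \<le> (Y + 1) powr (Y + 1) * (1 / a powr (Y + 1))" using a by (simp add: field_simps)
      also have "1 / a powr (Y + 1) = a powr (- Y - 1)" using powr_minus_divide[of a "Y + 1"] by simp
      finally show ?thesis using R mult_left_mono[of "1 / exp a" _ R] by simp
    qed
    finally show "\<bar>measure \<mu> {a..} - 0 * a powr (- Y)\<bar> \<le> R * (Y + 1) powr (Y + 1) * a powr (- Y - 1)" by (simp add: mult.assoc)
  qed
  have "(\<integral>\<^sup>+x. ennreal \<bar>x\<bar> \<partial>\<mu>) \<le> (\<integral>\<^sup>+x. ennreal (exp x + exp (- x)) \<partial>\<mu>)"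
  proof (intro nn_integral_mono ennreal_leI)
    fix x :: real
    show "\<bar>x\<bar> \<le> exp x + exp (- x)"
      using exp_ge_add_one_self[of x] exp_ge_add_one_self[of "- x"] exp_gt_zero[of x] exp_gt_zero[of "- x"] by linarith
  qed
  also have "\<dots> = ennreal (\<integral>x. exp x + exp (- x) \<partial>\<mu>)" using i by (intro nn_integral_eq_integral) auto
  also have "\<dots> \<le> ennreal (2 * R)" using i by (intro ennreal_leI) simp
  finally show "abs_moment_le \<mu> (2 * R)" using R by (simp add: abs_moment_le_def)
qed

text \<open>The compensator of all jumps above \<open>\<epsilon>\<close>, not only of those below 1, is subtracted here, so that
  convolving with the jumps above 1 yields a centred law.\<close>

definition small_jumps :: "real \<Rightarrow> real \<Rightarrow> real \<Rightarrow> real measure" where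
  "small_jumps C Y \<epsilon> = distr (levy_cp C Y {\<epsilon>..<1}) borel (\<lambda>x. x - (LBINT x:{\<epsilon>..}. x * (C * x powr (- Y - 1))))"

context
  fixes C Y \<epsilon> :: real
  assumes C: "C > 0" and Y: "1 < Y" "Y < 2" and \<epsilon>: "0 < \<epsilon>" "\<epsilon> < 1"
begin

lemma small_mass: "levy_mass C Y {\<epsilon>..<1} > 0"
proof -
  have i: "set_integrable lborel {\<epsilon>..<1} (\<lambda>x. C * x powr (- Y - 1))"
    using set_integrable_powr_tail[of "Y + 1" \<epsilon> "{\<epsilon>..<1}" C] Y \<epsilon> by (simp add: subset_iff)
  have "0 < C * (1 - \<epsilon>)" using C \<epsilon> by simp
  also have "\<dots> = (LBINT x:{\<epsilon>..<1}. C)" using \<epsilon> by (simp add: set_lebesgue_integral_def)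
  also have "\<dots> \<le> (LBINT x:{\<epsilon>..<1}. C * x powr (- Y - 1))"
  proof (intro set_integral_mono i)
    show "set_integrable lborel {\<epsilon>..<1} (\<lambda>x. C)"
      by (rule set_integrable_subset[OF borel_integrable_atLeastAtMost'[of \<epsilon> 1]]) auto
    fix x assume "x \<in> {\<epsilon>..<1}"
    then have "x powr (- Y - 1) \<ge> x powr 0" using \<epsilon> Y by (intro powr_mono') auto
    then show "C \<le> C * x powr (- Y - 1)" using C \<open>x \<in> _\<close> \<epsilon> by simp
  qed
  finally show ?thesis by (simp add: levy_mass_def)
qed

lemma truncation_conditions: "C > 0" "Y > 0" "\<epsilon> > 0" "{\<epsilon>..<1} \<in> sets borel" "{\<epsilon>..<1} \<subseteq> {\<epsilon>..}" "levy_mass C Y {\<epsilon>..<1} > 0"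
  using C Y \<epsilon> small_mass by auto

lemma first_moment_integrable: "set_integrable lborel {\<epsilon>..} (\<lambda>x. x * (C * x powr (- Y - 1)))"
proof -
  have "set_integrable lborel {\<epsilon>..} (\<lambda>x. C * x powr (- Y))"
    using set_integrable_powr_tail[of Y \<epsilon> "{\<epsilon>..}" C] Y \<epsilon> by auto
  then show ?thesis using \<epsilon> by (subst set_integrable_cong[OF refl refl]) (auto simp: powr_diff)
qed

lemma real_distribution_small_jumps: "real_distribution (small_jumps C Y \<epsilon>)"
proof -
  interpret real_distribution "levy_cp C Y {\<epsilon>..<1}" by (rule real_distribution_levy_cp[OF truncation_conditions])
  show ?thesis unfolding small_jumps_def by (intro real_distribution_distr) measurable
qed

lemma exp_small_jumps:
  fixes z :: complex
  shows "integrable (small_jumps C Y \<epsilon>) (\<lambda>x. exp (z * of_real x))"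
    and "(\<integral>x. exp (z * of_real x) \<partial>small_jumps C Y \<epsilon>) =
      exp ((CLBINT x:{\<epsilon>..<1}. (exp (z * of_real x) - 1) * of_real (C * x powr (- Y - 1))) - z * of_real (LBINT x:{\<epsilon>..}. x * (C * x powr (- Y - 1))))"
proof -
  let ?m = "LBINT x:{\<epsilon>..}. x * (C * x powr (- Y - 1))"
  have B: "norm (exp (z * of_real x)) \<le> exp \<bar>Re z\<bar>" if "x \<in> {\<epsilon>..<1}" for x
  proof -
    have "Re z * x \<le> \<bar>Re z\<bar> * x" using that \<epsilon> by (intro mult_right_mono) auto
    also have "\<dots> \<le> \<bar>Re z\<bar> * 1" using that by (intro mult_left_mono) auto
    finally show ?thesis by simp
  qed
  interpret real_distribution "levy_cp C Y {\<epsilon>..<1}" by (rule real_distribution_levy_cp[OF truncation_conditions])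
  note E = exp_levy_cp[OF truncation_conditions B]
  have e: "exp (z * of_real (x - ?m)) = exp (- z * of_real ?m) * exp (z * of_real x)" for x
    by (simp add: algebra_simps flip: exp_add)
  show "integrable (small_jumps C Y \<epsilon>) (\<lambda>x. exp (z * of_real x))"
    unfolding small_jumps_def using E(1) by (subst integrable_distr_eq) (auto simp only: e intro!: integrable_mult_right, auto)
  have "(\<integral>x. exp (z * of_real x) \<partial>small_jumps C Y \<epsilon>) = (\<integral>x. exp (- z * of_real ?m) * exp (z * of_real x) \<partial>levy_cp C Y {\<epsilon>..<1})"
    unfolding small_jumps_def e[symmetric] by (subst integral_distr) auto
  also have "\<dots> = exp (- z * of_real ?m) * exp (CLBINT x:{\<epsilon>..<1}. (exp (z * of_real x) - 1) * of_real (C * x powr (- Y - 1)))"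
    using E(2) by simp
  finally show "(\<integral>x. exp (z * of_real x) \<partial>small_jumps C Y \<epsilon>) =
      exp ((CLBINT x:{\<epsilon>..<1}. (exp (z * of_real x) - 1) * of_real (C * x powr (- Y - 1))) - z * of_real ?m)"
    by (simp add: exp_diff exp_minus field_simps)
qed

text \<open>Uniformity in \<epsilon>: on [\<epsilon>, 1) the compensator turns exp(s x) - 1 into
  exp(s x) - 1 - s x <= x^2, which is absorbed by \<open>stable_dom\<close>. The rest of the
  compensator, over [1, infinity), is a finite constant.\<close>

lemma exp_small_jumps_real:
  fixes s :: real assumes s: "s \<in> {1, -1}"
  shows "integrable (small_jumps C Y \<epsilon>) (\<lambda>x. exp (s * x))"
    and "(\<integral>x. exp (s * x) \<partial>small_jumps C Y \<epsilon>) \<le> exp (C * (LBINT x. stable_dom Y x) + (LBINT x:{1..}. x * (C * x powr (- Y - 1))))"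
proof -
  let ?k = "\<lambda>x. C * x powr (- Y - 1)"
  have c: "(\<lambda>x. exp (complex_of_real s * complex_of_real x)) = (\<lambda>x. complex_of_real (exp (s * x)))" by (simp add: exp_of_real[symmetric])
  show I: "integrable (small_jumps C Y \<epsilon>) (\<lambda>x. exp (s * x))"
    using integrable_Re[OF exp_small_jumps(1)[of "of_real s"]] by (simp only: fun_cong[OF c] Re_complex_of_real)
  let ?A = "{\<epsilon>..<1}"
  have kA: "set_integrable lborel ?A ?k" by (rule kernel_integrable[OF truncation_conditions])
  have eA: "set_integrable lborel ?A (\<lambda>x. (exp (s * x) - 1) * ?k x)"
  proof (rule set_integrable_bound[where f="\<lambda>x. 4 * ?k x"])
    show "set_borel_measurable lborel ?A (\<lambda>x. (exp (s * x) - 1) * ?k x)" unfolding set_borel_measurable_def by measurable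
    show "AE x in lborel. x \<in> ?A \<longrightarrow> norm ((exp (s * x) - 1) * ?k x) \<le> norm (4 * ?k x)"
    proof (intro always_eventually allI impI)
      fix x assume x: "x \<in> ?A"
      have "exp (s * x) \<le> exp 1" using s x \<epsilon> by auto
      then have "\<bar>exp (s * x) - 1\<bar> \<le> 4" using exp_le exp_gt_zero[of "s * x"] by linarith
      then have "\<bar>exp (s * x) - 1\<bar> * ?k x \<le> 4 * ?k x" using C by (intro mult_right_mono) auto
      then show "norm ((exp (s * x) - 1) * ?k x) \<le> norm (4 * ?k x)" using C by (simp add: abs_mult)
    qed
  qed (intro set_integrable_mult_right kA)
  have xA: "set_integrable lborel ?A (\<lambda>x. x * ?k x)"
    by (rule set_integrable_subset[OF first_moment_integrable]) auto
  have x1: "set_integrable lborel {1..} (\<lambda>x. x * ?k x)"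
    by (rule set_integrable_subset[OF first_moment_integrable]) (use \<epsilon> in auto)
  have split: "(LBINT x:{\<epsilon>..}. x * ?k x) = (LBINT x:?A. x * ?k x) + (LBINT x:{1..}. x * ?k x)"
  proof -
    have "{\<epsilon>..} = ?A \<union> {1..}" using \<epsilon> by auto
    moreover have "?A \<inter> {1..} = {}" by auto
    ultimately show ?thesis using set_integral_Un[OF _ xA x1] by (simp only:)
  qed
  have "complex_of_real (\<integral>x. exp (s * x) \<partial>small_jumps C Y \<epsilon>) = (\<integral>x. exp (of_real s * of_real x) \<partial>small_jumps C Y \<epsilon>)"
    unfolding c by simp
  also have "\<dots> = exp ((CLBINT x:?A. of_real ((exp (s * x) - 1) * ?k x)) - of_real (s * (LBINT x:{\<epsilon>..}. x * ?k x)))"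
    unfolding exp_small_jumps(2) by (simp add: exp_of_real[symmetric])
  also have "(CLBINT x:?A. complex_of_real ((exp (s * x) - 1) * ?k x)) = of_real (LBINT x:?A. (exp (s * x) - 1) * ?k x)"
    by (rule set_integral_complex_of_real)
  finally have "complex_of_real (\<integral>x. exp (s * x) \<partial>small_jumps C Y \<epsilon>) = complex_of_real (exp ((LBINT x:?A. (exp (s * x) - 1) * ?k x) - s * (LBINT x:{\<epsilon>..}. x * ?k x)))"
    by (simp only: of_real_diff[symmetric] exp_of_real)
  then have "(\<integral>x. exp (s * x) \<partial>small_jumps C Y \<epsilon>) = exp ((LBINT x:?A. (exp (s * x) - 1) * ?k x) - s * (LBINT x:{\<epsilon>..}. x * ?k x))"
    by (simp only: of_real_eq_iff)
  also have "\<dots> = exp (((LBINT x:?A. (exp (s * x) - 1) * ?k x) - (LBINT x:?A. s * (x * ?k x))) - s * (LBINT x:{1..}. x * ?k x))"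
    unfolding split set_integral_mult_right by (simp add: algebra_simps)
  also have "(LBINT x:?A. (exp (s * x) - 1) * ?k x) - (LBINT x:?A. s * (x * ?k x)) = (LBINT x:?A. (exp (s * x) - 1) * ?k x - s * (x * ?k x))"
    using eA xA by (intro set_integral_diff(2)[symmetric]) auto
  finally have eq: "(\<integral>x. exp (s * x) \<partial>small_jumps C Y \<epsilon>) = exp ((LBINT x:?A. (exp (s * x) - 1) * ?k x - s * (x * ?k x)) - s * (LBINT x:{1..}. x * ?k x))" .
  have "(LBINT x:?A. (exp (s * x) - 1) * ?k x - s * (x * ?k x)) \<le> C * (LBINT x. stable_dom Y x)"
  proof -
    have "(LBINT x:?A. (exp (s * x) - 1) * ?k x - s * (x * ?k x)) \<le> (LBINT x. C * stable_dom Y x)"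
      unfolding set_lebesgue_integral_def
    proof (rule integral_mono)
      show "integrable lborel (\<lambda>x. indicator ?A x *\<^sub>R ((exp (s * x) - 1) * ?k x - s * (x * ?k x)))"
        using set_integral_diff(1)[OF eA set_integrable_mult_right[OF xA, of s]] by (simp add: set_integrable_def)
      show "integrable lborel (\<lambda>x. C * stable_dom Y x)" using integrable_stable_dom[OF Y] by simp
      fix x :: real
      show "indicator ?A x *\<^sub>R ((exp (s * x) - 1) * ?k x - s * (x * ?k x)) \<le> C * stable_dom Y x"
      proof (cases "x \<in> ?A")
        case True
        then have x: "0 < x" "x < 1" using \<epsilon> by auto
        have "exp (s * x) - 1 - s * x \<le> x\<^sup>2"
        proof (cases "s = 1")
          case True
          then show ?thesis using exp_bound[of x] x by simp
        next
          case False
          then have "s = -1" using s by simp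
          moreover have "cmod (exp (- complex_of_real x) - 1 + of_real x) \<le> (cmod (of_real x))\<^sup>2"
            using x by (intro cmod_exp_minus_1_plus_le) auto
          moreover have "exp (- complex_of_real x) - 1 + of_real x = of_real (exp (- x) - 1 + x)"
            by (simp add: exp_of_real[symmetric])
          ultimately show ?thesis by (simp only: norm_of_real) simp
        qed
        then have "(exp (s * x) - 1 - s * x) * ?k x \<le> x\<^sup>2 * ?k x" using C by (intro mult_right_mono) auto
        also have "\<dots> = C * (x\<^sup>2 * x powr (- Y - 1))" by simp
        also have "x\<^sup>2 * x powr (- Y - 1) = x powr (1 - Y)"
          using x by (simp add: powr_numeral[symmetric] powr_add[symmetric] del: powr_numeral)
        finally show ?thesis using True x by (simp add: stable_dom_def algebra_simps)
      next
        case False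
        then show ?thesis using C by (simp add: stable_dom_nonneg)
      qed
    qed
    then show ?thesis by simp
  qed
  moreover have "- s * (LBINT x:{1..}. x * ?k x) \<le> (LBINT x:{1..}. x * ?k x)"
  proof -
    have "(LBINT x:{1..}. x * ?k x) \<ge> 0"
      unfolding set_lebesgue_integral_def using C by (intro Bochner_Integration.integral_nonneg) (auto simp: indicator_def)
    then show ?thesis using s by auto
  qed
  ultimately show "(\<integral>x. exp (s * x) \<partial>small_jumps C Y \<epsilon>) \<le> exp (C * (LBINT x. stable_dom Y x) + (LBINT x:{1..}. x * ?k x))"
    unfolding eq by simp
qed

end

text \<open>Compensated jumps in [\<epsilon>, 1) are convolved with the jumps above 1. The second
  factor carries the whole leading tail coefficient, the first has exponential moments uniformly in
  \<epsilon>; hence K and m are uniform. The Laplace exponents are integrals of the stable integrand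
  over [\<epsilon>, infinity) and converge by domination on the whole half-plane, not only on the
  imaginary axis.\<close>

lemma stable_approximation:
  assumes C: "C > 0" and Y: "1 < Y" "Y < 2"
  shows "\<exists>(V :: nat \<Rightarrow> real measure) K m. 0 \<le> K \<and> (\<forall>n. real_distribution (V n) \<and> tail_bound (V n) Y (C / Y) K \<and> abs_moment_le (V n) m) \<and>
    (\<forall>z. Re z \<ge> 0 \<longrightarrow> (\<forall>n. integrable (V n) (\<lambda>x. exp (- z * of_real x))) \<and>
       (\<lambda>n. \<integral>x. exp (- z * of_real x) \<partial>V n) \<longlonglongrightarrow> exp (stable_exponent C Y z))"
proof -
  let ?k = "\<lambda>x. C * x powr (- Y - 1)"
  let ?T = "levy_cp C Y {1..}"
  \<comment> \<open>The offset 2 keeps the level below 1 already for n = 0.\<close>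
  define \<epsilon> where "\<epsilon> n = 1 / real (n + 2)" for n
  have \<epsilon>: "0 < \<epsilon> n" "\<epsilon> n < 1" for n by (auto simp: \<epsilon>_def)
  note ctx = C Y \<epsilon>
  define S where "S n = small_jumps C Y (\<epsilon> n)" for n
  define V where "V n = (S n \<star> ?T)" for n
  have Y0: "Y > 0" using Y by simp
  have massT: "levy_mass C Y {1..} > 0" using levy_mass_tail[of C Y 1] C Y by simp
  have Tctx: "C > 0" "Y > 0" "(0 :: real) < 1" "{1 :: real..} \<in> sets borel" "{1 :: real..} \<subseteq> {1..}" "levy_mass C Y {1..} > 0"
    using C Y0 massT by auto
  have S: "real_distribution (S n)" for n unfolding S_def by (rule real_distribution_small_jumps[OF ctx])
  have T: "real_distribution ?T" by (rule real_distribution_levy_cp[OF Tctx])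
  have V: "real_distribution (V n)" for n unfolding V_def by (rule real_distribution_convolution[OF S T])
  obtain KT mT where KT: "KT \<ge> 0" "tail_bound ?T Y (C / Y) KT" "abs_moment_le ?T mT"
    using levy_cp_tail[OF C Y(1)] by blast
  define R where "R = exp (C * (LBINT x. stable_dom Y x) + (LBINT x:{1..}. x * ?k x))"
  have R0: "R \<ge> 0" by (simp add: R_def)
  have SR: "tail_bound (S n) Y 0 (R * (Y + 1) powr (Y + 1))" "abs_moment_le (S n) (2 * R)" for n
  proof -
    have "integrable (S n) (\<lambda>x. exp x)" "integrable (S n) (\<lambda>x. exp (- x))"
      "(\<integral>x. exp x \<partial>S n) \<le> R" "(\<integral>x. exp (- x) \<partial>S n) \<le> R"
      using exp_small_jumps_real[OF ctx, of 1 n] exp_small_jumps_real[OF ctx, of "-1" n] by (simp_all add: S_def R_def)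
    from exp_moments_bounds[OF S Y0 this] show "tail_bound (S n) Y 0 (R * (Y + 1) powr (Y + 1))" "abs_moment_le (S n) (2 * R)" .
  qed
  \<comment> \<open>The error produced by \<open>tail_bound_convolution\<close>; the vanishing
    summand reflects the leading coefficient 0 of the small jumps.\<close>
  define K where "K = conv_tail_const Y * (R * (Y + 1) powr (Y + 1) + KT + 0 * mT + C / Y * (2 * R))"
  have K0: "K \<ge> 0" unfolding K_def using R0 KT(1) abs_moment_leD(3)[OF KT(3) real_distribution.events_eq_borel[OF T]] C Y0 by (intro mult_nonneg_nonneg add_nonneg_nonneg conv_tail_const_nonneg) auto
  have tbV: "tail_bound (V n) Y (C / Y) K" for n
    using tail_bound_convolution[OF S T SR(1) KT(2) _ _ _ KT(1) SR(2) KT(3) Y0, of n] R0 C Y0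
    by (simp add: V_def K_def)
  have mV: "abs_moment_le (V n) (2 * R + mT)" for n
    unfolding V_def by (rule abs_moment_le_convolution[OF S T SR(2) KT(3)])
  have "(\<forall>n. integrable (V n) (\<lambda>x. exp (- z * of_real x))) \<and>
       (\<lambda>n. \<integral>x. exp (- z * of_real x) \<partial>V n) \<longlonglongrightarrow> exp (stable_exponent C Y z)" if z: "Re z \<ge> 0" for z
  proof
    have Tb: "norm (exp (- z * of_real x)) \<le> 1" if "x \<in> {1..}" for x using that z by simp
    note TE = exp_levy_cp[OF Tctx Tb]
    have ints: "set_integrable lborel A (stable_integrand C Y z)" if "A \<in> sets borel" "A \<subseteq> {0<..}" for A
      using that C Y z by (intro set_integrable_stable_integrand) auto
    show "\<forall>n. integrable (V n) (\<lambda>x. exp (- z * of_real x))"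
    proof
      fix n
      have "integrable (S n) (\<lambda>x. exp (- z * of_real x))" unfolding S_def by (rule exp_small_jumps(1)[OF ctx])
      then show "integrable (V n) (\<lambda>x. exp (- z * of_real x))"
        unfolding V_def by (rule exp_convolution(1)[OF S T _ TE(1)])
    qed
    \<comment> \<open>The exponents of the two factors add up to an integral over [\<epsilon>,
      infinity), and the compensator stored in the first factor restores the linear term of the
      stable integrand on that whole half-line.\<close>
    have eV: "(\<integral>x. exp (- z * of_real x) \<partial>V n) = exp (CLBINT x:{\<epsilon> n..}. stable_integrand C Y z x)" for n
    proof -
      let ?A = "{\<epsilon> n..<1}"
      let ?m = "LBINT x:{\<epsilon> n..}. x * ?k x"
      let ?e = "\<lambda>x. (exp (- z * of_real x) - 1) * complex_of_real (?k x)"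
      have un: "{\<epsilon> n..} = ?A \<union> {1..}" "?A \<inter> {1..} = {}" using \<epsilon>[of n] by auto
      have m: "set_integrable lborel {\<epsilon> n..} (\<lambda>x. x * ?k x)" by (rule first_moment_integrable[OF ctx])
      have mc: "set_integrable lborel {\<epsilon> n..} (\<lambda>x. z * complex_of_real (x * ?k x))"
        using integrable_of_real[where 'a=complex, OF m[unfolded set_integrable_def]]
        by (intro set_integrable_mult_right) (simp add: set_integrable_def scaleR_conv_of_real)
      have se: "set_integrable lborel {\<epsilon> n..} (stable_integrand C Y z)" using \<epsilon>[of n] by (intro ints) auto
      have eq: "?e x = stable_integrand C Y z x - z * complex_of_real (x * ?k x)" for x
        by (simp add: stable_integrand_def algebra_simps)
      have ee: "set_integrable lborel {\<epsilon> n..} ?e"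
        unfolding eq by (rule set_integral_diff(1)[OF se mc])
      have "set_integrable lborel ?A ?e" "set_integrable lborel {1..} ?e"
        by (rule set_integrable_subset[OF ee]; use \<epsilon>[of n] in \<open>simp add: subset_iff\<close>)+
      then have U: "(CLBINT x:{\<epsilon> n..}. ?e x) = (CLBINT x:?A. ?e x) + (CLBINT x:{1..}. ?e x)"
        using set_integral_Un[OF un(2), of lborel ?e] unfolding un(1)[symmetric] by blast
      have "(\<integral>x. exp (- z * of_real x) \<partial>V n) = (\<integral>x. exp (- z * of_real x) \<partial>S n) * (\<integral>x. exp (- z * of_real x) \<partial>?T)"
        unfolding V_def using exp_small_jumps(1)[OF ctx, where z="- z"] TE(1)
        by (intro exp_convolution(2)[OF S T]) (simp_all add: S_def)
      also have "\<dots> = exp ((CLBINT x:?A. ?e x) + z * of_real ?m + (CLBINT x:{1..}. ?e x))"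
        unfolding S_def exp_small_jumps(2)[OF ctx] using TE(2) by (simp add: exp_add)
      also have "(CLBINT x:?A. ?e x) + z * of_real ?m + (CLBINT x:{1..}. ?e x) = (CLBINT x:{\<epsilon> n..}. ?e x) + z * of_real ?m"
        unfolding U by (simp only: add_ac)
      also have "z * of_real ?m = (CLBINT x:{\<epsilon> n..}. z * complex_of_real (x * ?k x))"
        unfolding set_integral_mult_right by (simp only: set_integral_complex_of_real)
      also have "(CLBINT x:{\<epsilon> n..}. ?e x) + (CLBINT x:{\<epsilon> n..}. z * complex_of_real (x * ?k x)) = (CLBINT x:{\<epsilon> n..}. ?e x + z * complex_of_real (x * ?k x))"
        by (rule set_integral_add(2)[symmetric, OF ee mc])
      finally show ?thesis unfolding eq by simp
    qed
    have "(\<lambda>n. CLBINT x:{\<epsilon> n..}. stable_integrand C Y z x) \<longlonglongrightarrow> stable_exponent C Y z"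
      unfolding stable_exponent_def set_lebesgue_integral_def
    proof (rule integral_dominated_convergence)
      show "integrable lborel (\<lambda>x. norm (indicator {0<..} x *\<^sub>R stable_integrand C Y z x))"
        using ints[of "{0<..}"] by (intro integrable_norm) (simp add: set_integrable_def)
      show "AE x in lborel. norm (indicator {\<epsilon> n..} x *\<^sub>R stable_integrand C Y z x) \<le> norm (indicator {0<..} x *\<^sub>R stable_integrand C Y z x)" for n
        using \<epsilon>[of n] by (intro always_eventually allI) (auto simp: indicator_def)
      show "AE x in lborel. (\<lambda>n. indicator {\<epsilon> n..} x *\<^sub>R stable_integrand C Y z x) \<longlonglongrightarrow> indicator {0<..} x *\<^sub>R stable_integrand C Y z x"
      proof (rule always_eventually, rule allI, rule tendsto_eventually)
        fix x :: real
        show "\<forall>\<^sub>F n in sequentially. indicator {\<epsilon> n..} x *\<^sub>R stable_integrand C Y z x = indicator {0<..} x *\<^sub>R stable_integrand C Y z x"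
        proof (cases "x > 0")
          case True
          have "\<epsilon> \<longlonglongrightarrow> 0" unfolding \<epsilon>_def by real_asymp
          then have "\<forall>\<^sub>F n in sequentially. \<epsilon> n < x" using True by (rule order_tendstoD)
          then show ?thesis by eventually_elim (use True in \<open>auto simp: indicator_def\<close>)
        next
          case False
          then have "x < \<epsilon> n" for n using \<epsilon>(1)[of n] by linarith
          then show ?thesis using False by (intro always_eventually allI) (auto simp: indicator_def not_le)
        qed
      qed
    qed auto
    then show "(\<lambda>n. \<integral>x. exp (- z * of_real x) \<partial>V n) \<longlonglongrightarrow> exp (stable_exponent C Y z)"
      unfolding eV by (intro tendsto_intros)
  qed
  then show ?thesis using V tbV mV K0 by (intro exI[of _ V] exI[of _ K] exI[of _ "2 * R + mT"]) blast
qed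

text \<open>Fatou's lemma for weak convergence: truncated at N, the function is bounded and
  continuous, and monotone convergence in N then removes the truncation.\<close>

lemma weak_conv_nn_integral_le:
  fixes f :: "real \<Rightarrow> real"
  assumes V: "\<And>n. real_distribution (V n)" and M: "real_distribution M" and w: "weak_conv_m V M"
    and f: "\<And>x. isCont f x" "\<And>x. 0 \<le> f x" and B: "B \<ge> 0" "\<And>n. (\<integral>\<^sup>+x. ennreal (f x) \<partial>V n) \<le> ennreal B"
  shows "(\<integral>\<^sup>+x. ennreal (f x) \<partial>M) \<le> ennreal B"
proof -
  interpret M: real_distribution M by fact
  have [measurable]: "f \<in> borel_measurable borel"
    using f by (intro borel_measurable_continuous_onI continuous_at_imp_continuous_on) auto
  have trunc: "(\<integral>\<^sup>+x. ennreal (min (f x) (real N)) \<partial>M) \<le> ennreal B" for N :: nat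
  proof -
    have c: "isCont (\<lambda>x. min (f x) (real N)) x" for x using f by (intro continuous_intros)
    have b: "norm (min (f x) (real N)) \<le> real N" for x using f(2)[of x] by auto
    have i: "integrable (V n) (\<lambda>x. min (f x) (real N))" for n
    proof -
      interpret real_distribution "V n" by (rule V)
      show ?thesis using b by (intro integrable_const_bound[where B="real N"]) auto
    qed
    have "(\<lambda>n. \<integral>x. min (f x) (real N) \<partial>V n) \<longlonglongrightarrow> (\<integral>x. min (f x) (real N) \<partial>M)"
      by (rule weak_conv_imp_integral_bdd_continuous_conv[OF V M w c b])
    moreover have "(\<integral>x. min (f x) (real N) \<partial>V n) \<le> B" for n
    proof -
      have "ennreal (\<integral>x. min (f x) (real N) \<partial>V n) = (\<integral>\<^sup>+x. ennreal (min (f x) (real N)) \<partial>V n)"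
        using i f by (intro nn_integral_eq_integral[symmetric]) auto
      also have "\<dots> \<le> (\<integral>\<^sup>+x. ennreal (f x) \<partial>V n)" by (intro nn_integral_mono ennreal_leI) auto
      also have "\<dots> \<le> ennreal B" by (rule B)
      finally show ?thesis using B(1) by simp
    qed
    ultimately have "(\<integral>x. min (f x) (real N) \<partial>M) \<le> B" by (intro LIMSEQ_le_const2) auto
    moreover have "(\<integral>\<^sup>+x. ennreal (min (f x) (real N)) \<partial>M) = ennreal (\<integral>x. min (f x) (real N) \<partial>M)"
      using b f by (intro nn_integral_eq_integral M.integrable_const_bound[where B="real N"]) auto
    ultimately show ?thesis by (simp add: ennreal_leI)
  qed
  have "(\<integral>\<^sup>+x. ennreal (f x) \<partial>M) = (\<integral>\<^sup>+x. (SUP N. ennreal (min (f x) (real N))) \<partial>M)"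
  proof (intro nn_integral_cong antisym)
    fix x
    obtain N where "f x \<le> real N" using real_arch_simple by blast
    then have "ennreal (f x) = ennreal (min (f x) (real N))" by (simp add: min_absorb1)
    also have "\<dots> \<le> (SUP N. ennreal (min (f x) (real N)))" by (rule SUP_upper) simp
    finally show "ennreal (f x) \<le> (SUP N. ennreal (min (f x) (real N)))" .
    show "(SUP N. ennreal (min (f x) (real N))) \<le> ennreal (f x)" by (intro SUP_least ennreal_leI) auto
  qed
  also have "\<dots> = (SUP N. \<integral>\<^sup>+x. ennreal (min (f x) (real N)) \<partial>M)"
    by (intro nn_integral_monotone_convergence_SUP) (auto simp: incseq_def le_fun_def intro!: ennreal_leI)
  also have "\<dots> \<le> ennreal B" by (intro SUP_least trunc)
  finally show ?thesis .
qed

section \<open>One-sided stable laws\<close>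

lemma has_bochner_integral_exp_minus_abs_powr:
  fixes c Y :: real assumes "c > 0" "Y > 0"
  shows "has_bochner_integral lborel (\<lambda>u. exp (- (c * \<bar>u\<bar> powr Y))) (2 * Gamma (1 + 1 / Y) * c powr (- 1 / Y))"
proof -
  let ?I = "Gamma (1 + 1 / Y) * c powr (- 1 / Y)"
  let ?f = "\<lambda>u. indicator {0<..} u * exp (- (c * u powr Y))"
  have I: "?I \<ge> 0" using assms by (intro mult_nonneg_nonneg Gamma_real_nonneg) (auto simp: add_pos_pos)
  have "(\<integral>\<^sup>+u. ennreal (?f u) \<partial>lborel) = ennreal ?I"
    unfolding nn_integral_exp_minus_powr[OF assms, symmetric] by (intro nn_integral_cong) (auto simp: indicator_def)
  then have f: "has_bochner_integral lborel ?f ?I"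
    using I by (intro has_bochner_integral_nn_integral) auto
  have f': "has_bochner_integral lborel (\<lambda>u. ?f (- u)) ?I"
    using lborel_has_bochner_integral_real_affine_iff[of "-1" ?f ?I 0] f by simp
  have "has_bochner_integral lborel (\<lambda>u. ?f u + ?f (- u)) (?I + ?I)"
    by (rule has_bochner_integral_add[OF f f'])
  then have "has_bochner_integral lborel (\<lambda>u. exp (- (c * \<bar>u\<bar> powr Y))) (?I + ?I)"
    by (rule has_bochner_integralI_AE) (auto intro!: eventually_mono[OF AE_lborel_singleton[of 0]] simp: indicator_def)
  then show ?thesis by (simp add: mult.assoc)
qed

lemma stable_exponent_cnj: "stable_exponent C Y (cnj z) = cnj (stable_exponent C Y z)"
proof -
  have "cnj (stable_exponent C Y z) = (CLBINT x. cnj (indicator {0<..} x *\<^sub>R stable_integrand C Y z x))"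
    unfolding stable_exponent_def set_lebesgue_integral_def
    by (rule integral_bounded_linear'[OF bounded_linear_cnj bounded_linear_cnj, symmetric]) simp
  also have "\<dots> = stable_exponent C Y (cnj z)"
    unfolding stable_exponent_def set_lebesgue_integral_def stable_integrand_def
    by (rule Bochner_Integration.integral_cong) (auto simp: exp_cnj indicator_def)
  finally show ?thesis by (rule sym)
qed

lemma neg_Gamma_cos_pos:
  assumes "1 < Y" "Y < 2" shows "0 < - Gamma (- Y) * cos (pi * Y / 2)"
proof -
  have "sin (pi * Y / 2) > 0" "Gamma (Y + 1) > 0" using assms by (auto intro!: sin_gt_zero Gamma_real_pos)
  then show ?thesis using Gamma_neg_cos[OF assms] by simp
qed

locale stable_law = real_distribution M for M :: "real measure" +
  fixes C Y :: real
  assumes C: "C > 0" and Y: "1 < Y" "Y < 2"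
    and char_eq: "\<And>u. char M u = exp (stable_exponent C Y (- (\<i> * of_real u)))"
begin

lemma C_nonneg: "C \<ge> 0" using C by simp

text \<open>The modulus depends on the real part of the exponent, and that is half of the
  symmetrized exponent, because conjugation exchanges i u and -i u.\<close>

lemma norm_char: "norm (char M u) = exp (- (- C * Gamma (- Y) * cos (pi * Y / 2) * \<bar>u\<bar> powr Y))"
proof -
  let ?w = "stable_exponent C Y (- (\<i> * of_real u))"
  have "cnj ?w = stable_exponent C Y (\<i> * of_real u)" unfolding stable_exponent_cnj[symmetric] by simp
  then have "cnj ?w + ?w = of_real (2 * C * Gamma (- Y) * cos (pi * Y / 2) * \<bar>u\<bar> powr Y)"
    using stable_exponent_symmetrize[OF C_nonneg Y] by simp
  then have "Re (cnj ?w + ?w) = 2 * C * Gamma (- Y) * cos (pi * Y / 2) * \<bar>u\<bar> powr Y"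
    by (simp only: Re_complex_of_real)
  then show ?thesis by (simp add: char_eq)
qed

lemma integrable_char: "integrable lborel (char M)"
proof -
  have c: "- C * Gamma (- Y) * cos (pi * Y / 2) > 0"
    using mult_pos_pos[OF C neg_Gamma_cos_pos[OF Y]] by simp
  have "integrable lborel (\<lambda>u. norm (char M u))"
    unfolding norm_char using has_bochner_integral_exp_minus_abs_powr[OF c, of Y] Y
    by (auto simp: has_bochner_integral_iff)
  then show ?thesis by (subst (asm) integrable_norm_iff) simp
qed

lemma approximation:
  obtains V :: "nat \<Rightarrow> real measure" and K m :: real
  where "0 \<le> K" "\<And>n. real_distribution (V n)" "weak_conv_m V M"
    "\<And>n. tail_bound (V n) Y (C / Y) K" "\<And>n. abs_moment_le (V n) m"
    "\<And>z n. Re z \<ge> 0 \<Longrightarrow> integrable (V n) (\<lambda>x. exp (- z * of_real x))"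
    "\<And>z. Re z \<ge> 0 \<Longrightarrow> (\<lambda>n. \<integral>x. exp (- z * of_real x) \<partial>V n) \<longlonglongrightarrow> exp (stable_exponent C Y z)"
proof -
  obtain V :: "nat \<Rightarrow> real measure" and K m where V: "0 \<le> K" "\<And>n. real_distribution (V n)"
    "\<And>n. tail_bound (V n) Y (C / Y) K" "\<And>n. abs_moment_le (V n) m"
    "\<And>z n. Re z \<ge> 0 \<Longrightarrow> integrable (V n) (\<lambda>x. exp (- z * of_real x))"
    "\<And>z. Re z \<ge> 0 \<Longrightarrow> (\<lambda>n. \<integral>x. exp (- z * of_real x) \<partial>V n) \<longlonglongrightarrow> exp (stable_exponent C Y z)"
    using stable_approximation[OF C Y] by metis
  have "weak_conv_m V M"
  proof (rule levy_continuity[OF V(2) real_distribution_axioms])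
    fix t
    show "(\<lambda>n. char (V n) t) \<longlonglongrightarrow> char M t"
      unfolding char_eq using V(6)[of "- (\<i> * of_real t)"] by (simp add: char_def mult_ac)
  qed
  with V show ?thesis by (intro that) auto
qed

text \<open>The only boundary point a has mass zero since the characteristic function is integrable,
  so half-lines are continuity sets of the limit.\<close>

lemma measure_atLeast_tendsto:
  assumes "\<And>n. real_distribution (V n)" "weak_conv_m V M"
  shows "(\<lambda>n. measure (V n) {a..}) \<longlonglongrightarrow> measure M {a..}"
proof (rule weak_conv_imp_continuity_set_conv[OF assms(1) real_distribution_axioms assms(2)])
  have "{a<..} \<subseteq> interior {a..}" by (intro interior_maximal) auto
  then have "frontier {a..} \<subseteq> {a}" by (auto simp: frontier_def)
  then have "emeasure M (frontier {a..}) \<le> emeasure M {a}" by (intro emeasure_mono) auto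
  also have "\<dots> = 0" using measure_singleton_eq_0[OF integrable_char, of a] by (simp add: emeasure_eq_measure)
  finally show "emeasure M (frontier {a..}) = 0" by simp
qed simp

lemma tail: "\<exists>K\<ge>0. tail_bound M Y (C / Y) K"
proof -
  obtain V :: "nat \<Rightarrow> real measure" and K m where V: "0 \<le> K" "\<And>n. real_distribution (V n)" "weak_conv_m V M"
    "\<And>n. tail_bound (V n) Y (C / Y) K"
    using approximation by metis
  have "tail_bound M Y (C / Y) K"
    unfolding tail_bound_def
  proof (intro allI impI)
    fix a :: real assume a: "a > 0"
    have "(\<lambda>n. \<bar>measure (V n) {a..} - C / Y * a powr (- Y)\<bar>) \<longlonglongrightarrow> \<bar>measure M {a..} - C / Y * a powr (- Y)\<bar>"
      by (intro tendsto_intros measure_atLeast_tendsto V)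
    then show "\<bar>measure M {a..} - C / Y * a powr (- Y)\<bar> \<le> K * a powr (- Y - 1)"
      by (rule LIMSEQ_le_const2) (use tail_boundD[OF V(4) a] in auto)
  qed
  then show ?thesis using V(1) by blast
qed

lemma abs_moment: "\<exists>m. abs_moment_le M m"
proof -
  obtain V :: "nat \<Rightarrow> real measure" and K m where V: "\<And>n. real_distribution (V n)" "weak_conv_m V M" "\<And>n. abs_moment_le (V n) m"
    using approximation by metis
  have m: "m \<ge> 0" using V(3) by (simp add: abs_moment_le_def)
  have "(\<integral>\<^sup>+x. ennreal \<bar>x\<bar> \<partial>M) \<le> ennreal m"
    by (rule weak_conv_nn_integral_le[OF V(1) real_distribution_axioms V(2)])
      (use V(3) m in \<open>auto simp: abs_moment_le_def intro!: continuous_intros\<close>)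
  then show ?thesis using m by (auto simp: abs_moment_le_def)
qed

lemma integrable_id: "integrable M (\<lambda>x. x)"
  using abs_moment abs_moment_leD(1) M_is_borel by blast

text \<open>A convergent sequence of Laplace transforms is bounded, and the Fatou argument hands the
  bound on to the limit law. The common B is what makes the truncation in the next identity
  uniform.\<close>

lemma exp_real_bound:
  assumes V: "\<And>n. real_distribution (V n)" "weak_conv_m V M"
    "\<And>z n. Re z \<ge> 0 \<Longrightarrow> integrable (V n) (\<lambda>x. exp (- z * of_real x))"
    "\<And>z. Re z \<ge> 0 \<Longrightarrow> (\<lambda>n. \<integral>x. exp (- z * of_real x) \<partial>V n) \<longlonglongrightarrow> exp (stable_exponent C Y z)"
    and s: "s \<ge> 0"
  shows "\<exists>B\<ge>0. (\<forall>n. integrable (V n) (\<lambda>x. exp (- s * x)) \<and> (\<integral>x. exp (- s * x) \<partial>V n) \<le> B) \<and>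
    integrable M (\<lambda>x. exp (- s * x)) \<and> (\<integral>x. exp (- s * x) \<partial>M) \<le> B"
proof -
  have c: "(\<lambda>x. exp (- complex_of_real s * complex_of_real x)) = (\<lambda>x. complex_of_real (exp (- s * x)))"
    by (simp add: exp_of_real[symmetric])
  have i: "integrable (V n) (\<lambda>x. exp (- s * x))" for n
    using integrable_Re[OF V(3)[of "of_real s" n]] s by (simp only: fun_cong[OF c] Re_complex_of_real Re_complex_of_real)
  have "(\<lambda>n. Re (\<integral>x. exp (- of_real s * of_real x) \<partial>V n)) \<longlonglongrightarrow> Re (exp (stable_exponent C Y (of_real s)))"
    using s by (intro tendsto_Re V(4)) simp
  then have "convergent (\<lambda>n. \<integral>x. exp (- s * x) \<partial>V n)"
    unfolding c by (auto simp: convergent_def)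
  then obtain B where B: "\<And>n. norm (\<integral>x. exp (- s * x) \<partial>V n) \<le> B"
    using convergent_imp_Bseq by (meson BseqD Bseq_def)
  have B0: "B \<ge> 0" using B[of 0] by (rule order.trans[rotated]) simp
  have le: "(\<integral>x. exp (- s * x) \<partial>V n) \<le> B" for n using B[of n] by simp
  have nnM: "(\<integral>\<^sup>+x. ennreal (exp (- s * x)) \<partial>M) \<le> ennreal B"
  proof (rule weak_conv_nn_integral_le[OF V(1) real_distribution_axioms V(2) _ _ B0])
    fix n
    have "(\<integral>\<^sup>+x. ennreal (exp (- s * x)) \<partial>V n) = ennreal (\<integral>x. exp (- s * x) \<partial>V n)"
      using i by (intro nn_integral_eq_integral) auto
    then show "(\<integral>\<^sup>+x. ennreal (exp (- s * x)) \<partial>V n) \<le> ennreal B" using le by (simp add: ennreal_leI)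
  qed (auto intro!: continuous_intros)
  have iM: "integrable M (\<lambda>x. exp (- s * x))"
    using nnM by (intro integrableI_bounded) (auto elim: order.strict_trans1)
  moreover have "(\<integral>x. exp (- s * x) \<partial>M) \<le> B"
  proof -
    have "ennreal (\<integral>x. exp (- s * x) \<partial>M) = (\<integral>\<^sup>+x. ennreal (exp (- s * x)) \<partial>M)"
      using iM by (intro nn_integral_eq_integral[symmetric]) auto
    also have "\<dots> \<le> ennreal B" by (rule nnM)
    finally show ?thesis using B0 by simp
  qed
  ultimately show ?thesis using i le B0 by blast
qed

lemma integrable_exp_real: "s \<ge> 0 \<Longrightarrow> integrable M (\<lambda>x. exp (- s * x))"
  using approximation exp_real_bound by metis

lemma integrable_exp: "Re z \<ge> 0 \<Longrightarrow> integrable M (\<lambda>x. exp (- z * of_real x))"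
  by (rule Bochner_Integration.integrable_bound[OF integrable_exp_real[of "Re z"]]) auto

text \<open>No analytic continuation is used: the identity is inherited from the approximating laws.
  The integrand is unbounded at minus infinity, so weak convergence is applied to a truncation at
  -N. With r = Re z, for x < -N one has exp(-r x) <= exp(-r N) exp(-2 r x), and the uniformly
  bounded exponential moments of order 2 r make the truncation error vanish uniformly in n.\<close>

lemma exp_moment:
  assumes z: "Re z \<ge> 0"
  shows "(\<integral>x. exp (- z * of_real x) \<partial>M) = exp (stable_exponent C Y z)"
proof (cases "Re z = 0")
  case True
  then have z: "- (\<i> * of_real (- Im z)) = z" by (simp add: complex_eq_iff)
  have "- z * of_real x = \<i> * of_real (- Im z * x)" for x using True by (simp add: complex_eq_iff)
  then show ?thesis using char_eq[of "- Im z"] by (simp only: char_def z)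
next
  case False
  define r where "r = Re z"
  have r: "r > 0" using False z by (simp add: r_def)
  obtain V :: "nat \<Rightarrow> real measure" and K m where V: "\<And>n. real_distribution (V n)" "weak_conv_m V M"
    "\<And>z n. Re z \<ge> 0 \<Longrightarrow> integrable (V n) (\<lambda>x. exp (- z * of_real x))"
    "\<And>z. Re z \<ge> 0 \<Longrightarrow> (\<lambda>n. \<integral>x. exp (- z * of_real x) \<partial>V n) \<longlonglongrightarrow> exp (stable_exponent C Y z)"
    using approximation by metis
  obtain B where B: "B \<ge> 0" "\<And>n. integrable (V n) (\<lambda>x. exp (- (2 * r) * x))" "\<And>n. (\<integral>x. exp (- (2 * r) * x) \<partial>V n) \<le> B"
    "integrable M (\<lambda>x. exp (- (2 * r) * x))" "(\<integral>x. exp (- (2 * r) * x) \<partial>M) \<le> B"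
    using exp_real_bound[OF V, of "2 * r"] r by auto
  define f where "f x = exp (- z * of_real x)" for x :: real
  \<comment> \<open>Truncation only on the left of -N: the function stays continuous and is bounded
    by exp(r N).\<close>
  define g where "g N x = exp (- z * of_real (max x (- N)))" for N x :: real
  have gc: "isCont (g N) x" for N x unfolding g_def by (intro continuous_intros)
  have gb: "norm (g N x) \<le> exp (r * N)" for N x
  proof -
    have "- r * max x (- N) \<le> - r * (- N)" using r by (intro mult_left_mono_neg) auto
    then show ?thesis by (simp add: g_def r_def)
  qed
  have [measurable]: "f \<in> borel_measurable borel" "g N \<in> borel_measurable borel" for N
    unfolding f_def g_def by measurable
  have diff: "norm (f x - g N x) \<le> 2 * exp (- (r * N)) * exp (- (2 * r) * x)" for N x
  proof (cases "x \<ge> - N")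
    case True
    then show ?thesis by (simp add: f_def g_def max_absorb1)
  next
    case False
    then have x: "x < - N" by simp
    have "norm (f x - g N x) \<le> norm (f x) + norm (g N x)" by (rule norm_triangle_ineq4)
    also have "\<dots> = exp (- r * x) + exp (r * N)" using x by (simp add: f_def g_def r_def max_absorb2)
    also have "exp (r * N) \<le> exp (- r * x)" using x r mult_left_mono[of N "- x" r] by simp
    also have "exp (- r * x) + exp (- r * x) = 2 * (exp (r * x) * exp (- (2 * r) * x))"
      by (simp add: mult_exp_exp)
    also have "\<dots> \<le> 2 * (exp (- (r * N)) * exp (- (2 * r) * x))"
      using x r mult_left_mono[of x "- N" r] by (intro mult_left_mono mult_right_mono) auto
    finally show ?thesis by simp
  qed
  have est: "norm ((\<integral>x. f x \<partial>Q) - (\<integral>x. g N x \<partial>Q)) \<le> 2 * exp (- (r * N)) * B"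
    if Q: "real_distribution Q" "integrable Q (\<lambda>x. exp (- (2 * r) * x))" "(\<integral>x. exp (- (2 * r) * x) \<partial>Q) \<le> B" "integrable Q f" for Q N
  proof -
    interpret Q: real_distribution Q by fact
    have gi: "integrable Q (g N)" using gb by (intro Q.integrable_const_bound[where B="exp (r * N)"]) auto
    have "norm ((\<integral>x. f x \<partial>Q) - (\<integral>x. g N x \<partial>Q)) = norm (\<integral>x. f x - g N x \<partial>Q)" using Q(4) gi by simp
    also have "\<dots> \<le> (\<integral>x. norm (f x - g N x) \<partial>Q)" by (rule integral_norm_bound)
    also have "\<dots> \<le> (\<integral>x. 2 * exp (- (r * N)) * exp (- (2 * r) * x) \<partial>Q)"
      using Q gi by (intro integral_mono diff integrable_norm Bochner_Integration.integrable_diff integrable_mult_right) auto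
    also have "\<dots> \<le> 2 * exp (- (r * N)) * B" using Q(3) by simp
    finally show ?thesis .
  qed
  have close: "norm (exp (stable_exponent C Y z) - (\<integral>x. f x \<partial>M)) \<le> 4 * exp (- (r * N)) * B" for N
  proof -
    have "(\<lambda>n. norm ((\<integral>x. f x \<partial>V n) - (\<integral>x. g N x \<partial>V n))) \<longlonglongrightarrow> norm (exp (stable_exponent C Y z) - (\<integral>x. g N x \<partial>M))"
      unfolding f_def
      by (intro tendsto_intros V(4)[OF z] weak_conv_imp_integral_bdd_continuous_conv[OF V(1) real_distribution_axioms V(2) gc gb])
    then have "norm (exp (stable_exponent C Y z) - (\<integral>x. g N x \<partial>M)) \<le> 2 * exp (- (r * N)) * B"
    proof (rule LIMSEQ_le_const2, intro exI[of _ 0] allI impI)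
      fix n
      show "norm ((\<integral>x. f x \<partial>V n) - (\<integral>x. g N x \<partial>V n)) \<le> 2 * exp (- (r * N)) * B"
        by (rule est[OF V(1) B(2,3)]) (unfold f_def, rule V(3)[OF z])
    qed
    moreover have "norm ((\<integral>x. f x \<partial>M) - (\<integral>x. g N x \<partial>M)) \<le> 2 * exp (- (r * N)) * B"
      by (rule est[OF real_distribution_axioms B(4,5)]) (unfold f_def, rule integrable_exp[OF z])
    ultimately show ?thesis
      using norm_triangle_ineq4[of "exp (stable_exponent C Y z) - (\<integral>x. g N x \<partial>M)" "(\<integral>x. f x \<partial>M) - (\<integral>x. g N x \<partial>M)"] by simp
  qed
  have "((\<lambda>N. 4 * exp (- (r * N)) * B) \<longlongrightarrow> 0) at_top" using r by real_asymp
  then have "norm (exp (stable_exponent C Y z) - (\<integral>x. f x \<partial>M)) \<le> 0"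
    by (rule tendsto_lowerbound) (use close in auto)
  then show ?thesis by (simp add: f_def)
qed

lemma exp_moment_real:
  assumes s: "s \<ge> 0" shows "(\<integral>x. exp (- s * x) \<partial>M) = exp (C * Gamma (- Y) * s powr Y)"
proof -
  have c: "(\<lambda>x. exp (- complex_of_real s * complex_of_real x)) = (\<lambda>x. complex_of_real (exp (- s * x)))"
    by (simp add: exp_of_real[symmetric])
  have "complex_of_real (\<integral>x. exp (- s * x) \<partial>M) = exp (stable_exponent C Y (of_real s))"
    using exp_moment[of "of_real s"] s unfolding c by simp
  also have "\<dots> = complex_of_real (exp (C * Gamma (- Y) * s powr Y))"
    unfolding stable_exponent_of_real[OF C_nonneg Y s] exp_of_real ..
  finally show ?thesis by (simp only: of_real_eq_iff)
qed

text \<open>The mean is the negative derivative at 0 of the Laplace transform. The difference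
  quotients n (1 - exp(-x / n)) tend to x, while their expectations n (1 - exp(c n powr (-Y))) tend
  to 0 because Y > 1.\<close>

lemma mean_zero: "(\<integral>x. x \<partial>M) = 0"
proof -
  let ?d = "\<lambda>n x. real (Suc n) * (1 - exp (- (1 / real (Suc n)) * x))"
  have "(\<lambda>n. \<integral>x. ?d n x \<partial>M) \<longlonglongrightarrow> (\<integral>x. x \<partial>M)"
  proof (rule integral_dominated_convergence)
    show "integrable M (\<lambda>x. \<bar>x\<bar> + exp (- 2 * x))" using integrable_id integrable_exp_real[of 2] by auto
    show "AE x in M. (\<lambda>n. ?d n x) \<longlonglongrightarrow> x"
    proof (intro always_eventually allI)
      fix x :: real
      show "(\<lambda>n. ?d n x) \<longlonglongrightarrow> x" by real_asymp
    qed
    show "AE x in M. norm (?d n x) \<le> \<bar>x\<bar> + exp (- 2 * x)" for n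
    proof (intro always_eventually allI)
      fix x :: real
      let ?N = "real (Suc n)"
      have N: "?N \<ge> 1" by simp
      show "norm (?d n x) \<le> \<bar>x\<bar> + exp (- 2 * x)"
      proof (cases "x \<ge> 0")
        case True
        have "1 - exp (- (1 / ?N) * x) \<le> x / ?N" using exp_ge_add_one_self[of "- (1 / ?N) * x"] by simp
        then have "?N * (1 - exp (- (1 / ?N) * x)) \<le> ?N * (x / ?N)" by (intro mult_left_mono) auto
        then have "?d n x \<le> x" using N by simp
        moreover have "?d n x \<ge> 0" using True by (intro mult_nonneg_nonneg) auto
        moreover have "exp (- 2 * x) > 0" by simp
        ultimately show ?thesis using True by (simp only: real_norm_def abs_of_nonneg)
      next
        case False
        define y where "y = - x / ?N"
        have "x / ?N < 0" using False by (intro divide_neg_pos) auto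
        then have y: "y > 0" by (simp add: y_def)
        \<comment> \<open>For negative x put y = -x / ?N. From exp y - 1 <= y exp y together with ?N
          * y = -x <= exp(-x) and y <= -x, the quotient is dominated by exp(-2 x), which is
          integrable.\<close>
        have "1 - y \<le> exp (- y)" using exp_ge_add_one_self[of "- y"] by simp
        then have "(1 - y) * exp y \<le> exp (- y) * exp y" by (intro mult_right_mono) auto
        then have "exp y - 1 \<le> y * exp y" by (simp add: mult_exp_exp algebra_simps)
        then have "?N * (exp y - 1) \<le> ?N * (y * exp y)" by (intro mult_left_mono) auto
        also have "\<dots> = - x * exp y" by (simp add: y_def)
        also have "\<dots> \<le> exp (- x) * exp (- x)"
        proof (intro mult_mono)
          show "- x \<le> exp (- x)" using exp_ge_add_one_self[of "- x"] by simp
          have "- x \<le> - x * ?N" using False N mult_left_mono[of 1 ?N "- x"] by simp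
          then have "y \<le> - x" unfolding y_def by (subst pos_divide_le_eq) auto
          then show "exp y \<le> exp (- x)" by simp
        qed auto
        also have "\<dots> = exp (- 2 * x)" by (simp add: mult_exp_exp)
        finally have "?N * (exp y - 1) \<le> exp (- 2 * x)" .
        moreover have "norm (?d n x) = ?N * (exp y - 1)"
        proof -
          have "?d n x = - (?N * (exp y - 1))" by (simp add: y_def algebra_simps)
          moreover have "?N * (exp y - 1) \<ge> 0" using y by (intro mult_nonneg_nonneg) auto
          ultimately show ?thesis by (simp only: real_norm_def abs_minus_cancel abs_of_nonneg)
        qed
        ultimately show ?thesis by simp
      qed
    qed
  qed auto
  moreover have "(\<lambda>n. \<integral>x. ?d n x \<partial>M) \<longlonglongrightarrow> 0"
  proof -
    have "(\<integral>x. ?d n x \<partial>M) = real (Suc n) * (1 - exp (C * Gamma (- Y) * (1 / real (Suc n)) powr Y))" for n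
      using integrable_exp_real[of "1 / real (Suc n)"] exp_moment_real[of "1 / real (Suc n)"] prob_space
      by (simp del: of_nat_Suc space_eq_univ)
    moreover have "(\<lambda>n. real (Suc n) * (1 - exp (c * (1 / real (Suc n)) powr Y))) \<longlonglongrightarrow> 0" for c
      using Y by real_asymp
    ultimately show ?thesis by simp
  qed
  ultimately show ?thesis by (rule LIMSEQ_unique)
qed

end

section \<open>Two independent one-sided stable variables\<close>

lemma max_0_eq: "max x 0 = (\<bar>x\<bar> + x) / 2" for x :: real
  by (simp add: max_def)

text \<open>The variables \<open>A\<close> and \<open>B\<close> play the roles of \<open>Upos 1\<close> and \<open>- Uneg 1\<close>; correspondingly \<open>Z\<close> and \<open>U\<close> below
  are \<open>Z 1\<close> and \<open>Utilde 1\<close>.\<close>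

locale stable_pair = prob_space N for N :: "'b measure" +
  fixes A B :: "'b \<Rightarrow> real" and C Y M G :: real
  assumes indep: "indep_var borel A borel B"
    and law_A: "stable_law (distr N borel A) C Y" and law_B: "stable_law (distr N borel B) C Y"
    and M: "M > 1" and G: "G > 0"
begin

sublocale LA: stable_law "distr N borel A" C Y by (rule law_A)
sublocale LB: stable_law "distr N borel B" C Y by (rule law_B)

lemma A_measurable [measurable]: "A \<in> borel_measurable N"
  and B_measurable [measurable]: "B \<in> borel_measurable N"
  using indep_var_rv1[OF indep] indep_var_rv2[OF indep] by auto

lemmas C = LA.C and Y = LA.Y and C_nonneg = LA.C_nonneg

definition Z where "Z \<omega> = A \<omega> - B \<omega>"
definition U where "U \<omega> = (M - 1) * A \<omega> + (G + 1) * B \<omega>"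
definition V where "V \<omega> = max (Z \<omega>) 0 + U \<omega>"

lemma Z_measurable [measurable]: "Z \<in> borel_measurable N"
  and U_measurable [measurable]: "U \<in> borel_measurable N"
  and V_measurable [measurable]: "V \<in> borel_measurable N"
  unfolding Z_def U_def V_def by measurable

lemma exp_pair:
  assumes "Re z \<ge> 0" "Re w \<ge> 0"
  shows "integrable N (\<lambda>\<omega>. exp (- z * of_real (A \<omega>) - w * of_real (B \<omega>)))" (is ?I)
    and "(\<integral>\<omega>. exp (- z * of_real (A \<omega>) - w * of_real (B \<omega>)) \<partial>N) = exp (stable_exponent C Y z + stable_exponent C Y w)" (is ?E)
proof -
  have e: "(\<lambda>\<omega>. exp (- z * of_real (A \<omega>) - w * of_real (B \<omega>))) = (\<lambda>\<omega>. exp (- z * of_real (A \<omega>)) * exp (- w * of_real (B \<omega>)))"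
    by (simp add: exp_diff exp_minus field_simps)
  have ind: "indep_var borel (\<lambda>\<omega>. exp (- z * of_real (A \<omega>))) borel (\<lambda>\<omega>. exp (- w * of_real (B \<omega>)))"
    using indep_var_compose[OF indep, of "\<lambda>x. exp (- z * of_real x)" borel "\<lambda>x. exp (- w * of_real x)" borel] by (simp add: comp_def)
  have iA: "integrable N (\<lambda>\<omega>. exp (- z * of_real (A \<omega>)))"
    using LA.integrable_exp[OF assms(1)] by (subst (asm) integrable_distr_eq) auto
  have iB: "integrable N (\<lambda>\<omega>. exp (- w * of_real (B \<omega>)))"
    using LB.integrable_exp[OF assms(2)] by (subst (asm) integrable_distr_eq) auto
  show ?I unfolding e by (rule indep_var_integrable[OF ind iA iB])
  have "(\<integral>\<omega>. exp (- z * of_real (A \<omega>)) \<partial>N) = exp (stable_exponent C Y z)"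
    using LA.exp_moment[OF assms(1)] by (subst (asm) integral_distr) auto
  moreover have "(\<integral>\<omega>. exp (- w * of_real (B \<omega>)) \<partial>N) = exp (stable_exponent C Y w)"
    using LB.exp_moment[OF assms(2)] by (subst (asm) integral_distr) auto
  ultimately show ?E unfolding e indep_var_lebesgue_integral[OF ind iA iB] by (simp add: exp_add)
qed

lemma exp_pair_real:
  assumes "a \<ge> 0" "b \<ge> 0"
  shows "integrable N (\<lambda>\<omega>. exp (- (a * A \<omega> + b * B \<omega>)))"
    and "(\<integral>\<omega>. exp (- (a * A \<omega> + b * B \<omega>)) \<partial>N) = exp (C * Gamma (- Y) * (a powr Y + b powr Y))"
proof -
  have c: "(\<lambda>\<omega>. exp (- of_real a * of_real (A \<omega>) - of_real b * of_real (B \<omega>))) = (\<lambda>\<omega>. complex_of_real (exp (- (a * A \<omega> + b * B \<omega>))))"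
    by (simp add: exp_of_real[symmetric])
  have "integrable N (\<lambda>\<omega>. Re (exp (- of_real a * of_real (A \<omega>) - of_real b * of_real (B \<omega>))))"
    using assms by (intro integrable_Re exp_pair) auto
  then show "integrable N (\<lambda>\<omega>. exp (- (a * A \<omega> + b * B \<omega>)))"
    by (simp only: fun_cong[OF c] Re_complex_of_real)
  have "complex_of_real (\<integral>\<omega>. exp (- (a * A \<omega> + b * B \<omega>)) \<partial>N) = exp (stable_exponent C Y (of_real a) + stable_exponent C Y (of_real b))"
    using exp_pair(2)[of "of_real a" "of_real b"] assms unfolding c by simp
  also have "\<dots> = complex_of_real (exp (C * Gamma (- Y) * (a powr Y + b powr Y)))"
    unfolding stable_exponent_of_real[OF C_nonneg Y assms(1)] stable_exponent_of_real[OF C_nonneg Y assms(2)] of_real_add[symmetric] exp_of_real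
    by (simp add: algebra_simps)
  finally show "(\<integral>\<omega>. exp (- (a * A \<omega> + b * B \<omega>)) \<partial>N) = exp (C * Gamma (- Y) * (a powr Y + b powr Y))"
    by (simp only: of_real_eq_iff)
qed

lemma integrable_A [simp]: "integrable N A"
  by (rule iffD1[OF integrable_distr_eq LA.integrable_id]) measurable

lemma integrable_B [simp]: "integrable N B"
  by (rule iffD1[OF integrable_distr_eq LB.integrable_id]) measurable

lemma mean_A [simp]: "(\<integral>\<omega>. A \<omega> \<partial>N) = 0"
  by (rule trans[OF integral_distr[symmetric] LA.mean_zero]) measurable

lemma mean_B [simp]: "(\<integral>\<omega>. B \<omega> \<partial>N) = 0"
  by (rule trans[OF integral_distr[symmetric] LB.mean_zero]) measurable

lemma integrable_Z [simp]: "integrable N Z" and integrable_U [simp]: "integrable N U" and integrable_V [simp]: "integrable N V"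
  unfolding Z_def U_def V_def by auto

lemma mean_Z [simp]: "(\<integral>\<omega>. Z \<omega> \<partial>N) = 0" and mean_U [simp]: "(\<integral>\<omega>. U \<omega> \<partial>N) = 0"
  unfolding Z_def U_def by simp_all

lemma mean_V: "(\<integral>\<omega>. V \<omega> \<partial>N) = (\<integral>\<omega>. max (Z \<omega>) 0 \<partial>N)"
  unfolding V_def by simp

section \<open>The symmetric difference of the two variables: density and moments\<close>

definition cZ where "cZ = - 2 * C * Gamma (- Y) * cos (pi * Y / 2)"

lemma cZ_pos: "cZ > 0"
  using mult_pos_pos[OF C neg_Gamma_cos_pos[OF Y]] by (simp add: cZ_def)

lemma law_Z: "real_distribution (distr N borel Z)"
  by (rule real_distribution_distr) simp

sublocale LZ: real_distribution "distr N borel Z" by (rule law_Z)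

lemma char_Z: "char (distr N borel Z) u = exp (- (cZ * \<bar>u\<bar> powr Y))"
proof -
  have "char (distr N borel Z) u = (\<integral>\<omega>. exp (- (- (\<i> * of_real u)) * of_real (A \<omega>) - (\<i> * of_real u) * of_real (B \<omega>)) \<partial>N)"
    unfolding char_def by (subst integral_distr) (auto simp: Z_def algebra_simps intro!: Bochner_Integration.integral_cong)
  also have "\<dots> = exp (stable_exponent C Y (- (\<i> * of_real u)) + stable_exponent C Y (\<i> * of_real u))"
    by (rule exp_pair(2)) auto
  also have "stable_exponent C Y (- (\<i> * of_real u)) + stable_exponent C Y (\<i> * of_real u) = of_real (- (cZ * \<bar>u\<bar> powr Y))"
    using stable_exponent_symmetrize[OF C_nonneg Y, of u] by (simp add: cZ_def add.commute)
  finally show ?thesis by (simp only: exp_of_real)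
qed

lemma integrable_char_Z: "integrable lborel (char (distr N borel Z))"
proof -
  have "integrable lborel (\<lambda>u. complex_of_real (exp (- (cZ * \<bar>u\<bar> powr Y))))"
    using has_bochner_integral_exp_minus_abs_powr[OF cZ_pos, of Y] Y
    by (intro integrable_of_real) (auto simp: has_bochner_integral_iff)
  moreover have "char (distr N borel Z) = (\<lambda>u. complex_of_real (exp (- (cZ * \<bar>u\<bar> powr Y))))"
    by (rule ext) (simp only: char_Z)
  ultimately show ?thesis by simp
qed

definition pZ where "pZ = char_density (char (distr N borel Z))"

lemma pZ_0: "pZ 0 = 1 / pi * Gamma (1 + 1 / Y) * cZ powr (- 1 / Y)"
proof -
  have "(CLBINT u. iexp (- (u * 0)) * char (distr N borel Z) u) = (CLBINT u. complex_of_real (exp (- (cZ * \<bar>u\<bar> powr Y))))"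
    by (intro Bochner_Integration.integral_cong) (auto simp only: char_Z, simp)
  also have "\<dots> = of_real (LBINT u. exp (- (cZ * \<bar>u\<bar> powr Y)))" by (rule integral_complex_of_real)
  also have "(LBINT u. exp (- (cZ * \<bar>u\<bar> powr Y))) = 2 * Gamma (1 + 1 / Y) * cZ powr (- 1 / Y)"
    using has_bochner_integral_exp_minus_abs_powr[OF cZ_pos, of Y] Y by (auto simp: has_bochner_integral_iff)
  finally show ?thesis unfolding pZ_def char_density_def by simp
qed

lemma pZ_nonneg: "pZ x \<ge> 0"
  unfolding pZ_def by (rule LZ.char_density_nonneg[OF integrable_char_Z])

lemma pZ_continuous: "continuous_on UNIV pZ"
  unfolding pZ_def by (rule continuous_char_density[OF integrable_char_Z])

lemma pZ_measurable [measurable]: "pZ \<in> borel_measurable borel"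
  by (rule borel_measurable_continuous_onI[OF pZ_continuous])

lemma distr_Z: "distr N borel Z = density lborel (\<lambda>x. ennreal (pZ x))"
  unfolding pZ_def by (rule LZ.eq_density_char_density[OF integrable_char_Z])

definition pZ_bound where "pZ_bound = (LBINT u. norm (char (distr N borel Z) u)) / (2 * pi)"

lemma pZ_le: "\<bar>pZ x\<bar> \<le> pZ_bound"
  unfolding pZ_def pZ_bound_def by (rule abs_char_density_le)

lemma pZ_bound_nonneg: "pZ_bound \<ge> 0"
  using pZ_le[of 0] by linarith

text \<open>Uniqueness behind the definite description: two densities agree almost everywhere, and
  the set where two continuous ones differ is open and null, hence empty.\<close>

lemma continuous_density_Z: "continuous_density N Z = pZ"
  unfolding continuous_density_def
proof (rule the_equality)
  have "distr N lborel Z = distr N borel Z" by (rule distr_cong) auto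
  then have "distributed N lborel Z (\<lambda>x. ennreal (pZ x))"
    unfolding distributed_def using distr_Z by simp
  then show "continuous_on UNIV pZ \<and> (\<forall>x. 0 \<le> pZ x) \<and> distributed N lborel Z (\<lambda>x. ennreal (pZ x))"
    using pZ_continuous pZ_nonneg by blast
  fix q assume q: "continuous_on UNIV q \<and> (\<forall>x. 0 \<le> q x) \<and> distributed N lborel Z (\<lambda>x. ennreal (q x))"
  have [measurable]: "q \<in> borel_measurable borel" using q by (intro borel_measurable_continuous_onI) auto
  have "distr N lborel Z = density lborel (\<lambda>x. ennreal (q x))" using q by (auto simp: distributed_def)
  then have eq: "density lborel (\<lambda>x. ennreal (q x)) = density lborel (\<lambda>x. ennreal (pZ x))"
    using distr_Z \<open>distr N lborel Z = distr N borel Z\<close> by simp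
  have "AE x in lborel. ennreal (q x) = ennreal (pZ x)"
    using eq by (subst (asm) sigma_finite_measure.density_unique_iff[OF lborel.sigma_finite_measure_axioms]) auto
  then have AE: "AE x in lborel. q x = pZ x" using q pZ_nonneg by (auto elim!: eventually_mono)
  have op: "open {x. q x \<noteq> pZ x}"
    using q pZ_continuous by (intro open_Collect_neq) auto
  have "emeasure lborel {x. q x \<noteq> pZ x} = 0"
    using AE by (subst (asm) AE_iff_measurable[OF _ refl]) (auto intro: borel_open op)
  then have "{x. q x \<noteq> pZ x} \<in> null_sets lebesgue"
    using borel_open[OF op] by (auto intro!: null_sets_completionI)
  then have "negligible {x. q x \<noteq> pZ x}" by (simp add: negligible_iff_null_sets)
  then have "{x. q x \<noteq> pZ x} = {}" using open_not_negligible[OF op] by blast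
  then show "q = pZ" by auto
qed

text \<open>The representation of |x| through the characteristic function reduces the mean to the
  integral of (1 - exp(-\<open>cZ\<close> u powr Y)) u powr (-2), which was evaluated at the
  beginning.\<close>

lemma abs_Z_mean: "(\<integral>\<omega>. \<bar>Z \<omega>\<bar> \<partial>N) = 2 / pi * Gamma (1 - 1 / Y) * cZ powr (1 / Y)"
proof -
  have G: "Gamma (1 - 1 / Y) > 0" using Y by (intro Gamma_real_pos) auto
  have "ennreal (pi / 2 * (\<integral>\<omega>. \<bar>Z \<omega>\<bar> \<partial>N)) = ennreal (\<integral>\<omega>. pi / 2 * \<bar>Z \<omega>\<bar> \<partial>N)" by simp
  also have "\<dots> = (\<integral>\<^sup>+\<omega>. ennreal (pi / 2 * \<bar>Z \<omega>\<bar>) \<partial>N)"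
    by (intro nn_integral_eq_integral[symmetric]) auto
  also have "\<dots> = (\<integral>\<^sup>+x. ennreal (pi / 2 * \<bar>x\<bar>) \<partial>distr N borel Z)"
    by (subst nn_integral_distr) auto
  also have "\<dots> = (\<integral>\<^sup>+u. ennreal ((1 - Re (char (distr N borel Z) u)) * u powr (- 2)) * indicator {0<..} u \<partial>lborel)"
    by (rule LZ.nn_integral_abs_eq_char)
  also have "\<dots> = (\<integral>\<^sup>+u. ennreal ((1 - exp (- (cZ * u powr Y))) * u powr (- 2)) * indicator {0<..} u \<partial>lborel)"
    by (intro nn_integral_cong) (auto simp: char_Z indicator_def)
  also have "\<dots> = ennreal (cZ powr (1 / Y) * Gamma (1 - 1 / Y))"
    using cZ_pos Y by (intro nn_integral_1_minus_exp_minus_powr) auto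
  finally have "pi / 2 * (\<integral>\<omega>. \<bar>Z \<omega>\<bar> \<partial>N) = cZ powr (1 / Y) * Gamma (1 - 1 / Y)"
    using G by (subst (asm) ennreal_inj) (auto intro!: mult_nonneg_nonneg Bochner_Integration.integral_nonneg)
  then show ?thesis by (simp add: field_simps)
qed

lemma mean_pos_part_Z: "(\<integral>\<omega>. max (Z \<omega>) 0 \<partial>N) = 1 / pi * Gamma (1 - 1 / Y) * cZ powr (1 / Y)"
proof -
  have "(\<integral>\<omega>. max (Z \<omega>) 0 \<partial>N) = (\<integral>\<omega>. (\<bar>Z \<omega>\<bar> + Z \<omega>) / 2 \<partial>N)" by (simp only: max_0_eq)
  also have "\<dots> = (\<integral>\<omega>. \<bar>Z \<omega>\<bar> \<partial>N) / 2" by simp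
  finally show ?thesis by (simp add: abs_Z_mean)
qed

lemma prob_Z_interval:
  assumes "a \<le> b" shows "prob {\<omega>\<in>space N. a < Z \<omega> \<and> Z \<omega> \<le> b} \<le> pZ_bound * (b - a)"
proof -
  have "prob {\<omega>\<in>space N. a < Z \<omega> \<and> Z \<omega> \<le> b} = measure (distr N borel Z) {a<..b}"
    by (subst measure_distr) (auto intro!: arg_cong[where f=prob])
  also have "\<dots> = (LBINT x:{a..b}. pZ x)"
    unfolding pZ_def by (rule LZ.measure_Ioc_char_density[OF integrable_char_Z assms])
  also have "\<dots> \<le> \<bar>LBINT x:{a..b}. pZ x\<bar>" by simp
  also have "\<dots> \<le> pZ_bound * (b - a)"
    unfolding pZ_def pZ_bound_def by (rule LZ.set_integral_char_density_le[OF integrable_char_Z assms])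
  finally show ?thesis .
qed

lemma prob_Z_eq: "prob {\<omega>\<in>space N. Z \<omega> = x} = 0"
proof -
  have "prob {\<omega>\<in>space N. Z \<omega> = x} = measure (distr N borel Z) {x}"
    by (subst measure_distr) (auto intro!: arg_cong[where f=prob])
  then show ?thesis using LZ.measure_singleton_eq_0[OF integrable_char_Z] by simp
qed

lemma distr_neg_Z: "distr N borel (\<lambda>\<omega>. - Z \<omega>) = distr N borel Z"
proof (rule Levy_uniqueness)
  show "real_distribution (distr N borel (\<lambda>\<omega>. - Z \<omega>))" by (rule real_distribution_distr) simp
  show "char (distr N borel (\<lambda>\<omega>. - Z \<omega>)) = char (distr N borel Z)"
  proof
    fix u
    have "char (distr N borel (\<lambda>\<omega>. - Z \<omega>)) u = char (distr N borel Z) (- u)"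
      unfolding char_def by (subst (1 2) integral_distr) auto
    then show "char (distr N borel (\<lambda>\<omega>. - Z \<omega>)) u = char (distr N borel Z) u" by (simp add: char_Z)
  qed
qed (rule law_Z)

text \<open>Symmetry together with the absence of an atom at 0. This one half is the weight with
  which the drift enters the coefficient of t.\<close>

lemma prob_Z_pos: "prob {\<omega>\<in>space N. Z \<omega> > 0} = 1 / 2"
proof -
  have "prob {\<omega>\<in>space N. Z \<omega> < 0} = measure (distr N borel (\<lambda>\<omega>. - Z \<omega>)) {0<..}"
    by (subst measure_distr) (auto intro!: arg_cong[where f=prob])
  also have "\<dots> = prob {\<omega>\<in>space N. Z \<omega> > 0}"
    unfolding distr_neg_Z by (subst measure_distr) (auto intro!: arg_cong[where f=prob])
  finally have sym: "prob {\<omega>\<in>space N. Z \<omega> < 0} = prob {\<omega>\<in>space N. Z \<omega> > 0}" .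
  have "1 = prob (({\<omega>\<in>space N. Z \<omega> < 0} \<union> {\<omega>\<in>space N. Z \<omega> > 0}) \<union> {\<omega>\<in>space N. Z \<omega> = 0})"
    unfolding prob_space[symmetric] by (rule arg_cong[where f=prob]) auto
  also have "\<dots> = prob ({\<omega>\<in>space N. Z \<omega> < 0} \<union> {\<omega>\<in>space N. Z \<omega> > 0}) + prob {\<omega>\<in>space N. Z \<omega> = 0}"
    by (rule finite_measure_Union) auto
  also have "prob ({\<omega>\<in>space N. Z \<omega> < 0} \<union> {\<omega>\<in>space N. Z \<omega> > 0}) = prob {\<omega>\<in>space N. Z \<omega> < 0} + prob {\<omega>\<in>space N. Z \<omega> > 0}"
    by (rule finite_measure_Union) auto
  finally show ?thesis using sym prob_Z_eq[of 0] by simp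
qed

text \<open>A large value of \<open>A\<close> moves V like M times \<open>A\<close>, a large value
  of \<open>B\<close> like (G + 1) times \<open>B\<close>; in each case it is the larger of the two
  weights that counts, and each variable has tail coefficient C / Y.\<close>

definition K0 where "K0 = C / Y * M powr Y + C / Y * (G + 1) powr Y"

text \<open>V is the maximum of M A + G B and (M - 1) A + (G + 1) B. The weights of the two forms
  have the same sum M + G, and all four are positive because M > 1 and G > 0, so
  \<open>tail_max_linear\<close> applies to the joint law.\<close>

lemma tail_V: "\<exists>K\<ge>0. \<forall>w>0. \<bar>prob {\<omega>\<in>space N. V \<omega> \<ge> w} - K0 * w powr (- Y)\<bar> \<le> K * w powr (- Y - 1)"
proof -
  obtain KA where KA: "KA \<ge> 0" "tail_bound (distr N borel A) Y (C / Y) KA" using LA.tail by blast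
  obtain KB where KB: "KB \<ge> 0" "tail_bound (distr N borel B) Y (C / Y) KB" using LB.tail by blast
  obtain mA where mA: "abs_moment_le (distr N borel A) mA" using LA.abs_moment by blast
  obtain mB where mB: "abs_moment_le (distr N borel B) mB" using LB.abs_moment by blast
  note mA' = abs_moment_leD[OF mA LA.M_is_borel] and mB' = abs_moment_leD[OF mB LB.M_is_borel]
  have CY: "C / Y \<ge> 0" "Y > 0" using C Y by auto
  let ?c = "tail_const Y M G + tail_const Y (G + 1) (M - 1) + (M + G) powr (Y + 1)"
  let ?K = "?c * (KA + KB + C / Y * mB + C / Y * mA)"
  have "\<bar>prob {\<omega>\<in>space N. V \<omega> \<ge> w} - K0 * w powr (- Y)\<bar> \<le> ?K * w powr (- Y - 1)" if w: "w > 0" for w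
  proof -
    let ?E = "{(x, y). max (M * x + G * y) ((M - 1) * x + (G + 1) * y) \<ge> w}"
    have mE: "?E \<in> sets (borel \<Otimes>\<^sub>M borel)"
    proof -
      have "{z \<in> space (borel \<Otimes>\<^sub>M borel). w \<le> max (M * fst z + G * snd z) ((M - 1) * fst z + (G + 1) * snd z)} \<in> sets (borel \<Otimes>\<^sub>M borel)"
        by measurable
      then show ?thesis by (simp add: space_pair_measure case_prod_beta')
    qed
    have V_max: "V \<omega> = max (M * A \<omega> + G * B \<omega>) ((M - 1) * A \<omega> + (G + 1) * B \<omega>)" for \<omega>
      by (simp add: V_def Z_def U_def max_def algebra_simps)
    have "distr N borel A \<Otimes>\<^sub>M distr N borel B = distr N (borel \<Otimes>\<^sub>M borel) (\<lambda>\<omega>. (A \<omega>, B \<omega>))"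
      using indep unfolding indep_var_distribution_eq by simp
    then have "measure (distr N borel A \<Otimes>\<^sub>M distr N borel B) ?E = prob ((\<lambda>\<omega>. (A \<omega>, B \<omega>)) -` ?E \<inter> space N)"
      using mE by (simp only:) (rule measure_distr, auto)
    also have "(\<lambda>\<omega>. (A \<omega>, B \<omega>)) -` ?E \<inter> space N = {\<omega>\<in>space N. V \<omega> \<ge> w}"
      unfolding V_max by auto
    finally have "measure (distr N borel A \<Otimes>\<^sub>M distr N borel B) ?E = prob {\<omega>\<in>space N. V \<omega> \<ge> w}" .
    then show ?thesis
      using tail_max_linear[OF LA.real_distribution_axioms LB.real_distribution_axioms KA(2) KB(2) CY(1) KA(1) CY(1) KB(1)
          mA'(1,2) mB'(1,2) CY(2) _ _ _ _ _ w, of "M - 1" M G "G + 1"] M G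
      by (simp add: K0_def)
  qed
  moreover have "?K \<ge> 0"
    using M G CY KA KB mA'(3) mB'(3) by (intro mult_nonneg_nonneg add_nonneg_nonneg tail_const_nonneg) auto
  ultimately show ?thesis by blast
qed

lemma exp_U_integrable: "s \<ge> 0 \<Longrightarrow> integrable N (\<lambda>\<omega>. exp (- s * U \<omega>))"
proof -
  assume "s \<ge> 0"
  then have "integrable N (\<lambda>\<omega>. exp (- (s * (M - 1) * A \<omega> + s * (G + 1) * B \<omega>)))"
    using M G by (intro exp_pair_real(1)) auto
  moreover have "- (s * (M - 1) * A \<omega> + s * (G + 1) * B \<omega>) = - s * U \<omega>" for \<omega>
    by (simp add: U_def algebra_simps)
  ultimately show ?thesis by (simp only:)
qed

definition \<eta> where "\<eta> = C * Gamma (- Y) * ((M - 1) powr Y + (G + 1) powr Y)"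

lemma exp_U:
  assumes "h > 0" shows "(\<integral>\<omega>. exp (- h * U \<omega>) \<partial>N) = exp (\<eta> * h powr Y)"
proof -
  have "(\<integral>\<omega>. exp (- h * U \<omega>) \<partial>N) = (\<integral>\<omega>. exp (- ((h * (M - 1)) * A \<omega> + (h * (G + 1)) * B \<omega>)) \<partial>N)"
    by (simp add: U_def algebra_simps)
  also have "\<dots> = exp (C * Gamma (- Y) * ((h * (M - 1)) powr Y + (h * (G + 1)) powr Y))"
    using assms M G by (intro exp_pair_real) auto
  also have "(h * (M - 1)) powr Y = h powr Y * (M - 1) powr Y" using assms M by (intro powr_mult)
  also have "(h * (G + 1)) powr Y = h powr Y * (G + 1) powr Y" using assms G by (intro powr_mult)
  finally show ?thesis by (simp add: \<eta>_def algebra_simps)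
qed

end

section \<open>Layer cake formulas\<close>

text \<open>Integration by parts in the integral of exp(-x) - 1 + x, whose derivative is 1 -
  exp(-x). The value is the contribution of a pure power tail to the Laplace transform.\<close>

lemma nn_integral_1_minus_exp_powr:
  fixes Y :: real assumes Y: "1 < Y" "Y < 2"
  shows "(\<integral>\<^sup>+w. ennreal ((1 - exp (- w)) * w powr (- Y)) * indicator {0<..} w \<partial>lborel) = ennreal (Y * Gamma (- Y))"
proof -
  have inner: "(\<integral>\<^sup>+w. ennreal (if 0 < w \<and> w < x then 1 - exp (- w) else 0) \<partial>lborel) = ennreal (exp (- x) - 1 + x)" if x: "x > 0" for x :: real
  proof -
    have "((\<lambda>w. 1 - exp (- w)) has_integral ((x + exp (- x)) - (0 + exp (- 0)))) {0..x}"
      using x by (intro fundamental_theorem_of_calculus)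
        (auto intro!: derivative_eq_intros simp flip: has_real_derivative_iff_has_vector_derivative)
    moreover have "(x + exp (- x)) - (0 + exp (- 0)) = exp (- x) - 1 + x" by simp
    ultimately have "((\<lambda>w. 1 - exp (- w)) has_integral (exp (- x) - 1 + x)) {0..x}" by (simp only:)
    then have "ennreal (exp (- x) - 1 + x) = (\<integral>\<^sup>+w. ennreal (1 - exp (- w)) * indicator {0..x} w \<partial>lborel)"
      by (subst nn_integral_has_integral_lebesgue') auto
    also have "\<dots> = (\<integral>\<^sup>+w. ennreal (if 0 < w \<and> w < x then 1 - exp (- w) else 0) \<partial>lborel)"
      by (intro nn_integral_cong_AE eventually_mono[OF eventually_conj[OF AE_lborel_singleton[of 0] AE_lborel_singleton[of x]]]) (auto simp: indicator_def)
    finally show ?thesis by simp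
  qed
  have "ennreal (Gamma (- Y)) = (\<integral>\<^sup>+x. ennreal ((exp (- x) - 1 + x) * x powr (- Y - 1)) * indicator {0<..} x \<partial>lborel)"
    by (rule nn_integral_exp_minus_1_plus[OF Y, symmetric])
  also have "\<dots> = (\<integral>\<^sup>+x. (\<integral>\<^sup>+w. ennreal (if 0 < w \<and> w < x then (1 - exp (- w)) * x powr (- Y - 1) else 0) \<partial>lborel) \<partial>lborel)"
  proof (intro nn_integral_cong)
    fix x :: real
    have "(\<integral>\<^sup>+w. ennreal (if 0 < w \<and> w < x then (1 - exp (- w)) * x powr (- Y - 1) else 0) \<partial>lborel)
       = (\<integral>\<^sup>+w. ennreal (x powr (- Y - 1)) * ennreal (if 0 < w \<and> w < x then 1 - exp (- w) else 0) \<partial>lborel)"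
      by (intro nn_integral_cong) (auto simp: ennreal_mult[symmetric] mult_ac)
    also have "\<dots> = ennreal (x powr (- Y - 1)) * (\<integral>\<^sup>+w. ennreal (if 0 < w \<and> w < x then 1 - exp (- w) else 0) \<partial>lborel)"
      by (rule nn_integral_cmult) auto
    also have "\<dots> = ennreal ((exp (- x) - 1 + x) * x powr (- Y - 1)) * indicator {0<..} x"
    proof (cases "x > 0")
      case True
      have "exp (- x) - 1 + x \<ge> 0" using exp_ge_add_one_self[of "-x"] by simp
      with True show ?thesis by (simp add: inner ennreal_mult mult_ac)
    next
      case False
      then have "(\<lambda>w. ennreal (if 0 < w \<and> w < x then 1 - exp (- w) else 0)) = (\<lambda>_. 0)"
        by (auto intro!: ext)
      then show ?thesis using False by simp
    qed
    finally show "ennreal ((exp (- x) - 1 + x) * x powr (- Y - 1)) * indicator {0<..} x = (\<integral>\<^sup>+w. ennreal (if 0 < w \<and> w < x then (1 - exp (- w)) * x powr (- Y - 1) else 0) \<partial>lborel)" by simp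
  qed
  also have "\<dots> = (\<integral>\<^sup>+w. (\<integral>\<^sup>+x. ennreal (if 0 < w \<and> w < x then (1 - exp (- w)) * x powr (- Y - 1) else 0) \<partial>lborel) \<partial>lborel)"
    by (rule lborel_pair.Fubini') measurable
  also have "\<dots> = (\<integral>\<^sup>+w. ennreal (1 / Y) * (ennreal ((1 - exp (- w)) * w powr (- Y)) * indicator {0<..} w) \<partial>lborel)"
  proof (intro nn_integral_cong)
    fix w :: real
    show "(\<integral>\<^sup>+x. ennreal (if 0 < w \<and> w < x then (1 - exp (- w)) * x powr (- Y - 1) else 0) \<partial>lborel)
      = ennreal (1 / Y) * (ennreal ((1 - exp (- w)) * w powr (- Y)) * indicator {0<..} w)"
    proof (cases "w > 0")
      case True
      have "(\<integral>\<^sup>+x. ennreal (if 0 < w \<and> w < x then (1 - exp (- w)) * x powr (- Y - 1) else 0) \<partial>lborel)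
        = (\<integral>\<^sup>+x. ennreal (1 - exp (- w)) * (ennreal (x powr (- Y - 1)) * indicator {w..} x) \<partial>lborel)"
        using True by (intro nn_integral_cong_AE eventually_mono[OF AE_lborel_singleton[of w]])
          (auto simp: ennreal_mult indicator_def)
      also have "\<dots> = ennreal (1 - exp (- w)) * ennreal (w powr (- Y) / Y)"
        using True Y nn_integral_powr_upper[of "Y + 1" w] by (subst nn_integral_cmult) auto
      finally show ?thesis using True Y by (simp add: ennreal_mult[symmetric])
    qed simp
  qed
  also have "\<dots> = ennreal (1 / Y) * (\<integral>\<^sup>+w. ennreal ((1 - exp (- w)) * w powr (- Y)) * indicator {0<..} w \<partial>lborel)"
    by (rule nn_integral_cmult) auto
  finally have "ennreal Y * ennreal (Gamma (- Y)) = ennreal Y * (ennreal (1 / Y) * (\<integral>\<^sup>+w. ennreal ((1 - exp (- w)) * w powr (- Y)) * indicator {0<..} w \<partial>lborel))"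
    by simp
  then show ?thesis using Y by (simp add: mult.assoc[symmetric] ennreal_mult'[symmetric])
qed

lemma has_bochner_integral_1_minus_exp_powr:
  fixes Y h :: real assumes Y: "1 < Y" "Y < 2" and h: "h > 0"
  shows "has_bochner_integral lborel (\<lambda>w. indicator {0<..} w * (h * (1 - exp (- (h * w))) * w powr (- Y))) (Y * Gamma (- Y) * h powr Y)"
proof -
  let ?f = "\<lambda>w :: real. indicator {0<..} w * ((1 - exp (- w)) * w powr (- Y))"
  have G: "Y * Gamma (- Y) \<ge> 0"
  proof -
    have "cos (pi * Y / 2) < cos (pi / 2)" using Y by (intro cos_monotone_0_pi) (auto simp: field_simps)
    then have "cos (pi * Y / 2) < 0" by simp
    moreover have "Gamma (- Y) * cos (pi * Y / 2) < 0" using neg_Gamma_cos_pos[OF Y] by simp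
    ultimately have "Gamma (- Y) > 0" by (simp add: mult_less_0_iff)
    then show ?thesis using Y by simp
  qed
  have "(\<integral>\<^sup>+w. ennreal (?f w) \<partial>lborel) = ennreal (Y * Gamma (- Y))"
    unfolding nn_integral_1_minus_exp_powr[OF Y, symmetric] by (intro nn_integral_cong) (auto simp: indicator_def)
  then have "has_bochner_integral lborel ?f (Y * Gamma (- Y))"
    using G by (intro has_bochner_integral_nn_integral) (auto simp: indicator_def)
  then have "has_bochner_integral lborel (\<lambda>w. ?f (0 + h * w)) ((Y * Gamma (- Y)) /\<^sub>R \<bar>h\<bar>)"
    using h by (subst lborel_has_bochner_integral_real_affine_iff[symmetric]) auto
  then have "has_bochner_integral lborel (\<lambda>w. (h * h powr Y) * ?f (0 + h * w)) ((h * h powr Y) * ((Y * Gamma (- Y)) /\<^sub>R \<bar>h\<bar>))"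
    by (rule has_bochner_integral_mult_right)
  moreover have "(h * h powr Y) * ?f (0 + h * w) = indicator {0<..} w * (h * (1 - exp (- (h * w))) * w powr (- Y))" for w
    using h by (auto simp: indicator_def powr_mult zero_less_mult_iff powr_minus divide_simps)
  moreover have "(h * h powr Y) * ((Y * Gamma (- Y)) /\<^sub>R \<bar>h\<bar>) = Y * Gamma (- Y) * h powr Y"
    using h by (simp add: field_simps)
  ultimately show ?thesis by (simp only:)
qed

lemma (in prob_space) prob_ge_measurable:
  fixes X :: "'a \<Rightarrow> real"
  assumes [measurable]: "X \<in> borel_measurable M"
  shows "(\<lambda>w. prob {\<omega>\<in>space M. X \<omega> \<ge> w}) \<in> borel_measurable borel"
proof -
  have "mono (\<lambda>w. - prob {\<omega>\<in>space M. X \<omega> \<ge> w})" by (intro monoI le_imp_neg_le finite_measure_mono) auto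
  then have "(\<lambda>w. - (- prob {\<omega>\<in>space M. X \<omega> \<ge> w})) \<in> borel_measurable borel"
    by (intro borel_measurable_uminus borel_measurable_mono)
  then show ?thesis by simp
qed

text \<open>The expectation of g(X) is the integral of g'(w) P(X >= w). For g(x) = exp(-h x) - 1 + h
  x the derivative is nonnegative on w > 0, and g grows only linearly, so a first moment is
  enough.\<close>

lemma (in prob_space) layer_cake_exp:
  assumes [measurable]: "X \<in> borel_measurable M" and X: "integrable M X" and h: "h > 0"
  shows "integrable M (\<lambda>\<omega>. if 0 < X \<omega> then exp (- h * X \<omega>) - 1 + h * X \<omega> else 0)"
    and "has_bochner_integral lborel (\<lambda>w. indicator {0<..} w * (h * (1 - exp (- (h * w))) * prob {\<omega>\<in>space M. X \<omega> \<ge> w}))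
      (\<integral>\<omega>. (if 0 < X \<omega> then exp (- h * X \<omega>) - 1 + h * X \<omega> else 0) \<partial>M)"
proof -
  let ?g = "\<lambda>x. if 0 < x then exp (- h * x) - 1 + h * x else 0 :: real"
  interpret P: pair_sigma_finite lborel M
    by (intro pair_sigma_finite.intro sigma_finite_measure_axioms lborel.sigma_finite_measure_axioms)
  have g0: "?g x \<ge> 0" for x using exp_ge_add_one_self[of "- h * x"] by auto
  have gle: "?g x \<le> h * \<bar>x\<bar>" for x using h by (auto simp: mult_le_0_iff)
  show i: "integrable M (\<lambda>\<omega>. ?g (X \<omega>))"
    by (rule Bochner_Integration.integrable_bound[OF integrable_mult_right[OF integrable_abs[OF X], of h]])
      (use g0 gle h in \<open>auto simp: abs_mult\<close>)
  have pt: "ennreal (?g x) = (\<integral>\<^sup>+w. ennreal (if 0 < w \<and> w \<le> x then h * (1 - exp (- (h * w))) else 0) \<partial>lborel)" for x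
  proof (cases "x > 0")
    case True
    have "((\<lambda>w. h * (1 - exp (- (h * w)))) has_integral ((h * x + exp (- (h * x))) - (h * 0 + exp (- (h * 0))))) {0..x}"
      using True by (intro fundamental_theorem_of_calculus)
        (auto intro!: derivative_eq_intros simp: algebra_simps simp flip: has_real_derivative_iff_has_vector_derivative)
    moreover have "(h * x + exp (- (h * x))) - (h * 0 + exp (- (h * 0))) = ?g x" using True by simp
    ultimately have "((\<lambda>w. h * (1 - exp (- (h * w)))) has_integral ?g x) {0..x}" by (simp only:)
    then have "ennreal (?g x) = (\<integral>\<^sup>+w. ennreal (h * (1 - exp (- (h * w)))) * indicator {0..x} w \<partial>lborel)"
      using h by (subst nn_integral_has_integral_lebesgue') auto
    also have "\<dots> = (\<integral>\<^sup>+w. ennreal (if 0 < w \<and> w \<le> x then h * (1 - exp (- (h * w))) else 0) \<partial>lborel)"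
      by (intro nn_integral_cong_AE eventually_mono[OF AE_lborel_singleton[of 0]]) (auto simp: indicator_def)
    finally show ?thesis .
  next
    case False
    then have "(\<lambda>w. ennreal (if 0 < w \<and> w \<le> x then h * (1 - exp (- (h * w))) else 0)) = (\<lambda>_. 0)"
      by (auto intro!: ext)
    then show ?thesis using False by simp
  qed
  have "ennreal (\<integral>\<omega>. ?g (X \<omega>) \<partial>M) = (\<integral>\<^sup>+\<omega>. ennreal (?g (X \<omega>)) \<partial>M)"
    using i g0 by (intro nn_integral_eq_integral[symmetric]) auto
  also have "\<dots> = (\<integral>\<^sup>+\<omega>. (\<integral>\<^sup>+w. ennreal (if 0 < w \<and> w \<le> X \<omega> then h * (1 - exp (- (h * w))) else 0) \<partial>lborel) \<partial>M)"
    unfolding pt ..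
  also have "\<dots> = (\<integral>\<^sup>+w. (\<integral>\<^sup>+\<omega>. ennreal (if 0 < w \<and> w \<le> X \<omega> then h * (1 - exp (- (h * w))) else 0) \<partial>M) \<partial>lborel)"
    by (rule P.Fubini') measurable
  also have "\<dots> = (\<integral>\<^sup>+w. ennreal (indicator {0<..} w * (h * (1 - exp (- (h * w))) * prob {\<omega>\<in>space M. X \<omega> \<ge> w})) \<partial>lborel)"
  proof (intro nn_integral_cong)
    fix w :: real
    have "(\<integral>\<^sup>+\<omega>. ennreal (if 0 < w \<and> w \<le> X \<omega> then h * (1 - exp (- (h * w))) else 0) \<partial>M)
      = (\<integral>\<^sup>+\<omega>. ennreal (indicator {0<..} w * (h * (1 - exp (- (h * w))))) * indicator {\<omega>\<in>space M. X \<omega> \<ge> w} \<omega> \<partial>M)"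
      by (intro nn_integral_cong) (auto simp: indicator_def)
    also have "\<dots> = ennreal (indicator {0<..} w * (h * (1 - exp (- (h * w))))) * emeasure M {\<omega>\<in>space M. X \<omega> \<ge> w}"
      by (rule nn_integral_cmult_indicator) measurable
    also have "\<dots> = ennreal (indicator {0<..} w * (h * (1 - exp (- (h * w)))) * prob {\<omega>\<in>space M. X \<omega> \<ge> w})"
      using h unfolding emeasure_eq_measure by (intro ennreal_mult[symmetric]) (auto simp: indicator_def)
    finally show "(\<integral>\<^sup>+\<omega>. ennreal (if 0 < w \<and> w \<le> X \<omega> then h * (1 - exp (- (h * w))) else 0) \<partial>M)
       = ennreal (indicator {0<..} w * (h * (1 - exp (- (h * w))) * prob {\<omega>\<in>space M. X \<omega> \<ge> w}))" by (simp add: mult.assoc)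
  qed
  finally have eq: "(\<integral>\<^sup>+w. ennreal (indicator {0<..} w * (h * (1 - exp (- (h * w))) * prob {\<omega>\<in>space M. X \<omega> \<ge> w})) \<partial>lborel) = ennreal (\<integral>\<omega>. ?g (X \<omega>) \<partial>M)" ..
  note prob_ge_measurable[OF assms(1), measurable]
  show "has_bochner_integral lborel (\<lambda>w. indicator {0<..} w * (h * (1 - exp (- (h * w))) * prob {\<omega>\<in>space M. X \<omega> \<ge> w})) (\<integral>\<omega>. ?g (X \<omega>) \<partial>M)"
  proof (rule has_bochner_integral_nn_integral[OF _ _ _ eq])
    show "AE w in lborel. 0 \<le> indicator {0<..} w * (h * (1 - exp (- (h * w))) * prob {\<omega>\<in>space M. X \<omega> \<ge> w})"
      using h by (intro always_eventually allI) (auto simp: indicator_def)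
    show "0 \<le> (\<integral>\<omega>. ?g (X \<omega>) \<partial>M)" using g0 by (intro Bochner_Integration.integral_nonneg) auto
  qed measurable
qed

text \<open>Pointwise, the decrease of the positive part under a shift by \<kappa> is \<kappa> times
  the length of the set of w in [0, 1] with X >= \<kappa> w, for either sign of \<kappa>. This exact
  identity is the origin of the correction term on the left of the theorem.\<close>

lemma (in prob_space) integral_pos_part_diff:
  assumes X: "integrable M X"
  shows "(\<integral>\<omega>. max (X \<omega>) 0 - max (X \<omega> - \<kappa>) 0 \<partial>M) = \<kappa> * (LBINT w:{0..1}. prob {\<omega>\<in>space M. X \<omega> \<ge> \<kappa> * w})"
proof -
  have [measurable]: "X \<in> borel_measurable M" using X by auto
  interpret P: pair_sigma_finite lborel M
    by (intro pair_sigma_finite.intro sigma_finite_measure_axioms lborel.sigma_finite_measure_axioms)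
  define f where "f w \<omega> = (if 0 \<le> w \<and> w \<le> 1 \<and> \<kappa> * w \<le> X \<omega> then 1 else 0 :: real)" for w \<omega>
  have fm: "(\<lambda>(w, \<omega>). f w \<omega>) \<in> borel_measurable (lborel \<Otimes>\<^sub>M M)" unfolding f_def by measurable
  have inner: "(\<integral>\<omega>. f w \<omega> \<partial>M) = indicator {0..1} w * prob {\<omega>\<in>space M. X \<omega> \<ge> \<kappa> * w}" for w
  proof -
    have "(\<integral>\<omega>. f w \<omega> \<partial>M) = (\<integral>\<omega>. indicator {0..1} w * indicator {\<omega>\<in>space M. X \<omega> \<ge> \<kappa> * w} \<omega> \<partial>M)"
      by (intro Bochner_Integration.integral_cong) (auto simp: f_def indicator_def)
    then show ?thesis by simp
  qed
  have [measurable]: "f w \<in> borel_measurable M" for w unfolding f_def by measurable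
  have i1: "integrable M (f w)" for w
    by (rule integrable_const_bound[where B=1]) (auto simp: f_def)
  have int: "integrable (lborel \<Otimes>\<^sub>M M) (\<lambda>(w, \<omega>). f w \<omega>)"
  proof (rule P.Fubini_integrable[OF fm])
    have "(\<lambda>w. \<integral>\<omega>. norm (case (w, \<omega>) of (w, \<omega>) \<Rightarrow> f w \<omega>) \<partial>M) = (\<lambda>w. indicator {0..1} w * prob {\<omega>\<in>space M. X \<omega> \<ge> \<kappa> * w})"
      unfolding inner[symmetric] by (auto simp: f_def intro!: ext Bochner_Integration.integral_cong)
    moreover have "integrable lborel (\<lambda>w. indicator {0..1} w * prob {\<omega>\<in>space M. X \<omega> \<ge> \<kappa> * w})"
    proof (rule Bochner_Integration.integrable_bound)
      show "integrable lborel (indicator {0..1 :: real} :: real \<Rightarrow> real)"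
        by (intro integrable_real_indicator) (auto simp: emeasure_lborel_Icc_eq)
      have "(\<lambda>w. \<integral>\<omega>. f w \<omega> \<partial>M) \<in> borel_measurable lborel"
        using fm by (rule borel_measurable_lebesgue_integral)
      then show "(\<lambda>w. indicator {0..1} w * prob {\<omega>\<in>space M. X \<omega> \<ge> \<kappa> * w}) \<in> borel_measurable lborel"
        unfolding inner .
    qed (auto simp: indicator_def)
    ultimately show "integrable lborel (\<lambda>w. \<integral>\<omega>. norm (case (w, \<omega>) of (w, \<omega>) \<Rightarrow> f w \<omega>) \<partial>M)" by (simp only:)
  qed (use i1 in auto)
  have pt: "\<kappa> * (LBINT w. f w \<omega>) = max (X \<omega>) 0 - max (X \<omega> - \<kappa>) 0" for \<omega>
  proof -
    define x where "x = X \<omega>"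
    consider "\<kappa> = 0" | "\<kappa> > 0" | "\<kappa> < 0" by linarith
    then show ?thesis
    proof cases
      case 2
      have "(LBINT w. f w \<omega>) = (LBINT w. indicator {0..min 1 (x / \<kappa>)} w)"
        using 2 by (intro Bochner_Integration.integral_cong) (auto simp: f_def x_def indicator_def field_simps)
      also have "\<dots> = max 0 (min 1 (x / \<kappa>))" by (simp add: max_def)
      finally show ?thesis using 2 unfolding x_def[symmetric]
        by (auto simp: max_def min_def field_simps)
    next
      case 3
      have "(LBINT w. f w \<omega>) = (LBINT w. indicator {max 0 (x / \<kappa>)..1} w)"
        using 3 by (intro Bochner_Integration.integral_cong) (auto simp: f_def x_def indicator_def field_simps)
      also have "\<dots> = max 0 (1 - max 0 (x / \<kappa>))" by (simp add: max_def)
      finally show ?thesis using 3 unfolding x_def[symmetric]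
        by (auto simp: max_def min_def field_simps)
    qed simp
  qed
  have "\<kappa> * (LBINT w:{0..1}. prob {\<omega>\<in>space M. X \<omega> \<ge> \<kappa> * w}) = \<kappa> * (LBINT w. (\<integral>\<omega>. f w \<omega> \<partial>M))"
    unfolding inner set_lebesgue_integral_def by simp
  also have "(LBINT w. (\<integral>\<omega>. f w \<omega> \<partial>M)) = (\<integral>\<omega>. (LBINT w. f w \<omega>) \<partial>M)"
    by (rule P.Fubini_integral[OF int, symmetric])
  also have "\<kappa> * \<dots> = (\<integral>\<omega>. \<kappa> * (LBINT w. f w \<omega>) \<partial>M)" by simp
  finally show ?thesis unfolding pt ..
qed

text \<open>The function \<open>\<psi>\<close> is the payoff after a change of measure by \<open>exp x\<close>:
  \<open>max (exp x - exp k) 0 = exp x * \<psi> (x - k)\<close>.\<close>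

definition \<psi> :: "real \<Rightarrow> real" where "\<psi> x = 1 - exp (- max x 0)"

lemma \<psi>_measurable [measurable]: "\<psi> \<in> borel_measurable borel"
  unfolding \<psi>_def by measurable

lemma \<psi>_bounds: "0 \<le> \<psi> x" "\<psi> x \<le> 1" "\<psi> x \<le> \<bar>x\<bar>"
proof -
  show "0 \<le> \<psi> x" "\<psi> x \<le> 1" by (auto simp: \<psi>_def)
  show "\<psi> x \<le> \<bar>x\<bar>" using exp_ge_add_one_self[of "- max x 0"] by (auto simp: \<psi>_def max_def split: if_splits)
qed

text \<open>On [u, v] the slope of -exp(-x) lies between 1 - v and 1; this compares the increment
  with v - u. Monotonicity supplies the second alternative in the minimum.\<close>

lemma exp_defect_bounds:
  fixes u v :: real assumes "0 \<le> u" "u \<le> v"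
  shows "0 \<le> (v - u) - (exp (- u) - exp (- v))" "(v - u) - (exp (- u) - exp (- v)) \<le> (v - u) * min 1 v"
    "exp (- u) - exp (- v) \<ge> 0"
proof -
  show m: "exp (- u) - exp (- v) \<ge> 0" using assms by simp
  have "exp (- u) - exp (- v) = exp (- u) * (1 - exp (- (v - u)))" by (simp add: right_diff_distrib mult_exp_exp)
  also have "\<dots> \<le> 1 * (1 - exp (- (v - u)))" using assms by (intro mult_right_mono) auto
  also have "\<dots> \<le> v - u" unfolding mult_1_left using exp_ge_add_one_self[of "u - v"] by (simp add: algebra_simps)
  finally show "0 \<le> (v - u) - (exp (- u) - exp (- v))" by simp
  have "(1 - v) * (v - u) \<le> exp (- v) * (v - u)" using exp_ge_add_one_self[of "- v"] assms by (intro mult_right_mono) auto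
  also have "\<dots> \<le> exp (- v) * (exp (v - u) - 1)" using exp_ge_add_one_self[of "v - u"] by (intro mult_left_mono) (simp_all add: le_diff_eq add.commute)
  also have "\<dots> = exp (- u) - exp (- v)" by (simp add: right_diff_distrib mult_exp_exp)
  finally have "(v - u) - (exp (- u) - exp (- v)) \<le> (v - u) * v" by (simp add: algebra_simps)
  moreover have "(v - u) - (exp (- u) - exp (- v)) \<le> (v - u) * 1" using m by simp
  ultimately show "(v - u) - (exp (- u) - exp (- v)) \<le> (v - u) * min 1 v" by (simp add: min_def)
qed

text \<open>Near 0 the function behaves like the positive part. The error carries, besides the size
  of the increment, a factor that is small with the arguments; this extra factor makes the
  corrections below of lower order.\<close>

lemma \<psi>_increment:
  shows "\<bar>\<psi> y - \<psi> x\<bar> \<le> \<bar>y - x\<bar>"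
    and "\<bar>(\<psi> y - \<psi> x) - (max y 0 - max x 0)\<bar> \<le> \<bar>y - x\<bar> * min 1 (\<bar>x\<bar> + \<bar>y - x\<bar>)"
proof -
  have *: "\<bar>\<psi> y - \<psi> x\<bar> \<le> \<bar>y - x\<bar> \<and> \<bar>(\<psi> y - \<psi> x) - (max y 0 - max x 0)\<bar> \<le> \<bar>y - x\<bar> * min 1 m"
    if "x \<le> y" "\<bar>x\<bar> \<le> m" "\<bar>y\<bar> \<le> m" for x y m
  proof -
    define u v where "u = max x 0" and "v = max y 0"
    have uv: "0 \<le> u" "u \<le> v" "v - u \<le> y - x" "v \<le> m" using that by (auto simp: u_def v_def)
    note b = exp_defect_bounds[OF uv(1,2)]
    have "(v - u) * min 1 v \<le> (y - x) * min 1 m" using uv that by (intro mult_mono) auto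
    moreover have "\<psi> y - \<psi> x = exp (- u) - exp (- v)" by (simp add: \<psi>_def u_def v_def)
    ultimately show ?thesis using b uv that unfolding u_def[symmetric] v_def[symmetric] by auto
  qed
  show "\<bar>\<psi> y - \<psi> x\<bar> \<le> \<bar>y - x\<bar>"
    using *[of x y "\<bar>x\<bar> + \<bar>y\<bar>"] *[of y x "\<bar>x\<bar> + \<bar>y\<bar>"] by (cases "x \<le> y") (auto simp: abs_minus_commute)
  show "\<bar>(\<psi> y - \<psi> x) - (max y 0 - max x 0)\<bar> \<le> \<bar>y - x\<bar> * min 1 (\<bar>x\<bar> + \<bar>y - x\<bar>)"
  proof (cases "x \<le> y")
    case False
    have "\<bar>(\<psi> y - \<psi> x) - (max y 0 - max x 0)\<bar> = \<bar>(\<psi> x - \<psi> y) - (max x 0 - max y 0)\<bar>"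
      by (subst abs_minus_cancel[symmetric]) simp
    moreover have "\<bar>y\<bar> \<le> \<bar>x\<bar> + (x - y)" using False by linarith
    ultimately show ?thesis using *[of y x "\<bar>x\<bar> + \<bar>y - x\<bar>"] False by (auto simp: abs_minus_commute)
  qed (use *[of x y "\<bar>x\<bar> + \<bar>y - x\<bar>"] in auto)
qed

section \<open>Expansions in the scale of the stable law\<close>

lemma exp_minus_1_minus_le:
  fixes s :: real assumes "s \<ge> 0"
  shows "exp s - 1 - s \<le> s\<^sup>2 * exp s"
proof -
  have 1: "1 - exp (- s) \<le> s" using exp_ge_add_one_self[of "- s"] by simp
  have "s * (1 - exp (- s)) \<le> s * s" using 1 assms by (intro mult_left_mono) auto
  then have "1 - exp (- s) - s * exp (- s) \<le> s\<^sup>2" using 1 by (simp add: power2_eq_square algebra_simps)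
  then have "(1 - exp (- s) - s * exp (- s)) * exp s \<le> s\<^sup>2 * exp s" by (intro mult_right_mono) auto
  then show ?thesis by (simp add: algebra_simps mult_exp_exp)
qed

text \<open>Linear in h with a factor free of h that is integrable when u is the random variable
  \<open>U\<close>. For u = -y < 0 the mean value estimate gives y exp(h y) <= exp(2 y), as h <=
  1.\<close>

lemma abs_exp_minus_1_le:
  fixes h u :: real assumes "0 < h" "h \<le> 1"
  shows "\<bar>exp (- h * u) - 1\<bar> \<le> h * (\<bar>u\<bar> + exp (- 2 * u))"
proof (cases "u \<ge> 0")
  case True
  have "1 - exp (- h * u) \<le> h * u" using exp_ge_add_one_self[of "- h * u"] by simp
  moreover have "exp (- h * u) \<le> 1" using True assms by simp
  moreover have "h * exp (- 2 * u) \<ge> 0" using assms by simp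
  ultimately show ?thesis using True by (simp add: distrib_left)
next
  case False
  define y where "y = - u"
  have y: "y > 0" using False by (simp add: y_def)
  have hy: "h * y \<le> y" "0 \<le> h * y" using assms y by auto
  have "1 - h * y \<le> exp (- (h * y))" using exp_ge_add_one_self[of "- (h * y)"] by simp
  then have "(1 - h * y) * exp (h * y) \<le> exp (- (h * y)) * exp (h * y)" by (intro mult_right_mono) auto
  then have 1: "exp (h * y) - 1 \<le> h * y * exp (h * y)" by (simp add: mult_exp_exp algebra_simps)
  have "y \<le> exp y" using exp_ge_add_one_self[of y] by linarith
  then have "h * y * exp (h * y) \<le> h * (exp y * exp y)"
    using hy assms y by (subst mult.assoc) (intro mult_left_mono mult_mono, auto)
  with 1 have "exp (h * y) - 1 \<le> h * exp (- 2 * u)" by (simp add: mult_exp_exp y_def)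
  moreover have "exp (h * y) \<ge> 1" using hy by simp
  moreover have "h * \<bar>u\<bar> \<ge> 0" using assms by simp
  ultimately show ?thesis by (simp add: y_def distrib_left)
qed

context stable_pair
begin

lemma V_ge_U: "U \<omega> \<le> V \<omega>"
  by (simp add: V_def)

lemma exp_V_integrable: "h \<ge> 0 \<Longrightarrow> integrable N (\<lambda>\<omega>. exp (- h * V \<omega>))"
  by (rule Bochner_Integration.integrable_bound[OF exp_U_integrable[of h]])
    (auto intro!: mult_left_mono V_ge_U)

text \<open>The bracket in the integral defining d32: the two fractions subtracted there add up to
  the term with \<open>K0\<close>.\<close>

definition tail_diff where "tail_diff w = prob {\<omega>\<in>space N. V \<omega> \<ge> w} - K0 * w powr (- Y)"

lemma tail_diff_measurable [measurable]: "tail_diff \<in> borel_measurable borel"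
  unfolding tail_diff_def by (intro borel_measurable_diff prob_ge_measurable) measurable

lemma K0_nonneg: "K0 \<ge> 0"
  unfolding K0_def using C Y by (intro add_nonneg_nonneg mult_nonneg_nonneg) auto

text \<open>Near 0 the integrand is at most w + \<open>K0\<close> w powr (1 - Y), integrable as Y <
  2. At infinity the second-order tail estimate gives a multiple of w powr (-Y), integrable as Y >
  1.\<close>

lemma tail_diff_integrable: "integrable lborel (\<lambda>w. indicator {0<..} w * (w * \<bar>tail_diff w\<bar>))"
proof -
  obtain K where K: "K \<ge> 0" "\<And>w. w > 0 \<Longrightarrow> \<bar>tail_diff w\<bar> \<le> K * w powr (- Y - 1)"
    using tail_V unfolding tail_diff_def by blast
  show ?thesis
  proof (rule Bochner_Integration.integrable_bound)
    show "integrable lborel (\<lambda>w. (1 + K0 + K) * stable_dom Y w)" using integrable_stable_dom[OF Y] by simp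
    show "AE w in lborel. norm (indicator {0<..} w * (w * \<bar>tail_diff w\<bar>)) \<le> norm ((1 + K0 + K) * stable_dom Y w)"
    proof (intro always_eventually allI)
      fix w :: real
      show "norm (indicator {0<..} w * (w * \<bar>tail_diff w\<bar>)) \<le> norm ((1 + K0 + K) * stable_dom Y w)"
      proof (cases "w > 0")
        case True
        have "w * \<bar>tail_diff w\<bar> \<le> (1 + K0 + K) * stable_dom Y w"
        proof (cases "w \<le> 1")
          case w1: True
          have "\<bar>tail_diff w\<bar> \<le> 1 + K0 * w powr (- Y)"
            unfolding tail_diff_def using K0_nonneg by (intro order.trans[OF abs_triangle_ineq4] add_mono) auto
          then have "w * \<bar>tail_diff w\<bar> \<le> w * (1 + K0 * w powr (- Y))" using True by (intro mult_left_mono) auto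
          also have "\<dots> = w + K0 * w powr (1 - Y)" using True by (simp add: powr_diff powr_minus field_simps)
          also have "\<dots> \<le> (1 + K0) * w powr (1 - Y)"
            using powr_mono'[of "1 - Y" 1 w] True w1 Y by (simp add: algebra_simps)
          also have "\<dots> \<le> (1 + K0 + K) * stable_dom Y w"
            using K K0_nonneg True w1 by (intro mult_mono) (auto simp: stable_dom_def)
          finally show ?thesis by simp
        next
          case False
          have "w * \<bar>tail_diff w\<bar> \<le> w * (K * w powr (- Y - 1))" using True K by (intro mult_left_mono) auto
          also have "\<dots> = K * w powr (- Y)" using True by (simp add: powr_diff)
          also have "\<dots> \<le> (1 + K0 + K) * stable_dom Y w"
            using K K0_nonneg True False by (intro mult_mono) (auto simp: stable_dom_def)
          finally show ?thesis .
        qed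
        also have "\<dots> \<le> norm ((1 + K0 + K) * stable_dom Y w)" by simp
        finally show ?thesis using True by (simp add: abs_mult)
      qed simp
    qed
  qed measurable
qed

text \<open>The expectation is split at V = 0. For V > 0, integration by parts brings in the tail;
  its leading part contributes exactly the h powr Y term, and the rest divided by h^2 converges to
  the integral of w times \<open>tail_diff\<close>. For V <= 0, the bound V >= U provides
  exponential moments, so the second-order Taylor term can be taken inside and gives half the
  truncated second moment.\<close>

lemma exp_V_expansion:
  "((\<lambda>h. ((\<integral>\<omega>. exp (- h * V \<omega>) \<partial>N) - (1 - h * (\<integral>\<omega>. V \<omega> \<partial>N) + K0 * (Y * Gamma (- Y)) * h powr Y)) / h\<^sup>2)
     \<longlongrightarrow> (\<integral>\<omega>. (V \<omega>)\<^sup>2 * indicator {\<omega>. V \<omega> \<le> 0} \<omega> \<partial>N) / 2 + (LBINT w:{0<..}. w * tail_diff w)) (at_right 0)"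
proof (rule tendsto_at_right_sequentially[of 0 1])
  \<comment> \<open>Dominated convergence works along sequences; restricting them to (0, 1) also
    serves the domination on V <= 0.\<close>
  fix S :: "nat \<Rightarrow> real"
  assume S: "\<And>n. 0 < S n" "\<And>n. S n < 1" "S \<longlonglongrightarrow> 0"
  have S0: "filterlim S (at_right 0) sequentially"
    using S(3) S(1) by (auto simp: filterlim_at intro!: always_eventually) (metis less_irrefl)
  let ?g1 = "\<lambda>h. \<integral>\<omega>. (if 0 < V \<omega> then exp (- h * V \<omega>) - 1 + h * V \<omega> else 0) \<partial>N"
  let ?g2 = "\<lambda>h. \<integral>\<omega>. (if V \<omega> \<le> 0 then exp (- h * V \<omega>) - 1 + h * V \<omega> else 0) \<partial>N"
  have i2: "integrable N (\<lambda>\<omega>. if V \<omega> \<le> 0 then exp (- h * V \<omega>) - 1 + h * V \<omega> else 0)" if "h > 0" for h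
  proof (rule Bochner_Integration.integrable_bound)
    show "integrable N (\<lambda>\<omega>. exp (- h * V \<omega>) - 1 + h * V \<omega>)" using exp_V_integrable[of h] that by auto
  qed auto
  have dec: "(\<integral>\<omega>. exp (- h * V \<omega>) \<partial>N) - (1 - h * (\<integral>\<omega>. V \<omega> \<partial>N)) = ?g1 h + ?g2 h" if "h > 0" for h
  proof -
    have "?g1 h + ?g2 h = (\<integral>\<omega>. (if 0 < V \<omega> then exp (- h * V \<omega>) - 1 + h * V \<omega> else 0) + (if V \<omega> \<le> 0 then exp (- h * V \<omega>) - 1 + h * V \<omega> else 0) \<partial>N)"
      using layer_cake_exp(1)[OF V_measurable integrable_V that] i2[OF that] by (intro Bochner_Integration.integral_add[symmetric])
    also have "\<dots> = (\<integral>\<omega>. exp (- h * V \<omega>) - 1 + h * V \<omega> \<partial>N)"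
      by (intro Bochner_Integration.integral_cong) auto
    also have "\<dots> = (\<integral>\<omega>. exp (- h * V \<omega>) \<partial>N) - 1 + h * (\<integral>\<omega>. V \<omega> \<partial>N)"
      using exp_V_integrable[of h] that by (simp add: prob_space)
    finally show ?thesis by simp
  qed
  have lim1: "(\<lambda>n. (?g1 (S n) - K0 * (Y * Gamma (- Y)) * S n powr Y) / (S n)\<^sup>2) \<longlonglongrightarrow> (LBINT w:{0<..}. w * tail_diff w)"
  proof -
    \<comment> \<open>The pure power part is subtracted under the integral sign before dividing by
      h^2, so that only \<open>tail_diff\<close> remains.\<close>
    have eq: "(?g1 h - K0 * (Y * Gamma (- Y)) * h powr Y) / h\<^sup>2 = (LBINT w. indicator {0<..} w * ((1 - exp (- (h * w))) / h * tail_diff w))" if "h > 0" for h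
    proof -
      have "has_bochner_integral lborel (\<lambda>w. indicator {0<..} w * (h * (1 - exp (- (h * w))) * prob {\<omega>\<in>space N. V \<omega> \<ge> w})
          - K0 * (indicator {0<..} w * (h * (1 - exp (- (h * w))) * w powr (- Y)))) (?g1 h - K0 * (Y * Gamma (- Y) * h powr Y))"
        by (intro has_bochner_integral_diff has_bochner_integral_mult_right layer_cake_exp(2) has_bochner_integral_1_minus_exp_powr) (use that Y in auto)
      note has_bochner_integral_integral_eq[OF has_bochner_integral_divide_zero[OF this, of "h\<^sup>2"], symmetric]
      then have "(?g1 h - K0 * (Y * Gamma (- Y) * h powr Y)) / h\<^sup>2 = (LBINT w. (indicator {0<..} w * (h * (1 - exp (- (h * w))) * prob {\<omega>\<in>space N. V \<omega> \<ge> w})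
          - K0 * (indicator {0<..} w * (h * (1 - exp (- (h * w))) * w powr (- Y)))) / h\<^sup>2)" .
      also have "\<dots> = (LBINT w. indicator {0<..} w * ((1 - exp (- (h * w))) / h * tail_diff w))"
        using that by (intro Bochner_Integration.integral_cong) (auto simp: tail_diff_def power2_eq_square field_simps)
      finally show ?thesis by (simp add: mult.assoc)
    qed
    have "(\<lambda>n. LBINT w. indicator {0<..} w * ((1 - exp (- (S n * w))) / S n * tail_diff w)) \<longlonglongrightarrow> (LBINT w. indicator {0<..} w * (w * tail_diff w))"
    proof (rule integral_dominated_convergence[OF _ _ tail_diff_integrable])
      show "AE w in lborel. (\<lambda>n. indicator {0<..} w * ((1 - exp (- (S n * w))) / S n * tail_diff w)) \<longlonglongrightarrow> indicator {0<..} w * (w * tail_diff w)"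
      proof (intro always_eventually allI tendsto_intros)
        fix w :: real
        have "((\<lambda>h. (1 - exp (- (h * w))) / h) \<longlongrightarrow> w) (at_right 0)" by real_asymp
        then show "(\<lambda>n. (1 - exp (- (S n * w))) / S n) \<longlonglongrightarrow> w" by (rule filterlim_compose[OF _ S0])
      qed
      show "AE w in lborel. norm (indicator {0<..} w * ((1 - exp (- (S n * w))) / S n * tail_diff w)) \<le> indicator {0<..} w * (w * \<bar>tail_diff w\<bar>)" for n
      proof (intro always_eventually allI)
        fix w :: real
        have le: "\<bar>(1 - exp (- (S n * w))) / S n\<bar> \<le> w" if "w > 0"
        proof -
          have "1 - exp (- (S n * w)) \<le> S n * w" using exp_ge_add_one_self[of "- (S n * w)"] by simp
          moreover have "exp (- (S n * w)) \<le> 1" using that S(1)[of n] by simp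
          ultimately show ?thesis using S(1)[of n] by (simp add: field_simps)
        qed
        show "norm (indicator {0<..} w * ((1 - exp (- (S n * w))) / S n * tail_diff w)) \<le> indicator {0<..} w * (w * \<bar>tail_diff w\<bar>)"
        proof (cases "w > 0")
          case True
          have "\<bar>(1 - exp (- (S n * w))) / S n\<bar> * \<bar>tail_diff w\<bar> \<le> w * \<bar>tail_diff w\<bar>"
            using le[OF True] by (intro mult_right_mono) auto
          then show ?thesis using True by (simp add: abs_mult)
        qed simp
      qed
    qed measurable
    then show ?thesis using S(1) by (simp add: eq set_lebesgue_integral_def)
  qed
  have lim2: "(\<lambda>n. ?g2 (S n) / (S n)\<^sup>2) \<longlonglongrightarrow> (\<integral>\<omega>. (if V \<omega> \<le> 0 then (V \<omega>)\<^sup>2 / 2 else 0) \<partial>N)"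
  proof -
    have "(\<lambda>n. \<integral>\<omega>. (if V \<omega> \<le> 0 then exp (- S n * V \<omega>) - 1 + S n * V \<omega> else 0) / (S n)\<^sup>2 \<partial>N) \<longlonglongrightarrow> (\<integral>\<omega>. (if V \<omega> \<le> 0 then (V \<omega>)\<^sup>2 / 2 else 0) \<partial>N)"
    proof (rule integral_dominated_convergence)
      show "integrable N (\<lambda>\<omega>. 2 * exp (- 2 * U \<omega>))" using exp_U_integrable[of 2] by simp
      show "AE \<omega> in N. (\<lambda>n. (if V \<omega> \<le> 0 then exp (- S n * V \<omega>) - 1 + S n * V \<omega> else 0) / (S n)\<^sup>2) \<longlonglongrightarrow> (if V \<omega> \<le> 0 then (V \<omega>)\<^sup>2 / 2 else 0)"
      proof (intro always_eventually allI)
        fix \<omega>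
        have "((\<lambda>h. (exp (- h * v) - 1 + h * v) / h\<^sup>2) \<longlongrightarrow> v\<^sup>2 / 2) (at_right 0)" for v :: real
          unfolding power2_eq_square[of v] by real_asymp
        then have "(\<lambda>n. (exp (- S n * V \<omega>) - 1 + S n * V \<omega>) / (S n)\<^sup>2) \<longlonglongrightarrow> (V \<omega>)\<^sup>2 / 2" by (rule filterlim_compose[OF _ S0])
        then show "(\<lambda>n. (if V \<omega> \<le> 0 then exp (- S n * V \<omega>) - 1 + S n * V \<omega> else 0) / (S n)\<^sup>2) \<longlonglongrightarrow> (if V \<omega> \<le> 0 then (V \<omega>)\<^sup>2 / 2 else 0)" by simp
      qed
      show "AE \<omega> in N. norm ((if V \<omega> \<le> 0 then exp (- S n * V \<omega>) - 1 + S n * V \<omega> else 0) / (S n)\<^sup>2) \<le> 2 * exp (- 2 * U \<omega>)" for n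
      proof (intro always_eventually allI)
        fix \<omega>
        show "norm ((if V \<omega> \<le> 0 then exp (- S n * V \<omega>) - 1 + S n * V \<omega> else 0) / (S n)\<^sup>2) \<le> 2 * exp (- 2 * U \<omega>)"
        proof (cases "V \<omega> \<le> 0")
          case True
          define y where "y = - V \<omega>"
          have y: "y \<ge> 0" using True by (simp add: y_def)
          have Sy: "0 \<le> S n * y" "S n * y \<le> y" using S(1)[of n] S(2)[of n] y by (auto intro: mult_left_le_one_le less_imp_le)
          \<comment> \<open>With y = -V the majorant arises from y^2 <= 2 exp y and exp(S n y) <=
            exp y; then V >= U replaces it by a multiple of exp(-2 U).\<close>
          have "exp (S n * y) - 1 - S n * y \<le> (S n * y)\<^sup>2 * exp (S n * y)" by (rule exp_minus_1_minus_le[OF Sy(1)])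
          also have "\<dots> = (S n)\<^sup>2 * (y\<^sup>2 * exp (S n * y))" by (simp add: power_mult_distrib)
          also have "\<dots> \<le> (S n)\<^sup>2 * ((2 * exp y) * exp y)"
            using exp_lower_Taylor_quadratic[OF y] y Sy by (intro mult_left_mono mult_mono) auto
          also have "\<dots> = (S n)\<^sup>2 * (2 * exp (- 2 * V \<omega>))" by (simp add: mult_exp_exp y_def)
          also have "\<dots> \<le> (S n)\<^sup>2 * (2 * exp (- 2 * U \<omega>))" using V_ge_U[of \<omega>] by (intro mult_left_mono) auto
          finally have "exp (S n * y) - 1 - S n * y \<le> (S n)\<^sup>2 * (2 * exp (- 2 * U \<omega>))" .
          moreover have "exp (S n * y) - 1 - S n * y \<ge> 0" using exp_ge_add_one_self[of "S n * y"] by linarith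
          ultimately show ?thesis using True S(1)[of n] by (simp add: y_def field_simps)
        qed simp
      qed
    qed measurable
    then show ?thesis by simp
  qed
  have sq: "(\<integral>\<omega>. (if V \<omega> \<le> 0 then (V \<omega>)\<^sup>2 / 2 else 0) \<partial>N) = (\<integral>\<omega>. (V \<omega>)\<^sup>2 * indicator {\<omega>. V \<omega> \<le> 0} \<omega> \<partial>N) / 2"
    unfolding integral_divide_zero[symmetric] by (intro Bochner_Integration.integral_cong) (auto simp: indicator_def)
  have "(\<lambda>n. ?g2 (S n) / (S n)\<^sup>2 + (?g1 (S n) - K0 * (Y * Gamma (- Y)) * S n powr Y) / (S n)\<^sup>2)
     \<longlonglongrightarrow> (\<integral>\<omega>. (V \<omega>)\<^sup>2 * indicator {\<omega>. V \<omega> \<le> 0} \<omega> \<partial>N) / 2 + (LBINT w:{0<..}. w * tail_diff w)"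
    using tendsto_add[OF lim2 lim1] unfolding sq .
  moreover have "((\<integral>\<omega>. exp (- S n * V \<omega>) \<partial>N) - (1 - S n * (\<integral>\<omega>. V \<omega> \<partial>N) + K0 * (Y * Gamma (- Y)) * S n powr Y)) / (S n)\<^sup>2
     = ?g2 (S n) / (S n)\<^sup>2 + (?g1 (S n) - K0 * (Y * Gamma (- Y)) * S n powr Y) / (S n)\<^sup>2" for n
    unfolding add_divide_distrib[symmetric] using dec[OF S(1)[of n]] by (intro arg_cong2[where f="(/)"] refl) linarith
  ultimately show "(\<lambda>n. ((\<integral>\<omega>. exp (- S n * V \<omega>) \<partial>N) - (1 - S n * (\<integral>\<omega>. V \<omega> \<partial>N) + K0 * (Y * Gamma (- Y)) * S n powr Y)) / (S n)\<^sup>2)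
     \<longlonglongrightarrow> (\<integral>\<omega>. (V \<omega>)\<^sup>2 * indicator {\<omega>. V \<omega> \<le> 0} \<omega> \<partial>N) / 2 + (LBINT w:{0<..}. w * tail_diff w)"
    by (simp only:)
qed simp

lemma exp_U_L1: "\<exists>c\<ge>0. \<forall>h. 0 < h \<and> h \<le> 1 \<longrightarrow> (\<integral>\<omega>. \<bar>exp (- h * U \<omega>) - 1\<bar> \<partial>N) \<le> c * h"
proof (intro exI conjI allI impI)
  let ?c = "\<integral>\<omega>. \<bar>U \<omega>\<bar> + exp (- 2 * U \<omega>) \<partial>N"
  show "?c \<ge> 0" by (intro Bochner_Integration.integral_nonneg) auto
  fix h :: real assume h: "0 < h \<and> h \<le> 1"
  have "(\<integral>\<omega>. \<bar>exp (- h * U \<omega>) - 1\<bar> \<partial>N) \<le> (\<integral>\<omega>. h * (\<bar>U \<omega>\<bar> + exp (- 2 * U \<omega>)) \<partial>N)"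
    using exp_U_integrable[of h] exp_U_integrable[of 2] h by (intro integral_mono abs_exp_minus_1_le) auto
  then show "(\<integral>\<omega>. \<bar>exp (- h * U \<omega>) - 1\<bar> \<partial>N) \<le> ?c * h" by (simp add: mult.commute)
qed

text \<open>Rescaling z = \<beta> x turns the quotient into the integral of pZ(\<beta> x) r(x),
  where r is the remainder for a shift by one unit. It vanishes outside [-1, 1] and has integral
  1/2, so continuity of the density at 0 yields the limit. The sign s lets \<beta> tend to 0 from
  the right for both directions of the drift.\<close>

lemma pos_part_Z_expansion:
  assumes s: "s \<in> {1, -1}"
  shows "((\<lambda>\<beta>. (\<integral>\<omega>. max (Z \<omega> + s * \<beta>) 0 - max (Z \<omega>) 0 - s * \<beta> * indicator {0<..} (Z \<omega>) \<partial>N) / \<beta>\<^sup>2) \<longlongrightarrow> pZ 0 / 2) (at_right 0)"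
proof (rule tendsto_at_right_sequentially[of 0 1])
  fix S :: "nat \<Rightarrow> real"
  assume S: "\<And>n. 0 < S n" "\<And>n. S n < 1" "S \<longlonglongrightarrow> 0"
  define r where "r x = max (x + s) 0 - max x 0 - s * indicator {0<..} x" for x :: real
  have [measurable]: "r \<in> borel_measurable borel" unfolding r_def by measurable
  have r_le: "\<bar>r x\<bar> \<le> indicator {-1..1} x" for x
    using s by (auto simp: r_def indicator_def max_def split: if_splits)
  have r_int: "(LBINT x. r x) = 1 / 2"
  proof (cases "s = 1")
    case True
    have "(LBINT x. r x) = (LBINT x. (x + 1) * indicator {-1..0} x)"
      by (intro Bochner_Integration.integral_cong) (auto simp: r_def True indicator_def max_def)
    also have "\<dots> = (0\<^sup>2 / 2 + 0) - ((-1)\<^sup>2 / 2 + (-1))"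
      by (rule integral_FTC_Icc_real) (auto intro!: derivative_eq_intros continuous_intros)
    finally show ?thesis by simp
  next
    case False
    then have s1: "s = - 1" using s by simp
    have "(LBINT x. r x) = (LBINT x. (1 - x) * indicator {0..1} x)"
      by (rule integral_cong_AE) (auto intro!: eventually_mono[OF AE_lborel_singleton[of 0]] simp: r_def s1 indicator_def max_def)
    also have "\<dots> = (1 - 1\<^sup>2 / 2) - (0 - 0\<^sup>2 / 2)"
      by (rule integral_FTC_Icc_real) (auto intro!: derivative_eq_intros continuous_intros)
    finally show ?thesis by simp
  qed
  have eq: "(\<integral>\<omega>. max (Z \<omega> + s * \<beta>) 0 - max (Z \<omega>) 0 - s * \<beta> * indicator {0<..} (Z \<omega>) \<partial>N) / \<beta>\<^sup>2 = (LBINT x. pZ (\<beta> * x) * r x)" if \<beta>: "\<beta> > 0" for \<beta>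
  proof -
    define f where "f z = max (z + s * \<beta>) 0 - max z 0 - s * \<beta> * indicator {0<..} z" for z :: real
    have [measurable]: "f \<in> borel_measurable borel" unfolding f_def by measurable
    have fr: "f (\<beta> * x) = \<beta> * r x" for x
    proof -
      have "max (\<beta> * x + s * \<beta>) 0 = \<beta> * max (x + s) 0" "max (\<beta> * x) 0 = \<beta> * max x 0"
        using \<beta> by (simp_all add: max_mult_distrib_left algebra_simps)
      moreover have "indicator {0<..} (\<beta> * x) = (indicator {0<..} x :: real)"
        using \<beta> by (auto simp: indicator_def zero_less_mult_iff)
      ultimately show ?thesis by (simp add: f_def r_def algebra_simps)
    qed
    have "(\<integral>\<omega>. f (Z \<omega>) \<partial>N) = (\<integral>z. f z \<partial>distr N borel Z)" by (rule integral_distr[symmetric]) measurable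
    also have "\<dots> = (LBINT z. pZ z * f z)"
      unfolding distr_Z using pZ_nonneg by (subst integral_density) auto
    also have "\<dots> = \<beta> * (LBINT x. pZ (\<beta> * x) * f (\<beta> * x))"
      using \<beta> lborel_integral_real_affine[of \<beta> "\<lambda>z. pZ z * f z" 0] by simp
    also have "\<dots> = \<beta>\<^sup>2 * (LBINT x. pZ (\<beta> * x) * r x)"
    proof -
      have "(\<lambda>x. pZ (\<beta> * x) * f (\<beta> * x)) = (\<lambda>x. \<beta> * (pZ (\<beta> * x) * r x))" by (auto simp: fr)
      then show ?thesis by (simp add: power2_eq_square)
    qed
    finally show ?thesis using \<beta> by (simp add: f_def)
  qed
  have "(\<lambda>n. LBINT x. pZ (S n * x) * r x) \<longlonglongrightarrow> (LBINT x. pZ 0 * r x)"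
  proof (rule integral_dominated_convergence)
    have "integrable lborel (indicator {-1..1 :: real} :: real \<Rightarrow> real)"
      by (intro integrable_real_indicator) (auto simp: emeasure_lborel_Icc_eq)
    then show "integrable lborel (\<lambda>x :: real. pZ_bound * indicator {-1..1} x)" by simp
    show "AE x in lborel. (\<lambda>n. pZ (S n * x) * r x) \<longlonglongrightarrow> pZ 0 * r x"
    proof (intro always_eventually allI tendsto_mult tendsto_const)
      fix x :: real
      have "(\<lambda>n. S n * x) \<longlonglongrightarrow> 0 * x" by (intro tendsto_intros S)
      moreover have "isCont pZ (0 * x)" using pZ_continuous by (simp add: continuous_on_eq_continuous_at)
      ultimately show "(\<lambda>n. pZ (S n * x)) \<longlonglongrightarrow> pZ 0" using isCont_tendsto_compose by fastforce
    qed
    show "AE x in lborel. norm (pZ (S n * x) * r x) \<le> pZ_bound * indicator {-1..1} x" for n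
    proof (intro always_eventually allI)
      fix x :: real
      have "\<bar>pZ (S n * x)\<bar> * \<bar>r x\<bar> \<le> pZ_bound * indicator {-1..1} x"
        by (intro mult_mono pZ_le r_le pZ_bound_nonneg abs_ge_zero)
      then show "norm (pZ (S n * x) * r x) \<le> pZ_bound * indicator {-1..1} x" by (simp add: abs_mult)
    qed
  qed measurable
  then show "(\<lambda>n. (\<integral>\<omega>. max (Z \<omega> + s * S n) 0 - max (Z \<omega>) 0 - s * S n * indicator {0<..} (Z \<omega>) \<partial>N) / (S n)\<^sup>2) \<longlonglongrightarrow> pZ 0 / 2"
    using S(1) by (simp add: eq r_int)
qed simp

lemma integrable_mult_bounded:
  fixes f g :: "'b \<Rightarrow> real"
  assumes "integrable N f" "g \<in> borel_measurable N" "\<And>\<omega>. \<bar>g \<omega>\<bar> \<le> c"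
  shows "integrable N (\<lambda>\<omega>. f \<omega> * g \<omega>)"
proof (rule Bochner_Integration.integrable_bound[OF integrable_mult_right[OF integrable_abs[OF assms(1)], of c]])
  have "c \<ge> 0" using assms(3)[of undefined] by linarith
  then show "AE \<omega> in N. norm (f \<omega> * g \<omega>) \<le> norm (c * \<bar>f \<omega>\<bar>)"
    using assms(3) by (intro always_eventually allI) (auto simp: abs_mult mult.commute[of c] intro: mult_left_mono)
qed (use assms in measurable)

text \<open>The increment is at most |a|; replacing the weight by 1 costs a factor of order h in
  mean, replacing \<open>\<psi>\<close> by the positive part a factor h |Z| + |a|. For a = \<gamma>
  t and h = t powr (1/Y) the total is of order t h, which is o(h^2) since t / h tends to 0.\<close>

lemma drift_correction:
  assumes c: "\<And>h. 0 < h \<Longrightarrow> h \<le> 1 \<Longrightarrow> (\<integral>\<omega>. \<bar>exp (- h * U \<omega>) - 1\<bar> \<partial>N) \<le> c * h" and h: "0 < h" "h \<le> 1"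
  shows "\<bar>(\<integral>\<omega>. exp (- h * U \<omega>) * (\<psi> (h * Z \<omega> + a) - \<psi> (h * Z \<omega>)) \<partial>N) - (\<integral>\<omega>. max (h * Z \<omega> + a) 0 - max (h * Z \<omega>) 0 \<partial>N)\<bar>
     \<le> \<bar>a\<bar> * (c * h + h * (\<integral>\<omega>. \<bar>Z \<omega>\<bar> \<partial>N) + \<bar>a\<bar>)"
proof -
  let ?p = "\<lambda>\<omega>. \<psi> (h * Z \<omega> + a) - \<psi> (h * Z \<omega>)" and ?q = "\<lambda>\<omega>. max (h * Z \<omega> + a) 0 - max (h * Z \<omega>) 0"
  have iU: "integrable N (\<lambda>\<omega>. exp (- h * U \<omega>))" using exp_U_integrable[of h] h by simp
  have i1: "integrable N (\<lambda>\<omega>. exp (- h * U \<omega>) * ?p \<omega>)"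
  proof (rule integrable_mult_bounded[OF iU, where c="\<bar>a\<bar>"])
    show "\<bar>?p \<omega>\<bar> \<le> \<bar>a\<bar>" for \<omega> using \<psi>_increment(1)[of "h * Z \<omega> + a" "h * Z \<omega>"] by simp
  qed measurable
  have i2: "integrable N ?q" by auto
  have pt: "\<bar>exp (- h * U \<omega>) * ?p \<omega> - ?q \<omega>\<bar> \<le> \<bar>a\<bar> * (\<bar>exp (- h * U \<omega>) - 1\<bar> + h * \<bar>Z \<omega>\<bar> + \<bar>a\<bar>)" for \<omega>
  proof -
    have "exp (- h * U \<omega>) * ?p \<omega> - ?q \<omega> = (exp (- h * U \<omega>) - 1) * ?p \<omega> + (?p \<omega> - ?q \<omega>)" by (simp add: algebra_simps)
    then have "\<bar>exp (- h * U \<omega>) * ?p \<omega> - ?q \<omega>\<bar> \<le> \<bar>exp (- h * U \<omega>) - 1\<bar> * \<bar>?p \<omega>\<bar> + \<bar>?p \<omega> - ?q \<omega>\<bar>"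
      by (simp only:) (metis abs_triangle_ineq abs_mult)
    also have "\<bar>exp (- h * U \<omega>) - 1\<bar> * \<bar>?p \<omega>\<bar> \<le> \<bar>exp (- h * U \<omega>) - 1\<bar> * \<bar>a\<bar>"
      using \<psi>_increment(1)[of "h * Z \<omega> + a" "h * Z \<omega>"] by (intro mult_left_mono) auto
    also have "\<bar>?p \<omega> - ?q \<omega>\<bar> \<le> \<bar>a\<bar> * min 1 (\<bar>h * Z \<omega>\<bar> + \<bar>a\<bar>)"
      using \<psi>_increment(2)[of "h * Z \<omega> + a" "h * Z \<omega>"] by simp
    also have "\<dots> \<le> \<bar>a\<bar> * (h * \<bar>Z \<omega>\<bar> + \<bar>a\<bar>)" using h by (intro mult_left_mono) (auto simp: abs_mult)
    finally show ?thesis by (simp add: algebra_simps)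
  qed
  have "\<bar>(\<integral>\<omega>. exp (- h * U \<omega>) * ?p \<omega> \<partial>N) - (\<integral>\<omega>. ?q \<omega> \<partial>N)\<bar> = \<bar>\<integral>\<omega>. exp (- h * U \<omega>) * ?p \<omega> - ?q \<omega> \<partial>N\<bar>"
    using Bochner_Integration.integral_diff[OF i1 i2] by simp
  also have "\<dots> \<le> (\<integral>\<omega>. \<bar>exp (- h * U \<omega>) * ?p \<omega> - ?q \<omega>\<bar> \<partial>N)" by (rule integral_abs_bound)
  also have "\<dots> \<le> (\<integral>\<omega>. \<bar>a\<bar> * (\<bar>exp (- h * U \<omega>) - 1\<bar> + h * \<bar>Z \<omega>\<bar> + \<bar>a\<bar>) \<partial>N)"
    using iU i1 i2 by (intro integral_mono pt) auto
  also have "\<dots> = \<bar>a\<bar> * ((\<integral>\<omega>. \<bar>exp (- h * U \<omega>) - 1\<bar> \<partial>N) + h * (\<integral>\<omega>. \<bar>Z \<omega>\<bar> \<partial>N) + \<bar>a\<bar>)"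
    using iU by (simp add: prob_space)
  also have "\<dots> \<le> \<bar>a\<bar> * (c * h + h * (\<integral>\<omega>. \<bar>Z \<omega>\<bar> \<partial>N) + \<bar>a\<bar>)"
    using c[OF h] by (intro mult_left_mono) auto
  finally show ?thesis .
qed

text \<open>The two events differ only if \<open>Z\<close> falls between (x - a) / h and x / h, an
  interval of length |a| / h on which the density is bounded.\<close>

lemma prob_Z_shift:
  assumes h: "0 < h"
  shows "\<bar>prob {\<omega>\<in>space N. h * Z \<omega> + a \<ge> x} - prob {\<omega>\<in>space N. h * Z \<omega> \<ge> x}\<bar> \<le> pZ_bound * (\<bar>a\<bar> / h)"
proof -
  let ?l = "min ((x - a) / h) (x / h)" and ?r = "max ((x - a) / h) (x / h)"
  \<comment> \<open>The interval estimate is for half-open intervals, hence the left endpoint is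
    added as a null event.\<close>
  let ?I = "{\<omega>\<in>space N. ?l < Z \<omega> \<and> Z \<omega> \<le> ?r} \<union> {\<omega>\<in>space N. Z \<omega> = ?l}"
  have "prob ?I \<le> prob {\<omega>\<in>space N. ?l < Z \<omega> \<and> Z \<omega> \<le> ?r} + prob {\<omega>\<in>space N. Z \<omega> = ?l}"
    by (rule measure_Un_le) measurable
  also have "\<dots> \<le> pZ_bound * (?r - ?l) + 0"
    using prob_Z_interval[of ?l ?r] prob_Z_eq[of ?l] by (intro add_mono) auto
  also have "?r - ?l = \<bar>a\<bar> / h"
  proof -
    have "?r - ?l = \<bar>(x - a) / h - x / h\<bar>" by (simp add: max_def min_def)
    also have "(x - a) / h - x / h = - a / h" by (simp add: diff_divide_distrib)
    finally show ?thesis using h by simp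
  qed
  finally have I: "prob ?I \<le> pZ_bound * (\<bar>a\<bar> / h)" by simp
  have e: "h * Z \<omega> + a \<ge> x \<longleftrightarrow> (x - a) / h \<le> Z \<omega>" "h * Z \<omega> \<ge> x \<longleftrightarrow> x / h \<le> Z \<omega>" for \<omega>
    using h by (auto simp: field_simps)
  have mI: "?I \<in> events" by measurable
  have sub: "prob A1 \<le> prob A2 + prob ?I" if "A1 \<subseteq> A2 \<union> ?I" "A2 \<in> events" for A1 A2
  proof -
    have "prob A1 \<le> prob (A2 \<union> ?I)" using that mI by (intro finite_measure_mono) auto
    also have "\<dots> \<le> prob A2 + prob ?I" using that mI by (intro measure_Un_le) auto
    finally show ?thesis .
  qed
  have "prob {\<omega>\<in>space N. h * Z \<omega> + a \<ge> x} \<le> prob {\<omega>\<in>space N. h * Z \<omega> \<ge> x} + prob ?I"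
    unfolding e by (rule sub) auto
  moreover have "prob {\<omega>\<in>space N. h * Z \<omega> \<ge> x} \<le> prob {\<omega>\<in>space N. h * Z \<omega> + a \<ge> x} + prob ?I"
    unfolding e by (rule sub) auto
  ultimately show ?thesis using I by linarith
qed

text \<open>Every error retains the factor |\<kappa>|: the weight differs from 1 by d in mean,
  \<open>\<psi>\<close> is close to the positive part, the shift of the positive part is evaluated
  exactly, and removing the drift a from the probabilities costs |a| / h. The factor 3 is made up of
  2 for exp(-\<kappa>) - 1 and 1 for the increment of \<open>\<psi>\<close>.\<close>

lemma strike_correction:
  assumes W: "W \<in> borel_measurable N" "\<And>\<omega>. W \<omega> \<ge> 0" "integrable N W" and d: "(\<integral>\<omega>. \<bar>W \<omega> - 1\<bar> \<partial>N) \<le> d"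
    and h: "0 < h" and \<kappa>: "\<bar>\<kappa>\<bar> \<le> 1"
  shows "\<bar>(\<integral>\<omega>. W \<omega> * (exp (- \<kappa>) * \<psi> (h * Z \<omega> + a - \<kappa>)) \<partial>N) - (\<integral>\<omega>. W \<omega> * \<psi> (h * Z \<omega> + a) \<partial>N)
       + \<kappa> * (LBINT w:{0..1}. prob {\<omega>\<in>space N. h * Z \<omega> \<ge> \<kappa> * w})\<bar>
     \<le> \<bar>\<kappa>\<bar> * (3 * (d + h * (\<integral>\<omega>. \<bar>Z \<omega>\<bar> \<partial>N) + \<bar>a\<bar> + \<bar>\<kappa>\<bar>) + pZ_bound * (\<bar>a\<bar> / h))"
proof -
  define X where "X \<omega> = h * Z \<omega> + a" for \<omega>
  have [measurable]: "X \<in> borel_measurable N" "W \<in> borel_measurable N" unfolding X_def using W by auto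
  have iX: "integrable N X" unfolding X_def by auto
  let ?p = "\<lambda>\<omega>. exp (- \<kappa>) * \<psi> (X \<omega> - \<kappa>) - \<psi> (X \<omega>)" and ?q = "\<lambda>\<omega>. max (X \<omega> - \<kappa>) 0 - max (X \<omega>) 0"
  \<comment> \<open>The factor 2 for negative \<kappa> comes from exp x <= 1 + x + x^2 on [0, 1]
    with x^2 <= x.\<close>
  have ek: "\<bar>exp (- \<kappa>) - 1\<bar> \<le> 2 * \<bar>\<kappa>\<bar>"
  proof -
    have "exp (- \<kappa>) \<ge> 1 - \<kappa>" using exp_ge_add_one_self[of "- \<kappa>"] by simp
    moreover have "exp (- \<kappa>) \<le> 1 + 2 * \<bar>\<kappa>\<bar>"
    proof (cases "\<kappa> \<ge> 0")
      case True
      then have "exp (- \<kappa>) \<le> 1" by simp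
      then show ?thesis using True by linarith
    next
      case False
      then have "exp (- \<kappa>) \<le> 1 + (- \<kappa>) + (- \<kappa>)\<^sup>2" using \<kappa> by (intro exp_bound) auto
      also have "(- \<kappa>)\<^sup>2 \<le> - \<kappa>" using False \<kappa> mult_left_le[of "- \<kappa>" "- \<kappa>"] by (simp add: power2_eq_square)
      finally show ?thesis using False by simp
    qed
    ultimately show ?thesis by (auto simp: abs_le_iff)
  qed
  have inc: "\<bar>\<psi> (X \<omega> - \<kappa>) - \<psi> (X \<omega>)\<bar> \<le> \<bar>\<kappa>\<bar>" "\<bar>\<psi> (X \<omega> - \<kappa>) - \<psi> (X \<omega>) - ?q \<omega>\<bar> \<le> \<bar>\<kappa>\<bar> * (\<bar>X \<omega>\<bar> + \<bar>\<kappa>\<bar>)" for \<omega>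
  proof -
    show "\<bar>\<psi> (X \<omega> - \<kappa>) - \<psi> (X \<omega>)\<bar> \<le> \<bar>\<kappa>\<bar>" using \<psi>_increment(1)[of "X \<omega> - \<kappa>" "X \<omega>"] by simp
    have "\<bar>\<psi> (X \<omega> - \<kappa>) - \<psi> (X \<omega>) - ?q \<omega>\<bar> \<le> \<bar>\<kappa>\<bar> * min 1 (\<bar>X \<omega>\<bar> + \<bar>\<kappa>\<bar>)" using \<psi>_increment(2)[of "X \<omega> - \<kappa>" "X \<omega>"] by simp
    also have "\<dots> \<le> \<bar>\<kappa>\<bar> * (\<bar>X \<omega>\<bar> + \<bar>\<kappa>\<bar>)" by (intro mult_left_mono) auto
    finally show "\<bar>\<psi> (X \<omega> - \<kappa>) - \<psi> (X \<omega>) - ?q \<omega>\<bar> \<le> \<bar>\<kappa>\<bar> * (\<bar>X \<omega>\<bar> + \<bar>\<kappa>\<bar>)" .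
  qed
  have psi_le: "\<psi> (X \<omega> - \<kappa>) \<le> \<bar>X \<omega>\<bar> + \<bar>\<kappa>\<bar>" for \<omega> using \<psi>_bounds(3)[of "X \<omega> - \<kappa>"] by linarith
  have p_eq: "?p \<omega> = (exp (- \<kappa>) - 1) * \<psi> (X \<omega> - \<kappa>) + (\<psi> (X \<omega> - \<kappa>) - \<psi> (X \<omega>))" for \<omega> by (simp add: algebra_simps)
  have t1: "\<bar>(exp (- \<kappa>) - 1) * \<psi> (X \<omega> - \<kappa>)\<bar> \<le> 2 * \<bar>\<kappa>\<bar> * m" if "\<psi> (X \<omega> - \<kappa>) \<le> m" for \<omega> m
    unfolding abs_mult using ek \<psi>_bounds(1)[of "X \<omega> - \<kappa>"] that by (intro mult_mono) auto
  have p_le: "\<bar>?p \<omega>\<bar> \<le> 3 * \<bar>\<kappa>\<bar>" for \<omega>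
  proof -
    have "\<bar>?p \<omega>\<bar> \<le> \<bar>(exp (- \<kappa>) - 1) * \<psi> (X \<omega> - \<kappa>)\<bar> + \<bar>\<psi> (X \<omega> - \<kappa>) - \<psi> (X \<omega>)\<bar>"
      unfolding p_eq by (rule abs_triangle_ineq)
    then show ?thesis using t1[OF \<psi>_bounds(2)[of "X \<omega> - \<kappa>"]] inc(1)[of \<omega>] by simp
  qed
  have pq_le: "\<bar>?p \<omega> - ?q \<omega>\<bar> \<le> 3 * \<bar>\<kappa>\<bar> * (\<bar>X \<omega>\<bar> + \<bar>\<kappa>\<bar>)" for \<omega>
  proof -
    have "\<bar>?p \<omega> - ?q \<omega>\<bar> \<le> \<bar>(exp (- \<kappa>) - 1) * \<psi> (X \<omega> - \<kappa>)\<bar> + \<bar>\<psi> (X \<omega> - \<kappa>) - \<psi> (X \<omega>) - ?q \<omega>\<bar>"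
      unfolding p_eq add_diff_eq[symmetric] by (rule abs_triangle_ineq)
    also have "\<dots> \<le> 2 * \<bar>\<kappa>\<bar> * (\<bar>X \<omega>\<bar> + \<bar>\<kappa>\<bar>) + \<bar>\<kappa>\<bar> * (\<bar>X \<omega>\<bar> + \<bar>\<kappa>\<bar>)"
      by (intro add_mono t1 psi_le inc(2))
    finally show ?thesis by simp
  qed
  have i0: "integrable N (\<lambda>\<omega>. W \<omega> * (exp (- \<kappa>) * \<psi> (X \<omega> - \<kappa>)))" "integrable N (\<lambda>\<omega>. W \<omega> * \<psi> (X \<omega>))"
  proof -
    have b1: "\<bar>exp (- \<kappa>) * \<psi> (X \<omega> - \<kappa>)\<bar> \<le> exp (- \<kappa>)" for \<omega> using \<psi>_bounds(1,2)[of "X \<omega> - \<kappa>"] by (simp add: abs_mult)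
    show "integrable N (\<lambda>\<omega>. W \<omega> * (exp (- \<kappa>) * \<psi> (X \<omega> - \<kappa>)))" by (rule integrable_mult_bounded[OF W(3) _ b1]) measurable
    have b2: "\<bar>\<psi> (X \<omega>)\<bar> \<le> 1" for \<omega> using \<psi>_bounds(1,2)[of "X \<omega>"] by simp
    show "integrable N (\<lambda>\<omega>. W \<omega> * \<psi> (X \<omega>))" by (rule integrable_mult_bounded[OF W(3) _ b2]) measurable
  qed
  have i1: "integrable N (\<lambda>\<omega>. W \<omega> * ?p \<omega>)" using Bochner_Integration.integrable_diff[OF i0] by (simp add: right_diff_distrib)
  have i2: "integrable N ?q" using iX by auto
  have pt: "\<bar>W \<omega> * ?p \<omega> - ?q \<omega>\<bar> \<le> 3 * \<bar>\<kappa>\<bar> * (\<bar>W \<omega> - 1\<bar> + (h * \<bar>Z \<omega>\<bar> + \<bar>a\<bar> + \<bar>\<kappa>\<bar>))" for \<omega>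
  proof -
    have "W \<omega> * ?p \<omega> - ?q \<omega> = (W \<omega> - 1) * ?p \<omega> + (?p \<omega> - ?q \<omega>)" by (simp add: algebra_simps)
    then have "\<bar>W \<omega> * ?p \<omega> - ?q \<omega>\<bar> \<le> \<bar>W \<omega> - 1\<bar> * \<bar>?p \<omega>\<bar> + \<bar>?p \<omega> - ?q \<omega>\<bar>"
      by (simp only:) (metis abs_triangle_ineq abs_mult)
    also have "\<bar>W \<omega> - 1\<bar> * \<bar>?p \<omega>\<bar> \<le> \<bar>W \<omega> - 1\<bar> * (3 * \<bar>\<kappa>\<bar>)" by (intro mult_left_mono p_le) auto
    also have "\<bar>?p \<omega> - ?q \<omega>\<bar> \<le> 3 * \<bar>\<kappa>\<bar> * (\<bar>X \<omega>\<bar> + \<bar>\<kappa>\<bar>)" by (rule pq_le)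
    also have "\<dots> \<le> 3 * \<bar>\<kappa>\<bar> * (h * \<bar>Z \<omega>\<bar> + \<bar>a\<bar> + \<bar>\<kappa>\<bar>)"
    proof (intro mult_left_mono)
      have "\<bar>X \<omega>\<bar> \<le> \<bar>h * Z \<omega>\<bar> + \<bar>a\<bar>" unfolding X_def by (rule abs_triangle_ineq)
      then show "\<bar>X \<omega>\<bar> + \<bar>\<kappa>\<bar> \<le> h * \<bar>Z \<omega>\<bar> + \<bar>a\<bar> + \<bar>\<kappa>\<bar>" using h by (simp add: abs_mult)
    qed auto
    finally show ?thesis by (simp add: algebra_simps)
  qed
  have "\<bar>(\<integral>\<omega>. W \<omega> * ?p \<omega> \<partial>N) - (\<integral>\<omega>. ?q \<omega> \<partial>N)\<bar> = \<bar>\<integral>\<omega>. W \<omega> * ?p \<omega> - ?q \<omega> \<partial>N\<bar>"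
    using Bochner_Integration.integral_diff[OF i1 i2] by simp
  also have "\<dots> \<le> (\<integral>\<omega>. \<bar>W \<omega> * ?p \<omega> - ?q \<omega>\<bar> \<partial>N)" by (rule integral_abs_bound)
  also have "\<dots> \<le> (\<integral>\<omega>. 3 * \<bar>\<kappa>\<bar> * (\<bar>W \<omega> - 1\<bar> + (h * \<bar>Z \<omega>\<bar> + \<bar>a\<bar> + \<bar>\<kappa>\<bar>)) \<partial>N)"
    using W(3) i1 i2 by (intro integral_mono pt) auto
  also have "\<dots> = 3 * \<bar>\<kappa>\<bar> * ((\<integral>\<omega>. \<bar>W \<omega> - 1\<bar> \<partial>N) + (h * (\<integral>\<omega>. \<bar>Z \<omega>\<bar> \<partial>N) + \<bar>a\<bar> + \<bar>\<kappa>\<bar>))"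
    using W(3) by (simp add: prob_space)
  also have "\<dots> \<le> 3 * \<bar>\<kappa>\<bar> * (d + (h * (\<integral>\<omega>. \<bar>Z \<omega>\<bar> \<partial>N) + \<bar>a\<bar> + \<bar>\<kappa>\<bar>))"
    using d by (intro mult_left_mono) auto
  finally have E1: "\<bar>(\<integral>\<omega>. W \<omega> * ?p \<omega> \<partial>N) - (\<integral>\<omega>. ?q \<omega> \<partial>N)\<bar> \<le> 3 * \<bar>\<kappa>\<bar> * (d + (h * (\<integral>\<omega>. \<bar>Z \<omega>\<bar> \<partial>N) + \<bar>a\<bar> + \<bar>\<kappa>\<bar>))" .
  let ?F = "\<lambda>w. prob {\<omega>\<in>space N. X \<omega> \<ge> \<kappa> * w}" and ?G = "\<lambda>w. prob {\<omega>\<in>space N. h * Z \<omega> \<ge> \<kappa> * w}"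
  have q_eq: "(\<integral>\<omega>. ?q \<omega> \<partial>N) = - (\<kappa> * (LBINT w:{0..1}. ?F w))"
  proof -
    have "(\<integral>\<omega>. ?q \<omega> \<partial>N) = - (\<integral>\<omega>. max (X \<omega>) 0 - max (X \<omega> - \<kappa>) 0 \<partial>N)"
      by (subst Bochner_Integration.integral_minus[symmetric]) simp
    then show ?thesis unfolding integral_pos_part_diff[OF iX] .
  qed
  have int01: "set_integrable lborel {0..1} (\<lambda>w. prob {\<omega>\<in>space N. Q \<omega> \<ge> \<kappa> * w})" if "Q \<in> borel_measurable N" for Q
  proof (rule set_integrable_bound[where f="\<lambda>_. 1 :: real"])
    show "set_integrable lborel {0..1} (\<lambda>_ :: real. 1 :: real)" by (intro borel_integrable_atLeastAtMost' continuous_intros)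
    have "(\<lambda>w. prob {\<omega>\<in>space N. Q \<omega> \<ge> \<kappa> * w}) \<in> borel_measurable borel"
      by (rule measurable_compose[OF _ prob_ge_measurable[OF that]]) measurable
    then show "set_borel_measurable lborel {0..1} (\<lambda>w. prob {\<omega>\<in>space N. Q \<omega> \<ge> \<kappa> * w})"
      unfolding set_borel_measurable_def by measurable
  qed auto
  have FG: "\<bar>(LBINT w:{0..1}. ?F w) - (LBINT w:{0..1}. ?G w)\<bar> \<le> pZ_bound * (\<bar>a\<bar> / h)"
  proof -
    have iF: "set_integrable lborel {0..1} ?F" and iG: "set_integrable lborel {0..1} ?G" by (rule int01; measurable)+
    have "\<bar>(LBINT w:{0..1}. ?F w) - (LBINT w:{0..1}. ?G w)\<bar> = \<bar>LBINT w:{0..1}. ?F w - ?G w\<bar>"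
      using set_integral_diff(2)[OF iF iG] by simp
    also have "\<dots> \<le> (LBINT w:{0..1}. \<bar>?F w - ?G w\<bar>)"
      using set_integral_norm_bound[OF set_integral_diff(1)[OF iF iG]] by simp
    also have "\<dots> \<le> (LBINT w:{0..1 :: real}. pZ_bound * (\<bar>a\<bar> / h))"
    proof (rule set_integral_mono)
      show "set_integrable lborel {0..1} (\<lambda>w. \<bar>?F w - ?G w\<bar>)" by (rule set_integrable_abs[OF set_integral_diff(1)[OF iF iG]])
      show "set_integrable lborel {0..1} (\<lambda>_ :: real. pZ_bound * (\<bar>a\<bar> / h))" by (intro borel_integrable_atLeastAtMost' continuous_on_const)
      show "\<bar>?F w - ?G w\<bar> \<le> pZ_bound * (\<bar>a\<bar> / h)" for w
        unfolding X_def by (rule prob_Z_shift[OF h])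
    qed
    also have "\<dots> = pZ_bound * (\<bar>a\<bar> / h)" by (simp add: set_lebesgue_integral_def)
    finally show ?thesis .
  qed
  have "(\<integral>\<omega>. W \<omega> * ?p \<omega> \<partial>N) = (\<integral>\<omega>. W \<omega> * (exp (- \<kappa>) * \<psi> (X \<omega> - \<kappa>)) \<partial>N) - (\<integral>\<omega>. W \<omega> * \<psi> (X \<omega>) \<partial>N)"
    unfolding right_diff_distrib by (rule Bochner_Integration.integral_diff[OF i0])
  then have E2: "(\<integral>\<omega>. W \<omega> * (exp (- \<kappa>) * \<psi> (X \<omega> - \<kappa>)) \<partial>N) - (\<integral>\<omega>. W \<omega> * \<psi> (X \<omega>) \<partial>N) + \<kappa> * (LBINT w:{0..1}. ?G w)
    = ((\<integral>\<omega>. W \<omega> * ?p \<omega> \<partial>N) - (\<integral>\<omega>. ?q \<omega> \<partial>N)) - \<kappa> * ((LBINT w:{0..1}. ?F w) - (LBINT w:{0..1}. ?G w))"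
    unfolding q_eq by (simp add: algebra_simps)
  have E3: "\<bar>\<kappa> * ((LBINT w:{0..1}. ?F w) - (LBINT w:{0..1}. ?G w))\<bar> \<le> \<bar>\<kappa>\<bar> * (pZ_bound * (\<bar>a\<bar> / h))"
    unfolding abs_mult by (rule mult_left_mono[OF FG abs_ge_zero])
  have "\<bar>((\<integral>\<omega>. W \<omega> * ?p \<omega> \<partial>N) - (\<integral>\<omega>. ?q \<omega> \<partial>N)) - \<kappa> * ((LBINT w:{0..1}. ?F w) - (LBINT w:{0..1}. ?G w))\<bar>
      \<le> 3 * \<bar>\<kappa>\<bar> * (d + (h * (\<integral>\<omega>. \<bar>Z \<omega>\<bar> \<partial>N) + \<bar>a\<bar> + \<bar>\<kappa>\<bar>)) + \<bar>\<kappa>\<bar> * (pZ_bound * (\<bar>a\<bar> / h))"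
    by (rule order_trans[OF abs_triangle_ineq4 add_mono[OF E1 E3]])
  also have "\<dots> = \<bar>\<kappa>\<bar> * (3 * (d + h * (\<integral>\<omega>. \<bar>Z \<omega>\<bar> \<partial>N) + \<bar>a\<bar> + \<bar>\<kappa>\<bar>) + pZ_bound * (\<bar>a\<bar> / h))"
    by (simp add: algebra_simps)
  finally show ?thesis unfolding E2[symmetric] unfolding X_def .
qed

end

lemma powr_tendsto_0_at_right:
  fixes a :: real assumes "a > 0" shows "((\<lambda>t. t powr a) \<longlongrightarrow> 0) (at_right 0)"
  using assms by real_asymp

section \<open>The expansion at the money\<close>

context stable_pair
begin

definition shift_mean where "shift_mean b = (\<integral>\<omega>. max (Z \<omega> + b) 0 - max (Z \<omega>) 0 \<partial>N)"

text \<open>Remainder of the second-order Taylor formula at b = 0: the slope is P(Z > 0) = 1/2 and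
  the curvature is the density at 0.\<close>

definition shift_rest where "shift_rest b = shift_mean b - b / 2 - pZ 0 / 2 * b\<^sup>2"

lemma shift_rest_0: "shift_rest 0 = 0"
  by (simp add: shift_rest_def shift_mean_def)

lemma shift_rest_small:
  assumes s: "s \<in> {1, -1}"
  shows "((\<lambda>\<beta>. shift_rest (s * \<beta>) / \<beta>\<^sup>2) \<longlongrightarrow> 0) (at_right 0)"
proof -
  have "(\<integral>\<omega>. indicator {0<..} (Z \<omega>) \<partial>N) = (1 / 2 :: real)"
  proof -
    have "(\<integral>\<omega>. indicator {0<..} (Z \<omega>) \<partial>N) = (\<integral>\<omega>. indicator {\<omega>\<in>space N. Z \<omega> > 0} \<omega> \<partial>N :: real)"
      by (intro Bochner_Integration.integral_cong) (auto simp: indicator_def)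
    then show ?thesis using prob_Z_pos by simp
  qed
  then have e: "(\<integral>\<omega>. max (Z \<omega> + b) 0 - max (Z \<omega>) 0 - b * indicator {0<..} (Z \<omega>) \<partial>N) = shift_mean b - b / 2" for b :: real
  proof -
    have "integrable N (\<lambda>\<omega>. indicator {0<..} (Z \<omega>) :: real)" by (intro integrable_const_bound[where B=1]) auto
    moreover have "integrable N (\<lambda>\<omega>. max (Z \<omega> + b) 0 - max (Z \<omega>) 0)" unfolding max_0_eq by auto
    ultimately show ?thesis unfolding shift_mean_def using \<open>_ = 1/2\<close> by simp
  qed
  have "((\<lambda>\<beta>. (shift_mean (s * \<beta>) - s * \<beta> / 2) / \<beta>\<^sup>2 - pZ 0 / 2) \<longlongrightarrow> pZ 0 / 2 - pZ 0 / 2) (at_right 0)"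
    using pos_part_Z_expansion[OF s] unfolding e by (rule tendsto_diff[OF _ tendsto_const])
  moreover have "eventually (\<lambda>\<beta>. (shift_mean (s * \<beta>) - s * \<beta> / 2) / \<beta>\<^sup>2 - pZ 0 / 2 = shift_rest (s * \<beta>) / \<beta>\<^sup>2) (at_right 0)"
    using eventually_at_right_less[of "0 :: real"] by eventually_elim (use s in \<open>auto simp: shift_rest_def divide_simps\<close>)
  ultimately show ?thesis by (auto elim: Lim_transform_eventually)
qed

lemma abs_shift_mean_le: "\<bar>shift_mean b\<bar> \<le> \<bar>b\<bar>"
proof -
  have i: "integrable N (\<lambda>\<omega>. max (Z \<omega> + b) 0 - max (Z \<omega>) 0)" unfolding max_0_eq by auto
  have "\<bar>shift_mean b\<bar> \<le> (\<integral>\<omega>. \<bar>max (Z \<omega> + b) 0 - max (Z \<omega>) 0\<bar> \<partial>N)" unfolding shift_mean_def by (rule integral_abs_bound)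
  also have "\<dots> \<le> (\<integral>\<omega>. \<bar>b\<bar> \<partial>N)" using i by (intro integral_mono) auto
  finally show ?thesis by (simp add: prob_space)
qed

lemma shift_mean_scale:
  assumes "h > 0" shows "(\<integral>\<omega>. max (h * Z \<omega> + h * b) 0 - max (h * Z \<omega>) 0 \<partial>N) = h * shift_mean b"
proof -
  have "max (h * Z \<omega> + h * b) 0 - max (h * Z \<omega>) 0 = h * (max (Z \<omega> + b) 0 - max (Z \<omega>) 0)" for \<omega>
  proof -
    have "max (h * x) 0 = h * max x 0" for x :: real using assms by (simp add: max_def zero_le_mult_iff mult_le_0_iff)
    from this[of "Z \<omega> + b"] this[of "Z \<omega>"] show ?thesis by (simp add: algebra_simps)
  qed
  then show ?thesis by (simp add: shift_mean_def)
qed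

text \<open>The weight times \<open>\<psi>\<close> telescopes to exp(-h U) - exp(-h V); the first
  transform is known in closed form, the second is the one expanded above.\<close>

lemma exp_psi_Z:
  assumes h: "h > 0"
  shows "(\<integral>\<omega>. exp (- h * U \<omega>) * \<psi> (h * Z \<omega>) \<partial>N) = exp (\<eta> * h powr Y) - (\<integral>\<omega>. exp (- h * V \<omega>) \<partial>N)"
proof -
  have "exp (- h * U \<omega>) * \<psi> (h * Z \<omega>) = exp (- h * U \<omega>) - exp (- h * V \<omega>)" for \<omega>
  proof -
    have "max (h * Z \<omega>) 0 = h * max (Z \<omega>) 0" using h by (simp add: max_def zero_le_mult_iff mult_le_0_iff)
    then show ?thesis unfolding \<psi>_def V_def by (simp add: right_diff_distrib exp_add[symmetric] algebra_simps)
  qed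
  then show ?thesis using exp_U[OF h] exp_U_integrable[of h] exp_V_integrable[of h] h by simp
qed

text \<open>With h = t powr (1/Y) and q = t powr (1 - 1/Y) one has t = h q, t powr (2/Y) = h^2 and t
  powr (2 - 1/Y) = h q^2, so the expansion becomes a polynomial identity in h and q with remainders
  as coefficients. The Taylor remainder of the drift effect is measured against h q^2 and becomes
  r1; everything else is measured against h^2 and becomes r2.\<close>

theorem at_the_money_expansion:
  fixes \<gamma> :: real
  shows "\<exists>r1 r2. r1 \<in> o[at_right 0](\<lambda>t. t powr (2 - 1 / Y)) \<and> r2 \<in> o[at_right 0](\<lambda>t. t powr (2 / Y)) \<and>
    (\<forall>t>0. (\<integral>\<omega>. exp (- (t powr (1 / Y)) * U \<omega> - \<eta> * t) * \<psi> (t powr (1 / Y) * Z \<omega> + \<gamma> * t) \<partial>N) =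
       (\<integral>\<omega>. max (Z \<omega>) 0 \<partial>N) * t powr (1 / Y) + (\<eta> - K0 * (Y * Gamma (- Y)) + \<gamma> / 2) * t
       + \<gamma>\<^sup>2 / 2 * pZ 0 * t powr (2 - 1 / Y)
       - ((\<integral>\<omega>. (V \<omega>)\<^sup>2 * indicator {\<omega>. V \<omega> \<le> 0} \<omega> \<partial>N) / 2 + (LBINT w:{0<..}. w * tail_diff w)) * t powr (2 / Y)
       + r1 t + r2 t)"
proof -
  note Y = LA.Y
  define h where "h t = t powr (1 / Y)" for t :: real
  define q where "q t = t powr (1 - 1 / Y)" for t :: real
  define d1 where "d1 = (\<integral>\<omega>. V \<omega> \<partial>N)"
  define B where "B = K0 * (Y * Gamma (- Y))"
  define D where "D = (\<integral>\<omega>. (V \<omega>)\<^sup>2 * indicator {\<omega>. V \<omega> \<le> 0} \<omega> \<partial>N) / 2 + (LBINT w:{0<..}. w * tail_diff w)"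
  define e1 where "e1 t = ((\<integral>\<omega>. exp (- h t * V \<omega>) \<partial>N) - (1 - h t * d1 + B * h t powr Y)) / (h t)\<^sup>2" for t
  define R where "R t = (\<integral>\<omega>. exp (- h t * U \<omega>) * (\<psi> (h t * Z \<omega> + \<gamma> * t) - \<psi> (h t * Z \<omega>)) \<partial>N)" for t
  define e2 where "e2 t = (R t - h t * shift_mean (\<gamma> * q t)) / (h t)\<^sup>2" for t
  define r1 where "r1 t = h t * shift_rest (\<gamma> * q t)" for t
  \<comment> \<open>Chosen so that the Laplace transform of V minus R t equals 1 + h t * f t; f has
    the finite limit -d1.\<close>
  define f where "f t = (e1 t + e2 t * -1) * h t - d1 + B * q t - shift_mean (\<gamma> * q t)" for t
  define e3 where "e3 t = (1 - exp (- \<eta> * t) - \<eta> * t) / t\<^sup>2" for t :: real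
  \<comment> \<open>In this order: the remainder of the Laplace transform, the drift correction, and
    the two terms caused by exp(-\<eta> t), namely its second-order part e3 t * t^2 and the product
    of \<eta> t with h t * f t, both divided by h^2.\<close>
  define r2 where "r2 t = ((D - e1 t) + e2 t + e3 t * (q t)\<^sup>2 * (1 + h t * f t) + \<eta> * q t * f t) * t powr (2 / Y)" for t
  have hq: "h t > 0" "q t > 0" "h t powr Y = t" "t = h t * q t" "t powr (2 / Y) = (h t)\<^sup>2" "t powr (2 - 1 / Y) = h t * (q t)\<^sup>2" if "t > 0" for t
  proof -
    show "h t > 0" "q t > 0" "h t powr Y = t" using that Y by (auto simp: h_def q_def powr_powr)
    show "t = h t * q t" using that by (simp add: h_def q_def powr_add[symmetric])
    show "t powr (2 / Y) = (h t)\<^sup>2" by (simp add: h_def power2_eq_square powr_add[symmetric])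
    have "2 - 1 / Y = 1 / Y + ((1 - 1 / Y) + (1 - 1 / Y))" by simp
    then show "t powr (2 - 1 / Y) = h t * (q t)\<^sup>2" unfolding h_def q_def power2_eq_square powr_add[symmetric] by simp
  qed
  have h0: "(h \<longlongrightarrow> 0) (at_right 0)" unfolding h_def using Y by (intro powr_tendsto_0_at_right) auto
  have q0: "(q \<longlongrightarrow> 0) (at_right 0)" unfolding q_def using Y by (intro powr_tendsto_0_at_right) auto
  have pos: "eventually (\<lambda>t. t > 0) (at_right (0 :: real))" by (rule eventually_at_right_less)
  have hr: "filterlim h (at_right 0) (at_right 0)"
    by (rule tendsto_imp_filterlim_at_right[OF h0]) (use pos hq(1) in \<open>auto elim: eventually_mono\<close>)
  have e1: "(e1 \<longlongrightarrow> D) (at_right 0)"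
    using filterlim_compose[OF exp_V_expansion hr] unfolding e1_def D_def d1_def B_def .
  obtain c where c: "c \<ge> 0" "\<And>h. 0 < h \<Longrightarrow> h \<le> 1 \<Longrightarrow> (\<integral>\<omega>. \<bar>exp (- h * U \<omega>) - 1\<bar> \<partial>N) \<le> c * h"
    using exp_U_L1 by auto
  have h1: "eventually (\<lambda>t. h t < 1) (at_right 0)" by (rule order_tendstoD(2)[OF h0]) simp
  have e2: "(e2 \<longlongrightarrow> 0) (at_right 0)"
  proof (rule Lim_null_comparison)
    let ?E = "\<integral>\<omega>. \<bar>Z \<omega>\<bar> \<partial>N"
    show "((\<lambda>t. \<bar>\<gamma>\<bar> * q t * (c + ?E + \<bar>\<gamma>\<bar> * q t)) \<longlongrightarrow> 0) (at_right 0)"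
      by (rule tendsto_eq_intros q0 refl)+ simp
    show "eventually (\<lambda>t. norm (e2 t) \<le> \<bar>\<gamma>\<bar> * q t * (c + ?E + \<bar>\<gamma>\<bar> * q t)) (at_right 0)"
      using pos h1
    proof eventually_elim
      case (elim t)
      note hq = hq[OF elim(1)]
      have a: "\<gamma> * t = h t * (\<gamma> * q t)" using hq(4) by simp
      have "\<bar>R t - h t * shift_mean (\<gamma> * q t)\<bar> \<le> \<bar>\<gamma> * t\<bar> * (c * h t + h t * ?E + \<bar>\<gamma> * t\<bar>)"
        using drift_correction[OF c(2) hq(1), of "\<gamma> * t"] elim unfolding R_def shift_mean_scale[OF hq(1), of "\<gamma> * q t", folded a] by simp
      also have "\<dots> = (\<bar>\<gamma>\<bar> * q t * (c + ?E + \<bar>\<gamma>\<bar> * q t)) * (h t)\<^sup>2"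
        unfolding a using hq(1,2) by (simp add: abs_mult power2_eq_square algebra_simps)
      finally show ?case using hq(1) by (simp add: e2_def divide_le_eq)
    qed
  qed
  have sm: "((\<lambda>t. shift_mean (\<gamma> * q t)) \<longlongrightarrow> 0) (at_right 0)"
  proof (rule Lim_null_comparison)
    show "((\<lambda>t. \<bar>\<gamma> * q t\<bar>) \<longlongrightarrow> 0) (at_right 0)" by (rule tendsto_eq_intros q0 refl)+ simp
    show "eventually (\<lambda>t. norm (shift_mean (\<gamma> * q t)) \<le> \<bar>\<gamma> * q t\<bar>) (at_right 0)" using abs_shift_mean_le by simp
  qed
  have f: "(f \<longlongrightarrow> - d1) (at_right 0)"
    unfolding f_def by (rule tendsto_eq_intros e1 e2 h0 q0 sm refl)+ simp
  have e3: "(e3 \<longlongrightarrow> - (\<eta>\<^sup>2 / 2)) (at_right 0)" unfolding e3_def power2_eq_square by real_asymp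
  have "r1 \<in> o[at_right 0](\<lambda>t. t powr (2 - 1 / Y))"
  proof (rule smalloI_tendsto)
    show "eventually (\<lambda>t. t powr (2 - 1 / Y) \<noteq> 0) (at_right (0 :: real))" using pos by eventually_elim simp
    show "((\<lambda>t. r1 t / t powr (2 - 1 / Y)) \<longlongrightarrow> 0) (at_right 0)"
    proof (cases "\<gamma> = 0")
      case True then show ?thesis by (simp add: r1_def shift_rest_0)
    next
      case False
      have "filterlim (\<lambda>t. \<bar>\<gamma>\<bar> * q t) (at_right 0) (at_right 0)"
      proof (rule tendsto_imp_filterlim_at_right)
        show "((\<lambda>t. \<bar>\<gamma>\<bar> * q t) \<longlongrightarrow> 0) (at_right 0)" by (rule tendsto_eq_intros q0 refl)+ simp
        show "eventually (\<lambda>t. \<bar>\<gamma>\<bar> * q t > 0) (at_right 0)" using pos by eventually_elim (use hq False in auto)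
      qed
      \<comment> \<open>The smallness of \<open>shift_rest\<close> is known along s \<beta> with
        \<beta> > 0, so \<gamma> is written as sign times modulus; \<gamma> = 0 was treated
        separately to allow division.\<close>
      moreover have "sgn \<gamma> \<in> {1, -1}" using False by (auto simp: sgn_if)
      ultimately have "((\<lambda>t. shift_rest (sgn \<gamma> * (\<bar>\<gamma>\<bar> * q t)) / (\<bar>\<gamma>\<bar> * q t)\<^sup>2) \<longlongrightarrow> 0) (at_right 0)"
        by (rule filterlim_compose[OF shift_rest_small, rotated])
      from tendsto_mult[OF tendsto_const[of "\<gamma>\<^sup>2"] this]
      have "((\<lambda>t. \<gamma>\<^sup>2 * (shift_rest (sgn \<gamma> * (\<bar>\<gamma>\<bar> * q t)) / (\<bar>\<gamma>\<bar> * q t)\<^sup>2)) \<longlongrightarrow> 0) (at_right 0)" by simp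
      moreover have "eventually (\<lambda>t. \<gamma>\<^sup>2 * (shift_rest (sgn \<gamma> * (\<bar>\<gamma>\<bar> * q t)) / (\<bar>\<gamma>\<bar> * q t)\<^sup>2) = r1 t / t powr (2 - 1 / Y)) (at_right 0)"
        using pos
      proof eventually_elim
        case (elim t)
        have e: "sgn \<gamma> * (\<bar>\<gamma>\<bar> * q t) = \<gamma> * q t" by (simp add: mult.assoc[symmetric] sgn_mult_abs)
        show ?case unfolding r1_def hq(6)[OF elim] e using hq(1,2)[OF elim] False by (simp add: field_simps power_mult_distrib)
      qed
      ultimately show ?thesis by (rule Lim_transform_eventually)
    qed
  qed
  moreover have "r2 \<in> o[at_right 0](\<lambda>t. t powr (2 / Y))"
  proof (rule smalloI_tendsto)
    show "eventually (\<lambda>t. t powr (2 / Y) \<noteq> 0) (at_right (0 :: real))" using pos by eventually_elim simp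
    have "((\<lambda>t. (D - e1 t) + e2 t + e3 t * (q t)\<^sup>2 * (1 + h t * f t) + \<eta> * q t * f t) \<longlongrightarrow> 0) (at_right 0)"
      by (rule tendsto_eq_intros e1 e2 e3 h0 q0 f refl)+ simp
    moreover have "eventually (\<lambda>t. (D - e1 t) + e2 t + e3 t * (q t)\<^sup>2 * (1 + h t * f t) + \<eta> * q t * f t = r2 t / t powr (2 / Y)) (at_right 0)"
      using pos by eventually_elim (simp add: r2_def)
    ultimately show "((\<lambda>t. r2 t / t powr (2 / Y)) \<longlongrightarrow> 0) (at_right 0)" by (rule Lim_transform_eventually)
  qed
  moreover have "(\<integral>\<omega>. exp (- (t powr (1 / Y)) * U \<omega> - \<eta> * t) * \<psi> (t powr (1 / Y) * Z \<omega> + \<gamma> * t) \<partial>N) =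
      (\<integral>\<omega>. max (Z \<omega>) 0 \<partial>N) * t powr (1 / Y) + (\<eta> - B + \<gamma> / 2) * t + \<gamma>\<^sup>2 / 2 * pZ 0 * t powr (2 - 1 / Y)
       - D * t powr (2 / Y) + r1 t + r2 t" if t: "t > 0" for t
  proof -
    note hq = hq[OF t]
    let ?L = "\<integral>\<omega>. exp (- h t * V \<omega>) \<partial>N" and ?s = "shift_mean (\<gamma> * q t)"
    have iU: "integrable N (\<lambda>\<omega>. exp (- h t * U \<omega>))" using exp_U_integrable[of "h t"] hq(1) by simp
    have i1: "integrable N (\<lambda>\<omega>. exp (- h t * U \<omega>) * \<psi> (Q \<omega>))" if [measurable]: "Q \<in> borel_measurable N" for Q
    proof -
      have "\<bar>\<psi> (Q \<omega>)\<bar> \<le> 1" for \<omega> using \<psi>_bounds(1,2)[of "Q \<omega>"] by simp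
      then show ?thesis by (intro integrable_mult_bounded[OF iU]) measurable
    qed
    have "exp (- (h t) * U \<omega> - \<eta> * t) * \<psi> (h t * Z \<omega> + \<gamma> * t) = exp (- (\<eta> * t)) * (exp (- h t * U \<omega>) * \<psi> (h t * Z \<omega> + \<gamma> * t))" for \<omega>
      by (simp add: exp_diff exp_minus field_simps)
    then have "(\<integral>\<omega>. exp (- (h t) * U \<omega> - \<eta> * t) * \<psi> (h t * Z \<omega> + \<gamma> * t) \<partial>N)
        = exp (- (\<eta> * t)) * (\<integral>\<omega>. exp (- h t * U \<omega>) * \<psi> (h t * Z \<omega> + \<gamma> * t) \<partial>N)"
      by (simp only: Bochner_Integration.integral_mult_right_zero)
    also have "(\<integral>\<omega>. exp (- h t * U \<omega>) * \<psi> (h t * Z \<omega> + \<gamma> * t) \<partial>N) = (\<integral>\<omega>. exp (- h t * U \<omega>) * \<psi> (h t * Z \<omega>) \<partial>N) + R t"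
      using Bochner_Integration.integral_diff[OF i1[of "\<lambda>\<omega>. h t * Z \<omega> + \<gamma> * t"] i1[of "\<lambda>\<omega>. h t * Z \<omega>"]]
      unfolding R_def right_diff_distrib by simp
    also have "\<dots> = exp (\<eta> * t) - ?L + R t" unfolding exp_psi_Z[OF hq(1)] hq(3) by simp
    also have "exp (- (\<eta> * t)) * (exp (\<eta> * t) - ?L + R t) = 1 - exp (- (\<eta> * t)) * (?L - R t)"
      by (simp add: algebra_simps exp_add[symmetric])
    also have "exp (- (\<eta> * t)) = 1 - \<eta> * t - e3 t * t\<^sup>2" using t by (simp add: e3_def)
    finally have I: "(\<integral>\<omega>. exp (- (h t) * U \<omega> - \<eta> * t) * \<psi> (h t * Z \<omega> + \<gamma> * t) \<partial>N) = 1 - (1 - \<eta> * t - e3 t * t\<^sup>2) * (?L - R t)" .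
    have L: "?L = 1 - h t * d1 + B * t + e1 t * (h t)\<^sup>2" using hq(1) by (simp add: e1_def hq(3))
    have Rt: "R t = h t * ?s + e2 t * (h t)\<^sup>2" using hq(1) by (simp add: e2_def)
    have LR: "?L - R t = 1 + h t * f t" unfolding L Rt f_def by (subst hq(4)) (simp add: algebra_simps power2_eq_square)
    have s: "?s = shift_rest (\<gamma> * q t) + \<gamma> * q t / 2 + pZ 0 / 2 * (\<gamma> * q t)\<^sup>2" by (simp add: shift_rest_def)
    have "1 - (1 - \<eta> * t - e3 t * t\<^sup>2) * (?L - R t) = (1 - ?L + R t) + \<eta> * t + \<eta> * t * (h t * f t) + e3 t * t\<^sup>2 * (1 + h t * f t)"
      unfolding LR[symmetric] using LR by (simp add: algebra_simps)
    also have "\<dots> = d1 * h t + (\<eta> - B + \<gamma> / 2) * t + \<gamma>\<^sup>2 / 2 * pZ 0 * (h t * (q t)\<^sup>2) - D * (h t)\<^sup>2 + r1 t + r2 t"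
    proof -
      have r2: "r2 t = ((D - e1 t) + e2 t + e3 t * (q t)\<^sup>2 * (1 + h t * f t) + \<eta> * q t * f t) * (h t)\<^sup>2" unfolding r2_def hq(5) ..
      show ?thesis unfolding L Rt s r1_def r2 using hq(4)
        by algebra
    qed
    finally show ?thesis unfolding I[symmetric, unfolded h_def] hq(5,6)[symmetric] unfolding d1_def mean_V h_def[symmetric] I .
  qed
  ultimately show ?thesis unfolding B_def D_def by blast
qed

end

section \<open>The CGMY law as a tilted stable law\<close>

text \<open>Subtracting the stable integrands at m - i u and at m produces the tilted jump kernel
  with the full, untilted compensator. The discrepancy from the truncated, tilted compensator is i u
  k(x), so its integral is a mere drift; k is integrable because 1 - exp(-m x) vanishes linearly at
  0.\<close>

lemma has_integral_cgmy_half: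
  fixes C Y m u :: real
  assumes "C \<ge> 0" "1 < Y" "Y < 2" "m > 0"
  defines "k \<equiv> \<lambda>x. indicator {0<..} x * (x * (1 - exp (- m * x) * indicator {-1..1} x) * (C * x powr (- Y - 1)))"
  shows "has_bochner_integral lborel
     (\<lambda>x. (indicator {0<..} x * (C * x powr (- Y - 1) * exp (- m * x))) *\<^sub>R (iexp (u * x) - 1 - \<i> * of_real (u * x * indicator {-1..1} x)))
     (stable_exponent C Y (of_real m - \<i> * of_real u) - stable_exponent C Y (of_real m) + \<i> * of_real (u * (\<integral>x. k x \<partial>lborel)))"
proof -
  have kdom: "\<bar>k x\<bar> \<le> C * (m + 1) * stable_dom Y x" for x
  proof (cases "x > 0")
    case True
    show ?thesis
    proof (cases "x \<le> 1")
      case x1: True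
      have "1 - exp (- m * x) \<le> m * x" using exp_ge_add_one_self[of "- m * x"] by linarith
      moreover have "0 \<le> 1 - exp (- m * x)" using True assms by simp
      ultimately have "\<bar>k x\<bar> \<le> x * (m * x) * (C * x powr (- Y - 1))"
        unfolding k_def using True x1 assms by (simp add: abs_mult mult_left_mono mult_right_mono)
      also have "\<dots> = C * m * (x\<^sup>2 * x powr (- Y - 1))" by (simp add: power2_eq_square)
      also have "x\<^sup>2 * x powr (- Y - 1) = x powr (1 - Y)"
        using True by (simp add: powr_numeral[symmetric] powr_add[symmetric] del: powr_numeral)
      also have "C * m * x powr (1 - Y) \<le> C * (m + 1) * x powr (1 - Y)" using assms by (intro mult_right_mono mult_left_mono) auto
      also have "\<dots> \<le> C * (m + 1) * stable_dom Y x"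
        using True x1 assms by (intro mult_left_mono) (auto simp: stable_dom_def)
      finally show ?thesis .
    next
      case x1: False
      then have "\<bar>k x\<bar> = C * (x * x powr (- Y - 1))" unfolding k_def using True assms by (simp add: abs_mult)
      also have "x * x powr (- Y - 1) = x powr (- Y)" using True by (simp add: powr_diff)
      also have "C * x powr (- Y) \<le> C * (m + 1) * x powr (- Y)" using assms by (intro mult_right_mono) (auto simp: algebra_simps)
      also have "\<dots> \<le> C * (m + 1) * stable_dom Y x"
        using True x1 assms by (intro mult_left_mono) (auto simp: stable_dom_def)
      finally show ?thesis .
    qed
  next
    case False then show ?thesis using assms by (simp add: k_def stable_dom_nonneg)
  qed
  have ik: "integrable lborel k"
  proof (rule Bochner_Integration.integrable_bound)
    show "integrable lborel (\<lambda>x. C * (m + 1) * stable_dom Y x)" using integrable_stable_dom[OF assms(2,3)] by simp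
    show "AE x in lborel. norm (k x) \<le> norm (C * (m + 1) * stable_dom Y x)"
      unfolding real_norm_def by (intro always_eventually allI order_trans[OF kdom abs_ge_self])
  qed (simp add: k_def)
  have st: "has_bochner_integral lborel (\<lambda>x. indicator {0<..} x *\<^sub>R stable_integrand C Y z x) (stable_exponent C Y z)" if "Re z \<ge> 0" for z
    using set_integrable_stable_integrand[OF assms(1-3) that, of "{0<..}"]
    unfolding stable_exponent_def set_lebesgue_integral_def set_integrable_def by (simp add: has_bochner_integral_integrable)
  have "has_bochner_integral lborel (\<lambda>x. \<i> * complex_of_real (u * k x)) (\<i> * of_real (u * (\<integral>x. k x \<partial>lborel)))"
    using ik by (intro has_bochner_integral_mult_right has_bochner_integral_of_real has_bochner_integral_integrable)
  then have "has_bochner_integral lborel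
     (\<lambda>x. indicator {0<..} x *\<^sub>R stable_integrand C Y (of_real m - \<i> * of_real u) x - indicator {0<..} x *\<^sub>R stable_integrand C Y (of_real m) x + \<i> * of_real (u * k x))
     (stable_exponent C Y (of_real m - \<i> * of_real u) - stable_exponent C Y (of_real m) + \<i> * of_real (u * (\<integral>x. k x \<partial>lborel)))"
    using assms by (intro has_bochner_integral_add has_bochner_integral_diff st) auto
  moreover have "indicator {0<..} x *\<^sub>R stable_integrand C Y (of_real m - \<i> * of_real u) x - indicator {0<..} x *\<^sub>R stable_integrand C Y (of_real m) x + \<i> * of_real (u * k x)
      = (indicator {0<..} x * (C * x powr (- Y - 1) * exp (- m * x))) *\<^sub>R (iexp (u * x) - 1 - \<i> * of_real (u * x * indicator {-1..1} x))" for x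
  proof (cases "x > 0")
    case True
    have e: "exp (- (of_real m - \<i> * of_real u) * of_real x) = of_real (exp (- m * x)) * iexp (u * x)"
      by (simp add: exp_of_real[symmetric] exp_add[symmetric] algebra_simps)
    have e': "exp (- of_real m * of_real x) = complex_of_real (exp (- m * x))"
      by (simp add: exp_of_real[symmetric])
    show ?thesis unfolding stable_integrand_def e e' k_def using True by (simp add: scaleR_conv_of_real indicator_def algebra_simps)
  qed (simp add: k_def)
  ultimately show ?thesis by (simp only:)
qed

text \<open>The negative half-line is reflected onto the positive one, which exchanges u and -u. The
  drift collects the given b and both compensator integrals; its value is left open, since the
  martingale condition determines it later.\<close>

lemma cgmy_exponent:
  fixes C Y M G b :: real
  assumes "C \<ge> 0" "1 < Y" "Y < 2" "M > 0" "G > 0"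
  obtains \<beta> where "\<And>u. levy_exponent b 0 (cgmy_levy_measure C G M Y) u = \<i> * of_real (\<beta> * u)
      + (stable_exponent C Y (of_real M - \<i> * of_real u) - stable_exponent C Y (of_real M))
      + (stable_exponent C Y (of_real G + \<i> * of_real u) - stable_exponent C Y (of_real G))"
proof -
  define H where "H m u x = (indicator {0<..} x * (C * x powr (- Y - 1) * exp (- m * x))) *\<^sub>R (iexp (u * x) - 1 - \<i> * of_real (u * x * indicator {-1..1} x))" for m u x :: real
  define K where "K m = (\<integral>x. indicator {0<..} x * (x * (1 - exp (- m * x) * indicator {-1..1} x) * (C * x powr (- Y - 1))) \<partial>lborel)" for m :: real
  define f where "f u x = iexp (u * x) - 1 - \<i> * of_real (u * x * indicator {-1..1} x)" for u x :: real
  define g where "g x = C * \<bar>x\<bar> powr (- Y - 1) * (exp (- M * x) * indicator {0<..} x + exp (G * x) * indicator {..<0} x)" for x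
  have H: "has_bochner_integral lborel (H m u)
     (stable_exponent C Y (of_real m - \<i> * of_real u) - stable_exponent C Y (of_real m) + \<i> * of_real (u * K m))" if "m > 0" for m u
    unfolding H_def K_def by (rule has_integral_cgmy_half[OF assms(1-3) that])
  have "(\<integral>x. f u x \<partial>cgmy_levy_measure C G M Y) = (stable_exponent C Y (of_real M - \<i> * of_real u) - stable_exponent C Y (of_real M) + \<i> * of_real (u * K M))
    + (stable_exponent C Y (of_real G + \<i> * of_real u) - stable_exponent C Y (of_real G) - \<i> * of_real (u * K G))" for u
  proof -
    have "(\<integral>x. f u x \<partial>cgmy_levy_measure C G M Y) = (\<integral>x. g x *\<^sub>R f u x \<partial>lborel)"
      unfolding cgmy_levy_measure_def g_def[symmetric]
    proof (rule integral_density)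
      show "f u \<in> borel_measurable lborel" unfolding f_def by measurable
      show "g \<in> borel_measurable lborel" unfolding g_def by measurable
      show "AE x in lborel. 0 \<le> g x" using assms by (intro always_eventually allI) (auto simp: g_def indicator_def)
    qed
    \<comment> \<open>At x = 0 both sides vanish, so the identity holds everywhere and no null set
      has to be discarded.\<close>
    also have "(\<lambda>x. g x *\<^sub>R f u x) = (\<lambda>x. H M u x + H G (- u) (- x))"
      by (auto simp: fun_eq_iff g_def f_def H_def indicator_def)
    also have "(\<integral>x. H M u x + H G (- u) (- x) \<partial>lborel) = (\<integral>x. H M u x \<partial>lborel) + (\<integral>x. H G (- u) (- x) \<partial>lborel)"
    proof (rule Bochner_Integration.integral_add)
      show "integrable lborel (H M u)" using H[OF assms(4)] by (auto simp: has_bochner_integral_iff)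
      have "integrable lborel (H G (- u))" using H[OF assms(5)] by (auto simp: has_bochner_integral_iff)
      from lborel_integrable_real_affine[OF this, of "-1" 0] show "integrable lborel (\<lambda>x. H G (- u) (- x))" by simp
    qed
    also have "(\<integral>x. H G (- u) (- x) \<partial>lborel) = (\<integral>x. H G (- u) x \<partial>lborel)"
      using lborel_integral_real_affine[of "-1" "H G (- u)" 0] by simp
    finally show ?thesis using H[OF assms(4), of u] H[OF assms(5), of "- u"] by (simp add: has_bochner_integral_iff)
  qed
  then have "levy_exponent b 0 (cgmy_levy_measure C G M Y) u = \<i> * of_real ((b + K M - K G) * u)
      + (stable_exponent C Y (of_real M - \<i> * of_real u) - stable_exponent C Y (of_real M))
      + (stable_exponent C Y (of_real G + \<i> * of_real u) - stable_exponent C Y (of_real G))" for u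
    unfolding levy_exponent_def f_def[symmetric] by (simp add: algebra_simps)
  then show ?thesis by (rule that)
qed

context stable_pair
begin

text \<open>Log-Laplace exponent of M A + G B at 1, the normalization of the tilting
  density.\<close>

definition \<eta>0 where "\<eta>0 = C * Gamma (- Y) * (M powr Y + G powr Y)"

text \<open>The density has mean 1 because (h M) powr Y = t M powr Y and likewise for G. Under it
  the arguments of the two exponents move from -i u to M - i u and from i u to G + i u, up to the
  scale h, which is the given characteristic function. The identification concerns the law at a
  single time only, so no density process is needed.\<close>

lemma tilted_law:
  fixes f :: "real \<Rightarrow> real"
  assumes t: "t > 0" and \<mu>: "real_distribution \<mu>"
    and ch: "\<And>u. char \<mu> u = exp (of_real t * (\<i> * of_real (\<beta> * u)
      + (stable_exponent C Y (of_real M - \<i> * of_real u) - stable_exponent C Y (of_real M))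
      + (stable_exponent C Y (of_real G + \<i> * of_real u) - stable_exponent C Y (of_real G))))"
    and [measurable]: "f \<in> borel_measurable borel"
  defines "h \<equiv> t powr (1 / Y)"
  shows "(\<integral>x. f x \<partial>\<mu>) = (\<integral>\<omega>. exp (- h * (M * A \<omega> + G * B \<omega>) - \<eta>0 * t) * f (h * Z \<omega> + \<beta> * t) \<partial>N)"
proof -
  interpret \<mu>: real_distribution \<mu> by (rule \<mu>)
  define W where "W \<omega> = exp (- h * (M * A \<omega> + G * B \<omega>) - \<eta>0 * t)" for \<omega>
  have [measurable]: "W \<in> borel_measurable N" unfolding W_def by measurable
  have h: "h > 0" "h powr Y = t" using t LA.Y by (auto simp: h_def powr_powr)
  have W: "W \<omega> = exp (- \<eta>0 * t) * exp (- (h * M * A \<omega> + h * G * B \<omega>))" for \<omega>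
    by (simp add: W_def exp_add[symmetric] algebra_simps)
  have mg: "h * M \<ge> 0" "h * G \<ge> 0" using h M G by auto
  have iW: "integrable N W" unfolding W using exp_pair_real(1)[OF mg] by simp
  have "(\<integral>\<omega>. W \<omega> \<partial>N) = exp (- \<eta>0 * t) * exp (C * Gamma (- Y) * ((h * M) powr Y + (h * G) powr Y))"
    unfolding W using exp_pair_real(2)[OF mg] by simp
  also have "(h * M) powr Y = t * M powr Y" using h M by (simp add: powr_mult)
  also have "(h * G) powr Y = t * G powr Y" using h G by (simp add: powr_mult)
  finally have EW: "(\<integral>\<omega>. W \<omega> \<partial>N) = 1" by (simp add: \<eta>0_def exp_add[symmetric] algebra_simps)
  let ?D = "density N (\<lambda>\<omega>. ennreal (W \<omega>))"
  have "prob_space ?D"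
  proof (rule prob_spaceI)
    have "emeasure ?D (space ?D) = (\<integral>\<^sup>+\<omega>. ennreal (W \<omega>) \<partial>N)"
      by (auto simp: emeasure_density intro!: nn_integral_cong)
    also have "\<dots> = ennreal (\<integral>\<omega>. W \<omega> \<partial>N)" by (rule nn_integral_eq_integral[OF iW]) (simp add: W_def)
    finally show "emeasure ?D (space ?D) = 1" by (simp add: EW)
  qed
  then interpret D: prob_space ?D .
  have rD: "real_distribution (distr ?D borel (\<lambda>\<omega>. h * Z \<omega> + \<beta> * t))" by (rule D.real_distribution_distr) simp
  have int: "(\<integral>x. g x \<partial>distr ?D borel (\<lambda>\<omega>. h * Z \<omega> + \<beta> * t)) = (\<integral>\<omega>. W \<omega> *\<^sub>R g (h * Z \<omega> + \<beta> * t) \<partial>N)"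
    if [measurable]: "g \<in> borel_measurable borel" for g :: "real \<Rightarrow> 'c :: {banach, second_countable_topology}"
    by (subst integral_distr, simp, simp, subst integral_density) (auto simp: W_def)
  have "\<mu> = distr ?D borel (\<lambda>\<omega>. h * Z \<omega> + \<beta> * t)"
  proof (rule Levy_uniqueness[OF \<mu> rD ext])
    fix u
    let ?z = "of_real h * (of_real M - \<i> * of_real u)" and ?w = "of_real h * (of_real G + \<i> * of_real u)"
    have p: "W \<omega> *\<^sub>R iexp (u * (h * Z \<omega> + \<beta> * t)) = exp (of_real t * (\<i> * of_real (\<beta> * u)) - of_real (\<eta>0 * t)) * exp (- ?z * of_real (A \<omega>) - ?w * of_real (B \<omega>))" for \<omega>
      unfolding W_def Z_def scaleR_conv_of_real exp_of_real[symmetric] exp_add[symmetric] by (simp add: algebra_simps)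
    have "char (distr ?D borel (\<lambda>\<omega>. h * Z \<omega> + \<beta> * t)) u = (\<integral>\<omega>. W \<omega> *\<^sub>R iexp (u * (h * Z \<omega> + \<beta> * t)) \<partial>N)"
      unfolding char_def by (rule int) simp
    also have "\<dots> = exp (of_real t * (\<i> * of_real (\<beta> * u)) - of_real (\<eta>0 * t)) * exp (stable_exponent C Y ?z + stable_exponent C Y ?w)"
      unfolding p using exp_pair(2)[of ?z ?w] h M G by simp
    also have "stable_exponent C Y ?z = of_real t * stable_exponent C Y (of_real M - \<i> * of_real u)"
      using stable_exponent_scale[OF h(1)] h(2) by simp
    also have "stable_exponent C Y ?w = of_real t * stable_exponent C Y (of_real G + \<i> * of_real u)"
      using stable_exponent_scale[OF h(1)] h(2) by simp
    also have "complex_of_real (\<eta>0 * t) = of_real t * (stable_exponent C Y (of_real M) + stable_exponent C Y (of_real G))"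
      using stable_exponent_of_real[OF LA.C_nonneg LA.Y, of M] stable_exponent_of_real[OF LA.C_nonneg LA.Y, of G] M G
      by (simp add: \<eta>0_def algebra_simps)
    finally show "char \<mu> u = char (distr ?D borel (\<lambda>\<omega>. h * Z \<omega> + \<beta> * t)) u"
      unfolding ch exp_add[symmetric] by (simp add: algebra_simps)
  qed
  then show ?thesis using int[of f] by (simp add: W_def)
qed

end

section \<open>Prices of options close to the money\<close>

lemma (in prob_space) centered_stable_char:
  assumes "centered_positive_stable_process C Y X" "t \<ge> 0"
  shows "X t \<in> borel_measurable M"
    and "char (distr M borel (X t)) u = exp (of_real t * stable_exponent C Y (- (\<i> * of_real u)))"
proof -
  show "X t \<in> borel_measurable M"
    using assms by (auto simp: centered_positive_stable_process_def levy_process_def)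
  have "stable_exponent C Y (- (\<i> * of_real u)) = (CLBINT x:{0<..}. (iexp (u * x) - 1 - \<i> * of_real (u * x)) * of_real (C * x powr (- Y - 1)))"
    unfolding stable_exponent_def stable_integrand_def by (simp add: mult_ac)
  then show "char (distr M borel (X t)) u = exp (of_real t * stable_exponent C Y (- (\<i> * of_real u)))"
    using assms by (simp add: centered_positive_stable_process_def)
qed

lemma (in prob_space) stable_law_at_1:
  assumes "centered_positive_stable_process C Y X" "C > 0" "1 < Y" "Y < 2"
  shows "stable_law (distr M borel (X 1)) C Y"
proof -
  have "X 1 \<in> borel_measurable M" using centered_stable_char(1)[OF assms(1)] by simp
  then show ?thesis
    unfolding stable_law_def stable_law_axioms_def
    using assms centered_stable_char(2)[OF assms(1), of 1] by (simp add: real_distribution_distr)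
qed

lemma (in prob_space) indep_processes_at:
  assumes "indep_processes X X'" "t \<ge> 0" shows "indep_var borel (X t) borel (X' t)"
proof -
  have "(\<lambda>f. f t) \<in> measurable (PiM {0..} (\<lambda>_. borel)) (borel :: real measure)" using assms(2) by simp
  from indep_var_compose[OF assms(1)[unfolded indep_processes_def] this this] show ?thesis
    using assms(2) by (simp add: comp_def)
qed

context stable_pair
begin

text \<open>The expansion works with the variables at time 1, while the correction term involves the
  process at time t; both laws have the same symmetric stable characteristic function.\<close>

lemma Z_scaled_law:
  assumes t: "t > 0" and ind: "indep_var borel X borel X'"
    and X: "\<And>u. char (distr N borel X) u = exp (of_real t * stable_exponent C Y (- (\<i> * of_real u)))"
    and X': "\<And>u. char (distr N borel X') u = exp (of_real t * stable_exponent C Y (- (\<i> * of_real u)))"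
  shows "prob {\<omega>\<in>space N. X \<omega> - X' \<omega> \<ge> x} = prob {\<omega>\<in>space N. t powr (1 / Y) * Z \<omega> \<ge> x}"
proof -
  let ?h = "t powr (1 / Y)"
  have [measurable]: "X \<in> borel_measurable N" "X' \<in> borel_measurable N" using ind by (auto dest: indep_var_rv1 indep_var_rv2)
  have h: "?h > 0" "?h powr Y = t" using t LA.Y by (auto simp: powr_powr)
  have "distr N borel (\<lambda>\<omega>. X \<omega> + - X' \<omega>) = distr N borel (\<lambda>\<omega>. ?h * Z \<omega>)"
  proof (rule Levy_uniqueness[OF real_distribution_distr real_distribution_distr ext])
    fix u
    have ind': "indep_var borel X borel (\<lambda>\<omega>. - X' \<omega>)"
      using indep_var_compose[OF ind, of "\<lambda>x. x" borel "\<lambda>x. - x" borel] by (simp add: comp_def)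
    have "char (distr N borel (\<lambda>\<omega>. - X' \<omega>)) u = char (distr N borel X') (- u)"
      unfolding char_def by (simp add: integral_distr)
    then have "char (distr N borel (\<lambda>\<omega>. X \<omega> + - X' \<omega>)) u =
        exp (of_real t * (stable_exponent C Y (\<i> * of_real u) + stable_exponent C Y (- (\<i> * of_real u))))"
      unfolding char_distr_add[OF ind'] X X' by (simp add: exp_add[symmetric] algebra_simps)
    also have "stable_exponent C Y (\<i> * of_real u) + stable_exponent C Y (- (\<i> * of_real u)) = of_real (- (cZ * \<bar>u\<bar> powr Y))"
      unfolding stable_exponent_symmetrize[OF LA.C_nonneg LA.Y] cZ_def by simp
    also have "of_real t * complex_of_real (- (cZ * \<bar>u\<bar> powr Y)) = of_real (- (cZ * \<bar>?h * u\<bar> powr Y))"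
      using h by (simp add: abs_mult powr_mult)
    also have "exp (complex_of_real (- (cZ * \<bar>?h * u\<bar> powr Y))) = char (distr N borel Z) (?h * u)"
      by (simp only: char_Z exp_of_real)
    also have "\<dots> = char (distr N borel (\<lambda>\<omega>. ?h * Z \<omega>)) u"
      unfolding char_def by (simp add: integral_distr mult_ac)
    finally show "char (distr N borel (\<lambda>\<omega>. X \<omega> + - X' \<omega>)) u = char (distr N borel (\<lambda>\<omega>. ?h * Z \<omega>)) u" .
  qed simp_all
  then have "measure (distr N borel (\<lambda>\<omega>. X \<omega> - X' \<omega>)) {x..} = measure (distr N borel (\<lambda>\<omega>. ?h * Z \<omega>)) {x..}" by simp
  then show ?thesis by (simp add: measure_distr vimage_def Int_def conj_commute)
qed

text \<open>The bound is |\<kappa> t| times a quantity tending to 0. Keeping it as a product,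
  without dividing by \<kappa> t, also covers functions with zeros.\<close>

lemma strike_remainder:
  fixes \<gamma> :: real
  assumes \<kappa>: "\<kappa> \<in> o[at_right 0](\<lambda>_. 1 :: real)"
  defines "W \<equiv> \<lambda>t \<omega>. exp (- (t powr (1 / Y)) * U \<omega> - \<eta> * t)" and "X \<equiv> \<lambda>t \<omega>. t powr (1 / Y) * Z \<omega> + \<gamma> * t"
  shows "(\<lambda>t. (\<integral>\<omega>. W t \<omega> * (exp (- \<kappa> t) * \<psi> (X t \<omega> - \<kappa> t)) \<partial>N) - (\<integral>\<omega>. W t \<omega> * \<psi> (X t \<omega>) \<partial>N)
       + \<kappa> t * (LBINT w:{0..1}. prob {\<omega>\<in>space N. t powr (1 / Y) * Z \<omega> \<ge> \<kappa> t * w})) \<in> o[at_right 0](\<kappa>)"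
    (is "?F \<in> _")
proof -
  obtain c where c: "c \<ge> 0" "\<And>h. 0 < h \<Longrightarrow> h \<le> 1 \<Longrightarrow> (\<integral>\<omega>. \<bar>exp (- h * U \<omega>) - 1\<bar> \<partial>N) \<le> c * h"
    using exp_U_L1 by auto
  define h where "h t = t powr (1 / Y)" for t :: real
  \<comment> \<open>d bounds the mean distance of the normalized weight from 1, and b is then the
    bracket of \<open>strike_correction\<close> for the drift \<gamma> t, with |\<gamma> t| / h t
    written as a power of t.\<close>
  define d where "d t = exp (- \<eta> * t) * (c * h t) + \<bar>exp (- \<eta> * t) - 1\<bar>" for t
  define b where "b t = 3 * (d t + h t * (\<integral>\<omega>. \<bar>Z \<omega>\<bar> \<partial>N) + \<bar>\<gamma> * t\<bar> + \<bar>\<kappa> t\<bar>) + pZ_bound * (\<bar>\<gamma>\<bar> * t powr (1 - 1 / Y))" for t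
  have pos: "eventually (\<lambda>t. t > 0) (at_right (0 :: real))" by (rule eventually_at_right_less)
  have h0: "(h \<longlongrightarrow> 0) (at_right 0)" unfolding h_def using LA.Y by (intro powr_tendsto_0_at_right) auto
  have q0: "((\<lambda>t. t powr (1 - 1 / Y)) \<longlongrightarrow> 0) (at_right 0)" using LA.Y by (intro powr_tendsto_0_at_right) auto
  have k0: "(\<kappa> \<longlongrightarrow> 0) (at_right 0)" using smalloD_tendsto[OF \<kappa>] by simp
  have t0: "((\<lambda>t :: real. t) \<longlongrightarrow> 0) (at_right 0)" by (rule tendsto_ident_at)
  have "(b \<longlongrightarrow> 0) (at_right 0)" unfolding b_def d_def
    by (rule tendsto_eq_intros h0 q0 k0 t0 refl)+ simp
  have h1: "eventually (\<lambda>t. h t < 1) (at_right 0)" by (rule order_tendstoD(2)[OF h0]) simp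
  have k1: "eventually (\<lambda>t. \<bar>\<kappa> t\<bar> < 1) (at_right 0)" by (rule order_tendstoD(2)[OF tendsto_rabs[OF k0]]) simp
  have F: "eventually (\<lambda>t. \<bar>?F t\<bar> \<le> \<bar>\<kappa> t\<bar> * b t) (at_right 0)"
    using pos h1 k1
  proof eventually_elim
    case (elim t)
    have h: "h t > 0" "h t \<le> 1" using elim by (auto simp: h_def)
    have iU: "integrable N (\<lambda>\<omega>. exp (- h t * U \<omega>))" using exp_U_integrable[of "h t"] h by simp
    have W: "W t \<omega> = exp (- \<eta> * t) * exp (- h t * U \<omega>)" for \<omega>
      by (simp add: W_def h_def exp_add[symmetric] algebra_simps)
    have iW: "integrable N (W t)" unfolding W using iU by simp
    have "(\<integral>\<omega>. \<bar>W t \<omega> - 1\<bar> \<partial>N) \<le> (\<integral>\<omega>. exp (- \<eta> * t) * \<bar>exp (- h t * U \<omega>) - 1\<bar> + \<bar>exp (- \<eta> * t) - 1\<bar> \<partial>N)"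
    proof (rule integral_mono)
      show "\<bar>W t \<omega> - 1\<bar> \<le> exp (- \<eta> * t) * \<bar>exp (- h t * U \<omega>) - 1\<bar> + \<bar>exp (- \<eta> * t) - 1\<bar>" for \<omega>
      proof -
        have "W t \<omega> - 1 = exp (- \<eta> * t) * (exp (- h t * U \<omega>) - 1) + (exp (- \<eta> * t) - 1)" unfolding W by (simp add: algebra_simps)
        also have "\<bar>\<dots>\<bar> \<le> \<bar>exp (- \<eta> * t) * (exp (- h t * U \<omega>) - 1)\<bar> + \<bar>exp (- \<eta> * t) - 1\<bar>" by (rule abs_triangle_ineq)
        finally show ?thesis by (simp add: abs_mult)
      qed
    qed (use iU iW in auto)
    also have "\<dots> = exp (- \<eta> * t) * (\<integral>\<omega>. \<bar>exp (- h t * U \<omega>) - 1\<bar> \<partial>N) + \<bar>exp (- \<eta> * t) - 1\<bar>"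
      using iU by (simp add: prob_space)
    also have "\<dots> \<le> d t" unfolding d_def using c(2)[OF h] by (intro add_right_mono mult_left_mono) auto
    finally have dW: "(\<integral>\<omega>. \<bar>W t \<omega> - 1\<bar> \<partial>N) \<le> d t" .
    have ah: "\<bar>\<gamma> * t\<bar> / h t = \<bar>\<gamma>\<bar> * t powr (1 - 1 / Y)"
      using elim(1) by (simp add: h_def powr_diff abs_mult)
    have Wm: "W t \<in> borel_measurable N" and Wn: "\<And>\<omega>. W t \<omega> \<ge> 0" unfolding W_def by auto
    show ?case
      using strike_correction[OF Wm Wn iW dW h(1), of "\<kappa> t" "\<gamma> * t"] elim(3)
      unfolding ah b_def[symmetric] unfolding X_def h_def by simp
  qed
  show ?thesis
  proof (rule landau_o.smallI)
    fix e :: real assume "e > 0"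
    with \<open>(b \<longlongrightarrow> 0) (at_right 0)\<close> have "eventually (\<lambda>t. b t < e) (at_right 0)" by (rule order_tendstoD(2))
    with F show "eventually (\<lambda>t. norm (?F t) \<le> e * norm (\<kappa> t)) (at_right 0)"
    proof eventually_elim
      case (elim t)
      note elim(1)
      also have "\<bar>\<kappa> t\<bar> * b t \<le> \<bar>\<kappa> t\<bar> * e" using elim(2) by (intro mult_left_mono) auto
      finally show ?case by (simp add: mult.commute)
    qed
  qed
qed

text \<open>Multiplying the tilting density by exp(h Z + \<gamma> t) lowers the weight M to M - 1
  and raises G to G + 1, and the constants combine to -\<eta> t exactly when \<gamma> =
  \<open>\<eta>0\<close> - \<eta>.\<close>

lemma tilted_payoff:
  assumes "\<gamma> = \<eta>0 - \<eta>"
  shows "exp (- k) * (exp (- h * (M * A \<omega> + G * B \<omega>) - \<eta>0 * t) * max (exp (h * Z \<omega> + \<gamma> * t) - exp k) 0)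
    = exp (- h * U \<omega> - \<eta> * t) * (exp (- k) * \<psi> (h * Z \<omega> + \<gamma> * t - k))"
proof -
  let ?x = "h * Z \<omega> + \<gamma> * t"
  have "max (exp ?x - exp k) 0 = exp ?x * \<psi> (?x - k)"
    by (simp add: \<psi>_def max_def exp_diff exp_minus field_simps)
  moreover have "exp (- h * (M * A \<omega> + G * B \<omega>) - \<eta>0 * t) * exp ?x = exp (- h * U \<omega> - \<eta> * t)"
    unfolding exp_add[symmetric] assms Z_def U_def by (simp add: algebra_simps)
  ultimately show ?thesis by (simp add: mult_ac)
qed

text \<open>The martingale condition at time 1 suffices: the expectation there is exp(\<beta> -
  \<open>\<eta>0\<close> + \<eta>).\<close>

lemma drift_eq:
  assumes "(\<integral>\<omega>. exp (- 1 * (M * A \<omega> + G * B \<omega>) - \<eta>0 * 1) * exp (1 * Z \<omega> + \<beta> * 1) \<partial>N) = 1"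
  shows "\<beta> = \<eta>0 - \<eta>"
proof -
  have "exp (- 1 * (M * A \<omega> + G * B \<omega>) - \<eta>0 * 1) * exp (1 * Z \<omega> + \<beta> * 1) = exp (\<beta> - \<eta>0) * exp (- 1 * U \<omega>)" for \<omega>
    unfolding exp_add[symmetric] Z_def U_def by (simp add: algebra_simps)
  then have "exp (\<beta> - \<eta>0) * (\<integral>\<omega>. exp (- 1 * U \<omega>) \<partial>N) = 1"
    using assms by (simp only: Bochner_Integration.integral_mult_right_zero)
  then have "exp (\<beta> - \<eta>0 + \<eta>) = exp 0" using exp_U[of 1] by (simp add: exp_add)
  then show ?thesis by (simp only: exp_inj_iff)
qed

text \<open>The tail term is \<open>K0\<close> * (Y * Gamma(-Y)) = C Gamma(-Y) (M powr Y + (G + 1)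
  powr Y), so \<eta> minus it is C Gamma(-Y) ((M - 1) powr Y - M powr Y). Adding half of
  \<open>\<eta>0\<close> - \<eta> gives the stated antisymmetric form.\<close>

lemma second_order_coeff:
  assumes "\<gamma> = \<eta>0 - \<eta>"
  shows "\<eta> - K0 * (Y * Gamma (- Y)) + \<gamma> / 2 = C * Gamma (- Y) / 2 * ((M - 1) powr Y - M powr Y - (G + 1) powr Y + G powr Y)"
  using LA.Y unfolding assms K0_def \<eta>_def \<eta>0_def by (simp add: field_simps)

end

theorem theorem3p5:
  fixes P :: "'a measure" and Pt :: "'b measure"
    and C G M Y S0 \<gamma> d1 d2 d31 d32 :: real
    and L S :: "real \<Rightarrow> 'a \<Rightarrow> real"
    and Upos Uneg Z Utilde :: "real \<Rightarrow> 'b \<Rightarrow> real"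
    and c :: "(real \<Rightarrow> real) \<Rightarrow> real \<Rightarrow> real"
  assumes "prob_space P" and "prob_space Pt"
    and "C > 0" and "G > 0" and "M > 1" and "1 < Y" and "Y < 2" and "S0 > 0"
    and "prob_space.cgmy_process P C G M Y L"
    and "\<forall>t\<ge>0. (\<integral>\<omega>. exp (L t \<omega>) \<partial>P) = 1"
    and "S = (\<lambda>t \<omega>. S0 * exp (L t \<omega>))"
    and "prob_space.centered_positive_stable_process Pt C Y Upos"
    and "prob_space.centered_positive_stable_process Pt C Y (\<lambda>t \<omega>. - Uneg t \<omega>)"
    and "prob_space.indep_processes Pt Upos (\<lambda>t \<omega>. - Uneg t \<omega>)"
    and "Z = (\<lambda>t \<omega>. Upos t \<omega> + Uneg t \<omega>)"
    and "Utilde = (\<lambda>t \<omega>. (M - 1) * Upos t \<omega> - (G + 1) * Uneg t \<omega>)"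
    and "\<gamma> = cgmy_gamma_tilde C G M Y"
    and "d1 = (\<integral>\<omega>. max (Z 1 \<omega>) 0 \<partial>Pt)"
    and "d2 = C * Gamma (- Y) / 2 * ((M - 1) powr Y - M powr Y - (G + 1) powr Y + G powr Y)"
    and "d31 = \<gamma>\<^sup>2 / 2 * continuous_density Pt (Z 1) 0"
    and "d32 =
        - (1 / 2) * (\<integral>\<omega>. (max (Z 1 \<omega>) 0 + Utilde 1 \<omega>)\<^sup>2 *
                         indicator {\<omega>. max (Z 1 \<omega>) 0 + Utilde 1 \<omega> \<le> 0} \<omega> \<partial>Pt)
        - (LBINT w:{0<..}. w * (\<P>(\<omega> in Pt. max (Z 1 \<omega>) 0 + Utilde 1 \<omega> \<ge> w)
             - C * M powr Y / (Y * w powr Y) - C * (G + 1) powr Y / (Y * w powr Y)))"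
    and "c = (\<lambda>\<kappa> t. \<kappa> t * (LBINT w:{0..1}. \<P>(\<omega> in Pt. Z t \<omega> \<ge> \<kappa> t * w)))"
  shows "d1 = 1 / pi * Gamma (1 - 1 / Y) * (2 * C * Gamma (- Y) * \<bar>cos (pi * Y / 2)\<bar>) powr (1 / Y)
    \<and> d31 = \<gamma>\<^sup>2 / (2 * pi) * Gamma (1 + 1 / Y) * (- 2 * C * Gamma (- Y) * cos (pi * Y / 2)) powr (- 1 / Y)
    \<and> (\<exists>r1 r2. r1 \<in> o[at_right 0](\<lambda>t. t powr (2 - 1 / Y)) \<and> r2 \<in> o[at_right 0](\<lambda>t. t powr (2 / Y)) \<and>
         (\<forall>\<kappa> :: real \<Rightarrow> real. \<kappa> \<in> o[at_right 0](\<lambda>_. 1) \<longrightarrow>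
            (\<exists>r. r \<in> o[at_right 0](\<kappa>) \<and>
               (\<forall>t>0. exp (- \<kappa> t) / S0 * (\<integral>\<omega>. max (S t \<omega> - S0 * exp (\<kappa> t)) 0 \<partial>P) + c \<kappa> t =
                  d1 * t powr (1 / Y) + d2 * t + d31 * t powr (2 - 1 / Y) + d32 * t powr (2 / Y)
                  + r t + r1 t + r2 t))))"
proof -
  note as = assms
  interpret P: prob_space P by (rule as(1))
  interpret Pt: prob_space Pt by (rule as(2))
  note C = \<open>C > 0\<close> and Y = \<open>1 < Y\<close> \<open>Y < 2\<close>
  let ?B = "\<lambda>t \<omega>. - Uneg t \<omega>"
  note charU = Pt.centered_stable_char(2)[OF as(12)] and charB = Pt.centered_stable_char(2)[OF as(13)]
  have "stable_pair Pt (Upos 1) (?B 1) C Y M G"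
  proof (rule stable_pair.intro[OF as(2) stable_pair_axioms.intro])
    show "Pt.indep_var borel (Upos 1) borel (?B 1)" by (rule Pt.indep_processes_at[OF as(14)]) simp
  qed (rule Pt.stable_law_at_1[OF as(12) C Y] Pt.stable_law_at_1[OF as(13) C Y] as(4) as(5))+
  then interpret Q: stable_pair Pt "Upos 1" "?B 1" C Y M G .
  have Z1: "Z 1 = Q.Z" and U1: "Utilde 1 = Q.U" and V1: "max (Z 1 \<omega>) 0 + Utilde 1 \<omega> = Q.V \<omega>" for \<omega>
    by (auto simp: as(15,16) Q.Z_def Q.U_def Q.V_def fun_eq_iff algebra_simps)
  have lawZ: "Pt.prob {\<omega>\<in>space Pt. Z t \<omega> \<ge> x} = Pt.prob {\<omega>\<in>space Pt. t powr (1 / Y) * Q.Z \<omega> \<ge> x}" if "t > 0" for t x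
    using Q.Z_scaled_law[OF that Pt.indep_processes_at[OF as(14)] charU charB] that by (simp add: as(15))
  obtain b where b: "P.levy_process_with_triplet L b 0 (cgmy_levy_measure C G M Y)"
    using as(9) unfolding P.cgmy_process_def by auto
  obtain \<beta> where \<beta>: "\<And>u. levy_exponent b 0 (cgmy_levy_measure C G M Y) u = \<i> * of_real (\<beta> * u)
      + (stable_exponent C Y (of_real M - \<i> * of_real u) - stable_exponent C Y (of_real M))
      + (stable_exponent C Y (of_real G + \<i> * of_real u) - stable_exponent C Y (of_real G))"
    using cgmy_exponent[of C Y M G b] C Y as(4,5) by auto
  have Lm: "L t \<in> borel_measurable P" if "t > 0" for t
    using b that by (auto simp: P.levy_process_with_triplet_def P.levy_process_def)
  have lawL: "(\<integral>\<omega>. f (L t \<omega>) \<partial>P) = (\<integral>\<omega>. exp (- (t powr (1 / Y)) * (M * Upos 1 \<omega> + G * ?B 1 \<omega>) - Q.\<eta>0 * t) * f (t powr (1 / Y) * Q.Z \<omega> + \<beta> * t) \<partial>Pt)"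
    if t: "t > 0" and [measurable]: "f \<in> borel_measurable borel" for t and f :: "real \<Rightarrow> real"
  proof -
    have "char (distr P borel (L t)) u = exp (of_real t * (\<i> * of_real (\<beta> * u)
      + (stable_exponent C Y (of_real M - \<i> * of_real u) - stable_exponent C Y (of_real M))
      + (stable_exponent C Y (of_real G + \<i> * of_real u) - stable_exponent C Y (of_real G))))" for u
      using b t unfolding P.levy_process_with_triplet_def \<beta> by simp
    from Q.tilted_law[OF t P.real_distribution_distr[OF Lm[OF t]] this that(2)]
    show ?thesis by (subst (asm) integral_distr) (use Lm[OF t] in auto)
  qed
  \<comment> \<open>The identity of laws applied to the exponential function at t = 1 expresses the
    martingale condition on the stable side.\<close>
  have "\<beta> = Q.\<eta>0 - Q.\<eta>"
    using lawL[of 1 exp] as(10) by (intro Q.drift_eq) simp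
  moreover have \<gamma>: "\<gamma> = Q.\<eta>0 - Q.\<eta>"
    unfolding as(17) cgmy_gamma_tilde_def Q.\<eta>0_def Q.\<eta>_def by (simp add: algebra_simps)
  ultimately have \<beta>\<gamma>: "\<beta> = \<gamma>" by simp
  define W where "W t \<omega> = exp (- (t powr (1 / Y)) * Q.U \<omega> - Q.\<eta> * t)" for t \<omega>
  define X where "X t \<omega> = t powr (1 / Y) * Q.Z \<omega> + \<gamma> * t" for t \<omega>
  have price: "exp (- k) / S0 * (\<integral>\<omega>. max (S t \<omega> - S0 * exp k) 0 \<partial>P) = (\<integral>\<omega>. W t \<omega> * (exp (- k) * \<psi> (X t \<omega> - k)) \<partial>Pt)"
    if t: "t > 0" for t k
  proof -
    have "max (S t \<omega> - S0 * exp k) 0 = S0 * max (exp (L t \<omega>) - exp k) 0" for \<omega>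
      using as(8) unfolding as(11) right_diff_distrib[symmetric] by (simp add: max_def zero_le_mult_iff mult_le_0_iff)
    then have "exp (- k) / S0 * (\<integral>\<omega>. max (S t \<omega> - S0 * exp k) 0 \<partial>P) = exp (- k) * (\<integral>\<omega>. max (exp (L t \<omega>) - exp k) 0 \<partial>P)"
      using as(8) by simp
    also have "\<dots> = (\<integral>\<omega>. W t \<omega> * (exp (- k) * \<psi> (X t \<omega> - k)) \<partial>Pt)"
      unfolding lawL[OF t, of "\<lambda>x. max (exp x - exp k) 0", simplified] \<beta>\<gamma> W_def X_def Q.tilted_payoff[OF \<gamma>, symmetric]
      by simp
    finally show ?thesis .
  qed
  \<comment> \<open>As 1 < Y < 2 the cosine is negative; this matches the modulus in d1 with the
    signed constant \<open>cZ\<close>.\<close>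
  have cos: "cos (pi * Y / 2) < 0"
  proof -
    have "cos (pi - pi * Y / 2) > 0" using Y by (intro cos_gt_zero_pi) (auto simp: field_simps)
    then show ?thesis by simp
  qed
  have d1: "d1 = (\<integral>\<omega>. max (Q.Z \<omega>) 0 \<partial>Pt)" by (simp add: as(18) Z1)
  have d31: "d31 = \<gamma>\<^sup>2 / 2 * Q.pZ 0" by (simp add: as(20) Z1 Q.continuous_density_Z)
  have d32: "d32 = - ((\<integral>\<omega>. (Q.V \<omega>)\<^sup>2 * indicator {\<omega>. Q.V \<omega> \<le> 0} \<omega> \<partial>Pt) / 2 + (LBINT w:{0<..}. w * Q.tail_diff w))"
  proof -
    have "(LBINT w:{0<..}. w * (Pt.prob {\<omega>\<in>space Pt. Q.V \<omega> \<ge> w} - C * M powr Y / (Y * w powr Y) - C * (G + 1) powr Y / (Y * w powr Y)))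
      = (LBINT w:{0<..}. w * Q.tail_diff w)"
      by (intro set_lebesgue_integral_cong) (auto simp: Q.tail_diff_def Q.K0_def powr_minus field_simps)
    then show ?thesis unfolding as(21) V1 by simp
  qed
  then have d32': "(\<integral>\<omega>. (Q.V \<omega>)\<^sup>2 * indicator {\<omega>. Q.V \<omega> \<le> 0} \<omega> \<partial>Pt) / 2 + (LBINT w:{0<..}. w * Q.tail_diff w) = - d32" by simp
  \<comment> \<open>Obtained before any \<kappa> is introduced, which is the asserted independence
    of these two remainders.\<close>
  obtain r1 r2 where r1: "r1 \<in> o[at_right 0](\<lambda>t. t powr (2 - 1 / Y))" and r2: "r2 \<in> o[at_right 0](\<lambda>t. t powr (2 / Y))"
    and r: "\<And>t. t > 0 \<Longrightarrow> (\<integral>\<omega>. W t \<omega> * \<psi> (X t \<omega>) \<partial>Pt) =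
      d1 * t powr (1 / Y) + d2 * t + d31 * t powr (2 - 1 / Y) + d32 * t powr (2 / Y) + r1 t + r2 t"
    using Q.at_the_money_expansion[of \<gamma>] unfolding W_def X_def Q.second_order_coeff[OF \<gamma>] d32' d1 d31 as(19) by auto
  show ?thesis
  proof (intro conjI exI allI impI)
    show "d1 = 1 / pi * Gamma (1 - 1 / Y) * (2 * C * Gamma (- Y) * \<bar>cos (pi * Y / 2)\<bar>) powr (1 / Y)"
      using cos unfolding d1 Q.mean_pos_part_Z Q.cZ_def by simp
    show "d31 = \<gamma>\<^sup>2 / (2 * pi) * Gamma (1 + 1 / Y) * (- 2 * C * Gamma (- Y) * cos (pi * Y / 2)) powr (- 1 / Y)"
      unfolding d31 Q.pZ_0 Q.cZ_def by simp
    show "r1 \<in> o[at_right 0](\<lambda>t. t powr (2 - 1 / Y))" "r2 \<in> o[at_right 0](\<lambda>t. t powr (2 / Y))" by (fact r1 r2)+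
    fix \<kappa> :: "real \<Rightarrow> real" assume \<kappa>: "\<kappa> \<in> o[at_right 0](\<lambda>_. 1)"
    \<comment> \<open>Defined as the exact discrepancy between the corrected price at the strike and
      the price at the money, so the expansion is an identity for all t > 0 and only the order of ?r
      is at stake.\<close>
    let ?r = "\<lambda>t. (\<integral>\<omega>. W t \<omega> * (exp (- \<kappa> t) * \<psi> (X t \<omega> - \<kappa> t)) \<partial>Pt) - (\<integral>\<omega>. W t \<omega> * \<psi> (X t \<omega>) \<partial>Pt)
       + \<kappa> t * (LBINT w:{0..1}. Pt.prob {\<omega>\<in>space Pt. t powr (1 / Y) * Q.Z \<omega> \<ge> \<kappa> t * w})"
    show "?r \<in> o[at_right 0](\<kappa>)" unfolding W_def X_def by (rule Q.strike_remainder[OF \<kappa>])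
    fix t :: real assume t: "t > 0"
    show "exp (- \<kappa> t) / S0 * (\<integral>\<omega>. max (S t \<omega> - S0 * exp (\<kappa> t)) 0 \<partial>P) + c \<kappa> t =
        d1 * t powr (1 / Y) + d2 * t + d31 * t powr (2 - 1 / Y) + d32 * t powr (2 / Y) + ?r t + r1 t + r2 t"
      unfolding price[OF t] r[OF t] as(22) lawZ[OF t] by simp
  qed
qed

end
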